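(* Let $\Omega\subset\mathbb{R}^d$, $d\in\{2,3\}$, be a bounded Lipschitz domain with boundary $\Gamma=\partial\Omega$ and exterior unit normal field $\boldsymbol{n}$. Let $g\in H^{1/2}(\Gamma)$ and let $u\in H^1(\Omega)$ be the unique solution of $\Delta u=0$ in $\Omega$, $u|_\Gamma=g$ on $\Gamma$. Then for any $v\in H^1(\Omega)$ with $\Delta v=0$ in $\Omega$, $$\max_{\substack{\boldsymbol{\tau}\in L^2(\Omega)\\ \operatorname{div}\boldsymbol{\tau}=0}}\Big(2\,\langle g-v|_\Gamma,\ \boldsymbol{n}\cdot\boldsymbol{\tau}|_\Gamma\rangle_\Gamma-\|\boldsymbol{\tau}\|_{L^2(\Omega)}^2\Big)=\|\nabla(u-v)\|_{L^2(\Omega)}^2=\min_{\substack{w\in H^1(\Omega)\\ w|_\Gamma=g-v|_\Gamma}}\|\nabla w\|_{L^2(\Omega)}^2 ,$$ where the maximum is over vector fields $\boldsymbol{\tau}\in L^2(\Omega)^d$ with vanishing distributional divergence. The unique maximiser is $\underline{\boldsymbol{\tau}}=\nabla(u-v)$ and the unique minimiser is $\overline{w}=u-v$.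
   Context: $L^2(\Omega)$ denotes square-integrable scalar functions or $\mathbb{R}^d$-valued vector fields, as appropriate. $H(\operatorname{div},\Omega)=\{\boldsymbol{\sigma}\in L^2(\Omega)^d:\operatorname{div}\boldsymbol{\sigma}\in L^2(\Omega)\}$. $(\cdot)|_\Gamma$ is the trace operator on $H^1(\Omega)$; $H^{1/2}(\Gamma)=\{\varphi|_\Gamma:\varphi\in H^1(\Omega)\}$ carries the quotient norm $\|f\|_{H^{1/2}(\Gamma)}=\inf\{\|\varphi\|_{H^1(\Omega)}:\varphi\in H^1(\Omega),\ \varphi|_\Gamma=f\}$; $H^{-1/2}(\Gamma)$ is its dual space. $\langle\cdot,\cdot\rangle_\Gamma$ is the $H^{1/2}(\Gamma)\times H^{-1/2}(\Gamma)$ duality product extending the $L^2(\Gamma)$ inner product. For $\boldsymbol{\sigma}\in H(\operatorname{div},\Omega)$, $\boldsymbol{n}\cdot\boldsymbol{\sigma}|_\Gamma\in H^{-1/2}(\Gamma)$ is the normal trace, characterised by $\langle\varphi|_\Gamma,\boldsymbol{n}\cdot\boldsymbol{\sigma}|_\Gamma\rangle_\Gamma=\int_\Omega(\nabla\varphi\cdot\boldsymbol{\sigma}+\varphi\operatorname{div}\boldsymbol{\sigma})\,dx$ for all $\varphi\in H^1(\Omega)$. The equation $\Delta v=0$ is understood in the weak (distributional) sense. *)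

theory Defs
  imports "HOL-Analysis.Analysis"
begin

text \<open>
  Elements of Lebesgue and Sobolev spaces are represented by functions on the whole type; only
  their values almost everywhere on the domain (or on its boundary) matter. Integrals over the
  domain are taken with respect to \<^term>\<open>lebesgue_on Om\<close>.
\<close>

section \<open>Lipschitz domains and surface measure\<close>

text \<open>
  Near each boundary point, after a rotation taking \<open>e\<close> to the last coordinate direction,
  the domain is the strict epigraph of a Lipschitz function of the remaining coordinates.
  As \<open>ball x r\<close> is open, it follows that the boundary is the graph there.
\<close>
definition lipschitz_domain :: "'a::euclidean_space set \<Rightarrow> bool" where
  "lipschitz_domain Om \<longleftrightarrow> open Om \<and> connected Om \<and> Om \<noteq> {} \<and> bounded Om \<and>
     (\<forall>x\<in>frontier Om. \<exists>e r L \<gamma>. norm e = 1 \<and> 0 < r \<and>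
        L-lipschitz_on {y. y \<bullet> e = 0} (\<gamma> :: 'a \<Rightarrow> real) \<and>
        (\<forall>y\<in>ball x r. y \<in> Om \<longleftrightarrow> \<gamma> (y - (y \<bullet> e) *\<^sub>R e) < y \<bullet> e))"

definition hausdorff_pre :: "real \<Rightarrow> real \<Rightarrow> 'a::metric_space set \<Rightarrow> ennreal" where
  "hausdorff_pre s \<delta> A =
     (INF C\<in>{C :: nat \<Rightarrow> 'a set. A \<subseteq> (\<Union>i. C i) \<and> (\<forall>i. bounded (C i) \<and> diameter (C i) \<le> \<delta>)}.
        \<Sum>i. ennreal (unit_ball_vol s * (diameter (C i) / 2) powr s))"

text \<open>Meant for \<open>s > 0\<close>: sets of diameter zero then contribute nothing, since \<open>0 powr s = 0\<close>.\<close>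
definition hausdorff_outer :: "real \<Rightarrow> 'a::metric_space set \<Rightarrow> ennreal" where
  "hausdorff_outer s A = (SUP \<delta>\<in>{0<..}. hausdorff_pre s \<delta> A)"

definition hausdorff_measure :: "real \<Rightarrow> 'a::metric_space measure" where
  "hausdorff_measure s = measure_of UNIV (sets borel) (hausdorff_outer s)"

definition surface_measure :: "'a::euclidean_space set \<Rightarrow> 'a measure" where
  "surface_measure Om = restrict_space (hausdorff_measure (real (DIM('a) - 1))) (frontier Om)"

section \<open>Square-integrable functions and smooth functions\<close>

definition square_integrable :: "'a measure \<Rightarrow> ('a \<Rightarrow> 'b::euclidean_space) \<Rightarrow> bool" where
  "square_integrable M f \<longleftrightarrow> f \<in> borel_measurable M \<and> integrable M (\<lambda>x. (norm (f x))\<^sup>2)"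

definition l2_norm :: "'a measure \<Rightarrow> ('a \<Rightarrow> 'b::euclidean_space) \<Rightarrow> real" where
  "l2_norm M f = sqrt (LINT x|M. (norm (f x))\<^sup>2)"

definition grad :: "('a::euclidean_space \<Rightarrow> real) \<Rightarrow> 'a \<Rightarrow> 'a" where
  "grad f x = (\<Sum>e\<in>Basis. frechet_derivative f (at x) e *\<^sub>R e)"

primrec iterated_partial :: "'a::euclidean_space list \<Rightarrow> ('a \<Rightarrow> real) \<Rightarrow> 'a \<Rightarrow> real" where
  "iterated_partial [] f = f"
| "iterated_partial (e # es) f = iterated_partial es (\<lambda>x. frechet_derivative f (at x) e)"

text \<open>
  Differentiability of all iterated partial derivatives makes all of them continuous, so this is
  the class of infinitely differentiable functions on the whole space.
\<close>
definition smooth :: "('a::euclidean_space \<Rightarrow> real) \<Rightarrow> bool" where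
  "smooth f \<longleftrightarrow> (\<forall>es\<in>lists Basis. \<forall>x. iterated_partial es f differentiable (at x))"

definition test_function :: "'a::euclidean_space set \<Rightarrow> ('a \<Rightarrow> real) \<Rightarrow> bool" where
  "test_function Om \<psi> \<longleftrightarrow> smooth \<psi> \<and> compact (closure {x. \<psi> x \<noteq> 0}) \<and> closure {x. \<psi> x \<noteq> 0} \<subseteq> Om"

section \<open>Distributional derivatives\<close>

definition has_weak_grad ::
    "'a::euclidean_space set \<Rightarrow> ('a \<Rightarrow> real) \<Rightarrow> ('a \<Rightarrow> 'a) \<Rightarrow> bool" where
  "has_weak_grad Om \<phi> G \<longleftrightarrow> (\<forall>\<psi>. test_function Om \<psi> \<longrightarrow>
     (LINT x|lebesgue_on Om. \<phi> x *\<^sub>R grad \<psi> x) = - (LINT x|lebesgue_on Om. \<psi> x *\<^sub>R G x))"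

definition has_weak_div ::
    "'a::euclidean_space set \<Rightarrow> ('a \<Rightarrow> 'a) \<Rightarrow> ('a \<Rightarrow> real) \<Rightarrow> bool" where
  "has_weak_div Om \<sigma> h \<longleftrightarrow> (\<forall>\<psi>. test_function Om \<psi> \<longrightarrow>
     (LINT x|lebesgue_on Om. \<sigma> x \<bullet> grad \<psi> x) = - (LINT x|lebesgue_on Om. h x * \<psi> x))"

text \<open>The chosen representatives below are unique up to null sets.\<close>
definition weak_grad :: "'a::euclidean_space set \<Rightarrow> ('a \<Rightarrow> real) \<Rightarrow> 'a \<Rightarrow> 'a" where
  "weak_grad Om \<phi> = (SOME G. square_integrable (lebesgue_on Om) G \<and> has_weak_grad Om \<phi> G)"

definition weak_div :: "'a::euclidean_space set \<Rightarrow> ('a \<Rightarrow> 'a) \<Rightarrow> 'a \<Rightarrow> real" where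
  "weak_div Om \<sigma> = (SOME h. square_integrable (lebesgue_on Om) h \<and> has_weak_div Om \<sigma> h)"

definition H1 :: "'a::euclidean_space set \<Rightarrow> ('a \<Rightarrow> real) set" where
  "H1 Om = {\<phi>. square_integrable (lebesgue_on Om) \<phi> \<and>
     (\<exists>G. square_integrable (lebesgue_on Om) G \<and> has_weak_grad Om \<phi> G)}"

definition H1_norm :: "'a::euclidean_space set \<Rightarrow> ('a \<Rightarrow> real) \<Rightarrow> real" where
  "H1_norm Om \<phi> =
     sqrt ((l2_norm (lebesgue_on Om) \<phi>)\<^sup>2 + (l2_norm (lebesgue_on Om) (weak_grad Om \<phi>))\<^sup>2)"

definition Hdiv :: "'a::euclidean_space set \<Rightarrow> ('a \<Rightarrow> 'a) set" where
  "Hdiv Om = {\<sigma>. square_integrable (lebesgue_on Om) \<sigma> \<and>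
     (\<exists>h. square_integrable (lebesgue_on Om) h \<and> has_weak_div Om \<sigma> h)}"

definition div_free :: "'a::euclidean_space set \<Rightarrow> ('a \<Rightarrow> 'a) set" where
  "div_free Om = {\<tau>. square_integrable (lebesgue_on Om) \<tau> \<and> has_weak_div Om \<tau> (\<lambda>_. 0)}"

text \<open>The Laplace equation in the sense of distributions, for functions in \<^const>\<open>H1\<close>.\<close>
definition weakly_harmonic :: "'a::euclidean_space set \<Rightarrow> ('a \<Rightarrow> real) \<Rightarrow> bool" where
  "weakly_harmonic Om v \<longleftrightarrow> has_weak_div Om (weak_grad Om v) (\<lambda>_. 0)"

section \<open>The trace operator and the boundary spaces\<close>

definition bdry_eq :: "'a::euclidean_space set \<Rightarrow> ('a \<Rightarrow> real) \<Rightarrow> ('a \<Rightarrow> real) \<Rightarrow> bool" where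
  "bdry_eq Om f g \<longleftrightarrow> (AE x in surface_measure Om. f x = g x)"

text \<open>
  The trace operator is the continuous extension, from \<^const>\<open>H1\<close> to the square-integrable
  functions on the boundary, of the restriction map on functions smooth up to the boundary. For
  a Lipschitz domain the trace exists and is unique up to null sets of the surface measure.
\<close>
definition has_trace :: "'a::euclidean_space set \<Rightarrow> ('a \<Rightarrow> real) \<Rightarrow> ('a \<Rightarrow> real) \<Rightarrow> bool" where
  "has_trace Om \<phi> f \<longleftrightarrow> square_integrable (surface_measure Om) f \<and>
     (\<exists>\<Phi> :: nat \<Rightarrow> 'a \<Rightarrow> real.
        (\<forall>k. smooth (\<Phi> k) \<and> \<Phi> k \<in> H1 Om \<and> square_integrable (surface_measure Om) (\<Phi> k)) \<and>
        (\<lambda>k. H1_norm Om (\<lambda>x. \<Phi> k x - \<phi> x)) \<longlonglongrightarrow> 0 \<and>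
        (\<lambda>k. l2_norm (surface_measure Om) (\<lambda>x. \<Phi> k x - f x)) \<longlonglongrightarrow> 0)"

definition bdry_trace :: "'a::euclidean_space set \<Rightarrow> ('a \<Rightarrow> real) \<Rightarrow> 'a \<Rightarrow> real" where
  "bdry_trace Om \<phi> = (SOME f. has_trace Om \<phi> f)"

definition H_half :: "'a::euclidean_space set \<Rightarrow> ('a \<Rightarrow> real) set" where
  "H_half Om = {f. \<exists>\<phi>\<in>H1 Om. bdry_eq Om (bdry_trace Om \<phi>) f}"

definition H_half_norm :: "'a::euclidean_space set \<Rightarrow> ('a \<Rightarrow> real) \<Rightarrow> real" where
  "H_half_norm Om f = (INF \<phi>\<in>{\<phi>\<in>H1 Om. bdry_eq Om (bdry_trace Om \<phi>) f}. H1_norm Om \<phi>)"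

text \<open>
  The dual of \<^const>\<open>H_half\<close>. Boundedness forces a functional to take equal values on functions
  that agree almost everywhere on the boundary; values outside \<^const>\<open>H_half\<close> are irrelevant.
\<close>
definition H_minus_half :: "'a::euclidean_space set \<Rightarrow> (('a \<Rightarrow> real) \<Rightarrow> real) set" where
  "H_minus_half Om = {\<Lambda>.
     (\<forall>f\<in>H_half Om. \<forall>h\<in>H_half Om. \<Lambda> (\<lambda>x. f x + h x) = \<Lambda> f + \<Lambda> h) \<and>
     (\<forall>c. \<forall>f\<in>H_half Om. \<Lambda> (\<lambda>x. c * f x) = c * \<Lambda> f) \<and>
     (\<exists>C. \<forall>f\<in>H_half Om. \<bar>\<Lambda> f\<bar> \<le> C * H_half_norm Om f)}"

text \<open>
  A square-integrable boundary function \<open>h\<close> is identified with the functional mapping \<open>f\<close> to the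
  integral of \<open>f * h\<close> over the boundary, so that evaluation extends the inner product.
\<close>
definition bdry_pairing :: "('a \<Rightarrow> real) \<Rightarrow> (('a \<Rightarrow> real) \<Rightarrow> real) \<Rightarrow> real" where
  "bdry_pairing f \<Lambda> = \<Lambda> f"

text \<open>
  The normal trace of a field in \<^const>\<open>Hdiv\<close> is characterised by Green's formula, which
  determines the functional on \<^const>\<open>H_half\<close>. The exterior normal field enters only through this formula.
\<close>
definition normal_trace :: "'a::euclidean_space set \<Rightarrow> ('a \<Rightarrow> 'a) \<Rightarrow> ('a \<Rightarrow> real) \<Rightarrow> real" where
  "normal_trace Om \<sigma> = (SOME \<Lambda>. \<Lambda> \<in> H_minus_half Om \<and>
     (\<forall>\<phi>\<in>H1 Om. bdry_pairing (bdry_trace Om \<phi>) \<Lambda> =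
        (LINT x|lebesgue_on Om. weak_grad Om \<phi> x \<bullet> \<sigma> x + \<phi> x * weak_div Om \<sigma> x)))"

section \<open>Attained extrema\<close>

definition is_maximum :: "real set \<Rightarrow> real \<Rightarrow> bool" where
  "is_maximum S m \<longleftrightarrow> m \<in> S \<and> (\<forall>s\<in>S. s \<le> m)"

definition is_minimum :: "real set \<Rightarrow> real \<Rightarrow> bool" where
  "is_minimum S m \<longleftrightarrow> m \<in> S \<and> (\<forall>s\<in>S. m \<le> s)"

end

theory Submission
  imports Defs
begin

text \<open>
  Once traces behave well, the theorem is a completion of squares. With \<open>w\<^sub>0 = u - v\<close>, Green's formula turns the
  dual functional into \<open>\<parallel>\<nabla>w\<^sub>0\<parallel>\<^sup>2 - \<parallel>\<tau> - \<nabla>w\<^sub>0\<parallel>\<^sup>2\<close>, and since \<open>\<nabla>w\<^sub>0\<close> is free of divergence, it is orthogonal to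
  \<open>\<nabla>(w - w\<^sub>0)\<close> for every competitor \<open>w\<close> with the same trace.

  The normal trace of a divergence-free \<open>\<tau>\<close> is well defined because the integral of \<open>\<nabla>\<phi> \<bullet> \<tau>\<close> vanishes
  whenever \<open>\<phi>\<close> has zero trace. This follows by approximating both \<open>\<phi>\<close> and \<open>\<tau>\<close> by functions smooth up to the
  boundary and applying the inequality \<open>\<bar>\<integral> \<partial>\<psi>\<bar> \<le> C \<integral> \<bar>\<psi>\<bar>\<close> between the domain and its boundary, a substitute for the
  divergence theorem that avoids normal vectors: the difference quotients of \<open>\<psi>\<close> integrate to the mass of \<open>\<psi>\<close> in a thin
  layer along the boundary, and the volume of such a layer is bounded by the Hausdorff measure of the
  boundary, through coverings by small balls. On a Lipschitz domain the converse bound holds as well, since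
  the layer contains many disjoint balls; it yields the trace inequality.
\<close>

section \<open>Smooth functions\<close>

text \<open>\<open>weak_grad\<close>, \<open>bdry_trace\<close> and \<open>normal_trace\<close> are
  choice operators: nothing is known about their values until existence of the chosen object is
  proved, and equations between them hold only once uniqueness is known. Hence most of the work is
  trace theory and very little is variational. Traces are limits of restrictions of functions smooth
  on the whole space, so approximation has to work across the boundary, where averaging with a
  centred kernel would read values from outside the domain. Green's formula is needed only where the
  boundary term tends to zero along smooth approximations. Any finite constant in the divergence
  inequality will therefore do, which is why crude coverings by balls suffice and no exact surface
  integral is ever computed. The one constant that must be finite beforehand is the measure of the
  boundary, and this comes out of the trace inequality for the constant function 1.\<close>

lemma continuous_bounded_on_compact:
  fixes f :: "'a::topological_space \<Rightarrow> 'b::real_normed_vector"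
  assumes "continuous_on UNIV f" "compact K"
  shows "\<exists>B. \<forall>x\<in>K. norm (f x) \<le> B"
proof -
  have "bounded (f ` K)"
    by (intro compact_imp_bounded compact_continuous_image continuous_on_subset[OF assms(1)] assms(2)) auto
  then show ?thesis unfolding bounded_iff by simp
qed

text \<open>One step of \<open>iterated_partial\<close>, given a name. Arbitrary directions are
  allowed, so that \<open>pd 1 h\<close> is the usual derivative of a real function and unit vectors
  of charts may be used.\<close>

definition pd :: "'a::euclidean_space \<Rightarrow> ('a \<Rightarrow> real) \<Rightarrow> 'a \<Rightarrow> real" where
  "pd e f = (\<lambda>x. frechet_derivative f (at x) e)"

lemma pd_eqI: "(f has_derivative D) (at x) \<Longrightarrow> pd e f x = D e"
  unfolding pd_def by (metis frechet_derivative_at)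

lemma grad_inner_Basis: "b \<in> Basis \<Longrightarrow> grad f x \<bullet> b = pd b f x"
  unfolding grad_def pd_def by (simp add: inner_sum_left inner_Basis if_distrib sum.delta cong: if_cong)

lemma grad_eq_pd: "grad f x = (\<Sum>b\<in>Basis. pd b f x *\<^sub>R b)"
  unfolding grad_def pd_def by simp

lemma differentiable_has_derivative_pd:
  fixes f :: "'a::euclidean_space \<Rightarrow> real"
  assumes "f differentiable at x"
  shows "(f has_derivative (\<lambda>v. pd v f x)) (at x)"
  using assms unfolding pd_def by (simp add: frechet_derivative_works)

lemma pd_eq_grad_inner:
  fixes f :: "'a::euclidean_space \<Rightarrow> real"
  assumes "f differentiable at x"
  shows "pd v f x = grad f x \<bullet> v"
proof -
  have lin: "linear (\<lambda>v. pd v f x)"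
    using differentiable_has_derivative_pd[OF assms] has_derivative_linear by blast
  have "pd v f x = pd (\<Sum>b\<in>Basis. (v \<bullet> b) *\<^sub>R b) f x" by (simp add: euclidean_representation)
  also have "\<dots> = (\<Sum>b\<in>Basis. (v \<bullet> b) * pd b f x)"
    by (simp add: linear_sum[OF lin] linear_cmul[OF lin])
  also have "\<dots> = grad f x \<bullet> v"
    by (simp add: grad_eq_pd inner_sum_right mult.commute inner_commute[of _ v])
  finally show ?thesis .
qed

text \<open>Counting derivatives replaces the lists of directions in \<open>smooth\<close>.
  Induction on the count is what products and compositions need, since a derivative of these is a
  sum of products of functions with one derivative less.\<close>

primrec smooth_upto :: "nat \<Rightarrow> ('a::euclidean_space \<Rightarrow> real) \<Rightarrow> bool" where
  "smooth_upto 0 f \<longleftrightarrow> True"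
| "smooth_upto (Suc n) f \<longleftrightarrow> (\<forall>x. f differentiable at x) \<and> (\<forall>b\<in>Basis. smooth_upto n (pd b f))"

lemma iterated_partial_Cons_pd: "iterated_partial (e # es) f = iterated_partial es (pd e f)"
  by (simp add: pd_def)

lemma smooth_iff_step:
  "smooth f \<longleftrightarrow> (\<forall>x. f differentiable at x) \<and> (\<forall>b\<in>Basis. smooth (pd b f))"
  (is "?l \<longleftrightarrow> ?r")
proof
  assume s: ?l
  have "f differentiable at x" for x
    using s unfolding smooth_def by (metis iterated_partial.simps(1) lists.Nil)
  moreover have "smooth (pd b f)" if "b \<in> Basis" for b
    unfolding smooth_def
  proof (intro ballI allI)
    fix es and x assume "es \<in> lists (Basis::'a set)"
    then show "iterated_partial es (pd b f) differentiable at x"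
      using s that unfolding smooth_def by (metis iterated_partial_Cons_pd lists.Cons)
  qed
  ultimately show ?r by blast
next
  assume r: ?r
  show ?l unfolding smooth_def
  proof (intro ballI allI)
    fix es and x assume es: "es \<in> lists (Basis::'a set)"
    show "iterated_partial es f differentiable at x"
    proof (cases es)
      case Nil then show ?thesis using r by simp
    next
      case (Cons b bs)
      then show ?thesis using r es unfolding smooth_def Cons iterated_partial_Cons_pd by auto
    qed
  qed
qed

lemma smooth_iff_smooth_upto: "smooth f \<longleftrightarrow> (\<forall>n. smooth_upto n f)"
proof
  show "\<forall>n. smooth_upto n f" if "smooth f"
  proof
    fix n show "smooth_upto n f" using that
    proof (induction n arbitrary: f)
      case (Suc n) then show ?case using smooth_iff_step[of f] by auto
    qed simp
  qed
  show "smooth f" if "\<forall>n. smooth_upto n f"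
    unfolding smooth_def
  proof (intro ballI allI)
    fix es and x assume "es \<in> lists (Basis::'a set)"
    then show "iterated_partial es f differentiable at x" using that
    proof (induction es arbitrary: f)
      case Nil
      then show ?case using smooth_upto.simps(2)[of 0 f] by (metis iterated_partial.simps(1))
    next
      case (Cons e es)
      then have "\<forall>n. smooth_upto n (pd e f)" using smooth_upto.simps(2)[of _ f] by blast
      then show ?case using Cons unfolding iterated_partial_Cons_pd by auto
    qed
  qed
qed

lemma smooth_upto_mono: "smooth_upto n f \<Longrightarrow> m \<le> n \<Longrightarrow> smooth_upto m f"
proof (induction n arbitrary: m f)
  case (Suc n) then show ?case by (cases m) auto
qed simp

lemma pd_add:
  assumes "f differentiable at x" "g differentiable at x"
  shows "pd b (\<lambda>x. f x + g x) x = pd b f x + pd b g x"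
  using pd_eqI[OF has_derivative_add[OF assms[THEN differentiable_has_derivative_pd]]] by simp

lemma pd_mult:
  assumes "f differentiable at x" "g differentiable at x"
  shows "pd b (\<lambda>x. f x * g x) x = f x * pd b g x + pd b f x * g x"
  using pd_eqI[OF has_derivative_mult[OF assms[THEN differentiable_has_derivative_pd]]] by simp

lemma pd_sum:
  assumes "\<And>i. i \<in> I \<Longrightarrow> f i differentiable at x"
  shows "pd b (\<lambda>x. \<Sum>i\<in>I. f i x) x = (\<Sum>i\<in>I. pd b (f i) x)"
  using pd_eqI[OF has_derivative_sum[OF assms[THEN differentiable_has_derivative_pd], of I "\<lambda>i. i"]] by simp

lemma pd_const: "pd b (\<lambda>x. c) = (\<lambda>x. 0)"
  by (rule ext, rule pd_eqI) simp

lemma pd_compose: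
  fixes h :: "real \<Rightarrow> real"
  assumes "f differentiable at x" "h differentiable at (f x)"
  shows "pd b (\<lambda>x. h (f x)) x = pd 1 h (f x) * pd b f x"
proof -
  have "((\<lambda>x. h (f x)) has_derivative (\<lambda>v. pd (pd v f x) h (f x))) (at x)"
    using has_derivative_compose[OF assms[THEN differentiable_has_derivative_pd]] .
  from pd_eqI[OF this] have "pd b (\<lambda>x. h (f x)) x = pd (pd b f x) h (f x)" .
  also have "\<dots> = pd 1 h (f x) * pd b f x"
    using pd_eq_grad_inner[OF assms(2)] by simp
  finally show ?thesis .
qed

lemma smooth_upto_const: "smooth_upto n (\<lambda>x. c)"
  by (induction n arbitrary: c) (auto simp: pd_const)

lemma smooth_upto_add: "smooth_upto n f \<Longrightarrow> smooth_upto n g \<Longrightarrow> smooth_upto n (\<lambda>x. f x + g x)"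
proof (induction n arbitrary: f g)
  case (Suc n)
  have "pd b (\<lambda>x. f x + g x) = (\<lambda>x. pd b f x + pd b g x)" for b
    using Suc by (intro ext pd_add) auto
  then show ?case using Suc by auto
qed simp

lemma smooth_upto_mult: "smooth_upto n f \<Longrightarrow> smooth_upto n g \<Longrightarrow> smooth_upto n (\<lambda>x. f x * g x)"
proof (induction n arbitrary: f g)
  case (Suc n)
  have "pd b (\<lambda>x. f x * g x) = (\<lambda>x. f x * pd b g x + pd b f x * g x)" for b
    using Suc by (intro ext pd_mult) auto
  moreover have "smooth_upto n f" "smooth_upto n g" using Suc.prems smooth_upto_mono le_SucI by blast+
  ultimately show ?case using Suc by (auto intro!: smooth_upto_add)
qed simp

lemma smooth_upto_compose:
  fixes h :: "real \<Rightarrow> real"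
  shows "smooth_upto n f \<Longrightarrow> smooth_upto n h \<Longrightarrow> smooth_upto n (\<lambda>x. h (f x))"
proof (induction n arbitrary: h f)
  case (Suc n)
  have "pd b (\<lambda>x. h (f x)) = (\<lambda>x. pd 1 h (f x) * pd b f x)" for b
    using Suc by (intro ext pd_compose) auto
  moreover have "smooth_upto n f" using Suc.prems smooth_upto_mono le_SucI by blast
  moreover have "(\<lambda>x. h (f x)) differentiable at x" for x
    using Suc.prems by (auto intro: differentiable_compose)
  ultimately show ?case using Suc by (auto intro!: smooth_upto_mult)
qed simp

lemma smooth_differentiable: "smooth f \<Longrightarrow> f differentiable at x"
  using smooth_iff_step by blast

lemma smooth_pd: "smooth f \<Longrightarrow> b \<in> Basis \<Longrightarrow> smooth (pd b f)"
  using smooth_iff_step by blast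

lemma smooth_continuous_on: "smooth f \<Longrightarrow> continuous_on S f"
  by (meson smooth_differentiable continuous_at_imp_continuous_on differentiable_imp_continuous_within)

lemma continuous_on_grad: "smooth f \<Longrightarrow> continuous_on S (grad f)"
  unfolding grad_eq_pd[abs_def] by (intro continuous_intros smooth_continuous_on smooth_pd)

lemma smooth_const [simp]: "smooth (\<lambda>x. c)"
  by (simp add: smooth_iff_smooth_upto smooth_upto_const)

lemma smooth_add: "smooth f \<Longrightarrow> smooth g \<Longrightarrow> smooth (\<lambda>x. f x + g x)"
  by (simp add: smooth_iff_smooth_upto smooth_upto_add)

lemma smooth_mult: "smooth f \<Longrightarrow> smooth g \<Longrightarrow> smooth (\<lambda>x. f x * g x)"
  by (simp add: smooth_iff_smooth_upto smooth_upto_mult)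

lemma smooth_diff: "smooth f \<Longrightarrow> smooth g \<Longrightarrow> smooth (\<lambda>x. f x - g x)"
  using smooth_add[OF _ smooth_mult[OF smooth_const[of "-1"]], of f g] by simp

lemma smooth_sum: "(\<And>i. i \<in> I \<Longrightarrow> smooth (f i)) \<Longrightarrow> smooth (\<lambda>x. \<Sum>i\<in>I. f i x)"
  by (induction I rule: infinite_finite_induct) (auto intro: smooth_add)

lemma smooth_prod: "(\<And>i. i \<in> I \<Longrightarrow> smooth (f i)) \<Longrightarrow> smooth (\<lambda>x. \<Prod>i\<in>I. f i x)"
  by (induction I rule: infinite_finite_induct) (auto intro: smooth_mult)

lemma smooth_compose:
  fixes h :: "real \<Rightarrow> real"
  shows "smooth f \<Longrightarrow> smooth h \<Longrightarrow> smooth (\<lambda>x. h (f x))"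
  by (simp add: smooth_iff_smooth_upto smooth_upto_compose)

lemma smooth_inner: "smooth (\<lambda>x. x \<bullet> a)"
proof -
  have d: "((\<lambda>x. x \<bullet> a) has_derivative (\<lambda>v. v \<bullet> a)) (at x)" for x
    by (auto intro!: derivative_eq_intros)
  then have "pd b (\<lambda>x. x \<bullet> a) = (\<lambda>x. b \<bullet> a)" for b by (intro ext pd_eqI)
  then show ?thesis using d by (subst smooth_iff_step) (auto simp: differentiable_def)
qed

text \<open>Two cases matter: \<open>c = 1\<close> moves the centre of a bump, and
  \<open>c = -1\<close> turns a kernel \<open>K\<close> into \<open>K (y - z)\<close> as a function
  of \<open>z\<close>.\<close>

lemma smooth_translate_reflect:
  fixes f :: "'a::euclidean_space \<Rightarrow> real"
  assumes "smooth f" shows "smooth (\<lambda>z. f (c *\<^sub>R z + a))"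
proof -
  have key: "smooth_upto n g \<Longrightarrow> smooth_upto n (\<lambda>z. g (c *\<^sub>R z + a))" for n and g :: "'a \<Rightarrow> real"
  proof (induction n arbitrary: g)
    case (Suc n)
    have d: "((\<lambda>z. g (c *\<^sub>R z + a)) has_derivative (\<lambda>v. pd (c *\<^sub>R v) g (c *\<^sub>R z + a))) (at z)" for z
      by (rule has_derivative_compose[where f = "\<lambda>z. c *\<^sub>R z + a" and g = g])
        (use Suc.prems in \<open>auto intro!: derivative_eq_intros differentiable_has_derivative_pd\<close>)
    have "pd b (\<lambda>z. g (c *\<^sub>R z + a)) = (\<lambda>z. c * pd b g (c *\<^sub>R z + a))" for b
      using Suc.prems by (auto simp: pd_eqI[OF d] pd_eq_grad_inner)
    then show ?case using Suc d by (auto simp: differentiable_def intro!: smooth_upto_mult smooth_upto_const)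
  qed simp
  show ?thesis using assms key by (simp add: smooth_iff_smooth_upto)
qed

lemma pd_translate_reflect:
  fixes f :: "'a::euclidean_space \<Rightarrow> real"
  assumes "smooth f" shows "pd b (\<lambda>z. f (c *\<^sub>R z + a)) z = c * pd b f (c *\<^sub>R z + a)"
proof -
  have d: "((\<lambda>z. f (c *\<^sub>R z + a)) has_derivative (\<lambda>v. pd (c *\<^sub>R v) f (c *\<^sub>R z + a))) (at z)" for z
      by (rule has_derivative_compose[where f = "\<lambda>z. c *\<^sub>R z + a" and g = f])
        (use assms in \<open>auto intro!: derivative_eq_intros differentiable_has_derivative_pd smooth_differentiable\<close>)
  then show ?thesis
      using assms by (auto simp: pd_eqI[OF d] pd_eq_grad_inner smooth_differentiable)
qed

section \<open>The flat function exp (-1/s) and bump functions\<close>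

definition exp_inv_power :: "nat \<Rightarrow> real \<Rightarrow> real" where
  "exp_inv_power n s = (if s \<le> 0 then 0 else exp (- (1 / s)) * (1 / s) ^ n)"

lemma exp_inv_power_tendsto_0: "(exp_inv_power n \<longlongrightarrow> 0) (at 0)"
proof -
  have "((\<lambda>u::real. u ^ n / exp u) \<longlongrightarrow> 0) at_top" by (rule tendsto_power_div_exp_0)
  then have "((\<lambda>s::real. (inverse s) ^ n / exp (inverse s)) \<longlongrightarrow> 0) (at_right 0)"
    by (rule filterlim_compose[OF _ filterlim_inverse_at_top_right])
  then have 1: "(exp_inv_power n \<longlongrightarrow> 0) (at_right 0)"
    by (rule Lim_transform_eventually)
      (auto simp: exp_inv_power_def eventually_at_filter exp_minus field_simps intro!: always_eventually)
  have "((\<lambda>s. 0) \<longlongrightarrow> (0::real)) (at_left 0)" by simp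
  then have 2: "(exp_inv_power n \<longlongrightarrow> 0) (at_left 0)"
    by (rule Lim_transform_eventually)
      (auto simp: exp_inv_power_def eventually_at_filter intro!: always_eventually)
  show ?thesis using 1 2 by (simp add: filterlim_at_split)
qed

text \<open>The derivative stays in the span of the family. This is why the power \<open>n\<close>
  is carried along: smoothness of all members follows by one induction.\<close>

lemma exp_inv_power_has_field_derivative:
  "(exp_inv_power n has_real_derivative (exp_inv_power (n+2) s - real n * exp_inv_power (n+1) s)) (at s)"
proof (cases "s = 0")
  case True
  \<comment> \<open>Dividing by \<open>y\<close> raises the power by one, so the difference quotient
    at 0 is itself a member of the family.\<close>
  have "((\<lambda>y. exp_inv_power (n+1) y) \<longlongrightarrow> 0) (at 0)" by (rule exp_inv_power_tendsto_0)
  then have "((\<lambda>y. (exp_inv_power n y - exp_inv_power n 0) / (y - 0)) \<longlongrightarrow> 0) (at 0)"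
    by (rule Lim_transform_eventually)
      (auto simp: exp_inv_power_def eventually_at_filter intro!: always_eventually)
  then show ?thesis using True by (simp add: has_field_derivative_iff exp_inv_power_def)
next
  case False
  show ?thesis
  proof (cases "s < 0")
    case True
    have "((\<lambda>s. 0) has_real_derivative 0) (at s)" by simp
    then have "(exp_inv_power n has_real_derivative 0) (at s)"
      by (rule has_field_derivative_transform_within_open[where S="{..<0}"])
        (use True in \<open>auto simp: exp_inv_power_def\<close>)
    then show ?thesis using True by (simp add: exp_inv_power_def)
  next
    case f: False
    with False have s: "s > 0" by simp
    have "((\<lambda>s. exp (- (1 / s)) * (1 / s) ^ n) has_real_derivative
       (exp (- (1 / s)) * (1/s^2)) * (1/s)^n + exp (- (1 / s)) * (real n * (1/s)^(n-1) * (- 1/s^2))) (at s)"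
      using s by (auto intro!: derivative_eq_intros simp: power2_eq_square)
    moreover have "(exp (- (1 / s)) * (1/s^2)) * (1/s)^n + exp (- (1 / s)) * (real n * (1/s)^(n-1) * (- 1/s^2))
        = exp_inv_power (n+2) s - real n * exp_inv_power (n+1) s"
      using s by (cases n) (auto simp: exp_inv_power_def power2_eq_square field_simps)
    ultimately have "((\<lambda>s. exp (- (1 / s)) * (1 / s) ^ n) has_real_derivative
        exp_inv_power (n+2) s - real n * exp_inv_power (n+1) s) (at s)" by simp
    then show ?thesis
      by (rule has_field_derivative_transform_within_open[where S="{0<..}"])
        (use s in \<open>auto simp: exp_inv_power_def\<close>)
  qed
qed

lemma smooth_exp_inv_power: "smooth (exp_inv_power n)"
proof -
  have "smooth_upto m (exp_inv_power n)" for m n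
  proof (induction m arbitrary: n)
    case (Suc m)
    have d: "(exp_inv_power n has_derivative (\<lambda>v. (exp_inv_power (n+2) s - real n * exp_inv_power (n+1) s) * v)) (at s)" for s
      using exp_inv_power_has_field_derivative[of n s] by (simp add: has_field_derivative_def mult_commute_abs)
    have "pd 1 (exp_inv_power n) = (\<lambda>s. exp_inv_power (n+2) s + (- real n) * exp_inv_power (n+1) s)"
      using pd_eqI[OF d] by auto
    then have "smooth_upto m (pd 1 (exp_inv_power n))"
      by (simp only:) (intro smooth_upto_add smooth_upto_mult smooth_upto_const Suc.IH)
    then show ?case using d by (auto simp: differentiable_def)
  qed simp
  then show ?thesis by (simp add: smooth_iff_smooth_upto)
qed

text \<open>The square of the norm, unlike the norm, is smooth at the origin.\<close>

definition bump :: "real \<Rightarrow> 'a::euclidean_space \<Rightarrow> real" where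
  "bump \<rho> x = exp_inv_power 0 (\<rho>\<^sup>2 - x \<bullet> x)"

lemma smooth_bump: "smooth (bump \<rho> :: 'a::euclidean_space \<Rightarrow> real)"
proof -
  have "smooth (\<lambda>x::'a. \<Sum>b\<in>Basis. (x \<bullet> b) * (x \<bullet> b))"
    by (intro smooth_sum smooth_mult smooth_inner)
  then have "smooth (\<lambda>x::'a. x \<bullet> x)" by (subst euclidean_inner) 
  then have "smooth (\<lambda>x::'a. \<rho>\<^sup>2 - x \<bullet> x)" by (intro smooth_diff) auto
  from smooth_compose[OF this smooth_exp_inv_power[of 0]] show ?thesis by (simp add: bump_def[abs_def])
qed

lemma bump_nonneg: "0 \<le> bump \<rho> x" by (simp add: bump_def exp_inv_power_def)

lemma bump_pos_iff: "0 < \<rho> \<Longrightarrow> 0 < bump \<rho> x \<longleftrightarrow> norm x < \<rho>"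
  by (auto simp: bump_def exp_inv_power_def dot_square_norm power_mono_iff not_le abs_less_iff power2_less_imp_less intro: power_strict_mono)
  

section \<open>Square-integrable functions\<close>

lemma square_integrable_measurable: "square_integrable M f \<Longrightarrow> f \<in> borel_measurable M"
  by (simp add: square_integrable_def)

lemma square_integrable_dominated:
  assumes f: "square_integrable M f" and g: "g \<in> borel_measurable M"
    and le: "AE x in M. norm (g x) \<le> B * norm (f x)"
  shows "square_integrable M g"
proof -
  have "integrable M (\<lambda>x. B\<^sup>2 * (norm (f x))\<^sup>2)"
    using f by (simp add: square_integrable_def)
  then have "integrable M (\<lambda>x. (norm (g x))\<^sup>2)"
  proof (rule Bochner_Integration.integrable_bound)
    show "(\<lambda>x. (norm (g x))\<^sup>2) \<in> borel_measurable M" using g by measurable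
    show "AE x in M. norm ((norm (g x))\<^sup>2) \<le> norm (B\<^sup>2 * (norm (f x))\<^sup>2)"
      using le by eventually_elim (simp add: power_mult_distrib[symmetric] power_mono)
  qed
  then show ?thesis using g by (simp add: square_integrable_def)
qed

lemma l2_norm_nonneg [simp]: "0 \<le> l2_norm M f"
  by (simp add: l2_norm_def)

lemma l2_norm_power2: "(l2_norm M f)\<^sup>2 = (LINT x|M. (norm (f x))\<^sup>2)"
  by (simp add: l2_norm_def)

lemma l2_norm_cong: "(\<And>x. x \<in> space M \<Longrightarrow> norm (f x) = norm (g x)) \<Longrightarrow> l2_norm M f = l2_norm M g"
  unfolding l2_norm_def by (auto intro!: arg_cong[where f = sqrt] Bochner_Integration.integral_cong)

lemma l2_norm_cong_AE:
  assumes "f \<in> borel_measurable M" "g \<in> borel_measurable M" "AE x in M. f x = g x"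
  shows "l2_norm M f = l2_norm M g"
proof -
  have "(LINT x|M. (norm (f x))\<^sup>2) = (LINT x|M. (norm (g x))\<^sup>2)"
    by (rule integral_cong_AE) (use assms in \<open>auto elim: eventually_mono\<close>)
  then show ?thesis by (simp add: l2_norm_def)
qed

lemma square_integrable_cong_AE:
  assumes "square_integrable M f" "g \<in> borel_measurable M" "AE x in M. f x = g x"
  shows "square_integrable M g"
  by (rule square_integrable_dominated[OF assms(1,2), of 1]) (use assms(3) in auto)

lemma l2_norm_dominated:
  assumes f: "square_integrable M f" and g: "g \<in> borel_measurable M"
    and le: "AE x in M. norm (g x) \<le> B * norm (f x)" and "0 \<le> B"
  shows "l2_norm M g \<le> B * l2_norm M f"
proof -
  have "(LINT x|M. (norm (g x))\<^sup>2) \<le> (LINT x|M. B\<^sup>2 * (norm (f x))\<^sup>2)"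
  proof (rule integral_mono_AE)
    show "integrable M (\<lambda>x. (norm (g x))\<^sup>2)"
      using square_integrable_dominated[OF f g le] by (simp add: square_integrable_def)
    show "integrable M (\<lambda>x. B\<^sup>2 * (norm (f x))\<^sup>2)" using f by (simp add: square_integrable_def)
    show "AE x in M. (norm (g x))\<^sup>2 \<le> B\<^sup>2 * (norm (f x))\<^sup>2"
      using le
    proof eventually_elim
      case (elim x)
      then have "(norm (g x))\<^sup>2 \<le> (B * norm (f x))\<^sup>2" by (rule power_mono) simp
      then show ?case by (simp only: power_mult_distrib)
    qed
  qed
  also have "\<dots> = B\<^sup>2 * (LINT x|M. (norm (f x))\<^sup>2)" by simp
  finally have "(l2_norm M g)\<^sup>2 \<le> (B * l2_norm M f)\<^sup>2"
    by (simp only: l2_norm_power2 power_mult_distrib)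
  then show ?thesis by (rule power2_le_imp_le) (simp add: \<open>0 \<le> B\<close>)
qed

lemma square_integrable_zero [simp]: "square_integrable M (\<lambda>x. 0)"
  by (simp add: square_integrable_def)

lemma square_integrable_add:
  fixes f g :: "'a \<Rightarrow> 'b::euclidean_space"
  assumes "square_integrable M f" "square_integrable M g"
  shows "square_integrable M (\<lambda>x. f x + g x)"
proof -
  have m [measurable]: "f \<in> borel_measurable M" "g \<in> borel_measurable M"
    using assms by (auto simp: square_integrable_def)
  have "integrable M (\<lambda>x. 2 * (norm (f x))\<^sup>2 + 2 * (norm (g x))\<^sup>2)"
    using assms by (simp add: square_integrable_def)
  then have "integrable M (\<lambda>x. (norm (f x + g x))\<^sup>2)"
  proof (rule Bochner_Integration.integrable_bound)
    show "(\<lambda>x. (norm (f x + g x))\<^sup>2) \<in> borel_measurable M" by measurable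
    have "(norm (f x + g x))\<^sup>2 \<le> 2 * (norm (f x))\<^sup>2 + 2 * (norm (g x))\<^sup>2" for x
    proof -
      have "(norm (f x + g x))\<^sup>2 \<le> (norm (f x) + norm (g x))\<^sup>2"
        by (simp add: norm_triangle_ineq power_mono)
      also have "\<dots> \<le> 2 * (norm (f x))\<^sup>2 + 2 * (norm (g x))\<^sup>2"
        using sum_squares_bound[of "norm (f x)" "norm (g x)"] by (simp add: power2_sum)
      finally show ?thesis .
    qed
    then show "AE x in M. norm ((norm (f x + g x))\<^sup>2) \<le> norm (2 * (norm (f x))\<^sup>2 + 2 * (norm (g x))\<^sup>2)"
      by simp
  qed
  then show ?thesis by (simp add: square_integrable_def)
qed

lemma square_integrable_scaleR:
  fixes f :: "'a \<Rightarrow> 'b::euclidean_space"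
  assumes "square_integrable M f" shows "square_integrable M (\<lambda>x. c *\<^sub>R f x)"
  using assms unfolding square_integrable_def by (auto simp: power_mult_distrib)

lemma l2_norm_scaleR:
  fixes f :: "'a \<Rightarrow> 'b::euclidean_space"
  shows "l2_norm M (\<lambda>x. c *\<^sub>R f x) = \<bar>c\<bar> * l2_norm M f"
  by (simp add: l2_norm_def power_mult_distrib real_sqrt_mult)

lemma square_integrable_cmult:
  fixes f :: "'a \<Rightarrow> real"
  assumes "square_integrable M f" shows "square_integrable M (\<lambda>x. c * f x)"
  using square_integrable_scaleR[OF assms, of c] by simp

lemma square_integrable_diff:
  fixes f g :: "'a \<Rightarrow> 'b::euclidean_space"
  assumes "square_integrable M f" "square_integrable M g"
  shows "square_integrable M (\<lambda>x. f x - g x)"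
  using square_integrable_add[OF assms(1) square_integrable_scaleR[OF assms(2), of "-1"]] by simp

lemma square_integrable_sum:
  fixes f :: "'i \<Rightarrow> 'a \<Rightarrow> 'b::euclidean_space"
  shows "(\<And>i. i \<in> I \<Longrightarrow> square_integrable M (f i)) \<Longrightarrow> square_integrable M (\<lambda>x. \<Sum>i\<in>I. f i x)"
  by (induction I rule: infinite_finite_induct) (auto intro: square_integrable_add)

lemma square_integrable_inner:
  fixes f g :: "'a \<Rightarrow> 'b::euclidean_space"
  assumes "square_integrable M f" "square_integrable M g"
  shows "integrable M (\<lambda>x. f x \<bullet> g x)"
proof -
  have m [measurable]: "f \<in> borel_measurable M" "g \<in> borel_measurable M"
    using assms by (auto simp: square_integrable_def)
  have "integrable M (\<lambda>x. (norm (f x))\<^sup>2 + (norm (g x))\<^sup>2)"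
    using assms by (simp add: square_integrable_def)
  then show ?thesis
  proof (rule Bochner_Integration.integrable_bound)
    show "(\<lambda>x. f x \<bullet> g x) \<in> borel_measurable M" by measurable
    have "\<bar>f x \<bullet> g x\<bar> \<le> (norm (f x))\<^sup>2 + (norm (g x))\<^sup>2" for x
    proof -
      have "\<bar>f x \<bullet> g x\<bar> \<le> norm (f x) * norm (g x)" by (rule Cauchy_Schwarz_ineq2)
      also have "\<dots> \<le> (norm (f x))\<^sup>2 + (norm (g x))\<^sup>2"
      proof -
        have "0 \<le> norm (f x) * norm (g x)" by simp
        then show ?thesis using sum_squares_bound[of "norm (f x)" "norm (g x)"] by linarith
      qed
      finally show ?thesis .
    qed
    then show "AE x in M. norm (f x \<bullet> g x) \<le> norm ((norm (f x))\<^sup>2 + (norm (g x))\<^sup>2)" by simp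
  qed
qed

lemma square_integrable_times:
  fixes f g :: "'a \<Rightarrow> real"
  assumes "square_integrable M f" "square_integrable M g"
  shows "integrable M (\<lambda>x. f x * g x)"
  using square_integrable_inner[OF assms] by simp

lemma l2_norm_add_power2:
  fixes f g :: "'a \<Rightarrow> 'b::euclidean_space"
  assumes f: "square_integrable M f" and g: "square_integrable M g"
  shows "(l2_norm M (\<lambda>x. f x + g x))\<^sup>2 = (l2_norm M f)\<^sup>2 + 2 * (LINT x|M. f x \<bullet> g x) + (l2_norm M g)\<^sup>2"
proof -
  have "(LINT x|M. (norm (f x + g x))\<^sup>2) = (LINT x|M. (norm (f x))\<^sup>2 + 2 * (f x \<bullet> g x) + (norm (g x))\<^sup>2)"
    by (simp add: power2_norm_eq_inner inner_add algebra_simps inner_commute)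
  also have "\<dots> = (LINT x|M. (norm (f x))\<^sup>2) + 2 * (LINT x|M. f x \<bullet> g x) + (LINT x|M. (norm (g x))\<^sup>2)"
    using f g square_integrable_inner[OF f g] by (simp add: square_integrable_def)
  finally show ?thesis by (simp add: l2_norm_power2)
qed

lemma l2_Cauchy_Schwarz:
  fixes f g :: "'a \<Rightarrow> 'b::euclidean_space"
  assumes f: "square_integrable M f" and g: "square_integrable M g"
  shows "\<bar>LINT x|M. f x \<bullet> g x\<bar> \<le> l2_norm M f * l2_norm M g"
proof -
  define a b c where "a = (l2_norm M f)\<^sup>2" and "b = (LINT x|M. f x \<bullet> g x)" and "c = (l2_norm M g)\<^sup>2"
  have q: "0 \<le> a + 2 * t * b + t\<^sup>2 * c" for t
  proof -
    have "0 \<le> (l2_norm M (\<lambda>x. f x + t *\<^sub>R g x))\<^sup>2" by simp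
    also have "\<dots> = a + 2 * t * b + t\<^sup>2 * c"
      unfolding l2_norm_add_power2[OF f square_integrable_scaleR[OF g]] a_def b_def c_def
      by (simp add: l2_norm_scaleR power_mult_distrib)
    finally show ?thesis .
  qed
  have c0: "0 \<le> c" by (simp add: c_def)
  have "b\<^sup>2 \<le> a * c"
  proof (cases "c = 0")
    case True
    \<comment> \<open>With \<open>c = 0\<close> the quadratic in \<open>t\<close> is affine; a
      nonzero slope would make it equal to -1 where \<open>2 * t * b = - (a + 1)\<close>.\<close>
    have "b = 0"
    proof (rule ccontr)
      assume "b \<noteq> 0"
      then have "2 * (- (a + 1) / (2 * b)) * b = - (a + 1)" by (simp add: field_simps)
      then show False using q[of "- (a + 1) / (2 * b)"] True by simp
    qed
    then show ?thesis using True by simp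
  next
    case False
    then have "c > 0" using c0 by simp
    then have "a + 2 * (- b / c) * b + (- b / c)\<^sup>2 * c = a - b\<^sup>2 / c"
      by (simp add: power2_eq_square)
    then have "b\<^sup>2 / c \<le> a" using q[of "- b / c"] by simp
    then show ?thesis using \<open>c > 0\<close> by (simp add: pos_divide_le_eq)
  qed
  then have "b\<^sup>2 \<le> (l2_norm M f * l2_norm M g)\<^sup>2" by (simp add: a_def c_def power_mult_distrib)
  then have "\<bar>b\<bar> \<le> \<bar>l2_norm M f * l2_norm M g\<bar>" by (simp only: abs_le_square_iff)
  then show ?thesis unfolding b_def by (simp add: abs_mult)
qed

lemma l2_norm_triangle:
  fixes f g :: "'a \<Rightarrow> 'b::euclidean_space"
  assumes f: "square_integrable M f" and g: "square_integrable M g"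
  shows "l2_norm M (\<lambda>x. f x + g x) \<le> l2_norm M f + l2_norm M g"
proof (rule power2_le_imp_le)
  show "(l2_norm M (\<lambda>x. f x + g x))\<^sup>2 \<le> (l2_norm M f + l2_norm M g)\<^sup>2"
    unfolding l2_norm_add_power2[OF f g] power2_sum using l2_Cauchy_Schwarz[OF f g] by simp
qed simp

lemma l2_norm_triangle_diff:
  fixes f g :: "'a \<Rightarrow> 'b::euclidean_space"
  assumes f: "square_integrable M f" and g: "square_integrable M g"
  shows "l2_norm M (\<lambda>x. f x - g x) \<le> l2_norm M f + l2_norm M g"
  using l2_norm_triangle[OF f square_integrable_scaleR[OF g, of "-1"]] l2_norm_scaleR[of M "-1" g] by simp

lemma l2_norm_sum:
  fixes f :: "'i \<Rightarrow> 'a \<Rightarrow> 'b::euclidean_space"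
  assumes "\<And>i. i \<in> I \<Longrightarrow> square_integrable M (f i)"
  shows "l2_norm M (\<lambda>x. \<Sum>i\<in>I. f i x) \<le> (\<Sum>i\<in>I. l2_norm M (f i))"
  using assms
proof (induction I rule: infinite_finite_induct)
  case (insert i I)
  then have "l2_norm M (\<lambda>x. f i x + (\<Sum>i\<in>I. f i x)) \<le> l2_norm M (f i) + l2_norm M (\<lambda>x. \<Sum>i\<in>I. f i x)"
    by (intro l2_norm_triangle square_integrable_sum) auto
  then show ?case using insert by force
qed (auto simp: l2_norm_def)

lemma l2_norm_eq_0_iff:
  assumes f: "square_integrable M f"
  shows "l2_norm M f = 0 \<longleftrightarrow> (AE x in M. f x = 0)"
proof -
  have "l2_norm M f = 0 \<longleftrightarrow> (LINT x|M. (norm (f x))\<^sup>2) = 0" by (simp add: l2_norm_def)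
  also have "\<dots> \<longleftrightarrow> (AE x in M. (norm (f x))\<^sup>2 = 0)"
    using f by (intro integral_nonneg_eq_0_iff_AE) (auto simp: square_integrable_def)
  finally show ?thesis by simp
qed

lemma l2_norm_limit_unique:
  fixes f g :: "'a \<Rightarrow> 'b::euclidean_space"
  assumes F: "\<And>n. square_integrable M (F n)" and f: "square_integrable M f" and g: "square_integrable M g"
    and 1: "(\<lambda>n. l2_norm M (\<lambda>x. F n x - f x)) \<longlonglongrightarrow> 0"
    and 2: "(\<lambda>n. l2_norm M (\<lambda>x. F n x - g x)) \<longlonglongrightarrow> 0"
  shows "AE x in M. f x = g x"
proof -
  have "l2_norm M (\<lambda>x. f x - g x) \<le> l2_norm M (\<lambda>x. F n x - g x) + l2_norm M (\<lambda>x. F n x - f x)" for n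
    using l2_norm_triangle_diff[OF square_integrable_diff[OF F[of n] g] square_integrable_diff[OF F[of n] f]]
    by simp
  moreover have "(\<lambda>n. l2_norm M (\<lambda>x. F n x - g x) + l2_norm M (\<lambda>x. F n x - f x)) \<longlonglongrightarrow> 0 + 0"
    by (intro tendsto_add 1 2)
  ultimately have "l2_norm M (\<lambda>x. f x - g x) \<le> 0"
    by (intro LIMSEQ_le_const[where X = "\<lambda>n. l2_norm M (\<lambda>x. F n x - g x) + l2_norm M (\<lambda>x. F n x - f x)"]) auto
  then have "l2_norm M (\<lambda>x. f x - g x) = 0" by (simp add: antisym)
  then show ?thesis using l2_norm_eq_0_iff[OF square_integrable_diff[OF f g]] by simp
qed

lemma l2_inner_tendsto:
  fixes f g :: "'a \<Rightarrow> 'b::euclidean_space"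
  assumes F: "\<And>n. square_integrable M (F n)" and f: "square_integrable M f" and g: "square_integrable M g"
    and 1: "(\<lambda>n. l2_norm M (\<lambda>x. F n x - f x)) \<longlonglongrightarrow> 0"
  shows "(\<lambda>n. LINT x|M. F n x \<bullet> g x) \<longlonglongrightarrow> (LINT x|M. f x \<bullet> g x)"
proof -
  have "\<bar>(LINT x|M. F n x \<bullet> g x) - (LINT x|M. f x \<bullet> g x)\<bar> \<le> l2_norm M (\<lambda>x. F n x - f x) * l2_norm M g" for n
  proof -
    have "(LINT x|M. F n x \<bullet> g x) - (LINT x|M. f x \<bullet> g x) = (LINT x|M. (F n x - f x) \<bullet> g x)"
      using square_integrable_inner[OF F g] square_integrable_inner[OF f g] by (simp add: inner_diff_left)
    then show ?thesis using l2_Cauchy_Schwarz[OF square_integrable_diff[OF F f] g] by simp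
  qed
  moreover have "(\<lambda>n. l2_norm M (\<lambda>x. F n x - f x) * l2_norm M g) \<longlonglongrightarrow> 0"
    using tendsto_mult[OF 1 tendsto_const] by simp
  ultimately have "(\<lambda>n. (LINT x|M. F n x \<bullet> g x) - (LINT x|M. f x \<bullet> g x)) \<longlonglongrightarrow> 0"
    by - (rule Lim_null_comparison[OF always_eventually], auto)
  then show ?thesis by (simp only: LIM_zero_iff)
qed

lemma square_integrable_component:
  fixes f :: "'a \<Rightarrow> 'b::euclidean_space"
  assumes "square_integrable M f" shows "square_integrable M (\<lambda>x. f x \<bullet> b)"
proof (rule square_integrable_dominated[OF assms, of _ "norm b"])
  show "(\<lambda>x. f x \<bullet> b) \<in> borel_measurable M"
    using assms by (auto simp: square_integrable_def)
  show "AE x in M. norm (f x \<bullet> b) \<le> norm b * norm (f x)"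
    by (intro always_eventually allI) (metis Cauchy_Schwarz_ineq2 mult.commute real_norm_def)
qed

lemma square_integrable_scaleR_vector:
  fixes f :: "'a \<Rightarrow> real" and b :: "'b::euclidean_space"
  assumes "square_integrable M f" shows "square_integrable M (\<lambda>x. f x *\<^sub>R b)"
  by (rule square_integrable_dominated[OF assms, of _ "norm b"])
    (use assms in \<open>auto simp: square_integrable_def mult.commute\<close>)

lemma integrable_scaleR_l2:
  fixes G :: "'c \<Rightarrow> 'b::euclidean_space"
  assumes f: "square_integrable M f" and G: "square_integrable M G"
  shows "integrable M (\<lambda>x. f x *\<^sub>R G x)"
proof -
  have "integrable M (\<lambda>x. (f x * (G x \<bullet> b)) *\<^sub>R b)" for b
    by (intro integrable_scaleR_left square_integrable_times square_integrable_component G f)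
  then have "integrable M (\<lambda>x. \<Sum>b\<in>Basis. (f x * (G x \<bullet> b)) *\<^sub>R b)"
    by (intro Bochner_Integration.integrable_sum)
  moreover have "(\<Sum>b\<in>Basis. (f x * (G x \<bullet> b)) *\<^sub>R b) = f x *\<^sub>R G x" for x
    by (simp only: scaleR_scaleR[symmetric] scaleR_sum_right[symmetric] euclidean_representation)
  ultimately show ?thesis by simp
qed

lemma l2_norm_scaleR_vector:
  fixes f :: "'a \<Rightarrow> real" and b :: "'b::euclidean_space"
  shows "l2_norm M (\<lambda>x. f x *\<^sub>R b) = norm b * l2_norm M f"
  by (simp add: l2_norm_def power_mult_distrib real_sqrt_mult)

lemma square_integrable_from_components:
  fixes f :: "'b::euclidean_space \<Rightarrow> 'a \<Rightarrow> real"
  assumes "\<And>b. b \<in> Basis \<Longrightarrow> square_integrable M (f b)"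
  shows "square_integrable M (\<lambda>x. \<Sum>b\<in>Basis. f b x *\<^sub>R b)"
  using assms by (intro square_integrable_sum square_integrable_scaleR_vector)

lemma l2_norm_components_le:
  fixes f :: "'a \<Rightarrow> 'b::euclidean_space"
  assumes "square_integrable M f"
  shows "l2_norm M f \<le> (\<Sum>b\<in>Basis. l2_norm M (\<lambda>x. f x \<bullet> b))"
proof -
  have "l2_norm M (\<lambda>x. \<Sum>b\<in>Basis. (f x \<bullet> b) *\<^sub>R b) \<le> (\<Sum>b\<in>Basis. l2_norm M (\<lambda>x. (f x \<bullet> b) *\<^sub>R b))"
    by (intro l2_norm_sum square_integrable_scaleR_vector square_integrable_component assms)
  then show ?thesis by (simp add: euclidean_representation l2_norm_scaleR_vector)
qed

lemma nn_integral_power2_l2: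
  assumes "square_integrable M f"
  shows "(\<integral>\<^sup>+x. ennreal ((norm (f x))\<^sup>2) \<partial>M) = ennreal ((l2_norm M f)\<^sup>2)"
  using assms by (simp add: square_integrable_def l2_norm_power2 nn_integral_eq_integral)

text \<open>For convolutions and limits, whose square-integrability is not known beforehand: a bound
  on the nonnegative integral yields it together with the norm estimate.\<close>

lemma square_integrable_l2_norm_leI:
  assumes "f \<in> borel_measurable M" "(\<integral>\<^sup>+x. ennreal ((norm (f x))\<^sup>2) \<partial>M) \<le> ennreal (B\<^sup>2)" "0 \<le> B"
  shows "square_integrable M f" "l2_norm M f \<le> B"
proof -
  have "integrable M (\<lambda>x. (norm (f x))\<^sup>2)"
    by (rule integrableI_bounded) (use assms in \<open>auto simp: le_less_trans[OF _ ennreal_less_top]\<close>)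
  then show s: "square_integrable M f" using assms by (simp add: square_integrable_def)
  then have "(l2_norm M f)\<^sup>2 \<le> B\<^sup>2" using nn_integral_power2_l2[OF s] assms(2) by simp
  then show "l2_norm M f \<le> B" using assms(3) by (rule power2_le_imp_le)
qed

section \<open>Hausdorff measure\<close>

lemma hausdorff_pre_le:
  assumes "A \<subseteq> (\<Union>i. C i)" "\<And>i. bounded (C i)" "\<And>i. diameter (C i) \<le> \<delta>"
  shows "hausdorff_pre s \<delta> A \<le> (\<Sum>i. ennreal (unit_ball_vol s * (diameter (C i) / 2) powr s))"
  unfolding hausdorff_pre_def by (rule INF_lower) (use assms in auto)

lemma hausdorff_pre_greatest:
  assumes "\<And>C. A \<subseteq> (\<Union>i. C i) \<Longrightarrow> (\<And>i. bounded (C i)) \<Longrightarrow> (\<And>i. diameter (C i) \<le> \<delta>) \<Longrightarrow>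
      z \<le> (\<Sum>i. ennreal (unit_ball_vol s * (diameter (C i) / 2) powr s))"
  shows "z \<le> hausdorff_pre s \<delta> A"
  unfolding hausdorff_pre_def by (rule INF_greatest) (use assms in auto)

lemma hausdorff_pre_mono: "A \<subseteq> B \<Longrightarrow> hausdorff_pre s \<delta> A \<le> hausdorff_pre s \<delta> B"
  by (rule hausdorff_pre_greatest, rule hausdorff_pre_le) auto

lemma hausdorff_pre_antimono: "\<delta>' \<le> \<delta> \<Longrightarrow> hausdorff_pre s \<delta> A \<le> hausdorff_pre s \<delta>' A"
  by (rule hausdorff_pre_greatest, rule hausdorff_pre_le) (auto intro: order_trans)

lemma hausdorff_pre_empty: "0 \<le> \<delta> \<Longrightarrow> hausdorff_pre s \<delta> {} = 0"
  using hausdorff_pre_le[of "{}" "\<lambda>i. {}" \<delta> s] by simp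

text \<open>Each \<open>A n\<close> gets a cover that is optimal up to
  \<open>e * (1/2) ^ Suc n\<close>; the doubly indexed covers are then enumerated as one sequence,
  and the errors add up to \<open>e\<close>.\<close>

lemma hausdorff_pre_countably_subadditive:
  "hausdorff_pre s \<delta> (\<Union>n. A n) \<le> (\<Sum>n. hausdorff_pre s \<delta> (A n))"
proof (rule ennreal_le_epsilon)
  fix e :: real
  assume fin: "(\<Sum>n. hausdorff_pre s \<delta> (A n)) < top" and "0 < e"
  let ?w = "\<lambda>X. ennreal (unit_ball_vol s * (diameter X / 2) powr s)"
  have ex: "\<exists>C. A n \<subseteq> (\<Union>i. C i) \<and> (\<forall>i. bounded (C i) \<and> diameter (C i) \<le> \<delta>) \<and>
      (\<Sum>i. ?w (C i)) \<le> hausdorff_pre s \<delta> (A n) + ennreal (e * (1/2) ^ Suc n)" for n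
  proof -
    have "hausdorff_pre s \<delta> (A n) \<noteq> top"
      using fin by (metis ennreal_suminf_lessD infinity_ennreal_def less_top)
    then obtain h where h: "hausdorff_pre s \<delta> (A n) = ennreal h" "0 \<le> h"
      by (cases "hausdorff_pre s \<delta> (A n)") auto
    have "0 < e * (1/2) ^ Suc n" using \<open>0 < e\<close> by simp
    then have "hausdorff_pre s \<delta> (A n) < hausdorff_pre s \<delta> (A n) + ennreal (e * (1/2) ^ Suc n)"
      unfolding h using h(2) ennreal_less_iff[of h "h + e * (1/2) ^ Suc n"] ennreal_plus[of h "e * (1/2) ^ Suc n"] by simp
    moreover have "\<exists>C. A n \<subseteq> (\<Union>i. C i) \<and> (\<forall>i. bounded (C i) \<and> diameter (C i) \<le> \<delta>) \<and> (\<Sum>i. ?w (C i)) \<le> z"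
      if "hausdorff_pre s \<delta> (A n) < z" for z
    proof -
      from that[unfolded hausdorff_pre_def INF_less_iff]
      obtain C where C: "C \<in> {C. A n \<subseteq> (\<Union>i. C i) \<and> (\<forall>i. bounded (C i) \<and> diameter (C i) \<le> \<delta>)}" "(\<Sum>i. ?w (C i)) < z"
        by (rule bexE)
      show ?thesis
        using C(1) less_imp_le[OF C(2)] by (intro exI[of _ C]) simp
    qed
    ultimately show ?thesis by blast
  qed
  then obtain C where C: "\<And>n. A n \<subseteq> (\<Union>i. C n i)" "\<And>n i. bounded (C n i)" "\<And>n i. diameter (C n i) \<le> \<delta>"
      "\<And>n. (\<Sum>i. ?w (C n i)) \<le> hausdorff_pre s \<delta> (A n) + ennreal (e * (1/2) ^ Suc n)"
    by metis
  have "hausdorff_pre s \<delta> (\<Union>n. A n) \<le> (\<Sum>k. ?w (case_prod C (prod_decode k)))"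
  proof (rule hausdorff_pre_le)
    show "(\<Union>n. A n) \<subseteq> (\<Union>k. case_prod C (prod_decode k))"
    proof
      fix x assume "x \<in> (\<Union>n. A n)"
      then obtain n where "x \<in> A n" by (rule UN_E)
      then have "x \<in> (\<Union>i. C n i)" using C(1)[of n] by (rule rev_subsetD)
      then obtain i where "x \<in> C n i" by (rule UN_E)
      then have "x \<in> case_prod C (prod_decode (prod_encode (n, i)))" by simp
      then show "x \<in> (\<Union>k. case_prod C (prod_decode k))" by (rule UN_I[OF UNIV_I])
    qed
  qed (auto simp: C split: prod.split)
  also have "\<dots> = (\<Sum>n. \<Sum>i. ?w (C n i))"
    using suminf_ennreal_2dimen[of "\<lambda>n. \<Sum>i. ?w (C n i)" "\<lambda>(n,i). ?w (C n i)"]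
    by (simp add: comp_def split_beta' )
  also have "\<dots> \<le> (\<Sum>n. hausdorff_pre s \<delta> (A n) + ennreal (e * (1/2) ^ Suc n))"
    by (intro suminf_le C(4)) auto
  also have "\<dots> = (\<Sum>n. hausdorff_pre s \<delta> (A n)) + (\<Sum>n. ennreal (e * (1/2) ^ Suc n))"
    by (intro suminf_add[symmetric]) auto
  also have "(\<Sum>n. ennreal (e * (1/2) ^ Suc n)) = ennreal e"
  proof -
    have "(\<lambda>n. e * (1/2) ^ Suc n) sums (e * 1)" by (intro sums_mult power_half_series)
    then show ?thesis using \<open>0 < e\<close> by (simp add: suminf_ennreal_eq sums_unique[symmetric])
  qed
  finally show "hausdorff_pre s \<delta> (\<Union>n. A n) \<le> (\<Sum>n. hausdorff_pre s \<delta> (A n)) + ennreal e" .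
qed

section \<open>Hausdorff outer measure and Caratheodory's theorem\<close>

lemma hausdorff_pre_le_outer: "0 < \<delta> \<Longrightarrow> hausdorff_pre s \<delta> A \<le> hausdorff_outer s A"
  unfolding hausdorff_outer_def by (rule SUP_upper) auto

lemma hausdorff_outer_mono: "A \<subseteq> B \<Longrightarrow> hausdorff_outer s A \<le> hausdorff_outer s B"
  unfolding hausdorff_outer_def by (intro SUP_mono') (auto intro: hausdorff_pre_mono)

lemma outer_measure_space_hausdorff: "outer_measure_space (Pow UNIV) (hausdorff_outer s :: 'a::metric_space set \<Rightarrow> ennreal)"
  unfolding outer_measure_space_def
proof (intro conjI)
  show "positive (Pow UNIV) (hausdorff_outer s :: 'a set \<Rightarrow> ennreal)"
    unfolding positive_def hausdorff_outer_def
    by (rule antisym) (auto intro!: SUP_least simp: hausdorff_pre_empty)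
  show "increasing (Pow UNIV) (hausdorff_outer s :: 'a set \<Rightarrow> ennreal)"
    unfolding increasing_def by (simp add: hausdorff_outer_mono)
  show "countably_subadditive (Pow UNIV) (hausdorff_outer s :: 'a set \<Rightarrow> ennreal)"
    unfolding countably_subadditive_def
  proof (intro allI impI)
    fix A :: "nat \<Rightarrow> 'a set"
    have "hausdorff_pre s \<delta> (\<Union>n. A n) \<le> (\<Sum>n. hausdorff_outer s (A n))" if "0 < \<delta>" for \<delta>
    proof -
      have "hausdorff_pre s \<delta> (\<Union>n. A n) \<le> (\<Sum>n. hausdorff_pre s \<delta> (A n))"
        by (rule hausdorff_pre_countably_subadditive)
      also have "\<dots> \<le> (\<Sum>n. hausdorff_outer s (A n))"
        by (intro suminf_le hausdorff_pre_le_outer that) auto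
      finally show ?thesis .
    qed
    then show "hausdorff_outer s (\<Union>n. A n) \<le> (\<Sum>n. hausdorff_outer s (A n))"
      unfolding hausdorff_outer_def[of s "\<Union>n. A n"] by (intro SUP_least) auto
  qed
qed

text \<open>As soon as the mesh is below the gap \<eta>, no covering set meets both parts, so a
  cover of the union splits into a cover of each.\<close>

lemma hausdorff_outer_separated:
  fixes P Q :: "'a::metric_space set"
  assumes \<eta>: "0 < \<eta>" and sep: "\<And>x y. x \<in> P \<Longrightarrow> y \<in> Q \<Longrightarrow> \<eta> \<le> dist x y"
  shows "hausdorff_outer s P + hausdorff_outer s Q \<le> hausdorff_outer s (P \<union> Q)"
proof -
  let ?w = "\<lambda>X. ennreal (unit_ball_vol s * (diameter X / 2) powr s)"
  have small: "hausdorff_pre s \<delta> P + hausdorff_pre s \<delta> Q \<le> hausdorff_pre s \<delta> (P \<union> Q)" if "0 < \<delta>" "\<delta> < \<eta>" for \<delta>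
  proof (rule hausdorff_pre_greatest)
    fix C :: "nat \<Rightarrow> 'a set"
    assume C: "P \<union> Q \<subseteq> (\<Union>i. C i)" "\<And>i. bounded (C i)" "\<And>i. diameter (C i) \<le> \<delta>"
    \<comment> \<open>Covering sets that miss \<open>X\<close> are emptied instead of removed: the
      indexing is kept, and empty sets cost nothing.\<close>
    define C' where "C' X i = (if C i \<inter> X = {} then {} else C i)" for X i
    have "0 \<le> diameter (C i)" for i using C(2) by (rule diameter_ge_0)
    then have C': "bounded (C' X i)" "diameter (C' X i) \<le> \<delta>" for X i
      using C(2,3) \<open>0 < \<delta>\<close> by (auto simp: C'_def)
    have cov: "X \<subseteq> (\<Union>i. C' X i)" if "X \<subseteq> P \<union> Q" for X
    proof
      fix x assume "x \<in> X"
      with that C(1) have "x \<in> (\<Union>i. C i)" by (meson subsetD)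
      then obtain i where "x \<in> C i" by (rule UN_E)
      with \<open>x \<in> X\<close> have "x \<in> C' X i" by (auto simp: C'_def)
      then show "x \<in> (\<Union>i. C' X i)" by blast
    qed
    have "hausdorff_pre s \<delta> P \<le> (\<Sum>i. ?w (C' P i))"
      by (rule hausdorff_pre_le) (use cov C' in auto)
    moreover have "hausdorff_pre s \<delta> Q \<le> (\<Sum>i. ?w (C' Q i))"
      by (rule hausdorff_pre_le) (use cov C' in auto)
    ultimately have "hausdorff_pre s \<delta> P + hausdorff_pre s \<delta> Q \<le> (\<Sum>i. ?w (C' P i)) + (\<Sum>i. ?w (C' Q i))"
      by (rule add_mono)
    also have "\<dots> = (\<Sum>i. ?w (C' P i) + ?w (C' Q i))" by (rule suminf_add) auto
    also have "\<dots> \<le> (\<Sum>i. ?w (C i))"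
    proof (intro suminf_le)
      fix i
      have "C i \<inter> P = {} \<or> C i \<inter> Q = {}"
      proof (rule ccontr)
        assume "\<not> ?thesis"
        then obtain x y where xy: "x \<in> C i" "x \<in> P" "y \<in> C i" "y \<in> Q" by blast
        then have "dist x y \<le> diameter (C i)" using C(2) by (intro diameter_bounded_bound)
        then show False using sep[of x y] xy C(3)[of i] that by simp
      qed
      then show "?w (C' P i) + ?w (C' Q i) \<le> ?w (C i)"
        by (auto simp: C'_def)
    qed auto
    finally show "hausdorff_pre s \<delta> P + hausdorff_pre s \<delta> Q \<le> (\<Sum>i. ?w (C i))" .
  qed
  \<comment> \<open>Two independent scales allow the two suprema to be taken one at a time; a common
    smaller scale reduces to the case above.\<close>
  have *: "hausdorff_pre s \<delta>1 P + hausdorff_pre s \<delta>2 Q \<le> hausdorff_outer s (P \<union> Q)" if "0 < \<delta>1" "0 < \<delta>2" for \<delta>1 \<delta>2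
  proof -
    define \<delta> where "\<delta> = min (\<eta> / 2) (min \<delta>1 \<delta>2)"
    have \<delta>: "0 < \<delta>" "\<delta> < \<eta>" "\<delta> \<le> \<delta>1" "\<delta> \<le> \<delta>2" using that \<eta> by (auto simp: \<delta>_def min_def)
    have "hausdorff_pre s \<delta>1 P + hausdorff_pre s \<delta>2 Q \<le> hausdorff_pre s \<delta> P + hausdorff_pre s \<delta> Q"
      using \<delta> by (intro add_mono hausdorff_pre_antimono)
    also have "\<dots> \<le> hausdorff_pre s \<delta> (P \<union> Q)" by (rule small) (use \<delta> in auto)
    also have "\<dots> \<le> hausdorff_outer s (P \<union> Q)" by (rule hausdorff_pre_le_outer) (use \<delta> in auto)
    finally show ?thesis .
  qed
  have "hausdorff_outer s P + hausdorff_pre s \<delta>2 Q \<le> hausdorff_outer s (P \<union> Q)" if "0 < \<delta>2" for \<delta>2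
    unfolding hausdorff_outer_def[of s P]
    by (subst ennreal_SUP_add_left[symmetric]) (use * that in \<open>auto intro!: SUP_least\<close>)
  then have "hausdorff_pre s \<delta> Q + hausdorff_outer s P \<le> hausdorff_outer s (P \<union> Q)" if "0 < \<delta>" for \<delta>
    using that by (simp add: add.commute)
  then have "hausdorff_outer s Q + hausdorff_outer s P \<le> hausdorff_outer s (P \<union> Q)"
    unfolding hausdorff_outer_def[of s Q]
    by (subst ennreal_SUP_add_left[symmetric]) (auto intro!: SUP_least)
  then show ?thesis by (simp add: add.commute)
qed

text \<open>
  Caratheodory's criterion for a metric outer measure: the part of \<open>A\<close> near \<open>F\<close> is split into
  the shells \<open>C n\<close>; shells of the same parity are separated, so their measures are summable.
\<close>
lemma closed_in_lambda_system_hausdorff: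
  fixes F :: "'a::metric_space set"
  assumes "closed F"
  shows "F \<in> lambda_system UNIV (Pow UNIV) (hausdorff_outer s)"
proof (cases "F = {}")
  case True
  then show ?thesis
    using outer_measure_space_hausdorff[of s] unfolding lambda_system_def outer_measure_space_def positive_def by auto
next
  case F: False
  let ?H = "hausdorff_outer s"
  have csub: "?H (\<Union>n. X n) \<le> (\<Sum>n. ?H (X n))" for X :: "nat \<Rightarrow> 'a set"
  proof -
    have "?H (\<Union>n. disjointed X n) \<le> (\<Sum>n. ?H (disjointed X n))"
      using outer_measure_space_hausdorff[of s] disjoint_family_disjointed[of X]
      unfolding outer_measure_space_def countably_subadditive_def by auto
    also have "\<dots> \<le> (\<Sum>n. ?H (X n))"
      by (intro suminf_le hausdorff_outer_mono disjointed_subset) auto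
    finally show ?thesis by (simp add: UN_disjointed_eq)
  qed
  have sub: "?H (X \<union> Y) \<le> ?H X + ?H Y" for X Y :: "'a set"
  proof -
    have "?H {} = 0" using outer_measure_space_hausdorff[of s] by (auto simp: outer_measure_space_def positive_def)
    then have "(\<Sum>n. ?H (if n = 0 then X else if n = Suc 0 then Y else {})) = ?H X + ?H Y"
      by (subst suminf_finite[of "{0, Suc 0}"]) auto
    moreover have "(\<Union>n. if n = 0 then X else if n = Suc 0 then Y else {}) = X \<union> Y"
      by (auto split: if_splits)
    ultimately show ?thesis using csub[of "\<lambda>n. if n = 0 then X else if n = Suc 0 then Y else {}"] by simp
  qed
  have "?H (A \<inter> F) + ?H (A - F) \<le> ?H A" for A
  proof (cases "?H A = top")
    case fin: False
    define d where "d x = infdist x F" for x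
    define B where "B n = {x \<in> A. 1 / real (Suc n) \<le> d x}" for n
    define C where "C n = B (Suc n) - B n" for n
    have dl: "d x \<le> d y + dist x y" for x y unfolding d_def by (rule infdist_triangle)
    \<comment> \<open>The distance to \<open>F\<close> is 1-Lipschitz, so points whose distances to
      \<open>F\<close> differ by some amount are at least that far apart.\<close>
    have sepB: "(1 / real (Suc n)) - (1 / real (Suc (Suc n))) \<le> dist x y"
      if "x \<in> B n" "d y \<le> 1 / real (Suc (Suc n))" for x y n
      using that dl[of x y] by (auto simp: B_def)
    have pos: "0 < (1 / real (Suc n)) - (1 / real (Suc (Suc n)))" for n by (simp add: frac_less2)
    have Bmono: "B n \<subseteq> B m" if "n \<le> m" for n m
    proof -
      have "1 / real (Suc m) \<le> 1 / real (Suc n)" using that by (simp add: frac_le)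
      then show ?thesis by (auto simp: B_def)
    qed
    have par: "(\<Sum>k<N. ?H (C (2 * k + p))) \<le> ?H A" for N p
    proof -
      have "(\<Sum>k<N. ?H (C (2 * k + p))) \<le> ?H (\<Union>k<N. C (2 * k + p))"
      proof (induction N)
        case (Suc N)
        have s: "?H (\<Union>k<N. C (2 * k + p)) + ?H (C (2 * N + p)) \<le> ?H ((\<Union>k<N. C (2 * k + p)) \<union> C (2 * N + p))"
        proof (cases "N = 0")
          case False
          define m where "m = 2 * N + p - 1"
          have m: "2 * N + p = Suc m" using False by (simp add: m_def)
          show ?thesis
          proof (rule hausdorff_outer_separated[OF pos[of m]])
            fix x y assume x: "x \<in> (\<Union>k<N. C (2 * k + p))" and y: "y \<in> C (2 * N + p)"
            from x obtain k where k: "k < N" "x \<in> B (Suc (2 * k + p))" by (auto simp: C_def)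
            have "Suc (2 * k + p) \<le> m" using k m by simp
            then have "x \<in> B m" using k Bmono by blast
            moreover have "d y \<le> 1 / real (Suc (Suc m))" using y unfolding m C_def by (auto simp: B_def)
            ultimately show "1 / real (Suc m) - 1 / real (Suc (Suc m)) \<le> dist x y" by (rule sepB)
          qed
        qed (use outer_measure_space_hausdorff[of s] in \<open>auto simp: outer_measure_space_def positive_def\<close>)
        have "(\<Sum>k<Suc N. ?H (C (2 * k + p))) \<le> ?H (\<Union>k<N. C (2 * k + p)) + ?H (C (2 * N + p))"
          using Suc by (simp add: add_mono)
        also note s
        also have "(\<Union>k<N. C (2 * k + p)) \<union> C (2 * N + p) = (\<Union>k<Suc N. C (2 * k + p))"
          by (auto simp: less_Suc_eq)
        finally show ?case .
      qed (simp)
      also have "\<dots> \<le> ?H A" by (rule hausdorff_outer_mono) (auto simp: C_def B_def)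
      finally show ?thesis .
    qed
    have all: "(\<Sum>k. ?H (C k)) \<le> 2 * ?H A"
    proof (rule suminf_le_const)
      fix N
      have split: "(\<Sum>k<2*N. ?H (C k)) = (\<Sum>k<N. ?H (C (2 * k + 0))) + (\<Sum>k<N. ?H (C (2 * k + 1)))"
        by (induction N) (auto simp: algebra_simps)
      have "(\<Sum>k<N. ?H (C k)) \<le> (\<Sum>k<2*N. ?H (C k))" by (intro sum_mono2) auto
      also have "\<dots> \<le> ?H A + ?H A" unfolding split by (intro add_mono par)
      finally show "(\<Sum>k<N. ?H (C k)) \<le> 2 * ?H A" by (simp add: mult_2)
    qed simp
    \<comment> \<open>Convergence of this series makes its tails vanish, and the tails are all that
      is lost when \<open>A - F\<close> is replaced by \<open>B n\<close>.\<close>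
    have fin2: "(\<Sum>k. ?H (C k)) \<noteq> top"
      using all fin by (auto simp: top_unique ennreal_mult_eq_top_iff)
    have "?H (A \<inter> F) + ?H (A - F) \<le> ?H A + (\<Sum>k. ?H (C (k + n)))" for n
    proof -
      have eq: "A - F \<subseteq> B n \<union> (\<Union>k. C (k + n))"
      proof
        fix x assume x: "x \<in> A - F"
        then have "d x > 0" using assms F infdist_pos_not_in_closed unfolding d_def by auto
        then obtain j where j: "1 / real (Suc j) < d x" using nat_approx_posE by metis
        then have xj: "x \<in> B j" using x by (auto simp: B_def)
        \<comment> \<open>The first level that contains \<open>x\<close>. If it exceeds
          \<open>n\<close>, then \<open>x\<close> lies in the shell \<open>C (l - 1)\<close>, which
          belongs to the tail from \<open>n\<close> on.\<close>
        define l where "l = (LEAST j. x \<in> B j)"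
        have l: "x \<in> B l" "\<And>i. i < l \<Longrightarrow> x \<notin> B i" using xj unfolding l_def by (auto intro: LeastI dest: not_less_Least)
        show "x \<in> B n \<union> (\<Union>k. C (k + n))"
        proof (cases "l \<le> n")
          case True then show ?thesis using l Bmono by blast
        next
          case False
          then have "x \<in> C ((l - 1 - n) + n)" using l by (auto simp: C_def)
          then show ?thesis by blast
        qed
      qed
      have "?H (A - F) \<le> ?H (B n) + ?H (\<Union>k. C (k + n))"
        using hausdorff_outer_mono[OF eq] sub order_trans by blast
      also have "\<dots> \<le> ?H (B n) + (\<Sum>k. ?H (C (k + n)))" by (intro add_left_mono csub)
      finally have "?H (A \<inter> F) + ?H (A - F) \<le> (?H (A \<inter> F) + ?H (B n)) + (\<Sum>k. ?H (C (k + n)))"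
        by (simp add: add.assoc add_left_mono)
      also have "?H (A \<inter> F) + ?H (B n) \<le> ?H ((A \<inter> F) \<union> B n)"
      proof (rule hausdorff_outer_separated)
        show "0 < 1 / real (Suc n)" by simp
        fix x y assume xy: "x \<in> A \<inter> F" "y \<in> B n"
        then have "d x = 0" by (simp add: d_def)
        then show "1 / real (Suc n) \<le> dist x y" using xy dl[of y x] by (auto simp: B_def dist_commute)
      qed
      also have "\<dots> \<le> ?H A" by (rule hausdorff_outer_mono) (auto simp: B_def)
      finally show ?thesis by (simp add: add_right_mono)
    qed
    moreover have "(\<lambda>n. ?H A + (\<Sum>k. ?H (C (k + n)))) \<longlonglongrightarrow> ?H A + 0"
    proof (intro tendsto_add tendsto_const)
      define c where "c k = enn2real (?H (C k))" for k
      have Hc: "?H (C k) = ennreal (c k)" for k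
        using fin2 ennreal_suminf_lessD[of "\<lambda>k. ?H (C k)" top] unfolding c_def
        by (simp add: less_top)
      have c0: "0 \<le> c k" for k by (simp add: c_def)
      have sc: "summable c"
        using fin2 unfolding Hc by (intro summable_suminf_not_top c0) auto
      have "(\<lambda>n. \<Sum>k. c (k + n)) \<longlonglongrightarrow> 0" by (rule suminf_exist_split2[OF sc])
      then have "(\<lambda>n. ennreal (\<Sum>k. c (k + n))) \<longlonglongrightarrow> ennreal 0" by (rule tendsto_ennrealI)
      moreover have "ennreal (\<Sum>k. c (k + n)) = (\<Sum>k. ?H (C (k + n)))" for n
        unfolding Hc using sc c0 by (intro suminf_ennreal2[symmetric]) (auto simp: summable_iff_shift)
      ultimately show "(\<lambda>n. \<Sum>k. ?H (C (k + n))) \<longlonglongrightarrow> 0" by simp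
    qed
    ultimately show ?thesis
      by (intro LIMSEQ_le_const[where X = "\<lambda>n. ?H A + (\<Sum>k. ?H (C (k + n)))"]) auto
  qed (simp add: top_unique)
  moreover have "?H A \<le> ?H (A \<inter> F) + ?H (A - F)" for A
    using sub[of "A \<inter> F" "A - F"] by (simp add: Int_Diff_Un)
  ultimately have "?H (A \<inter> F) + ?H (A - F) = ?H A" for A by (rule antisym)
  moreover have "F \<inter> A = A \<inter> F" "(UNIV - F) \<inter> A = A - F" for A by auto
  ultimately show ?thesis unfolding lambda_system_def by simp
qed

lemma
  fixes s :: real
  shows sets_hausdorff_measure [simp]: "sets (hausdorff_measure s :: 'a::metric_space measure) = sets borel"
    and space_hausdorff_measure [simp]: "space (hausdorff_measure s :: 'a measure) = UNIV"
  using sets.space_closed[of "borel :: 'a measure"] sets.sigma_sets_eq[of "borel :: 'a measure"]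
  by (auto simp: hausdorff_measure_def space_measure_of_conv sets_measure_of_conv)

text \<open>Caratheodory's sigma-algebra contains the closed sets, hence all Borel sets, and the
  outer measure is countably additive there. This is what entitles \<open>measure_of\<close> to keep
  the given values.\<close>

lemma emeasure_hausdorff_measure:
  fixes A :: "'a::metric_space set"
  assumes "A \<in> sets borel"
  shows "emeasure (hausdorff_measure s) A = hausdorff_outer s A"
proof -
  interpret P: sigma_algebra "UNIV :: 'a set" "Pow UNIV" by (rule sigma_algebra_Pow)
  let ?L = "lambda_system UNIV (Pow UNIV) (hausdorff_outer s) :: 'a set set"
  have L: "measure_space UNIV ?L (hausdorff_outer s)"
    by (rule P.caratheodory_lemma[OF outer_measure_space_hausdorff])
  then have sa: "sigma_algebra UNIV ?L" by (simp add: measure_space_def)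
  have "sigma_sets UNIV (Collect closed) \<subseteq> ?L"
    by (rule sigma_algebra.sigma_sets_subset[OF sa]) (use closed_in_lambda_system_hausdorff in blast)
  then have sub: "sets (borel :: 'a measure) \<subseteq> ?L"
    by (simp add: borel_eq_closed)
  have "measure_space UNIV (sets borel) (hausdorff_outer s :: 'a set \<Rightarrow> ennreal)"
    using L sub sets.sigma_algebra_axioms[of "borel :: 'a measure"]
    unfolding measure_space_def positive_def countably_additive_def by auto
  then show ?thesis
    unfolding hausdorff_measure_def using assms sets.space_closed[of "borel :: 'a measure"]
    by (intro emeasure_measure_of_sigma) (auto simp: measure_space_def)
qed

lemma space_surface_measure: "space (surface_measure Om) = frontier Om"
  by (simp add: surface_measure_def space_restrict_space)

lemma sets_surface_measure_cong: "sets (surface_measure Om) = sets (restrict_space borel (frontier Om))"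
  unfolding surface_measure_def by (rule sets_restrict_space_cong) simp

lemma emeasure_surface_measure:
  fixes Om :: "'a::euclidean_space set"
  assumes "A \<in> sets borel" "A \<subseteq> frontier Om"
  shows "emeasure (surface_measure Om) A = hausdorff_outer (real (DIM('a) - 1)) A"
  unfolding surface_measure_def
  using assms by (subst emeasure_restrict_space) (auto simp: emeasure_hausdorff_measure)

lemma closed_in_sets_surface_measure:
  fixes Om :: "'a::euclidean_space set"
  assumes "closed A" "A \<subseteq> frontier Om"
  shows "A \<in> sets (surface_measure Om)"
  unfolding sets_surface_measure_cong sets_restrict_space_iff[of "frontier Om" borel, simplified]
  using assms by (simp add: sets_restrict_space_iff)

lemma continuous_measurable_surface_measure:
  fixes f :: "'a::euclidean_space \<Rightarrow> 'b::topological_space"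
  assumes "continuous_on UNIV f"
  shows "f \<in> borel_measurable (surface_measure Om)"
proof -
  have "f \<in> borel_measurable (restrict_space borel (frontier Om))"
    by (intro measurable_restrict_space1 borel_measurable_continuous_onI assms)
  then show ?thesis using measurable_cong_sets[OF sets_surface_measure_cong refl] by blast
qed

section \<open>A divergence inequality\<close>

definition sweep :: "'a::euclidean_space \<Rightarrow> real \<Rightarrow> 'a set \<Rightarrow> 'a set" where
  "sweep e t A = (\<lambda>(x, s). x + s *\<^sub>R e) ` (A \<times> {0..t})"

lemma compact_sweep: "compact A \<Longrightarrow> compact (sweep e t A)"
  unfolding sweep_def
  by (intro compact_continuous_image compact_Times compact_Icc) (auto intro!: continuous_intros simp: split_beta)

lemma sweepI: "x \<in> A \<Longrightarrow> 0 \<le> s \<Longrightarrow> s \<le> t \<Longrightarrow> x + s *\<^sub>R e \<in> sweep e t A"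
  unfolding sweep_def by force

lemma sweepE:
  assumes "y \<in> sweep e t A"
  obtains x s where "x \<in> A" "0 \<le> s" "s \<le> t" "y = x + s *\<^sub>R e"
  using assms unfolding sweep_def by auto

text \<open>A set of diameter \<rho> swept over length \<open>t\<close> is covered by at most
  \<open>3 * t / \<rho>\<close> balls of radius \<open>2 * \<rho>\<close>, which gives the factor 3,
  the volume of the unit ball and \<open>2 ^ DIM('a)\<close>. The remaining factors compare the
  resulting power of \<rho> with the weight \<open>unit_ball_vol s * (\<rho> / 2) powr s\<close> of
  the Hausdorff sum.\<close>

definition sweep_const :: "'a::euclidean_space itself \<Rightarrow> real" where
  "sweep_const _ = 3 * unit_ball_vol (real DIM('a)) * 2 ^ DIM('a) * 2 ^ (DIM('a) - 1)
     / unit_ball_vol (real (DIM('a) - 1))"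

lemma sweep_const_pos: "0 < sweep_const TYPE('a::euclidean_space)"
  by (simp add: sweep_const_def)

text \<open>About \<open>t / \<rho>\<close> balls of radius comparable to the diameter \<rho> cover
  the swept set. Their total volume is of order \<open>t\<close> times the power of \<rho> with
  which the set enters a Hausdorff sum.\<close>

lemma sweep_cover_single:
  fixes X :: "'a::euclidean_space set" and e :: 'a
  assumes d: "DIM('a) \<ge> 2" and e: "norm e = 1" and t: "0 < t" and X: "bounded X" "diameter X \<le> t"
  shows "\<exists>S\<in>sets borel. sweep e t X \<subseteq> S \<and> emeasure lborel S \<le>
    ennreal (sweep_const TYPE('a) * t) * ennreal (unit_ball_vol (real (DIM('a) - 1)) * (diameter X / 2) powr real (DIM('a) - 1))"
    (is "\<exists>S\<in>_. _ \<and> _ \<le> ?rhs")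
proof (cases "X = {}")
  case True
  then show ?thesis by (intro bexI[of _ "{}"]) (auto simp: sweep_def)
next
  case False
  then obtain c where c: "c \<in> X" by blast
  define \<rho> where "\<rho> = diameter X"
  have \<rho>0: "0 \<le> \<rho>" unfolding \<rho>_def using X by (rule_tac diameter_ge_0)
  have near: "dist x c \<le> \<rho>" if "x \<in> X" for x
    unfolding \<rho>_def by (rule diameter_bounded_bound) (use X that c in auto)
  show ?thesis
  proof (cases "\<rho> = 0")
    case True
    \<comment> \<open>A single point has weight zero, so its sweep must have volume zero: it lies on
      a line, and the dimension is at least 2.\<close>
    have "x = c" if "x \<in> X" for x using near[OF that] True by simp
    then have Xc: "X = {c}" using c by blast
    have cl: "closed (sweep e t X)" unfolding Xc by (intro compact_imp_closed compact_sweep) simp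
    have "dim (span {e}) \<le> 1" using dim_le_card'[of "{e}"] by (simp add: dim_span)
    then have "dim (span {e}) < DIM('a)" using d by linarith
    then have "negligible (span {e})" by (rule negligible_lowdim)
    then have "negligible ((+) c ` span {e})" by (rule negligible_translation)
    moreover have "sweep e t X \<subseteq> (+) c ` span {e}"
      unfolding Xc sweep_def by (auto intro!: imageI span_scale intro: span_base)
    ultimately have "negligible (sweep e t X)" by (rule negligible_subset)
    then have "emeasure lebesgue (sweep e t X) = 0" by (auto simp: negligible_iff_null_sets)
    then have "emeasure lborel (sweep e t X) = 0" using cl by simp
    then show ?thesis using cl by (intro bexI[of _ "sweep e t X"]) auto
  next
    case False
    with \<rho>0 have \<rho>: "0 < \<rho>" by simp
    define n where "n = nat \<lceil>t / \<rho>\<rceil>"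
    define S where "S = (\<Union>j\<le>n. cball (c + (real j * \<rho>) *\<^sub>R e) (2 * \<rho>))"
    have sub: "sweep e t X \<subseteq> S"
    proof
      fix y assume "y \<in> sweep e t X"
      then obtain x s where xs: "x \<in> X" "0 \<le> s" "s \<le> t" "y = x + s *\<^sub>R e" by (rule sweepE)
      \<comment> \<open>The ball centres are spaced by \<rho> along the direction \<open>e\<close>;
        rounding down misses the height \<open>s\<close> by at most \<rho>, and \<rho> more is lost
        between \<open>x\<close> and \<open>c\<close>.\<close>
      define j where "j = nat \<lfloor>s / \<rho>\<rfloor>"
      have q: "0 \<le> s / \<rho>" using xs \<rho> by simp
      then have j: "real j \<le> s / \<rho>" "s / \<rho> < real j + 1" unfolding j_def by linarith+
      have "s / \<rho> \<le> t / \<rho>" using xs \<rho> by (simp add: divide_right_mono)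
      then have jn: "j \<le> n" unfolding j_def n_def by linarith
      have sj: "\<bar>s - real j * \<rho>\<bar> \<le> \<rho>" using j \<rho> by (auto simp: field_simps)
      have eq: "y - (c + (real j * \<rho>) *\<^sub>R e) = (x - c) + (s - real j * \<rho>) *\<^sub>R e"
        using xs by (simp add: algebra_simps)
      have "norm (y - (c + (real j * \<rho>) *\<^sub>R e)) \<le> norm (x - c) + \<bar>s - real j * \<rho>\<bar>"
        unfolding eq using norm_triangle_ineq[of "x - c" "(s - real j * \<rho>) *\<^sub>R e"] e by simp
      also have "\<dots> \<le> 2 * \<rho>" using near[OF xs(1)] sj by (simp add: dist_norm)
      finally show "y \<in> S" unfolding S_def using jn by (auto simp: dist_norm norm_minus_commute)
    qed
    let ?V = "unit_ball_vol (real DIM('a))"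
    have "emeasure lborel S \<le> (\<Sum>j\<le>n. emeasure lborel (cball (c + (real j * \<rho>) *\<^sub>R e) (2 * \<rho>)))"
      unfolding S_def by (rule emeasure_subadditive_finite) auto
    also have "\<dots> = (\<Sum>j\<le>n. ennreal (?V * (2 * \<rho>) ^ DIM('a)))"
      using \<rho> by (simp add: emeasure_cball)
    also have "\<dots> = ennreal (real (n + 1) * (?V * (2 * \<rho>) ^ DIM('a)))"
      using \<rho> by (subst sum_ennreal) auto
    also have "\<dots> \<le> ennreal (3 * t / \<rho> * (?V * (2 * \<rho>) ^ DIM('a)))"
    proof (rule ennreal_leI, rule mult_right_mono)
      \<comment> \<open>The restriction of the diameter to at most \<open>t\<close> enters here: it
        absorbs the rounding and the extra ball at the end,
        \<open>n + 1 \<le> t / \<rho> + 2 \<le> 3 * t / \<rho>\<close>.\<close>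
      have "1 \<le> t / \<rho>" using X \<rho> by (simp add: \<rho>_def)
      then show "real (n + 1) \<le> 3 * t / \<rho>" unfolding n_def by linarith
    qed (use \<rho> in auto)
    also have "3 * t / \<rho> * (?V * (2 * \<rho>) ^ DIM('a)) =
        (sweep_const TYPE('a) * t) * (unit_ball_vol (real (DIM('a) - 1)) * (\<rho> / 2) powr real (DIM('a) - 1))"
    proof -
      obtain k where k: "DIM('a) = Suc k" using d by (metis Suc_diff_1 DIM_positive)
      have U: "unit_ball_vol (real k) \<noteq> 0" using unit_ball_vol_pos[of "real k"] by linarith
      show ?thesis using \<rho>
        by (simp add: U sweep_const_def k powr_realpow power_mult_distrib power_divide)
    qed
    also have "ennreal \<dots> = ?rhs"
      using t sweep_const_pos[where 'a='a] by (simp add: ennreal_mult \<rho>_def)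
    finally show ?thesis using sub by (intro bexI[of _ S]) (auto simp: S_def)
  qed
qed

text \<open>The covering estimate is summed over a cover of mesh \<open>t\<close>. The constant is
  divided out on the left because \<open>hausdorff_pre\<close> is an infimum, hence bounded below by
  what bounds every cover.\<close>

lemma emeasure_sweep_le:
  fixes K :: "'a::euclidean_space set"
  assumes d: "DIM('a) \<ge> 2" and e: "norm e = 1" and t: "0 < t"
  shows "emeasure lborel (sweep e t K) \<le> ennreal (sweep_const TYPE('a) * t) * hausdorff_outer (real (DIM('a) - 1)) K"
proof -
  let ?c = "sweep_const TYPE('a) * t"
  let ?w = "\<lambda>X. ennreal (unit_ball_vol (real (DIM('a) - 1)) * (diameter X / 2) powr real (DIM('a) - 1))"
  have c: "0 < ?c" using t sweep_const_pos[where 'a='a] by simp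
  have "ennreal (1 / ?c) * emeasure lborel (sweep e t K) \<le> hausdorff_pre (real (DIM('a) - 1)) t K"
  proof (rule hausdorff_pre_greatest)
    fix C :: "nat \<Rightarrow> 'a set"
    assume C: "K \<subseteq> (\<Union>i. C i)" "\<And>i. bounded (C i)" "\<And>i. diameter (C i) \<le> t"
    have "\<exists>S. S \<in> sets borel \<and> sweep e t (C i) \<subseteq> S \<and> emeasure lborel S \<le> ennreal ?c * ?w (C i)" for i
      using sweep_cover_single[OF d e t C(2,3), of i] by blast
    then obtain S where S: "\<And>i. S i \<in> sets borel" "\<And>i. sweep e t (C i) \<subseteq> S i"
        "\<And>i. emeasure lborel (S i) \<le> ennreal ?c * ?w (C i)" by metis
    have "sweep e t K \<subseteq> (\<Union>i. S i)"
    proof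
      fix y assume "y \<in> sweep e t K"
      then obtain x s where xs: "x \<in> K" "0 \<le> s" "s \<le> t" "y = x + s *\<^sub>R e" by (rule sweepE)
      from C(1) xs(1) have "x \<in> (\<Union>i. C i)" by (rule subsetD)
      then obtain i where "x \<in> C i" by (rule UN_E)
      then have "y \<in> S i" using S(2)[of i] sweepI[of x "C i" s t e] xs by auto
      then show "y \<in> (\<Union>i. S i)" by (rule UN_I[OF UNIV_I])
    qed
    then have "emeasure lborel (sweep e t K) \<le> emeasure lborel (\<Union>i. S i)"
      using S(1) by (intro emeasure_mono) auto
    also have "\<dots> \<le> (\<Sum>i. emeasure lborel (S i))" using S(1) by (intro emeasure_subadditive_countably) auto
    also have "\<dots> \<le> (\<Sum>i. ennreal ?c * ?w (C i))" by (intro suminf_le S(3)) auto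
    also have "\<dots> = ennreal ?c * (\<Sum>i. ?w (C i))" by simp
    finally have "ennreal (1 / ?c) * emeasure lborel (sweep e t K) \<le> ennreal (1 / ?c) * (ennreal ?c * (\<Sum>i. ?w (C i)))"
      by (rule mult_left_mono) simp
    also have "\<dots> = (\<Sum>i. ?w (C i))"
    proof -
      have "ennreal (1 / ?c) * ennreal ?c = 1"
        using c by (subst ennreal_mult[symmetric]) auto
      then show ?thesis by (simp only: mult.assoc[symmetric] mult_1_left)
    qed
    finally show "ennreal (1 / ?c) * emeasure lborel (sweep e t K) \<le> (\<Sum>i. ?w (C i))" .
  qed
  also have "\<dots> \<le> hausdorff_outer (real (DIM('a) - 1)) K" by (rule hausdorff_pre_le_outer[OF t])
  finally have "ennreal ?c * (ennreal (1 / ?c) * emeasure lborel (sweep e t K)) \<le> ennreal ?c * hausdorff_outer (real (DIM('a) - 1)) K"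
    by (rule mult_left_mono) simp
  moreover have "ennreal ?c * ennreal (1 / ?c) = 1"
    using c by (subst ennreal_mult[symmetric]) auto
  ultimately show ?thesis by (simp only: mult.assoc[symmetric] mult_1_left)
qed

text \<open>The discrete layer-cake formula: adding \<epsilon> for each level
  \<open>k * \<epsilon>\<close> below \<open>a\<close> rounds \<open>a\<close> down to a multiple of
  \<epsilon>, capped at \<open>M * \<epsilon>\<close>. It reduces integrals to measures of
  superlevel sets.\<close>

lemma layer_sum_eq:
  fixes a \<epsilon> :: real
  assumes "0 \<le> a" "0 < \<epsilon>"
  shows "(\<Sum>k\<in>{1..M}. if real k * \<epsilon> \<le> a then \<epsilon> else 0) = real (min M (nat \<lfloor>a / \<epsilon>\<rfloor>)) * \<epsilon>"
proof -
  have "(\<Sum>k\<in>{1..M}. if real k * \<epsilon> \<le> a then \<epsilon> else 0) = (\<Sum>k\<in>{k\<in>{1..M}. real k * \<epsilon> \<le> a}. \<epsilon>)"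
    by (rule sum.inter_filter[symmetric]) simp
  also have "{k\<in>{1..M}. real k * \<epsilon> \<le> a} = {1..min M (nat \<lfloor>a / \<epsilon>\<rfloor>)}"
  proof -
    have "real k * \<epsilon> \<le> a \<longleftrightarrow> k \<le> nat \<lfloor>a / \<epsilon>\<rfloor>" for k
    proof -
      have "0 \<le> a / \<epsilon>" using assms by simp
      then have "real k \<le> a / \<epsilon> \<longleftrightarrow> k \<le> nat \<lfloor>a / \<epsilon>\<rfloor>"
        by (auto simp: le_nat_iff le_floor_iff)
      then show ?thesis using assms(2) by (simp add: pos_le_divide_eq)
    qed
    then show ?thesis by (simp add: set_eq_iff)
  qed
  finally show ?thesis by simp
qed

lemma layer_sum_le:
  fixes a \<epsilon> :: real
  assumes "0 \<le> a" "0 < \<epsilon>"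
  shows "(\<Sum>k\<in>{1..M}. if real k * \<epsilon> \<le> a then \<epsilon> else 0) \<le> a"
proof -
  have "0 \<le> a / \<epsilon>" using assms by simp
  then have "real (min M (nat \<lfloor>a / \<epsilon>\<rfloor>)) \<le> a / \<epsilon>" by linarith
  then show ?thesis unfolding layer_sum_eq[OF assms] using assms by (simp add: pos_le_divide_eq)
qed

lemma layer_sum_ge:
  fixes a \<epsilon> :: real
  assumes "0 \<le> a" "0 < \<epsilon>" "a \<le> real M * \<epsilon>"
  shows "a \<le> (\<Sum>k\<in>{1..M}. if real k * \<epsilon> \<le> a then \<epsilon> else 0) + \<epsilon>"
proof -
  have "a / \<epsilon> \<le> real M" using assms by (simp add: pos_divide_le_eq)
  moreover have "0 \<le> a / \<epsilon>" using assms by simp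
  ultimately have "a / \<epsilon> \<le> real (min M (nat \<lfloor>a / \<epsilon>\<rfloor>)) + 1" by linarith
  then show ?thesis unfolding layer_sum_eq[OF assms(1,2)] using assms by (simp add: pos_divide_le_eq algebra_simps)
qed

text \<open>The volume bound for swept sets is applied to the superlevel sets of \<open>f\<close> on
  the boundary and summed over the levels. Of the error \<open>2 * \<epsilon>\<close>, one half is
  the oscillation of \<open>f\<close> along the sweep and one half the rounding to levels.\<close>

lemma nn_integral_sweep_le:
  fixes Om :: "'a::euclidean_space set" and f :: "'a \<Rightarrow> real"
  assumes d: "DIM('a) \<ge> 2" and e: "norm e = 1" and t: "0 < t" and bd: "bounded Om"
    and f: "continuous_on UNIV f" "\<And>x. 0 \<le> f x" and \<epsilon>: "0 < \<epsilon>"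
    and osc: "\<And>x s. x \<in> frontier Om \<Longrightarrow> 0 \<le> s \<Longrightarrow> s \<le> t \<Longrightarrow> f (x + s *\<^sub>R e) \<le> f x + \<epsilon>"
  shows "(\<integral>\<^sup>+y. ennreal (f y) * indicator (sweep e t (frontier Om)) y \<partial>lborel) \<le>
    ennreal (sweep_const TYPE('a) * t) * ((\<integral>\<^sup>+x. ennreal (f x) \<partial>surface_measure Om)
      + ennreal (2 * \<epsilon>) * emeasure (surface_measure Om) (frontier Om))"
proof -
  let ?G = "frontier Om" and ?N = "surface_measure Om" and ?c = "ennreal (sweep_const TYPE('a) * t)"
  have G: "compact ?G" using bd by (simp add: compact_frontier_bounded)
  obtain B where B: "\<And>x. x \<in> ?G \<Longrightarrow> f x \<le> B"
    using continuous_bounded_on_compact[OF f(1) G] by (metis abs_le_D1 real_norm_def)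
  \<comment> \<open>Finitely many levels suffice, since \<open>f\<close> is bounded on the compact
    boundary.\<close>
  obtain M :: nat where M: "B \<le> real M * \<epsilon>"
    using reals_Archimedean2[of "B / \<epsilon>"] \<epsilon> by (auto simp: pos_divide_less_eq intro: less_imp_le)
  define A where "A k = {x \<in> ?G. real k * \<epsilon> \<le> f x}" for k
  have cA: "compact (A k)" for k
  proof -
    have "closed {x. real k * \<epsilon> \<le> f x}"
      by (intro closed_Collect_le continuous_intros f(1))
    with G have "compact (?G \<inter> {x. real k * \<epsilon> \<le> f x})" by (rule compact_Int_closed)
    then show ?thesis by (simp add: A_def Collect_conj_eq)
  qed
  have sA: "A k \<in> sets ?N" for k
    by (rule closed_in_sets_surface_measure) (use cA in \<open>auto simp: compact_imp_closed A_def\<close>)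
  have sw: "emeasure lborel (sweep e t (A k)) \<le> ?c * emeasure ?N (A k)" for k
    using emeasure_sweep_le[OF d e t, of "A k"] emeasure_surface_measure[of "A k" Om] cA
    by (auto simp: A_def compact_imp_closed)
  have swG: "emeasure lborel (sweep e t ?G) \<le> ?c * emeasure ?N ?G"
    using emeasure_sweep_le[OF d e t, of ?G] emeasure_surface_measure[of ?G Om] by auto
  have bsw [measurable]: "sweep e t (A k) \<in> sets borel" "sweep e t ?G \<in> sets borel" for k
    by (intro borel_closed compact_imp_closed compact_sweep cA G)+
  have pt: "ennreal (f y) * indicator (sweep e t ?G) y \<le>
      (\<Sum>k\<in>{1..M}. ennreal \<epsilon> * indicator (sweep e t (A k)) y) + ennreal (2 * \<epsilon>) * indicator (sweep e t ?G) y" for y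
  proof (cases "y \<in> sweep e t ?G")
    case True
    then obtain x s where xs: "x \<in> ?G" "0 \<le> s" "s \<le> t" "y = x + s *\<^sub>R e" by (rule sweepE)
    have "f y \<le> f x + \<epsilon>" using osc xs by simp
    also have "\<dots> \<le> (\<Sum>k\<in>{1..M}. if real k * \<epsilon> \<le> f x then \<epsilon> else 0) + 2 * \<epsilon>"
      using layer_sum_ge[of "f x" \<epsilon> M] f(2) \<epsilon> B[OF xs(1)] M by simp
    also have "\<dots> \<le> (\<Sum>k\<in>{1..M}. \<epsilon> * indicator (sweep e t (A k)) y) + 2 * \<epsilon>"
      using \<epsilon> xs by (intro add_mono sum_mono) (auto simp: A_def xs(4) indicator_def intro!: sweepI)
    finally have "ennreal (f y) \<le> ennreal ((\<Sum>k\<in>{1..M}. \<epsilon> * indicator (sweep e t (A k)) y) + 2 * \<epsilon>)"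
      by (rule ennreal_leI)
    also have "\<dots> = (\<Sum>k\<in>{1..M}. ennreal \<epsilon> * indicator (sweep e t (A k)) y) + ennreal (2 * \<epsilon>)"
    proof -
      have "(\<Sum>k\<in>{1..M}. ennreal \<epsilon> * indicator (sweep e t (A k)) y) = (\<Sum>k\<in>{1..M}. ennreal (\<epsilon> * indicator (sweep e t (A k)) y))"
        using \<epsilon> by (intro sum.cong refl) (simp add: indicator_def)
      also have "\<dots> = ennreal (\<Sum>k\<in>{1..M}. \<epsilon> * indicator (sweep e t (A k)) y)"
        using \<epsilon> by (intro sum_ennreal) auto
      finally show ?thesis using \<epsilon> by (simp only: ennreal_plus[OF sum_nonneg] mult_nonneg_nonneg indicator_pos_le less_imp_le zero_le_numeral)
    qed
    finally show ?thesis using True by simp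
  qed simp
  have "(\<integral>\<^sup>+y. ennreal (f y) * indicator (sweep e t ?G) y \<partial>lborel) \<le>
     (\<integral>\<^sup>+y. (\<Sum>k\<in>{1..M}. ennreal \<epsilon> * indicator (sweep e t (A k)) y) + ennreal (2 * \<epsilon>) * indicator (sweep e t ?G) y \<partial>lborel)"
    by (intro nn_integral_mono pt)
  also have "\<dots> = (\<Sum>k\<in>{1..M}. ennreal \<epsilon> * emeasure lborel (sweep e t (A k))) + ennreal (2 * \<epsilon>) * emeasure lborel (sweep e t ?G)"
  proof -
    have c: "(\<integral>\<^sup>+y. ennreal a * indicator X y \<partial>lborel) = ennreal a * emeasure lborel X" if "X \<in> sets borel" for a :: real and X :: "'a set"
      using that by (intro nn_integral_cmult_indicator) simp
    show ?thesis
      by (subst nn_integral_add, measurable, subst nn_integral_sum, measurable, subst c, measurable, subst c, measurable)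
  qed
  also have "\<dots> \<le> (\<Sum>k\<in>{1..M}. ennreal \<epsilon> * (?c * emeasure ?N (A k))) + ennreal (2 * \<epsilon>) * (?c * emeasure ?N ?G)"
    by (intro add_mono sum_mono mult_left_mono sw swG) auto
  also have "\<dots> = ?c * ((\<Sum>k\<in>{1..M}. ennreal \<epsilon> * emeasure ?N (A k)) + ennreal (2 * \<epsilon>) * emeasure ?N ?G)"
    by (simp add: sum_distrib_left distrib_left mult.left_commute)
  also have "(\<Sum>k\<in>{1..M}. ennreal \<epsilon> * emeasure ?N (A k)) = (\<integral>\<^sup>+x. (\<Sum>k\<in>{1..M}. ennreal \<epsilon> * indicator (A k) x) \<partial>?N)"
  proof -
    note sA [measurable]
    have c: "(\<integral>\<^sup>+x. ennreal \<epsilon> * indicator (A k) x \<partial>?N) = ennreal \<epsilon> * emeasure ?N (A k)" for k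
      by (intro nn_integral_cmult_indicator sA)
    show ?thesis by (subst nn_integral_sum, measurable, simp only: c)
  qed
  also have "\<dots> \<le> (\<integral>\<^sup>+x. ennreal (f x) \<partial>?N)"
  proof (rule nn_integral_mono)
    fix x assume "x \<in> space ?N"
    then have x: "x \<in> ?G" by (simp add: space_surface_measure)
    have "(\<Sum>k\<in>{1..M}. ennreal \<epsilon> * indicator (A k) x) = ennreal (\<Sum>k\<in>{1..M}. if real k * \<epsilon> \<le> f x then \<epsilon> else 0)"
    proof -
      have "(\<Sum>k\<in>{1..M}. ennreal \<epsilon> * indicator (A k) x) = (\<Sum>k\<in>{1..M}. ennreal (if real k * \<epsilon> \<le> f x then \<epsilon> else 0))"
        using x by (intro sum.cong refl) (simp add: A_def indicator_def)
      also have "\<dots> = ennreal (\<Sum>k\<in>{1..M}. if real k * \<epsilon> \<le> f x then \<epsilon> else 0)"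
        using \<epsilon> by (intro sum_ennreal) auto
      finally show ?thesis .
    qed
    also have "\<dots> \<le> ennreal (f x)" by (intro ennreal_leI layer_sum_le f \<epsilon>)
    finally show "(\<Sum>k\<in>{1..M}. ennreal \<epsilon> * indicator (A k) x) \<le> ennreal (f x)" .
  qed
  finally show ?thesis by (simp add: mult_left_mono add_right_mono)
qed

section \<open>Difference quotients, translations and the divergence inequality\<close>

lemma smooth_lipschitz_bound:
  fixes f :: "'a::euclidean_space \<Rightarrow> real"
  assumes "smooth f"
  obtains M where "0 \<le> M" "\<And>x y. x \<in> cball 0 R \<Longrightarrow> y \<in> cball 0 R \<Longrightarrow> \<bar>f x - f y\<bar> \<le> M * norm (x - y)"
proof -
  obtain B where B: "\<forall>x\<in>cball 0 R. norm (grad f x) \<le> B"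
    using continuous_bounded_on_compact[OF continuous_on_grad[OF assms] compact_cball] by blast
  define M where "M = \<bar>B\<bar>"
  have M: "\<And>x. x \<in> cball 0 R \<Longrightarrow> norm (grad f x) \<le> M" "0 \<le> M" using B by (force simp: M_def)+
  have "\<bar>f x - f y\<bar> \<le> M * norm (x - y)" if "x \<in> cball 0 R" "y \<in> cball 0 R" for x y
    unfolding real_norm_def[symmetric]
  proof (rule differentiable_bound[where S = "cball 0 R" and f' = "\<lambda>x v. pd v f x"])
    fix x :: 'a assume x: "x \<in> cball 0 R"
    show "(f has_derivative (\<lambda>v. pd v f x)) (at x within cball 0 R)"
      using differentiable_has_derivative_pd[OF smooth_differentiable[OF assms]] by (rule has_derivative_at_withinI)
    have "pd v f x = grad f x \<bullet> v" for v by (rule pd_eq_grad_inner[OF smooth_differentiable[OF assms]])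
    then have "\<bar>pd v f x\<bar> \<le> M * norm v" for v
      using order_trans[OF Cauchy_Schwarz_ineq2[of "grad f x" v] mult_right_mono[OF M(1)[OF x] norm_ge_zero[of v]]] by simp
    then show "onorm (\<lambda>v. pd v f x) \<le> M" by (intro onorm_le) simp
  qed (use that in auto)
  then show ?thesis using that[of M] M(2) by simp
qed

lemma difference_quotient_tendsto:
  fixes f :: "'a::euclidean_space \<Rightarrow> real"
  assumes "smooth f" and t: "\<And>n. 0 < t n" "t \<longlonglongrightarrow> 0"
  shows "(\<lambda>n. (f (x + t n *\<^sub>R v) - f x) / t n) \<longlonglongrightarrow> pd v f x"
proof -
  have d: "((\<lambda>s. f (x + s *\<^sub>R v)) has_derivative (\<lambda>s. pd (s *\<^sub>R v) f (x + 0 *\<^sub>R v))) (at 0)"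
    by (rule has_derivative_compose[where f = "\<lambda>s. x + s *\<^sub>R v" and g = f])
      (auto intro!: derivative_eq_intros differentiable_has_derivative_pd smooth_differentiable assms)
  have "(\<lambda>s. pd (s *\<^sub>R v) f (x + 0 *\<^sub>R v)) = (*) (pd v f x)"
    by (auto simp: pd_eq_grad_inner smooth_differentiable assms)
  with d have "((\<lambda>s. f (x + s *\<^sub>R v)) has_real_derivative pd v f x) (at 0)"
    by (simp add: has_field_derivative_def)
  then have "((\<lambda>s. (f (x + s *\<^sub>R v) - f x) / s) \<longlongrightarrow> pd v f x) (at 0)"
    by (simp add: has_field_derivative_iff)
  moreover have "filterlim t (at 0) sequentially"
    using t by (auto simp: filterlim_at intro!: always_eventually less_imp_neq[symmetric])
  ultimately show ?thesis by (rule filterlim_compose)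
qed

lemma smooth_borel_measurable: "smooth f \<Longrightarrow> f \<in> borel_measurable borel"
  by (intro borel_measurable_continuous_onI smooth_continuous_on)

lemma integral_difference_quotient_tendsto:
  fixes f :: "'a::euclidean_space \<Rightarrow> real"
  assumes f: "smooth f" and Om: "Om \<in> sets borel" "bounded Om" and v: "norm v = 1"
    and t: "\<And>n. 0 < t n" "\<And>n. t n \<le> 1" "t \<longlonglongrightarrow> 0"
  shows "(\<lambda>n. (LINT x|lborel. indicator Om x * (f (x + t n *\<^sub>R v) - f x)) / t n)
    \<longlonglongrightarrow> (LINT x|lborel. indicator Om x * pd v f x)"
proof -
  obtain R where R: "Om \<subseteq> cball 0 R" using Om(2) by (auto simp: bounded_iff subset_iff)
  \<comment> \<open>The radius is enlarged by 1 because translations by at most 1 occur. The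
    Lipschitz constant dominates all difference quotients.\<close>
  obtain M where M: "0 \<le> M" "\<And>x y. x \<in> cball 0 (R + 1) \<Longrightarrow> y \<in> cball 0 (R + 1) \<Longrightarrow> \<bar>f x - f y\<bar> \<le> M * norm (x - y)"
    using smooth_lipschitz_bound[OF f] by blast
  have [measurable]: "f \<in> borel_measurable borel" "Om \<in> sets borel" using f Om by (auto intro: smooth_borel_measurable)
  have pdm [measurable]: "pd v f \<in> borel_measurable borel"
  proof -
    have "pd v f x = (\<Sum>b\<in>Basis. pd b f x * (b \<bullet> v))" for x
      by (simp add: pd_eq_grad_inner smooth_differentiable f grad_eq_pd inner_sum_left)
    then have "pd v f = (\<lambda>x. \<Sum>b\<in>Basis. pd b f x * (b \<bullet> v))" by auto
    then show ?thesis using smooth_borel_measurable[OF smooth_pd[OF f]] by simp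
  qed
  have "(\<lambda>n. LINT x|lborel. indicator Om x * ((f (x + t n *\<^sub>R v) - f x) / t n))
      \<longlonglongrightarrow> (LINT x|lborel. indicator Om x * pd v f x)"
  proof (rule integral_dominated_convergence[where w = "\<lambda>x. indicator Om x * M"])
    show "integrable lborel (\<lambda>x. indicator Om x * M)"
      using Om emeasure_bounded_finite[OF Om(2)] by (intro integrable_mult_left integrable_indicator) (auto simp: less_top)
    show "AE x in lborel. (\<lambda>n. indicator Om x * ((f (x + t n *\<^sub>R v) - f x) / t n)) \<longlonglongrightarrow> indicator Om x * pd v f x"
      by (intro always_eventually allI tendsto_intros difference_quotient_tendsto f t)
    show "AE x in lborel. norm (indicator Om x * ((f (x + t n *\<^sub>R v) - f x) / t n)) \<le> indicator Om x * M" for n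
    proof (intro always_eventually allI)
      fix x show "norm (indicator Om x * ((f (x + t n *\<^sub>R v) - f x) / t n)) \<le> indicator Om x * M"
      proof (cases "x \<in> Om")
        case True
        then have x: "norm x \<le> R" using R by auto
        then have "norm (x + t n *\<^sub>R v) \<le> R + 1"
          using norm_triangle_ineq[of x "t n *\<^sub>R v"] t(1,2)[of n] v by simp
        then have "\<bar>f (x + t n *\<^sub>R v) - f x\<bar> \<le> M * t n"
          using M(2)[of "x + t n *\<^sub>R v" x] x t(1)[of n] v by simp
        then show ?thesis using True t(1)[of n] by (simp add: pos_divide_le_eq abs_divide)
      qed simp
    qed
  qed measurable
  then show ?thesis by (simp add: )
qed

lemma integral_lborel_translate:
  fixes f :: "'a::euclidean_space \<Rightarrow> real"
  assumes [measurable]: "f \<in> borel_measurable borel"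
  shows "(LINT x|lborel. f (x + a)) = (LINT x|lborel. f x)"
proof -
  have "(LINT x|lborel. f x) = (LINT x|distr lborel borel ((+) a). f x)" by (simp add: lborel_distr_plus)
  also have "\<dots> = (LINT x|lborel. f (a + x))" by (rule integral_distr) auto
  finally show ?thesis by (simp add: add.commute)
qed

lemma integrable_indicator_continuous:
  fixes g :: "'a::euclidean_space \<Rightarrow> real"
  assumes g: "continuous_on UNIV g" and S: "S \<in> sets borel" "bounded S"
  shows "integrable lborel (\<lambda>y. indicator S y * g y)"
proof -
  obtain R where R: "S \<subseteq> cball 0 R" using S(2) by (auto simp: bounded_iff subset_iff)
  obtain B where B: "\<forall>y\<in>cball 0 R. norm (g y) \<le> B"
    using continuous_bounded_on_compact[OF g compact_cball] by blast
  show ?thesis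
  proof (rule Bochner_Integration.integrable_bound)
    show "integrable lborel (\<lambda>y. indicator S y * B)"
      using S emeasure_bounded_finite[OF S(2)]
      by (intro integrable_mult_left integrable_real_indicator) auto
    show "(\<lambda>y. indicator S y * g y) \<in> borel_measurable lborel"
    proof -
      have [measurable]: "g \<in> borel_measurable borel" by (rule borel_measurable_continuous_onI[OF g])
      note S(1) [measurable]
      show ?thesis by measurable
    qed
    show "AE y in lborel. norm (indicator S y * g y) \<le> norm (indicator S y * B)"
    proof (intro always_eventually allI)
      fix y show "norm (indicator S y * g y) \<le> norm (indicator S y * B)"
      proof (cases "y \<in> S")
        case True
        then have "norm (g y) \<le> B" using B R by blast
        then show ?thesis using True by simp
      qed simp
    qed
  qed
qed

text \<open>A discrete integration by parts: the translation moves from \<open>f\<close> to the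
  indicator, so only the symmetric difference of the set and its translate contributes.\<close>

lemma integral_difference_indicator:
  fixes f :: "'a::euclidean_space \<Rightarrow> real"
  assumes f: "continuous_on UNIV f" and Om: "Om \<in> sets borel" "bounded Om"
  shows "integrable lborel (\<lambda>y. (indicator Om (y - a) - indicator Om y) * f y)"
    "(LINT x|lborel. indicator Om x * (f (x + a) - f x)) = (LINT y|lborel. (indicator Om (y - a) - indicator Om y) * f y)"
proof -
  have [measurable]: "f \<in> borel_measurable borel" "Om \<in> sets borel"
    using f Om by (auto intro: borel_measurable_continuous_onI)
  let ?T = "(\<lambda>y. y - a) -` Om"
  have "?T = (+) a ` Om" by (force simp: image_iff)
  then have T: "?T \<in> sets borel" "bounded ?T"
    using measurable_sets_borel[of "\<lambda>y. y - a" borel Om] bounded_translation[OF Om(2), of a] by auto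
  have i1: "integrable lborel (\<lambda>y. indicator Om y * f y)" by (rule integrable_indicator_continuous[OF f Om])
  have i2: "integrable lborel (\<lambda>y. indicator Om (y - a) * f y)"
    using integrable_indicator_continuous[OF f T] by (simp add: indicator_def)
  have i3: "integrable lborel (\<lambda>y. indicator Om y * f (y + a))"
    by (rule integrable_indicator_continuous[OF _ Om])
      (auto intro!: continuous_on_compose2[OF f] continuous_intros)
  show "integrable lborel (\<lambda>y. (indicator Om (y - a) - indicator Om y) * f y)"
    using i1 i2 by (simp add: left_diff_distrib)
  have "(LINT x|lborel. indicator Om x * f (x + a)) = (LINT y|lborel. indicator Om (y - a) * f y)"
    using integral_lborel_translate[of "\<lambda>y. indicator Om (y - a) * f y" a] by simp
  then show "(LINT x|lborel. indicator Om x * (f (x + a) - f x)) = (LINT y|lborel. (indicator Om (y - a) - indicator Om y) * f y)"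
    using i1 i2 i3 by (simp add: left_diff_distrib right_diff_distrib)
qed

text \<open>By connectedness the segment meets the frontier at some \<open>z\<close>, and
  \<open>y\<close> is reached from \<open>z\<close> by moving on in the direction
  \<open>e\<close>.\<close>

lemma segment_crosses_frontier:
  fixes Om :: "'a::euclidean_space set"
  assumes "(y - t *\<^sub>R e \<in> Om) \<noteq> (y \<in> Om)" "0 \<le> t"
  shows "y \<in> sweep e t (frontier Om)"
proof -
  have "connected (closed_segment (y - t *\<^sub>R e) y)" by (rule connected_segment)
  moreover have "closed_segment (y - t *\<^sub>R e) y \<inter> Om \<noteq> {}" "closed_segment (y - t *\<^sub>R e) y - Om \<noteq> {}"
    using assms(1) by auto
  ultimately obtain z where z: "z \<in> closed_segment (y - t *\<^sub>R e) y" "z \<in> frontier Om"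
    using connected_Int_frontier by blast
  then obtain u where u: "0 \<le> u" "u \<le> 1" "z = (1 - u) *\<^sub>R (y - t *\<^sub>R e) + u *\<^sub>R y"
    by (auto simp: in_segment)
  then have "y = z + ((1 - u) * t) *\<^sub>R e" by (simp add: algebra_simps)
  then show ?thesis using sweepI[OF z(2), of "(1 - u) * t" t e] u assms(2) by (simp add: mult_left_le_one_le)
qed

text \<open>
  The divergence theorem as an inequality. The difference quotient of the integral is an integral over the
  symmetric difference of \<open>Om\<close> and its translate, which lies in the set swept by the boundary, so
  no normal vector is needed.
\<close>
lemma integral_pd_le_surface_integral:
  fixes Om :: "'a::euclidean_space set" and \<psi> :: "'a \<Rightarrow> real"
  assumes d: "DIM('a) \<ge> 2" and e: "norm e = 1" and Om: "open Om" "bounded Om"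
    and fin: "emeasure (surface_measure Om) (frontier Om) < \<infinity>" and \<psi>: "smooth \<psi>"
  shows "\<bar>LINT x|lborel. indicator Om x * pd e \<psi> x\<bar> \<le> sweep_const TYPE('a) * (LINT x|surface_measure Om. \<bar>\<psi> x\<bar>)"
proof -
  let ?G = "frontier Om" and ?N = "surface_measure Om" and ?C = "sweep_const TYPE('a)"
  define t where "t n = 1 / real (Suc n)" for n
  have t: "0 < t n" "t n \<le> 1" for n by (auto simp: t_def)
  have t0: "t \<longlonglongrightarrow> 0" unfolding t_def by (rule LIMSEQ_Suc[OF lim_1_over_n])
  let ?q = "\<lambda>n. (LINT x|lborel. indicator Om x * (\<psi> (x + t n *\<^sub>R e) - \<psi> x)) / t n"
  have lim: "?q \<longlonglongrightarrow> (LINT x|lborel. indicator Om x * pd e \<psi> x)"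
    by (rule integral_difference_quotient_tendsto[OF \<psi> _ Om(2) e t t0]) (use Om in auto)
  have [measurable]: "\<psi> \<in> borel_measurable borel" "Om \<in> sets borel"
    using \<psi> Om by (auto intro: smooth_borel_measurable)
  have cont: "continuous_on S \<psi>" for S by (rule smooth_continuous_on[OF \<psi>])
  have G: "compact ?G" using Om by (simp add: compact_frontier_bounded)
  define m where "m = measure ?N ?G"
  have m: "emeasure ?N ?G = ennreal m" "0 \<le> m"
    using fin by (auto simp: m_def emeasure_eq_ennreal_measure)
  obtain R where R: "closure Om \<subseteq> cball 0 R" using Om(2) bounded_closure[OF Om(2)] by (auto simp: bounded_iff subset_iff)
  have GR: "?G \<subseteq> cball 0 R" using R by (auto simp: frontier_def)
  obtain B where B: "\<And>x. x \<in> cball 0 (R + 1) \<Longrightarrow> \<bar>\<psi> x\<bar> \<le> B"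
    using continuous_bounded_on_compact[OF cont compact_cball] by (metis real_norm_def)
  have fm: "finite_measure ?N" by (rule finite_measureI) (use fin in \<open>simp add: space_surface_measure\<close>)
  have int: "integrable ?N (\<lambda>x. \<bar>\<psi> x\<bar>)"
  proof (rule finite_measure.integrable_const_bound[OF fm, of _ B])
    show "AE x in ?N. norm \<bar>\<psi> x\<bar> \<le> B"
      using B GR by (intro AE_I2) (auto simp: space_surface_measure)
    show "(\<lambda>x. \<bar>\<psi> x\<bar>) \<in> borel_measurable ?N"
      by (intro continuous_measurable_surface_measure continuous_intros cont)
  qed
  \<comment> \<open>The swept layer is thin enough for \<psi> to vary by less than \<epsilon> across
    it. The error is proportional to the measure \<open>m\<close> of the boundary, so finiteness of
    \<open>m\<close> lets it vanish in the end.\<close>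
  have bound: "\<bar>LINT x|lborel. indicator Om x * pd e \<psi> x\<bar> \<le> ?C * ((LINT x|?N. \<bar>\<psi> x\<bar>) + 2 * \<epsilon> * m)" if \<epsilon>: "0 < \<epsilon>" for \<epsilon>
  proof -
    have "uniformly_continuous_on (cball 0 (R + 1)) (\<lambda>x. \<bar>\<psi> x\<bar>)"
      by (intro compact_uniformly_continuous continuous_intros cont) auto
    then obtain \<delta> where \<delta>: "0 < \<delta>" "\<And>x y. x \<in> cball 0 (R + 1) \<Longrightarrow> y \<in> cball 0 (R + 1) \<Longrightarrow> dist y x < \<delta> \<Longrightarrow> dist \<bar>\<psi> y\<bar> \<bar>\<psi> x\<bar> < \<epsilon>"
      using \<epsilon> unfolding uniformly_continuous_on_def by metis
    have ev: "\<forall>\<^sub>F n in sequentially. t n < \<delta>" using order_tendstoD(2)[OF t0 \<delta>(1)] .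
    have "\<bar>?q n\<bar> \<le> ?C * ((LINT x|?N. \<bar>\<psi> x\<bar>) + 2 * \<epsilon> * m)" if tn: "t n < \<delta>" for n
    proof -
      let ?S = "sweep e (t n) ?G"
      have cS: "compact ?S" by (rule compact_sweep[OF G])
      have [measurable]: "?S \<in> sets borel" using cS by (simp add: compact_imp_closed borel_closed)
      have osc: "\<bar>\<psi> (x + s *\<^sub>R e)\<bar> \<le> \<bar>\<psi> x\<bar> + \<epsilon>" if "x \<in> ?G" "0 \<le> s" "s \<le> t n" for x s
      proof -
        have x: "norm x \<le> R" using that GR by auto
        have "norm (x + s *\<^sub>R e) \<le> R + 1"
          using norm_triangle_ineq[of x "s *\<^sub>R e"] x that t(2)[of n] e by simp
        moreover have "dist (x + s *\<^sub>R e) x < \<delta>" using that e tn by (simp add: dist_norm)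
        ultimately have "dist \<bar>\<psi> (x + s *\<^sub>R e)\<bar> \<bar>\<psi> x\<bar> < \<epsilon>" using x by (intro \<delta>(2)) auto
        then show ?thesis by (simp add: dist_real_def)
      qed
      have int_S: "integrable lborel (\<lambda>y. \<bar>\<psi> y\<bar> * indicator ?S y)"
        using integrable_indicator_continuous[of "\<lambda>y. \<bar>\<psi> y\<bar>" ?S] cS cont
        by (auto simp: mult.commute compact_imp_bounded intro: continuous_on_rabs)
      note sh = integral_difference_indicator[OF cont _ Om(2), of "t n *\<^sub>R e"]
      have "\<bar>LINT x|lborel. indicator Om x * (\<psi> (x + t n *\<^sub>R e) - \<psi> x)\<bar> \<le>
          (LINT y|lborel. \<bar>(indicator Om (y - t n *\<^sub>R e) - indicator Om y) * \<psi> y\<bar>)"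
        by (simp only: sh(2) borel_open Om integral_abs_bound)
      also have "\<dots> \<le> (LINT y|lborel. \<bar>\<psi> y\<bar> * indicator ?S y)"
      proof (rule integral_mono[OF integrable_abs[OF sh(1)] int_S])
        fix y
        have "y \<in> ?S" if "(y - t n *\<^sub>R e \<in> Om) \<noteq> (y \<in> Om)"
          by (rule segment_crosses_frontier[OF that]) (use t(1)[of n] in simp)
        then show "\<bar>(indicator Om (y - t n *\<^sub>R e) - indicator Om y) * \<psi> y\<bar> \<le> \<bar>\<psi> y\<bar> * indicator ?S y"
          by (cases "y - t n *\<^sub>R e \<in> Om"; cases "y \<in> Om") (auto simp: indicator_def)
      qed simp
      also have "\<dots> \<le> (?C * t n) * ((LINT x|?N. \<bar>\<psi> x\<bar>) + 2 * \<epsilon> * m)"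
      proof -
        have "ennreal (LINT y|lborel. \<bar>\<psi> y\<bar> * indicator ?S y) = (\<integral>\<^sup>+y. ennreal (\<bar>\<psi> y\<bar>) * indicator ?S y \<partial>lborel)"
          using nn_integral_eq_integral[OF int_S] by (simp add: ennreal_mult ennreal_indicator)
        also have "\<dots> \<le> ennreal (?C * t n) * ((\<integral>\<^sup>+x. ennreal \<bar>\<psi> x\<bar> \<partial>?N) + ennreal (2 * \<epsilon>) * emeasure ?N ?G)"
          by (rule nn_integral_sweep_le[OF d e t(1) Om(2)]) (use osc \<epsilon> cont in \<open>auto intro!: continuous_intros\<close>)
        also have "\<dots> = ennreal ((?C * t n) * ((LINT x|?N. \<bar>\<psi> x\<bar>) + 2 * \<epsilon> * m))"
        proof -
          have n0: "0 \<le> ?C * t n" "0 \<le> (LINT x|?N. \<bar>\<psi> x\<bar>)" "0 \<le> 2 * \<epsilon> * m"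
            using t(1)[of n] sweep_const_pos[where 'a='a] \<epsilon> m(2) by auto
          have "(\<integral>\<^sup>+x. ennreal \<bar>\<psi> x\<bar> \<partial>?N) = ennreal (LINT x|?N. \<bar>\<psi> x\<bar>)"
            by (rule nn_integral_eq_integral[OF int]) simp
          moreover have "ennreal (2 * \<epsilon>) * ennreal m = ennreal (2 * \<epsilon> * m)" using \<epsilon> m(2) by (subst ennreal_mult) auto
          ultimately show ?thesis unfolding m(1) using n0
            by (simp only: ennreal_plus[symmetric] ennreal_mult[symmetric] add_nonneg_nonneg)
        qed
        finally show ?thesis
          using t(1)[of n] sweep_const_pos[where 'a='a] \<epsilon> m(2) by (subst (asm) ennreal_le_iff) auto
      qed
      finally show ?thesis using t(1)[of n] by (simp add: abs_divide pos_divide_le_eq mult.commute mult.left_commute)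
    qed
    then have "\<forall>\<^sub>F n in sequentially. \<bar>?q n\<bar> \<le> ?C * ((LINT x|?N. \<bar>\<psi> x\<bar>) + 2 * \<epsilon> * m)"
      using ev by (auto elim: eventually_mono)
    then show ?thesis by (rule tendsto_upperbound[OF tendsto_rabs[OF lim]]) simp
  qed
  show ?thesis
  proof (rule field_le_epsilon)
    fix \<eta> :: real assume \<eta>: "0 < \<eta>"
    \<comment> \<open>Chosen so that the error term is at most \<eta>; \<open>m + 1\<close> avoids a
      division by zero.\<close>
    define \<epsilon> where "\<epsilon> = \<eta> / (2 * ?C * (m + 1))"
    have C: "0 < ?C" by (rule sweep_const_pos)
    have \<epsilon>: "0 < \<epsilon>" using \<eta> C m(2) by (simp add: \<epsilon>_def)
    have "\<epsilon> * (2 * ?C * (m + 1)) = \<eta>" using C m(2) by (simp add: \<epsilon>_def)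
    then have "?C * (2 * \<epsilon> * m) = \<eta> - 2 * ?C * \<epsilon>" by (simp add: algebra_simps)
    then have "?C * (2 * \<epsilon> * m) \<le> \<eta>" using C \<epsilon> by simp
    then show "\<bar>LINT x|lborel. indicator Om x * pd e \<psi> x\<bar> \<le> ?C * (LINT x|?N. \<bar>\<psi> x\<bar>) + \<eta>"
      using bound[OF \<epsilon>] by (simp add: distrib_left)
  qed
qed

section \<open>Mollification\<close>

lemma integral_lebesgue_on_borel:
  fixes f :: "'a::euclidean_space \<Rightarrow> 'b::euclidean_space"
  assumes "f \<in> borel_measurable borel" "Om \<in> sets borel"
  shows "(LINT x|lebesgue_on Om. f x) = (LINT x|lborel. indicator Om x *\<^sub>R f x)"
proof -
  have "(LINT x|lebesgue_on Om. f x) = (LINT x|lebesgue. indicator Om x *\<^sub>R f x)"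
    using assms by (subst integral_restrict_space) auto
  also have "\<dots> = (LINT x|lborel. indicator Om x *\<^sub>R f x)"
    using assms by (intro integral_completion) auto
  finally show ?thesis .
qed

lemma borel_measurable_lebesgue_on:
  fixes f :: "'a::euclidean_space \<Rightarrow> 'b::euclidean_space"
  assumes "f \<in> borel_measurable borel"
  shows "f \<in> borel_measurable (lebesgue_on Om)"
  using assms by (intro measurable_restrict_space1 measurable_completion) simp

lemma square_integrable_lebesgue_on:
  fixes f :: "'a::euclidean_space \<Rightarrow> real"
  assumes f: "square_integrable lborel f" and Om: "Om \<in> sets borel"
  shows "square_integrable (lebesgue_on Om) f" "l2_norm (lebesgue_on Om) f \<le> l2_norm lborel f"
proof -
  have m [measurable]: "f \<in> borel_measurable borel"
    using f by (auto simp: square_integrable_def)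
  have nn: "(\<integral>\<^sup>+x. ennreal ((norm (f x))\<^sup>2) \<partial>lebesgue_on Om) \<le> ennreal ((l2_norm lborel f)\<^sup>2)"
  proof -
    have "(\<integral>\<^sup>+x. ennreal ((norm (f x))\<^sup>2) \<partial>lebesgue_on Om) = (\<integral>\<^sup>+x. ennreal ((norm (f x))\<^sup>2) * indicator Om x \<partial>lebesgue)"
      using Om by (subst nn_integral_restrict_space) auto
    also have "\<dots> \<le> (\<integral>\<^sup>+x. ennreal ((norm (f x))\<^sup>2) \<partial>lebesgue)"
      by (intro nn_integral_mono) (auto simp: indicator_def)
    also have "\<dots> = (\<integral>\<^sup>+x. ennreal ((norm (f x))\<^sup>2) \<partial>lborel)"
      by (rule nn_integral_completion)
    also have "\<dots> = ennreal ((l2_norm lborel f)\<^sup>2)" by (rule nn_integral_power2_l2[OF f])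
    finally show ?thesis .
  qed
  show "square_integrable (lebesgue_on Om) f" "l2_norm (lebesgue_on Om) f \<le> l2_norm lborel f"
    using square_integrable_l2_norm_leI[OF borel_measurable_lebesgue_on[OF m] nn] by auto
qed

definition vanishes_outside :: "real \<Rightarrow> ('a::real_normed_vector \<Rightarrow> 'b::zero) \<Rightarrow> bool" where
  "vanishes_outside R g \<longleftrightarrow> (\<forall>x. norm x > R \<longrightarrow> g x = 0)"

lemma vanishes_outsideD: "vanishes_outside R g \<Longrightarrow> norm x > R \<Longrightarrow> g x = 0"
  by (simp add: vanishes_outside_def)

lemma uniformly_continuous_compact_support:
  fixes g :: "'a::euclidean_space \<Rightarrow> 'b::real_normed_vector"
  assumes "continuous_on UNIV g" "vanishes_outside R g"
  shows "uniformly_continuous_on UNIV g"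
  unfolding uniformly_continuous_on_def
proof (intro allI impI)
  fix e :: real assume "0 < e"
  have "uniformly_continuous_on (cball 0 (R + 1)) g"
    by (intro compact_uniformly_continuous continuous_on_subset[OF assms(1)]) auto
  then obtain d where d: "0 < d" "\<And>x y. x \<in> cball 0 (R + 1) \<Longrightarrow> y \<in> cball 0 (R + 1) \<Longrightarrow> dist y x < d \<Longrightarrow> dist (g y) (g x) < e"
    using \<open>0 < e\<close> unfolding uniformly_continuous_on_def by metis
  show "\<exists>d>0. \<forall>x\<in>UNIV. \<forall>y\<in>UNIV. dist y x < d \<longrightarrow> dist (g y) (g x) < e"
  proof (intro exI[of _ "min d 1"] conjI ballI impI)
    fix x y :: 'a assume xy: "dist y x < min d 1"
    show "dist (g y) (g x) < e"
    proof (cases "norm x > R \<and> norm y > R")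
      case True then show ?thesis using vanishes_outsideD[OF assms(2)] \<open>0 < e\<close> by simp
    next
      case False
      have "norm x \<le> norm y + dist y x" "norm y \<le> norm x + dist y x"
        using norm_triangle_ineq2[of x y] norm_triangle_ineq2[of y x] by (auto simp: dist_norm norm_minus_commute)
      then have "norm x \<le> R + 1" "norm y \<le> R + 1" using False xy by auto
      then show ?thesis using d(2)[of x y] xy by simp
    qed
  qed (use d in auto)
qed

lemma pd_support:
  fixes k :: "'a::euclidean_space \<Rightarrow> real"
  assumes "vanishes_outside R k"
  shows "vanishes_outside R (pd b k)"
  unfolding vanishes_outside_def
proof (intro allI impI)
  fix x :: 'a assume "norm x > R"
  have "((\<lambda>x. 0) has_derivative (\<lambda>v. 0)) (at x)" by simp
  then have "(k has_derivative (\<lambda>v. 0)) (at x)"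
  proof (rule has_derivative_transform_within_open)
    show "open {x :: 'a. R < norm x}" by (intro open_Collect_less continuous_intros)
  qed (use \<open>norm x > R\<close> vanishes_outsideD[OF assms] in auto)
  then show "pd b k x = 0" by (simp add: pd_eqI)
qed

section \<open>Convolution with smooth kernels of bounded support\<close>

definition conv :: "('a::euclidean_space \<Rightarrow> real) \<Rightarrow> ('a \<Rightarrow> real) \<Rightarrow> 'a \<Rightarrow> real" where
  "conv k f x = (LINT z|lborel. k (x - z) * f z)"

lemma bounded_compact_support:
  fixes g :: "'a::euclidean_space \<Rightarrow> real"
  assumes "continuous_on UNIV g" "vanishes_outside R g"
  obtains B where "0 \<le> B" "\<And>x. \<bar>g x\<bar> \<le> B"
proof -
  obtain B where B: "\<forall>y\<in>cball 0 R. norm (g y) \<le> B"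
    using continuous_bounded_on_compact[OF assms(1) compact_cball] by blast
  have "\<bar>g x\<bar> \<le> \<bar>B\<bar>" for x
  proof (cases "norm x > R")
    case False
    then have "norm (g x) \<le> B" using B by (simp add: not_less)
    then show ?thesis by simp
  qed (use vanishes_outsideD[OF assms(2)] in auto)
  then show ?thesis using that[of "\<bar>B\<bar>"] by auto
qed

lemma conv_integrable:
  fixes k :: "'a::euclidean_space \<Rightarrow> real"
  assumes k: "continuous_on UNIV k" "vanishes_outside R k" and f: "integrable lborel f"
  shows "integrable lborel (\<lambda>z. k (x - z) * f z)"
proof -
  obtain B where B: "0 \<le> B" "\<And>x. \<bar>k x\<bar> \<le> B" using bounded_compact_support[OF k] by blast
  have [measurable]: "k \<in> borel_measurable borel" "f \<in> borel_measurable borel"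
    using k f by (auto intro: borel_measurable_continuous_onI)
  show ?thesis
  proof (rule Bochner_Integration.integrable_bound[where f = "\<lambda>z. B * f z"])
    show "integrable lborel (\<lambda>z. B * f z)" using f by simp
    show "AE z in lborel. norm (k (x - z) * f z) \<le> norm (B * f z)"
      using B by (auto simp: abs_mult intro!: mult_right_mono)
  qed measurable
qed

text \<open>A gradient of bounded support is uniformly continuous, so the linearisation error is
  uniform in the base point. This uniformity replaces dominated convergence when differentiating
  under the integral against a merely integrable function.\<close>

lemma smooth_linearization_uniform:
  fixes k :: "'a::euclidean_space \<Rightarrow> real"
  assumes k: "smooth k" "vanishes_outside R k" and e: "0 < e"
  obtains d where "0 < d" "\<And>w h. norm h < d \<Longrightarrow> \<bar>k (w + h) - k w - pd h k w\<bar> \<le> e * norm h"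
proof -
  have "continuous_on UNIV (grad k)" by (rule continuous_on_grad[OF k(1)])
  moreover have "vanishes_outside R (grad k)"
    using vanishes_outsideD[OF pd_support[OF k(2)]] by (simp add: vanishes_outside_def grad_eq_pd)
  ultimately have "uniformly_continuous_on UNIV (grad k)" by (rule uniformly_continuous_compact_support)
  then obtain d where d: "0 < d" "\<And>x y. dist y x < d \<Longrightarrow> dist (grad k y) (grad k x) < e"
    using e unfolding uniformly_continuous_on_def by (metis UNIV_I)
  have "\<bar>k (w + h) - k w - pd h k w\<bar> \<le> e * norm h" if h: "norm h < d" for w h
  proof -
    let ?S = "closed_segment w (w + h)"
    have "norm (k (w + h) - k w - pd (w + h - w) k w) \<le> norm (w + h - w) * e"
    proof (rule differentiable_bound_linearization[where f' = "\<lambda>x v. pd v k x" and S = ?S])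
      show "\<And>t. t \<in> {0..1} \<Longrightarrow> w + t *\<^sub>R (w + h - w) \<in> ?S"
        by (auto simp: in_segment algebra_simps intro!: exI)
      show "(k has_derivative (\<lambda>v. pd v k x)) (at x within ?S)" for x
        by (rule has_derivative_at_withinI[OF differentiable_has_derivative_pd[OF smooth_differentiable[OF k(1)]]])
      show "onorm ((\<lambda>v. pd v k x) - (\<lambda>v. pd v k w)) \<le> e" if "x \<in> ?S" for x
        unfolding fun_diff_def
      proof (rule onorm_le)
        fix v
        have "norm (x - w) \<le> norm h" using segment_bound1[OF that] by simp
        then have "norm (grad k x - grad k w) \<le> e" using d(2)[of x w] h by (simp add: dist_norm)
        moreover have "pd v k x - pd v k w = (grad k x - grad k w) \<bullet> v"
          by (simp add: pd_eq_grad_inner[OF smooth_differentiable[OF k(1)]] inner_diff_left)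
        ultimately show "norm (pd v k x - pd v k w) \<le> e * norm v"
          using order_trans[OF Cauchy_Schwarz_ineq2[of "grad k x - grad k w" v] mult_right_mono[of _ e "norm v"]] by simp
      qed
    qed simp
    then show ?thesis by (simp add: mult.commute)
  qed
  then show ?thesis using that d(1) by blast
qed

lemma conv_has_derivative:
  fixes k :: "'a::euclidean_space \<Rightarrow> real"
  assumes k: "smooth k" "vanishes_outside R k" and f: "integrable lborel f"
  shows "(conv k f has_derivative (\<lambda>v. \<Sum>b\<in>Basis. (v \<bullet> b) * conv (pd b k) f x)) (at x)"
proof -
  have ik: "integrable lborel (\<lambda>z. k (y - z) * f z)" for y
    by (rule conv_integrable[OF smooth_continuous_on[OF k(1)] k(2) f])
  have ip: "integrable lborel (\<lambda>z. pd b k (y - z) * f z)" if "b \<in> Basis" for b y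
    by (rule conv_integrable[OF smooth_continuous_on[OF smooth_pd[OF k(1) that]] pd_support[OF k(2)] f])
  have pdsum: "pd v k y = (\<Sum>b\<in>Basis. (v \<bullet> b) * pd b k y)" for v y
  proof -
    have "pd v k y = grad k y \<bullet> v" by (rule pd_eq_grad_inner[OF smooth_differentiable[OF k(1)]])
    also have "\<dots> = (\<Sum>b\<in>Basis. (v \<bullet> b) * pd b k y)"
      unfolding grad_eq_pd inner_sum_left by (simp add: inner_commute mult.commute)
    finally show ?thesis .
  qed
  let ?D = "\<lambda>v. \<Sum>b\<in>Basis. (v \<bullet> b) * conv (pd b k) f x"
  have D: "?D v = (LINT z|lborel. pd v k (x - z) * f z)" for v
    unfolding pdsum[of v] sum_distrib_right conv_def
    using ip by (subst Bochner_Integration.integral_sum) (auto simp: mult.assoc)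
  have iD: "integrable lborel (\<lambda>z. pd v k (x - z) * f z)" for v
    unfolding pdsum[of v] sum_distrib_right mult.assoc
    by (intro Bochner_Integration.integrable_sum integrable_mult_right ip)
  show ?thesis
    unfolding has_derivative_at_alt
  proof (intro conjI allI impI)
    show "bounded_linear ?D" by (intro bounded_linear_sum bounded_linear_mult_left[THEN bounded_linear_compose] bounded_linear_inner_left)
    fix e :: real assume e: "0 < e"
    define I where "I = (LINT z|lborel. \<bar>f z\<bar>)"
    have I: "0 \<le> I" by (simp add: I_def)
    \<comment> \<open>The linearisation error is integrated against the absolute value of
      \<open>f\<close>, whose integral is \<open>I\<close>; hence the division by
      \<open>I + 1\<close>.\<close>
    obtain d where d: "0 < d" "\<And>w h. norm h < d \<Longrightarrow> \<bar>k (w + h) - k w - pd h k w\<bar> \<le> e / (I + 1) * norm h"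
      using smooth_linearization_uniform[OF k, of "e / (I + 1)"] e I by auto
    show "\<exists>d>0. \<forall>y. norm (y - x) < d \<longrightarrow> norm (conv k f y - conv k f x - ?D (y - x)) \<le> e * norm (y - x)"
    proof (intro exI[of _ d] conjI allI impI d(1))
      fix y assume y: "norm (y - x) < d"
      have "conv k f y - conv k f x - ?D (y - x) =
          (LINT z|lborel. (k (x - z + (y - x)) - k (x - z) - pd (y - x) k (x - z)) * f z)"
        unfolding D unfolding conv_def using ik[of x] ik[of y] iD[of "y - x"]
        by (simp add: left_diff_distrib)
      also have "norm \<dots> \<le> (LINT z|lborel. e / (I + 1) * norm (y - x) * \<bar>f z\<bar>)"
      proof (rule order_trans[OF integral_norm_bound], rule integral_mono)
        have "integrable lborel (\<lambda>z. (k (x - z + (y - x)) - k (x - z) - pd (y - x) k (x - z)) * f z)"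
          using ik[of x] ik[of y] iD[of "y - x"] by (simp add: left_diff_distrib)
        then show "integrable lborel (\<lambda>z. norm ((k (x - z + (y - x)) - k (x - z) - pd (y - x) k (x - z)) * f z))"
          by (rule integrable_norm)
        show "integrable lborel (\<lambda>z. e / (I + 1) * norm (y - x) * \<bar>f z\<bar>)" using f by simp
        show "norm ((k (x - z + (y - x)) - k (x - z) - pd (y - x) k (x - z)) * f z) \<le> e / (I + 1) * norm (y - x) * \<bar>f z\<bar>" for z
          unfolding real_norm_def abs_mult by (intro mult_right_mono d(2) y) simp
      qed
      also have "\<dots> = e * norm (y - x) * (I / (I + 1))" by (simp add: I_def)
      also have "\<dots> \<le> e * norm (y - x) * 1" using e I by (intro mult_left_mono) auto
      finally show "norm (conv k f y - conv k f x - ?D (y - x)) \<le> e * norm (y - x)" by simp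
    qed
  qed
qed

lemma pd_conv:
  fixes k :: "'a::euclidean_space \<Rightarrow> real"
  assumes "smooth k" "vanishes_outside R k" "integrable lborel f" "b \<in> Basis"
  shows "pd b (conv k f) = conv (pd b k) f"
proof
  fix x show "pd b (conv k f) x = conv (pd b k) f x"
    using pd_eqI[OF conv_has_derivative[OF assms(1-3), where x = x], of b] assms(4)
    by (simp add: inner_Basis if_distrib[of "\<lambda>c. c * _"] cong: if_cong)
qed

lemma smooth_conv:
  fixes k :: "'a::euclidean_space \<Rightarrow> real"
  assumes "smooth k" "vanishes_outside R k" "integrable lborel f"
  shows "smooth (conv k f)"
proof -
  have "smooth_upto n (conv k f)" for n
    using assms(1,2)
  proof (induction n arbitrary: k)
    case (Suc n)
    have "smooth_upto n (pd b (conv k f))" if "b \<in> Basis" for b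
      unfolding pd_conv[OF Suc.prems assms(3) that]
      by (rule Suc.IH[OF smooth_pd[OF Suc.prems(1) that]]) (rule pd_support[OF Suc.prems(2)])
    then show ?case using conv_has_derivative[OF Suc.prems assms(3)] by (auto simp: differentiable_def)
  qed simp
  then show ?thesis by (simp add: smooth_iff_smooth_upto)
qed

text \<open>Centred at \<open>c\<close> instead of the origin, because convolution at
  \<open>x\<close> then averages around \<open>x - c\<close>. Near the boundary, \<open>c\<close> is
  chosen to move this average into the domain.\<close>

definition mollifier :: "'a::euclidean_space \<Rightarrow> real \<Rightarrow> 'a \<Rightarrow> real" where
  "mollifier c \<rho> y = bump \<rho> (y - c) / (LINT z|lborel. bump \<rho> (z::'a))"

text \<open>No symmetry and no scaling from a fixed profile is imposed, so that off-centre
  mollifiers with chart-dependent directions qualify.\<close>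

definition kernel :: "real \<Rightarrow> ('a::euclidean_space \<Rightarrow> real) \<Rightarrow> bool" where
  "kernel R K \<longleftrightarrow> smooth K \<and> (\<forall>y. 0 \<le> K y) \<and> (LINT y|lborel. K y) = 1 \<and> vanishes_outside R K"

lemma integrable_compact_support:
  fixes g :: "'a::euclidean_space \<Rightarrow> real"
  assumes "continuous_on UNIV g" "vanishes_outside R g"
  shows "integrable lborel g"
proof -
  obtain B where B: "0 \<le> B" "\<And>x. \<bar>g x\<bar> \<le> B" using bounded_compact_support[OF assms] by blast
  show ?thesis
  proof (rule Bochner_Integration.integrable_bound[where f = "\<lambda>x. indicator (cball 0 R) x * B"])
    show "integrable lborel (\<lambda>x::'a. indicator (cball 0 R) x * B)"
      using emeasure_bounded_finite[of "cball 0 R :: 'a set"]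
      by (intro integrable_mult_left integrable_indicator) (auto simp: less_top)
    show "g \<in> borel_measurable lborel" using assms by (auto intro: borel_measurable_continuous_onI)
    show "AE x in lborel. norm (g x) \<le> norm (indicator (cball 0 R) x * B)"
      using B vanishes_outsideD[OF assms(2)] by (intro always_eventually allI) (auto simp: indicator_def not_le)
  qed
qed

lemma bump_support: "0 < \<rho> \<Longrightarrow> \<rho> \<le> norm x \<Longrightarrow> bump \<rho> x = 0"
  using bump_pos_iff[of \<rho> x] bump_nonneg[of \<rho> x] by simp

lemma integrable_bump: "0 < \<rho> \<Longrightarrow> integrable lborel (bump \<rho>)"
  by (rule integrable_compact_support[of _ \<rho>]) (auto intro: smooth_continuous_on smooth_bump bump_support simp: vanishes_outside_def)

lemma integral_bump_pos:
  assumes "0 < \<rho>" shows "0 < (LINT z|lborel. bump \<rho> (z::'a::euclidean_space))"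
proof -
  have "(LINT z|lborel. bump \<rho> (z::'a)) \<noteq> 0"
  proof
    assume "(LINT z|lborel. bump \<rho> (z::'a)) = 0"
    then have "AE z in lborel. bump \<rho> (z::'a) = 0"
      using integral_nonneg_eq_0_iff_AE[OF integrable_bump[OF assms]] bump_nonneg by auto
    then have "AE z in lborel. z \<notin> ball (0::'a) \<rho>"
      by eventually_elim (metis bump_pos_iff[OF assms] less_irrefl mem_ball_0)
    then have "emeasure lborel (ball (0::'a) \<rho>) = 0"
      by (subst (asm) AE_iff_measurable[of "ball (0::'a) \<rho>"]) auto
    then show False using assms unit_ball_vol_pos[of "real DIM('a)"] by (simp add: emeasure_ball)
  qed
  moreover have "0 \<le> (LINT z|lborel. bump \<rho> (z::'a))" by (simp add: bump_nonneg)
  ultimately show ?thesis by simp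
qed

lemma mollifier_support: "0 < \<rho> \<Longrightarrow> \<rho> \<le> norm (y - c) \<Longrightarrow> mollifier c \<rho> y = 0"
  by (simp add: mollifier_def bump_support)

lemma kernel_mollifier:
  assumes "0 < \<rho>" "norm c + \<rho> \<le> R"
  shows "kernel R (mollifier c \<rho>)"
  unfolding kernel_def
proof (intro conjI allI impI)
  let ?I = "LINT z|lborel. bump \<rho> (z::'a)"
  have I: "0 < ?I" by (rule integral_bump_pos[OF assms(1)])
  have "smooth (\<lambda>y::'a. (1 / ?I) * bump \<rho> (1 *\<^sub>R y + (- c)))"
    by (intro smooth_mult smooth_const smooth_translate_reflect smooth_bump)
  then show "smooth (mollifier c \<rho>)" by (simp add: mollifier_def[abs_def])
  show "0 \<le> mollifier c \<rho> y" for y using I by (simp add: mollifier_def bump_nonneg)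
  have "(LINT y|lborel. bump \<rho> (y + (- c))) = ?I"
    by (rule integral_lborel_translate) (rule smooth_borel_measurable[OF smooth_bump])
  then show "(LINT y|lborel. mollifier c \<rho> y) = 1" using I by (simp add: mollifier_def)
  have "mollifier c \<rho> y = 0" if "norm y > R" for y
    using norm_triangle_ineq2[of y c] that assms by (intro mollifier_support) auto
  then show "vanishes_outside R (mollifier c \<rho>)" by (simp add: vanishes_outside_def)
qed

lemma kernel_reflect_integral:
  fixes x :: "'a::euclidean_space"
  assumes "kernel R K"
  shows "(LINT z|lborel. K (x - z)) = 1" "integrable lborel (\<lambda>z. K (x - z))"
proof -
  have K: "integrable lborel K"
    by (rule integrable_compact_support[of _ R]) (use assms in \<open>auto simp: kernel_def smooth_continuous_on\<close>)
  have km: "K \<in> borel_measurable borel" using assms by (auto simp: kernel_def smooth_borel_measurable)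
  have e: "distr lborel borel (\<lambda>z. x - z) = (lborel :: 'a measure)"
  proof -
    have "(lborel :: 'a measure) = distr (distr lborel borel uminus) borel ((+) x)"
      using lborel_affine[of "-1" "0::'a"] by (simp add: lborel_distr_plus density_1 one_ennreal_def[symmetric])
    also have "\<dots> = distr lborel borel ((+) x \<circ> uminus)" by (rule distr_distr) auto
    finally show ?thesis by (simp add: comp_def)
  qed
  show "(LINT z|lborel. K (x - z)) = 1"
    using integral_distr[of "\<lambda>z. x - z" lborel borel K] km e assms by (auto simp: kernel_def)
  show "integrable lborel (\<lambda>z. K (x - z))"
    using integrable_distr_eq[of "\<lambda>z. x - z" lborel borel K] km e K by auto
qed

text \<open>Jensen's inequality for the probability density \<open>K (x - z)\<close>: the variance
  of \<open>f\<close> under it is nonnegative.\<close>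

lemma power2_conv_le:
  fixes f :: "'a::euclidean_space \<Rightarrow> real"
  assumes K: "kernel R K" and f: "integrable lborel f" "integrable lborel (\<lambda>z. (f z)\<^sup>2)"
  shows "(conv K f x)\<^sup>2 \<le> (LINT z|lborel. K (x - z) * (f z)\<^sup>2)" "integrable lborel (\<lambda>z. K (x - z) * (f z)\<^sup>2)"
proof -
  have k: "continuous_on UNIV K" "vanishes_outside R K" "\<And>y. 0 \<le> K y"
    using K by (auto simp: kernel_def smooth_continuous_on)
  note i1 = conv_integrable[OF k(1,2) f(1), of x] and i2 = conv_integrable[OF k(1,2) f(2), of x]
  note i0 = kernel_reflect_integral[OF K, of x]
  let ?a = "conv K f x"
  have "0 \<le> (LINT z|lborel. K (x - z) * (f z - ?a)\<^sup>2)" by (rule Bochner_Integration.integral_nonneg) (simp add: k)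
  also have "\<dots> = (LINT z|lborel. K (x - z) * (f z)\<^sup>2 - 2 * ?a * (K (x - z) * f z) + ?a\<^sup>2 * K (x - z))"
    by (intro Bochner_Integration.integral_cong) (auto simp: power2_eq_square algebra_simps)
  also have "\<dots> = (LINT z|lborel. K (x - z) * (f z)\<^sup>2) - 2 * ?a * (LINT z|lborel. K (x - z) * f z) + ?a\<^sup>2 * (LINT z|lborel. K (x - z))"
    using i0(2) i1 i2 by simp
  also have "\<dots> = (LINT z|lborel. K (x - z) * (f z)\<^sup>2) - ?a\<^sup>2"
    unfolding i0(1) conv_def[of K f x, symmetric] by (simp add: power2_eq_square)
  finally show "(conv K f x)\<^sup>2 \<le> (LINT z|lborel. K (x - z) * (f z)\<^sup>2)" by simp
  show "integrable lborel (\<lambda>z. K (x - z) * (f z)\<^sup>2)" by (rule i2)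
qed

text \<open>Young's inequality for a kernel of mass one: Jensen's inequality at each point, then
  Tonelli's theorem and translation invariance of the mass.\<close>

lemma square_integrable_conv:
  fixes f :: "'a::euclidean_space \<Rightarrow> real"
  assumes K: "kernel R K" and f: "integrable lborel f" "square_integrable lborel f"
  shows "square_integrable lborel (conv K f)" "l2_norm lborel (conv K f) \<le> l2_norm lborel f"
proof -
  have f2: "integrable lborel (\<lambda>z. (f z)\<^sup>2)" and [measurable]: "f \<in> borel_measurable borel"
    using f by (auto simp: square_integrable_def)
  have k: "smooth K" "vanishes_outside R K" "\<And>y. 0 \<le> K y" using K by (auto simp: kernel_def)
  have [measurable]: "K \<in> borel_measurable borel" by (rule smooth_borel_measurable[OF k(1)])
  have Kt: "(\<integral>\<^sup>+x. ennreal (K (x - z)) \<partial>lborel) = 1" for z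
  proof -
    have iK: "integrable lborel K" by (rule integrable_compact_support[of _ R]) (use k in \<open>auto simp: smooth_continuous_on\<close>)
    have "integrable lborel (\<lambda>x. K (x + - z))"
    proof -
      have "integrable (distr lborel borel ((+) (- z))) K" using iK by (simp add: lborel_distr_plus)
      then show ?thesis by (subst (asm) integrable_distr_eq) (auto simp: add.commute)
    qed
    then have "(\<integral>\<^sup>+x. ennreal (K (x + - z)) \<partial>lborel) = ennreal (LINT x|lborel. K (x + - z))"
      by (rule nn_integral_eq_integral) (simp add: k)
    also have "(LINT x|lborel. K (x + - z)) = 1"
      using K by (subst integral_lborel_translate) (auto simp: kernel_def)
    finally show ?thesis by simp
  qed
  have "(\<integral>\<^sup>+x. ennreal ((norm (conv K f x))\<^sup>2) \<partial>lborel) \<le> (\<integral>\<^sup>+x. (\<integral>\<^sup>+z. ennreal (K (x - z) * (f z)\<^sup>2) \<partial>lborel) \<partial>lborel)"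
  proof (rule nn_integral_mono)
    fix x
    have "(\<integral>\<^sup>+z. ennreal (K (x - z) * (f z)\<^sup>2) \<partial>lborel) = ennreal (LINT z|lborel. K (x - z) * (f z)\<^sup>2)"
      by (rule nn_integral_eq_integral[OF power2_conv_le(2)[OF K f(1) f2]]) (simp add: k)
    then show "ennreal ((norm (conv K f x))\<^sup>2) \<le> (\<integral>\<^sup>+z. ennreal (K (x - z) * (f z)\<^sup>2) \<partial>lborel)"
      using power2_conv_le(1)[OF K f(1) f2, of x] by (simp add: ennreal_leI)
  qed
  also have "\<dots> = (\<integral>\<^sup>+z. (\<integral>\<^sup>+x. ennreal (K (x - z) * (f z)\<^sup>2) \<partial>lborel) \<partial>lborel)"
    by (rule lborel_pair.Fubini'[symmetric]) measurable
  also have "\<dots> = (\<integral>\<^sup>+z. ennreal ((f z)\<^sup>2) \<partial>lborel)"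
    by (simp add: ennreal_mult k nn_integral_multc Kt)
  also have "\<dots> = ennreal ((l2_norm lborel f)\<^sup>2)" using nn_integral_power2_l2[OF f(2)] by simp
  finally have le: "(\<integral>\<^sup>+x. ennreal ((norm (conv K f x))\<^sup>2) \<partial>lborel) \<le> ennreal ((l2_norm lborel f)\<^sup>2)" .
  have m: "conv K f \<in> borel_measurable lborel"
    using smooth_borel_measurable[OF smooth_conv[OF k(1,2) f(1)]] by simp
  show "square_integrable lborel (conv K f)" "l2_norm lborel (conv K f) \<le> l2_norm lborel f"
    using square_integrable_l2_norm_leI[OF m le] by auto
qed

text \<open>The function is multiplied by the indicator of a ball, which is square-integrable as
  well.\<close>

lemma integrable_of_bounded_support:
  fixes f :: "'a::euclidean_space \<Rightarrow> real"
  assumes "square_integrable lborel f" "vanishes_outside R f"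
  shows "integrable lborel f"
proof -
  have "square_integrable lborel (indicator (cball 0 R) :: 'a \<Rightarrow> real)"
  proof -
    have "(\<lambda>x::'a. (norm (indicator (cball 0 R) x :: real))\<^sup>2) = indicator (cball 0 R)"
      by (auto simp: indicator_def)
    moreover have "integrable lborel (indicator (cball 0 R) :: 'a \<Rightarrow> real)"
      using emeasure_bounded_finite[of "cball 0 R :: 'a set"] by (intro integrable_real_indicator) auto
    ultimately show ?thesis by (simp add: square_integrable_def)
  qed
  from square_integrable_times[OF this assms(1)] have "integrable lborel (\<lambda>x. indicator (cball 0 R) x * f x)" .
  moreover have "indicator (cball 0 R) x * f x = f x" for x using vanishes_outsideD[OF assms(2), of x] by (auto simp: indicator_def)
  ultimately show ?thesis by simp
qed


lemma l2_norm_tendsto_0_dominated: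
  fixes h :: "nat \<Rightarrow> 'a \<Rightarrow> real"
  assumes [measurable]: "\<And>n. h n \<in> borel_measurable M" and w: "square_integrable M w"
    and le: "\<And>n. AE x in M. \<bar>h n x\<bar> \<le> \<bar>w x\<bar>" and lim: "AE x in M. (\<lambda>n. h n x) \<longlonglongrightarrow> 0"
  shows "(\<lambda>n. l2_norm M (h n)) \<longlonglongrightarrow> 0"
proof -
  have "(\<lambda>n. LINT x|M. (norm (h n x))\<^sup>2) \<longlonglongrightarrow> (LINT x|M. 0)"
  proof (rule integral_dominated_convergence[where w = "\<lambda>x. (norm (w x))\<^sup>2"])
    show "integrable M (\<lambda>x. (norm (w x))\<^sup>2)" using w by (simp add: square_integrable_def)
    show "AE x in M. (\<lambda>n. (norm (h n x))\<^sup>2) \<longlonglongrightarrow> 0"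
      using lim by eventually_elim (auto intro!: tendsto_eq_intros)
    show "AE x in M. norm ((norm (h n x))\<^sup>2) \<le> (norm (w x))\<^sup>2" for n
      using le[of n] by eventually_elim (simp add: abs_le_square_iff)
  qed auto
  then have "(\<lambda>n. sqrt (LINT x|M. (norm (h n x))\<^sup>2)) \<longlonglongrightarrow> sqrt 0"
    by (intro tendsto_real_sqrt) simp
  then show ?thesis by (simp add: l2_norm_def)
qed

lemma square_integrable_indicator:
  fixes S :: "'a::euclidean_space set"
  assumes "S \<in> sets borel" "bounded S"
  shows "square_integrable lborel (\<lambda>x. indicator S x * (c::real))"
proof -
  have "(\<lambda>x. (norm (indicator S x * c))\<^sup>2) = (\<lambda>x. indicator S x * c\<^sup>2)" by (auto simp: indicator_def)
  moreover have "integrable lborel (\<lambda>x. indicator S x * c\<^sup>2)"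
    using assms emeasure_bounded_finite[OF assms(2)] by (intro integrable_mult_left integrable_real_indicator) auto
  ultimately show ?thesis using assms by (simp add: square_integrable_def)
qed

section \<open>Density of continuous functions, approximate identities and cutoffs\<close>

definition clamp_real :: "real \<Rightarrow> real \<Rightarrow> real" where
  "clamp_real m a = max (- m) (min m a)"

text \<open>Measurability supplies continuous functions converging almost everywhere, without any
  domination. Clamping \<open>f\<close> and its approximants at the same level provides a dominating
  constant on the bounded set \<open>S\<close>; clamping \<open>f\<close> alone costs
  little.\<close>

lemma continuous_dense_l2:
  fixes f :: "'a::euclidean_space \<Rightarrow> real"
  assumes f: "square_integrable lborel f" and S: "S \<in> sets borel" "bounded S" and \<epsilon>: "0 < \<epsilon>"
  obtains g where "continuous_on UNIV g" "square_integrable lborel (\<lambda>x. indicator S x * (f x - g x))"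
    "l2_norm lborel (\<lambda>x. indicator S x * (f x - g x)) < \<epsilon>"
proof -
  have [measurable]: "f \<in> borel_measurable borel" "S \<in> sets borel" using f S by (auto simp: square_integrable_def)
  have cc: "continuous_on X (clamp_real m)" for m X unfolding clamp_real_def[abs_def] by (intro continuous_intros)
  have [measurable]: "clamp_real m \<in> borel_measurable borel" for m
    by (intro borel_measurable_continuous_onI cc)
  have cb: "\<bar>clamp_real (real n) a\<bar> \<le> real n" for n a by (auto simp: clamp_real_def)
  have "(\<lambda>n. l2_norm lborel (\<lambda>x. indicator S x * (f x - clamp_real (real n) (f x)))) \<longlonglongrightarrow> 0"
  proof (rule l2_norm_tendsto_0_dominated[OF _ f])
    show "AE x in lborel. \<bar>indicator S x * (f x - clamp_real (real n) (f x))\<bar> \<le> \<bar>f x\<bar>" for n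
      by (intro always_eventually allI) (auto simp: indicator_def clamp_real_def)
    have "(\<lambda>n. indicator S x * (f x - clamp_real (real n) (f x))) \<longlonglongrightarrow> 0" for x
    proof (rule tendsto_eventually)
      obtain m where "\<bar>f x\<bar> \<le> real m" using real_arch_simple by blast
      then have "indicator S x * (f x - clamp_real (real n) (f x)) = 0" if "m \<le> n" for n
        using that by (auto simp: clamp_real_def max_def min_def)
      then show "\<forall>\<^sub>F n in sequentially. indicator S x * (f x - clamp_real (real n) (f x)) = 0"
        by (auto simp: eventually_sequentially)
    qed
    then show "AE x in lborel. (\<lambda>n. indicator S x * (f x - clamp_real (real n) (f x))) \<longlonglongrightarrow> 0" by simp
  qed measurable
  then have "\<forall>\<^sub>F n in sequentially. l2_norm lborel (\<lambda>x. indicator S x * (f x - clamp_real (real n) (f x))) < \<epsilon> / 2"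
    using \<epsilon> by (intro order_tendstoD(2)) auto
  then obtain m where m: "l2_norm lborel (\<lambda>x. indicator S x * (f x - clamp_real (real m) (f x))) < \<epsilon> / 2"
    by (auto simp: eventually_sequentially)
  have "f measurable_on UNIV"
    by (rule lebesgue_measurable_imp_measurable_on) (auto intro: measurable_completion)
  then obtain N g where N: "negligible N" and g: "\<And>j. continuous_on UNIV (g j)" "\<And>x. x \<notin> N \<Longrightarrow> (\<lambda>j. g j x) \<longlonglongrightarrow> f x"
    by (auto simp: measurable_on_def)
  have gm [measurable]: "g j \<in> borel_measurable borel" for j by (intro borel_measurable_continuous_onI g)
  have lim2: "(\<lambda>j. l2_norm lborel (\<lambda>x. indicator S x * (clamp_real (real m) (f x) - clamp_real (real m) (g j x)))) \<longlonglongrightarrow> 0"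
  proof (rule l2_norm_tendsto_0_dominated[OF _ square_integrable_indicator[OF S, of "2 * real m"]])
    show "AE x in lborel. \<bar>indicator S x * (clamp_real (real m) (f x) - clamp_real (real m) (g j x))\<bar> \<le> \<bar>indicator S x * (2 * real m)\<bar>" for j
    proof (intro always_eventually allI)
      fix x
      have "\<bar>clamp_real (real m) (f x) - clamp_real (real m) (g j x)\<bar> \<le> 2 * real m"
        using cb[of m "f x"] cb[of m "g j x"] by linarith
      then show "\<bar>indicator S x * (clamp_real (real m) (f x) - clamp_real (real m) (g j x))\<bar> \<le> \<bar>indicator S x * (2 * real m)\<bar>"
        by (simp add: indicator_def)
    qed
    have "AE x in lborel. x \<notin> N"
    proof -
      have "AE x in lebesgue. x \<notin> N" using N by (auto simp: negligible_iff_null_sets intro: AE_not_in)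
      then show ?thesis by (simp add: AE_completion_iff)
    qed
    then show "AE x in lborel. (\<lambda>j. indicator S x * (clamp_real (real m) (f x) - clamp_real (real m) (g j x))) \<longlonglongrightarrow> 0"
    proof eventually_elim
      case (elim x)
      have "isCont (clamp_real (real m)) (f x)" using cc[of UNIV "real m"] by (simp add: continuous_on_eq_continuous_at)
      then have "(\<lambda>j. clamp_real (real m) (g j x)) \<longlonglongrightarrow> clamp_real (real m) (f x)"
        by (rule isCont_tendsto_compose) (rule g(2)[OF elim])
      then have "(\<lambda>j. indicator S x * (clamp_real (real m) (f x) - clamp_real (real m) (g j x))) \<longlonglongrightarrow>
          indicator S x * (clamp_real (real m) (f x) - clamp_real (real m) (f x))"
        by (intro tendsto_intros)
      then show ?case by simp
    qed
  qed measurable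
  then have "\<forall>\<^sub>F j in sequentially. l2_norm lborel (\<lambda>x. indicator S x * (clamp_real (real m) (f x) - clamp_real (real m) (g j x))) < \<epsilon> / 2"
    using \<epsilon> by (intro order_tendstoD(2)) auto
  then obtain j where j: "l2_norm lborel (\<lambda>x. indicator S x * (clamp_real (real m) (f x) - clamp_real (real m) (g j x))) < \<epsilon> / 2"
    by (auto simp: eventually_sequentially)
  have q1: "square_integrable lborel (\<lambda>x. indicator S x * (f x - clamp_real (real m) (f x)))"
    by (rule square_integrable_dominated[OF f, of _ 1]) (measurable, auto simp: indicator_def clamp_real_def)
  have q2: "square_integrable lborel (\<lambda>x. indicator S x * (clamp_real (real m) (f x) - clamp_real (real m) (g j x)))"
  proof (rule square_integrable_dominated[OF square_integrable_indicator[OF S, of "2 * real m"], of _ 1])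
    have "\<bar>clamp_real (real m) (f x) - clamp_real (real m) (g j x)\<bar> \<le> 2 * real m" for x
      using cb[of m "f x"] cb[of m "g j x"] by linarith
    then show "AE x in lborel. norm (indicator S x * (clamp_real (real m) (f x) - clamp_real (real m) (g j x))) \<le> 1 * norm (indicator S x * (2 * real m))"
      by (intro always_eventually allI) (simp add: indicator_def)
  qed measurable
  have eq: "indicator S x * (f x - clamp_real (real m) (g j x)) = indicator S x * (f x - clamp_real (real m) (f x)) +
      indicator S x * (clamp_real (real m) (f x) - clamp_real (real m) (g j x))" for x
    by (simp add: algebra_simps)
  show ?thesis
  proof (rule that[of "\<lambda>x. clamp_real (real m) (g j x)"])
    show "continuous_on UNIV (\<lambda>x. clamp_real (real m) (g j x))"
      by (rule continuous_on_compose2[OF cc[of UNIV] g(1)]) auto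
    show "square_integrable lborel (\<lambda>x. indicator S x * (f x - clamp_real (real m) (g j x)))"
      unfolding eq by (rule square_integrable_add[OF q1 q2])
    show "l2_norm lborel (\<lambda>x. indicator S x * (f x - clamp_real (real m) (g j x))) < \<epsilon>"
      unfolding eq using l2_norm_triangle[OF q1 q2] m j by simp
  qed
qed

text \<open>The radius \<rho> depends on \<open>f\<close> and not on the kernel, because the charts
  will use different kernels at the same scale. The continuous part \<open>g\<close> of
  \<open>f\<close> is handled by uniform continuity, the small remainder \<open>h\<close> by the
  contraction property of convolution.\<close>

lemma conv_approximate_identity:
  fixes f :: "'a::euclidean_space \<Rightarrow> real"
  assumes f: "square_integrable lborel f" "vanishes_outside R f" and Om: "Om \<in> sets borel" "Om \<subseteq> cball 0 R" and \<epsilon>: "0 < \<epsilon>"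
  shows "\<exists>\<rho>>0. \<forall>K. kernel \<rho> K \<longrightarrow> l2_norm (lebesgue_on Om) (\<lambda>x. conv K f x - f x) \<le> \<epsilon>"
proof -
  let ?S = "cball (0::'a) (R + 1)"
  obtain g where g: "continuous_on UNIV g" "square_integrable lborel (\<lambda>x. indicator ?S x * (f x - g x))"
    "l2_norm lborel (\<lambda>x. indicator ?S x * (f x - g x)) < \<epsilon> / 3"
    using continuous_dense_l2[OF f(1), of ?S "\<epsilon> / 3"] \<epsilon> by auto
  have [measurable]: "f \<in> borel_measurable borel" "g \<in> borel_measurable borel" "Om \<in> sets borel"
    using f g Om by (auto simp: square_integrable_def intro: borel_measurable_continuous_onI)
  define m where "m = l2_norm (lebesgue_on Om) (\<lambda>x. 1::real)"
  have m0: "0 \<le> m" by (simp add: m_def)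
  \<comment> \<open>A uniform error \<eta> on \<open>Om\<close> costs \<open>\<eta> * m\<close> in
    the norm, one third of \<epsilon>; the other two thirds go to \<open>h\<close> and its
    convolution.\<close>
  define \<eta> where "\<eta> = \<epsilon> / (3 * (m + 1))"
  have \<eta>: "0 < \<eta>" using \<epsilon> m0 by (simp add: \<eta>_def)
  have "uniformly_continuous_on ?S g" by (intro compact_uniformly_continuous continuous_on_subset[OF g(1)]) auto
  then obtain d where d: "0 < d" "\<And>x y. x \<in> ?S \<Longrightarrow> y \<in> ?S \<Longrightarrow> dist y x < d \<Longrightarrow> dist (g y) (g x) < \<eta>"
    using \<eta> unfolding uniformly_continuous_on_def by metis
  define \<rho> where "\<rho> = min 1 (d / 2)"
  have \<rho>: "0 < \<rho>" "\<rho> \<le> 1" "\<rho> < d" using d by (auto simp: \<rho>_def)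
  have one: "square_integrable (lebesgue_on Om) (\<lambda>x. 1::real)"
  proof -
    have "bounded Om" using Om bounded_subset bounded_cball by blast
    from square_integrable_lebesgue_on(1)[OF square_integrable_indicator[OF Om(1) this, of 1] Om(1)]
    show ?thesis
      by (rule square_integrable_cong_AE) (auto intro!: AE_I2 simp: space_restrict_space)
  qed
  define h where "h x = indicator ?S x * (f x - g x)" for x
  have hv: "vanishes_outside (R + 1) h" by (auto simp: vanishes_outside_def h_def)
  have hs: "square_integrable lborel h" "l2_norm lborel h < \<epsilon> / 3" using g(2,3) by (simp_all add: h_def[abs_def])
  have hi: "integrable lborel h" by (rule integrable_of_bounded_support[OF hs(1)]) (use hv in \<open>simp add: vanishes_outside_def\<close>)
  have fi: "integrable lborel f" by (rule integrable_of_bounded_support[OF f(1)]) (use f in \<open>simp add: vanishes_outside_def\<close>)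
  show ?thesis
  proof (intro exI[of _ \<rho>] conjI allI impI \<rho>(1))
    fix K :: "'a \<Rightarrow> real" assume K: "kernel \<rho> K"
    have k: "continuous_on UNIV K" "vanishes_outside \<rho> K" "\<And>y. 0 \<le> K y" "smooth K"
      using K by (auto simp: kernel_def smooth_continuous_on)
    \<comment> \<open>The error due to \<open>g\<close>, written as a difference: \<open>g\<close>
      need not have bounded support, so it is never convolved itself. For \<open>x\<close> in
      \<open>Om\<close> the kernel reaches only points where \<open>f - h\<close> equals
      \<open>g\<close>.\<close>
    define r where "r x = conv K f x - f x - (conv K h x - h x)" for x
    have rm: "r \<in> borel_measurable borel"
    proof -
      have [measurable]: "conv K f \<in> borel_measurable borel" "conv K h \<in> borel_measurable borel"
        using smooth_borel_measurable[OF smooth_conv[OF k(4,2)]] fi hi by auto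
      have [measurable]: "h \<in> borel_measurable borel" using hs(1) by (simp add: square_integrable_def)
      show ?thesis unfolding r_def[abs_def] by measurable
    qed
    have r: "\<bar>r x\<bar> \<le> \<eta>" if x: "x \<in> Om" for x
    proof -
      have nx: "norm x \<le> R" using x Om by auto
      then have hx: "h x = f x - g x" by (simp add: h_def indicator_def)
      have i0: "integrable lborel (\<lambda>z. K (x - z))" "(LINT z|lborel. K (x - z)) = 1"
        using kernel_reflect_integral[OF K] by auto
      have eq: "K (x - z) * f z - K (x - z) * h z - g x * K (x - z) = K (x - z) * (g z - g x)" for z
      proof (cases "norm z \<le> R + 1")
        case True then show ?thesis by (simp add: h_def indicator_def algebra_simps)
      next
        case False
        then have "norm (x - z) > \<rho>" using norm_triangle_ineq2[of z x] nx \<rho> by (simp add: norm_minus_commute)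
        then show ?thesis using vanishes_outsideD[OF k(2)] by simp
      qed
      have ig: "integrable lborel (\<lambda>z. K (x - z) * (g z - g x))"
        unfolding eq[symmetric] using conv_integrable[OF k(1,2) fi, of x] conv_integrable[OF k(1,2) hi, of x] i0(1) by auto
      have "r x = conv K f x - conv K h x - g x * (LINT z|lborel. K (x - z))" by (simp add: r_def hx i0)
      also have "\<dots> = (LINT z|lborel. K (x - z) * (g z - g x))"
        unfolding conv_def eq[symmetric]
        using conv_integrable[OF k(1,2) fi, of x] conv_integrable[OF k(1,2) hi, of x] i0(1) by simp
      also have "norm \<dots> \<le> (LINT z|lborel. \<eta> * K (x - z))"
      proof (rule order_trans[OF integral_norm_bound], rule integral_mono)
        show "integrable lborel (\<lambda>z. norm (K (x - z) * (g z - g x)))" using ig by (rule integrable_norm)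
        show "integrable lborel (\<lambda>z. \<eta> * K (x - z))" using i0(1) by simp
        fix z show "norm (K (x - z) * (g z - g x)) \<le> \<eta> * K (x - z)"
        proof (cases "norm (x - z) > \<rho>")
          case True then show ?thesis using vanishes_outsideD[OF k(2)] by simp
        next
          case False
          then have "norm z \<le> R + 1" using norm_triangle_ineq2[of z x] nx \<rho> by (simp add: norm_minus_commute)
          moreover have "dist z x < d" using False \<rho> by (simp add: dist_norm norm_minus_commute)
          ultimately have "\<bar>g z - g x\<bar> \<le> \<eta>" using d(2)[of x z] nx by (simp add: dist_real_def)
          then show ?thesis using mult_left_mono[of "\<bar>g z - g x\<bar>" \<eta> "K (x - z)"] k(3)[of "x - z"] by (simp add: abs_mult mult.commute)
        qed
      qed
      also have "\<dots> = \<eta>" using i0 by simp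
      finally show ?thesis by simp
    qed
    have rs: "square_integrable (lebesgue_on Om) r"
      by (rule square_integrable_dominated[OF one borel_measurable_lebesgue_on[OF rm], of \<eta>])
        (use r Om in \<open>auto intro!: AE_I2 simp: space_restrict_space\<close>)
    have rn: "l2_norm (lebesgue_on Om) r \<le> \<eta> * m"
      unfolding m_def by (rule l2_norm_dominated[OF one borel_measurable_lebesgue_on[OF rm]])
        (use r Om \<eta> in \<open>auto intro!: AE_I2 simp: space_restrict_space\<close>)
    note cs = square_integrable_conv[OF K hi hs(1)]
    note cs' = square_integrable_lebesgue_on[OF cs(1) Om(1)] and hs' = square_integrable_lebesgue_on[OF hs(1) Om(1)]
    have "l2_norm (lebesgue_on Om) (\<lambda>x. conv K f x - f x) = l2_norm (lebesgue_on Om) (\<lambda>x. r x + (conv K h x - h x))"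
      by (rule l2_norm_cong) (simp add: r_def)
    also have "\<dots> \<le> l2_norm (lebesgue_on Om) r + l2_norm (lebesgue_on Om) (\<lambda>x. conv K h x - h x)"
      by (rule l2_norm_triangle[OF rs square_integrable_diff[OF cs'(1) hs'(1)]])
    also have "\<dots> \<le> \<eta> * m + (l2_norm lborel h + l2_norm lborel h)"
      using rn l2_norm_triangle_diff[OF cs'(1) hs'(1)] cs(2) cs'(2) hs'(2) by linarith
    also have "\<dots> \<le> \<epsilon> / 3 + (\<epsilon> / 3 + \<epsilon> / 3)"
    proof -
      have "m + 1 \<noteq> 0" using m0 by simp
      then have "\<eta> * (m + 1) = \<epsilon> / 3" unfolding \<eta>_def by (simp add: divide_simps del: distrib_left_numeral)
      then have "\<eta> * m \<le> \<epsilon> / 3" using \<eta> by (simp add: algebra_simps)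
      then show ?thesis using hs(2) by simp
    qed
    finally show "l2_norm (lebesgue_on Om) (\<lambda>x. conv K f x - f x) \<le> \<epsilon>" by simp
  qed
qed

text \<open>The indicator of the ball of radius \<open>3 / 2 * r\<close> is mollified at scale
  \<open>r / 2\<close>.\<close>

lemma smooth_cutoff:
  fixes x :: "'a::euclidean_space"
  assumes r: "0 < r"
  obtains \<theta> :: "'a \<Rightarrow> real" where "smooth \<theta>" "\<And>y. 0 \<le> \<theta> y" "\<And>y. \<theta> y \<le> 1"
    "\<And>y. dist x y \<le> r \<Longrightarrow> \<theta> y = 1" "\<And>y. \<theta> y \<noteq> 0 \<Longrightarrow> dist x y \<le> 2 * r"
proof -
  define \<rho> where "\<rho> = r / 2"
  have \<rho>: "0 < \<rho>" using r by (simp add: \<rho>_def)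
  define K :: "'a \<Rightarrow> real" where "K = mollifier 0 \<rho>"
  have K: "kernel \<rho> K" unfolding K_def by (rule kernel_mollifier) (use \<rho> in auto)
  then have k: "smooth K" "vanishes_outside \<rho> K" "\<And>y. 0 \<le> K y" by (auto simp: kernel_def)
  let ?B = "cball x (r + \<rho>)"
  let ?f = "indicator ?B :: 'a \<Rightarrow> real"
  have fi: "integrable lborel ?f"
    using emeasure_bounded_finite[of ?B] by (intro integrable_real_indicator) auto
  note i0 = kernel_reflect_integral[OF K]
  have ci: "integrable lborel (\<lambda>z. K (y - z) * ?f z)" for y
    by (rule conv_integrable[OF smooth_continuous_on[OF k(1)] k(2) fi])
  show ?thesis
  proof (rule that[of "conv K ?f"])
    show "smooth (conv K ?f)" by (rule smooth_conv[OF k(1,2) fi])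
    show "0 \<le> conv K ?f y" for y unfolding conv_def by (rule Bochner_Integration.integral_nonneg) (simp add: k)
    show "conv K ?f y \<le> 1" for y
      unfolding i0(1)[of y, symmetric] conv_def
      by (rule integral_mono[OF ci i0(2)]) (simp add: k indicator_def)
    show "conv K ?f y = 1" if y: "dist x y \<le> r" for y
    proof -
      have "K (y - z) * ?f z = K (y - z)" for z
      proof (cases "norm (y - z) > \<rho>")
        case True then show ?thesis using vanishes_outsideD[OF k(2)] by simp
      next
        case False
        then have "dist x z \<le> r + \<rho>" using y dist_triangle[of x z y] by (simp add: dist_norm)
        then show ?thesis by simp
      qed
      then show ?thesis unfolding conv_def by (simp only: i0(1))
    qed
    show "dist x y \<le> 2 * r" if ne: "conv K ?f y \<noteq> 0" for y
    proof (rule ccontr)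
      assume far: "\<not> dist x y \<le> 2 * r"
      have "K (y - z) * ?f z = 0" for z
      proof (cases "norm (y - z) > \<rho>")
        case True then show ?thesis using vanishes_outsideD[OF k(2)] by simp
      next
        case False
        then have "\<not> dist x z \<le> r + \<rho>" using far dist_triangle[of x y z] by (simp add: dist_norm norm_minus_commute \<rho>_def)
        then show ?thesis by simp
      qed
      then have "conv K ?f y = 0" unfolding conv_def by (simp only: Bochner_Integration.integral_zero)
      then show False using ne by simp
    qed
  qed
qed

section \<open>Trace inequality on Lipschitz domains\<close>

text \<open>
  The uniform cone property is all that is used of the Lipschitz condition; in this form it also holds
  near interior points, so that boundary and interior are covered by the same kind of chart.
\<close>
definition cone_chart :: "'a::euclidean_space set \<Rightarrow> 'a \<Rightarrow> 'a \<Rightarrow> real \<Rightarrow> real \<Rightarrow> bool" where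
  "cone_chart Om x e \<kappa> r \<longleftrightarrow> norm e = 1 \<and> 0 < \<kappa> \<and> \<kappa> \<le> 1 / 2 \<and> 0 < r \<and>
     (\<forall>y t. y \<in> closure Om \<longrightarrow> y \<in> ball x r \<longrightarrow> 0 < t \<longrightarrow> t < r \<longrightarrow> cball (y + t *\<^sub>R e) (\<kappa> * t) \<subseteq> Om) \<and>
     (\<forall>y t. y \<notin> Om \<longrightarrow> y \<in> ball x r \<longrightarrow> 0 < t \<longrightarrow> t < r \<longrightarrow> cball (y - t *\<^sub>R e) (\<kappa> * t) \<inter> Om = {})"

lemma cone_chart_inner:
  "cone_chart Om x e \<kappa> r \<Longrightarrow> y \<in> closure Om \<Longrightarrow> y \<in> ball x r \<Longrightarrow> 0 < t \<Longrightarrow> t < r \<Longrightarrow> cball (y + t *\<^sub>R e) (\<kappa> * t) \<subseteq> Om"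
  unfolding cone_chart_def by blast

lemma cone_chart_outer:
  "cone_chart Om x e \<kappa> r \<Longrightarrow> y \<notin> Om \<Longrightarrow> y \<in> ball x r \<Longrightarrow> 0 < t \<Longrightarrow> t < r \<Longrightarrow> cball (y - t *\<^sub>R e) (\<kappa> * t) \<inter> Om = {}"
  unfolding cone_chart_def by blast

text \<open>At an interior point any direction works: the inner condition holds in a small ball and
  the outer one is void. At a boundary point, moving by \<open>t\<close> along \<open>e\<close>
  gains height \<open>t\<close> over the graph, and a perturbation of size
  \<open>\<kappa> * t\<close> loses at most half of it.\<close>

lemma lipschitz_domain_cone_chart:
  assumes Om: "lipschitz_domain Om" and x: "x \<in> closure Om"
  obtains e \<kappa> r where "cone_chart Om x e \<kappa> r"
proof (cases "x \<in> Om")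
  case True
  have "open Om" using Om by (simp add: lipschitz_domain_def)
  then obtain R where R: "0 < R" "ball x R \<subseteq> Om" using True open_contains_ball by blast
  obtain e :: 'a where e: "e \<in> Basis" using nonempty_Basis by blast
  \<comment> \<open>The three thirds of \<open>R\<close> pay for the distance from \<open>x\<close>
    to \<open>y\<close>, for the translation by \<open>t\<close>, and for the radius of the small
    ball.\<close>
  have "cone_chart Om x e (1/2) (R/3)"
    unfolding cone_chart_def
  proof (intro conjI allI impI)
    fix y t assume y: "y \<in> ball x (R/3)" and t: "0 < t" "t < R/3"
    show "cball (y + t *\<^sub>R e) (1 / 2 * t) \<subseteq> Om"
    proof
      fix z assume z: "z \<in> cball (y + t *\<^sub>R e) (1 / 2 * t)"
      have "dist x z \<le> dist x y + dist y (y + t *\<^sub>R e) + dist (y + t *\<^sub>R e) z"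
        using dist_triangle[of x z "y + t *\<^sub>R e"] dist_triangle[of x "y + t *\<^sub>R e" y] by linarith
      then have "dist x z < R" using y t z e by (simp add: dist_norm[of y])
      then show "z \<in> Om" using R by auto
    qed
  next
    fix y t assume "y \<notin> Om" "y \<in> ball x (R/3)"
    then have "y \<in> ball x R" "y \<notin> Om" using R(1) by auto
    then have False using R(2) by blast
    then show "cball (y - t *\<^sub>R e) (1 / 2 * t) \<inter> Om = {}" ..
  qed (use e R in auto)
  then show ?thesis by (rule that)
next
  case False
  then have "x \<in> frontier Om" using x Om by (simp add: frontier_def lipschitz_domain_def interior_open)
  then obtain e R L and \<gamma> :: "'a \<Rightarrow> real" where e: "norm e = 1" and R: "0 < R"
    and \<gamma>: "L-lipschitz_on {y. y \<bullet> e = 0} \<gamma>"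
    and gr: "\<And>y. y \<in> ball x R \<Longrightarrow> y \<in> Om \<longleftrightarrow> \<gamma> (y - (y \<bullet> e) *\<^sub>R e) < y \<bullet> e"
    using Om unfolding lipschitz_domain_def by blast
  have L: "0 \<le> L" using \<gamma> by (rule lipschitz_on_nonneg)
  have ee: "e \<bullet> e = 1" using e by (simp add: norm_eq_1)
  define P where "P y = y - (y \<bullet> e) *\<^sub>R e" for y
  have P0: "P y \<in> {y. y \<bullet> e = 0}" for y by (simp add: P_def inner_diff_left ee)
  have Padd: "P (y + v) = P y + P v" for y v by (simp add: P_def inner_add_left algebra_simps)
  have Pe: "P (t *\<^sub>R e) = 0" for t by (simp add: P_def ee)
  have Pn: "norm (P v) \<le> norm v" for v
  proof -
    have "(norm (P v))\<^sup>2 = (norm v)\<^sup>2 - (v \<bullet> e)\<^sup>2"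
      unfolding P_def power2_norm_eq_inner
      by (simp add: inner_diff_left inner_diff_right ee inner_commute power2_eq_square algebra_simps)
    then have "(norm (P v))\<^sup>2 \<le> (norm v)\<^sup>2" by simp
    then show ?thesis by (rule power2_le_imp_le) simp
  qed
  have lip: "\<bar>\<gamma> (P y) - \<gamma> (P z)\<bar> \<le> L * norm (P y - P z)" for y z
    using lipschitz_onD[OF \<gamma> P0 P0, of y z] by (simp add: dist_norm)
  have step: "\<bar>\<gamma> (P (y + t *\<^sub>R e + v)) - \<gamma> (P y)\<bar> \<le> L * norm v" for y t v
  proof -
    have "P (y + t *\<^sub>R e + v) - P y = P v" by (simp add: Padd Pe)
    then show ?thesis using lip[of "y + t *\<^sub>R e + v" y] mult_left_mono[OF Pn[of v] L] by simp
  qed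
  have ve: "\<bar>v \<bullet> e\<bar> \<le> norm v" for v using Cauchy_Schwarz_ineq2[of v e] e by simp
  \<comment> \<open>A displacement \<open>v\<close> changes the height by at most
    \<open>norm v\<close> and the graph by at most \<open>L * norm v\<close>; this \<kappa> bounds
    the total change by \<open>t / 2\<close>.\<close>
  define \<kappa> where "\<kappa> = 1 / (2 * (1 + L))"
  have \<kappa>: "0 < \<kappa>" "\<kappa> \<le> 1/2" using L by (auto simp: \<kappa>_def divide_simps)
  have \<kappa>L: "\<kappa> * (1 + L) = 1/2" using L by (simp add: \<kappa>_def divide_simps)
  have "cone_chart Om x e \<kappa> (R/3)"
    unfolding cone_chart_def
  proof (intro conjI allI impI)
    fix y t assume yc: "y \<in> closure Om" and y: "y \<in> ball x (R/3)" and t: "0 < t" "t < R/3"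
    \<comment> \<open>The strict inequality inside \<open>Om\<close> survives as a weak one on the
      closure, by continuity of the graph function.\<close>
    have yg: "\<gamma> (P y) \<le> y \<bullet> e"
    proof -
      have "y \<in> closure (Om \<inter> ball x R)"
        using yc y R closure_subset[of "ball x R"] open_Int_closure_subset[OF open_ball, of x R Om] by (force simp: Int_commute)
      then obtain Y where Y: "\<And>n. Y n \<in> Om \<inter> ball x R" "Y \<longlonglongrightarrow> y" by (auto simp: closure_sequential)
      have lt: "\<gamma> (P (Y n)) \<le> Y n \<bullet> e" for n using gr[of "Y n"] Y(1)[of n] by (auto simp: P_def less_imp_le)
      have "(\<lambda>n. Y n \<bullet> e + L * norm (Y n - y)) \<longlonglongrightarrow> y \<bullet> e + L * norm (y - y)"
        by (intro tendsto_intros Y(2))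
      moreover have "\<gamma> (P y) \<le> Y n \<bullet> e + L * norm (Y n - y)" for n
      proof -
        have "\<bar>\<gamma> (P (y + 0 *\<^sub>R e + (Y n - y))) - \<gamma> (P y)\<bar> \<le> L * norm (Y n - y)" by (rule step)
        then show ?thesis using lt[of n] by simp
      qed
      ultimately show ?thesis by (intro LIMSEQ_le_const[where X = "\<lambda>n. Y n \<bullet> e + L * norm (Y n - y)"]) auto
    qed
    show "cball (y + t *\<^sub>R e) (\<kappa> * t) \<subseteq> Om"
    proof
      fix z assume z: "z \<in> cball (y + t *\<^sub>R e) (\<kappa> * t)"
      define v where "v = z - (y + t *\<^sub>R e)"
      have zv: "z = y + t *\<^sub>R e + v" by (simp add: v_def)
      have v: "norm v \<le> \<kappa> * t" using z by (simp add: v_def dist_norm norm_minus_commute)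
      have "\<kappa> * t \<le> 1/2 * t" using \<kappa> t by (intro mult_right_mono) auto
      then have "norm v < R/3" using v t by linarith
      moreover have "dist x z \<le> dist x y + norm (t *\<^sub>R e + v)"
      proof -
        have "dist y z = norm (z - y)" by (simp add: dist_norm norm_minus_commute)
        also have "z - y = t *\<^sub>R e + v" by (simp add: zv)
        finally show ?thesis using dist_triangle[of x z y] by simp
      qed
      moreover have "norm (t *\<^sub>R e + v) \<le> t + norm v" using norm_triangle_ineq[of "t *\<^sub>R e" v] e t by simp
      ultimately have zR: "z \<in> ball x R" using y t by simp
      have "\<gamma> (P z) \<le> \<gamma> (P y) + L * norm v" using step[of y t v] by (simp add: zv)
      moreover have "z \<bullet> e = y \<bullet> e + t + v \<bullet> e" by (simp add: zv inner_add_left ee)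
      moreover have "norm v * (1 + L) \<le> \<kappa> * t * (1 + L)" using v L by (intro mult_right_mono) auto
      moreover have "\<kappa> * t * (1 + L) < t"
      proof -
        have "\<kappa> * t * (1 + L) = (\<kappa> * (1 + L)) * t" by (simp only: ac_simps)
        also have "\<dots> = (1/2) * t" by (simp only: \<kappa>L)
        also have "\<dots> < t" using t by simp
        finally show ?thesis .
      qed
      ultimately have "\<gamma> (P z) < z \<bullet> e" using ve[of v] yg by (simp add: algebra_simps abs_le_iff)
      then show "z \<in> Om" using gr[OF zR] by (simp add: P_def)
    qed
  next
    fix y t assume yc: "y \<notin> Om" and y: "y \<in> ball x (R/3)" and t: "0 < t" "t < R/3"
    have "y \<in> ball x R" using y R by auto
    then have yg: "y \<bullet> e \<le> \<gamma> (P y)" using gr yc by (auto simp: P_def)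
    show "cball (y - t *\<^sub>R e) (\<kappa> * t) \<inter> Om = {}"
    proof (rule ccontr)
      assume "\<not> ?thesis"
      then obtain z where z: "z \<in> cball (y - t *\<^sub>R e) (\<kappa> * t)" and zO: "z \<in> Om" by blast
      define v where "v = z - (y + (-t) *\<^sub>R e)"
      have zv: "z = y + (-t) *\<^sub>R e + v" by (simp add: v_def)
      have v: "norm v \<le> \<kappa> * t" using z by (simp add: v_def dist_norm norm_minus_commute)
      have "\<kappa> * t \<le> 1/2 * t" using \<kappa> t by (intro mult_right_mono) auto
      then have "norm v < R/3" using v t by linarith
      moreover have "dist x z \<le> dist x y + norm ((-t) *\<^sub>R e + v)"
      proof -
        have "dist y z = norm (z - y)" by (simp add: dist_norm norm_minus_commute)
        also have "z - y = (-t) *\<^sub>R e + v" by (simp add: zv)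
        finally show ?thesis using dist_triangle[of x z y] by simp
      qed
      moreover have "norm ((-t) *\<^sub>R e + v) \<le> t + norm v" using norm_triangle_ineq[of "(-t) *\<^sub>R e" v] e t by simp
      ultimately have zR: "z \<in> ball x R" using y t by simp
      have "\<gamma> (P y) \<le> \<gamma> (P z) + L * norm v" using step[of y "-t" v] unfolding zv by linarith
      moreover have "z \<bullet> e = y \<bullet> e - t + v \<bullet> e" by (simp add: zv inner_add_left inner_diff_left ee)
      moreover have "norm v * (1 + L) \<le> \<kappa> * t * (1 + L)" using v L by (intro mult_right_mono) auto
      moreover have "\<kappa> * t * (1 + L) < t"
      proof -
        have "\<kappa> * t * (1 + L) = (\<kappa> * (1 + L)) * t" by (simp only: ac_simps)
        also have "\<dots> = (1/2) * t" by (simp only: \<kappa>L)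
        also have "\<dots> < t" using t by simp
        finally show ?thesis .
      qed
      ultimately have "z \<bullet> e < \<gamma> (P z)" using ve[of v] yg by (simp add: algebra_simps abs_le_iff)
      then show False using gr[OF zR] zO by (simp add: P_def)
    qed
  qed (use e R \<kappa> in auto)
  then show ?thesis by (rule that)
qed

section \<open>Coverings of the boundary and thin interior layers\<close>

lemma hausdorff_pre_finite_cover:
  fixes A :: "'a::metric_space set"
  assumes X: "finite X" and A: "A \<subseteq> (\<Union>p\<in>X. D p)" and D: "\<And>p. p \<in> X \<Longrightarrow> bounded (D p)" "\<And>p. p \<in> X \<Longrightarrow> diameter (D p) \<le> \<delta>"
    and \<delta>: "0 \<le> \<delta>"
  shows "hausdorff_pre s \<delta> A \<le> (\<Sum>p\<in>X. ennreal (unit_ball_vol s * (diameter (D p) / 2) powr s))"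
proof -
  let ?w = "\<lambda>X. ennreal (unit_ball_vol s * (diameter X / 2) powr s)"
  obtain h where h: "bij_betw h {0..<card X} X" using ex_bij_betw_nat_finite[OF X] by blast
  define C where "C i = (if i < card X then D (h i) else {})" for i
  have hX: "h i \<in> X" if "i < card X" for i using h that by (auto simp: bij_betw_def)
  have "hausdorff_pre s \<delta> A \<le> (\<Sum>i. ?w (C i))"
  proof (rule hausdorff_pre_le)
    show "A \<subseteq> (\<Union>i. C i)"
    proof
      fix y assume "y \<in> A"
      then obtain p where p: "p \<in> X" "y \<in> D p" using A by blast
      then have "p \<in> h ` {0..<card X}" using h by (simp add: bij_betw_def)
      then obtain i where "i < card X" "h i = p" by auto
      then have "y \<in> C i" using p by (simp add: C_def)
      then show "y \<in> (\<Union>i. C i)" by (rule UN_I[OF UNIV_I])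
    qed
  qed (use hX D \<delta> in \<open>auto simp: C_def\<close>)
  also have "\<dots> = (\<Sum>i\<in>{0..<card X}. ?w (C i))"
    by (rule suminf_finite) (auto simp: C_def)
  also have "\<dots> = (\<Sum>i\<in>{0..<card X}. ?w (D (h i)))" by (intro sum.cong) (auto simp: C_def)
  also have "\<dots> = (\<Sum>p\<in>X. ?w (D p))" by (rule sum.reindex_bij_betw[OF h])
  finally show ?thesis .
qed

text \<open>Total boundedness limits the size of a separated set: each of its points needs its own
  ball of radius \<open>t / 2\<close>. One of largest cardinality must cover, since an uncovered
  point could be added.\<close>

lemma maximal_separated_set:
  fixes A :: "'a::metric_space set"
  assumes A: "compact A" and t: "0 < t"
  shows "\<exists>X. (finite X \<and> X \<subseteq> A \<and> (\<forall>p\<in>X. \<forall>q\<in>X. p \<noteq> q \<longrightarrow> t \<le> dist p q)) \<and> A \<subseteq> (\<Union>p\<in>X. ball p t)"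
proof -
  let ?sep = "\<lambda>X. finite X \<and> X \<subseteq> A \<and> (\<forall>p\<in>X. \<forall>q\<in>X. p \<noteq> q \<longrightarrow> t \<le> dist p q)"
  obtain Y where Y: "finite Y" "A \<subseteq> (\<Union>y\<in>Y. ball y (t/2))"
    using A t unfolding compact_eq_totally_bounded by (meson half_gt_zero)
  have card: "card X \<le> card Y" if X: "?sep X" for X
  proof -
    have "\<exists>y. y \<in> Y \<and> p \<in> ball y (t/2)" if "p \<in> X" for p
    proof -
      have "p \<in> (\<Union>y\<in>Y. ball y (t/2))" using that X Y(2) by (meson subsetD)
      then show ?thesis by (auto simp: Bex_def)
    qed
    then obtain c where c: "\<And>p. p \<in> X \<Longrightarrow> c p \<in> Y \<and> p \<in> ball (c p) (t/2)" by metis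
    have "inj_on c X"
    proof (rule inj_onI)
      fix p q assume pq: "p \<in> X" "q \<in> X" "c p = c q"
      have "dist p q \<le> dist (c p) p + dist (c p) q" by (metis dist_commute dist_triangle)
      also have "\<dots> < t" using c[OF pq(1)] c[OF pq(2)] pq(3) by simp
      finally show "p = q" using X pq by force
    qed
    then show ?thesis by (rule card_inj_on_le) (use c Y in auto)
  qed
  have "?sep {}" by simp
  then have "\<exists>X. ?sep X \<and> (\<forall>X'. ?sep X' \<longrightarrow> card X' \<le> card X)"
    by (rule ex_has_greatest_nat[where b = "Suc (card Y)"]) (intro allI impI le_imp_less_Suc card)
  then obtain X where Xmax: "?sep X \<and> (\<forall>X'. ?sep X' \<longrightarrow> card X' \<le> card X)" by (rule exE)
  then have X: "?sep X" by (rule conjunct1)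
  have max: "card X' \<le> card X" if "?sep X'" for X'
    using spec[OF conjunct2[OF Xmax], of X'] that by (rule mp)
  have cov: "A \<subseteq> (\<Union>p\<in>X. ball p t)"
  proof (rule ccontr)
    assume "\<not> ?thesis"
    then have "\<exists>a. a \<in> A \<and> a \<notin> (\<Union>p\<in>X. ball p t)" unfolding subset_iff by simp
    then obtain a where a1: "a \<in> A" and a2: "a \<notin> (\<Union>p\<in>X. ball p t)" by (elim exE conjE)
    have a: "a \<in> A" "\<And>p. p \<in> X \<Longrightarrow> t \<le> dist p a" using a1 a2 by (simp_all add: not_less)
    then have "a \<notin> X" using t by force
    moreover have "?sep (insert a X)" using X a by (auto simp: dist_commute)
    ultimately show False using max[of "insert a X"] X by simp
  qed
  with X show ?thesis by (intro exI[of _ X] conjI[of "?sep X"])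
qed

text \<open>Up to a factor \<open>t\<close>, the quotient of what a ball of radius \<open>t\<close>
  costs in the Hausdorff sum and the volume of the ball of radius \<open>\<kappa> * (t / 2)\<close>
  placed in the layer.\<close>

definition chart_const :: "'a::euclidean_space itself \<Rightarrow> real \<Rightarrow> real" where
  "chart_const _ \<kappa> = unit_ball_vol (real (DIM('a) - 1)) / (unit_ball_vol (real DIM('a)) * (\<kappa> / 2) ^ DIM('a))"

lemma chart_const_pos: "0 < \<kappa> \<Longrightarrow> 0 < chart_const TYPE('a::euclidean_space) \<kappa>"
  by (simp add: chart_const_def)

text \<open>
  Around a maximal \<open>t\<close>-separated subset of \<open>A\<close>, pushed inwards by \<open>t / 2\<close>, one finds disjoint balls of
  radius comparable to \<open>t\<close> inside the layer that the translation by \<open>t *\<^sub>R e\<close> vacates.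
\<close>
lemma hausdorff_pre_le_layer:
  fixes Om :: "'a::euclidean_space set"
  assumes d: "DIM('a) \<ge> 2" and ch: "cone_chart Om x e \<kappa> r" and oOm: "open Om"
    and A: "compact A" "A \<subseteq> frontier Om" "A \<subseteq> ball x r" and t: "0 < t" "t < r"
  obtains U where "U \<in> sets borel" "U \<subseteq> Om" "\<And>y. y \<in> U \<Longrightarrow> y - t *\<^sub>R e \<notin> Om" "\<And>y. y \<in> U \<Longrightarrow> \<exists>p\<in>A. dist p y \<le> t"
    "hausdorff_pre (real (DIM('a) - 1)) (2 * t) A \<le> ennreal (chart_const TYPE('a) \<kappa> / t) * emeasure lborel U"
proof -
  let ?s = "real (DIM('a) - 1)"
  have e: "norm e = 1" and \<kappa>: "0 < \<kappa>" "\<kappa> \<le> 1/2" using ch by (auto simp: cone_chart_def)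
  from maximal_separated_set[OF A(1) t(1)]
  obtain X where "(finite X \<and> X \<subseteq> A \<and> (\<forall>p\<in>X. \<forall>q\<in>X. p \<noteq> q \<longrightarrow> t \<le> dist p q)) \<and> A \<subseteq> (\<Union>p\<in>X. ball p t)"
    by (rule exE)
  then have X: "finite X" "X \<subseteq> A" "\<And>p q. p \<in> X \<Longrightarrow> q \<in> X \<Longrightarrow> p \<noteq> q \<Longrightarrow> t \<le> dist p q" "A \<subseteq> (\<Union>p\<in>X. ball p t)"
    by simp_all
  \<comment> \<open>Half the step goes inwards: translating back by \<open>t\<close> then lands the
    same distance outside, so both halves of the cone condition apply with
    \<open>t / 2\<close>.\<close>
  define B where "B p = cball (p + (t/2) *\<^sub>R e) (\<kappa> * (t/2))" for p
  define U where "U = (\<Union>p\<in>X. B p)"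
  have small: "\<kappa> * (t/2) \<le> t/4" using \<kappa> t by (simp add: mult_left_le)
  have pX: "p \<in> closure Om" "p \<notin> Om" "p \<in> ball x r" if "p \<in> X" for p
    using that X(2) A oOm by (auto simp: frontier_def interior_open)
  have BOm: "B p \<subseteq> Om" if "p \<in> X" for p
    unfolding B_def by (rule cone_chart_inner[OF ch pX(1,3)[OF that]]) (use t in auto)
  have out: "y - t *\<^sub>R e \<notin> Om" if "p \<in> X" "y \<in> B p" for p y
  proof -
    have "y - t *\<^sub>R e \<in> cball (p - (t/2) *\<^sub>R e) (\<kappa> * (t/2))"
    proof -
      have eq: "p - (t/2) *\<^sub>R e - (y - t *\<^sub>R e) = p + (t/2) *\<^sub>R e - y"
        using scaleR_left_distrib[of "t/2" "t/2" e] by (simp add: algebra_simps)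
      have "norm (p + (t/2) *\<^sub>R e - y) \<le> \<kappa> * (t/2)" using that(2) by (simp add: B_def dist_norm)
      then show ?thesis by (simp only: mem_cball dist_norm eq)
    qed
    moreover have "cball (p - (t/2) *\<^sub>R e) (\<kappa> * (t/2)) \<inter> Om = {}"
      by (rule cone_chart_outer[OF ch pX(2,3)[OF that(1)]]) (use t in auto)
    ultimately show ?thesis by blast
  qed
  have near: "dist p y \<le> t" if "y \<in> B p" for p y
  proof -
    have "dist p y \<le> dist p (p + (t/2) *\<^sub>R e) + dist (p + (t/2) *\<^sub>R e) y" by (rule dist_triangle)
    also have "\<dots> \<le> t/2 + t/4" using that small t e order_trans[of "dist (p + (t/2) *\<^sub>R e) y" "\<kappa> * (t/2)" "t/4"]
      by (intro add_mono) (auto simp: B_def dist_norm[of p])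
    finally show ?thesis using t by simp
  qed
  have disj: "disjoint_family_on B X"
  proof (unfold disjoint_family_on_def, intro ballI impI, rule ccontr)
    fix p q assume pq: "p \<in> X" "q \<in> X" "p \<noteq> q" and "B p \<inter> B q \<noteq> {}"
    then obtain y where "y \<in> B p" "y \<in> B q" by blast
    then have "dist (p + (t/2) *\<^sub>R e) (q + (t/2) *\<^sub>R e) \<le> t/4 + t/4"
      using dist_triangle2[of "p + (t/2) *\<^sub>R e" "q + (t/2) *\<^sub>R e" y] small by (simp add: B_def)
    then show False using X(3)[OF pq] t by simp
  qed
  have eU: "emeasure lborel U = ennreal (real (card X) * (unit_ball_vol (real DIM('a)) * (\<kappa> * (t/2)) ^ DIM('a)))"
  proof -
    have "emeasure lborel U = (\<Sum>p\<in>X. emeasure lborel (B p))"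
      unfolding U_def by (rule sum_emeasure[symmetric, OF _ disj X(1)]) (auto simp: B_def)
    also have "\<dots> = (\<Sum>p\<in>X. ennreal (unit_ball_vol (real DIM('a)) * (\<kappa> * (t/2)) ^ DIM('a)))"
      using \<kappa> t by (simp add: B_def emeasure_cball)
    also have "\<dots> = ennreal (\<Sum>p\<in>X. unit_ball_vol (real DIM('a)) * (\<kappa> * (t/2)) ^ DIM('a))"
      using \<kappa> t by (intro sum_ennreal) auto
    finally show ?thesis by simp
  qed
  \<comment> \<open>These balls have diameter \<open>2 * t\<close>, hence the scale
    \<open>2 * t\<close> of the premeasure.\<close>
  have "A \<subseteq> (\<Union>p\<in>X. cball p t)"
    using X(4) by (rule order_trans) (intro UN_mono ball_subset_cball subset_refl)
  then have "hausdorff_pre ?s (2 * t) A \<le> (\<Sum>p\<in>X. ennreal (unit_ball_vol ?s * (diameter (cball p t) / 2) powr ?s))"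
    by (rule hausdorff_pre_finite_cover[OF X(1)]) (use t in \<open>auto simp: diameter_cball\<close>)
  also have "\<dots> = (\<Sum>p\<in>X. ennreal (unit_ball_vol ?s * t ^ (DIM('a) - 1)))"
  proof -
    have "t powr ?s = t ^ (DIM('a) - 1)" by (rule powr_realpow[OF t(1)])
    moreover have "diameter (cball p t) / 2 = t" for p :: 'a using t by (simp add: diameter_cball)
    ultimately show ?thesis by (simp only:)
  qed
  also have "\<dots> = ennreal (\<Sum>p\<in>X. unit_ball_vol ?s * t ^ (DIM('a) - 1))"
    using t by (intro sum_ennreal) auto
  also have "(\<Sum>p\<in>X. unit_ball_vol ?s * t ^ (DIM('a) - 1)) =
      (chart_const TYPE('a) \<kappa> / t) * (real (card X) * (unit_ball_vol (real DIM('a)) * (\<kappa> * (t/2)) ^ DIM('a)))"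
  proof -
    obtain k where k: "DIM('a) = Suc k" using d by (metis Suc_diff_1 DIM_positive)
    have V: "unit_ball_vol (real (Suc k)) \<noteq> 0" using unit_ball_vol_pos[of "real (Suc k)"] by linarith
    have "(\<kappa> * (t/2)) ^ Suc k = (\<kappa>/2) ^ Suc k * (t * t ^ k)" by (simp add: power_mult_distrib power_divide)
    then show ?thesis using t \<kappa> V unfolding chart_const_def k by (simp del: of_nat_Suc power_Suc)
  qed
  also have "ennreal \<dots> = ennreal (chart_const TYPE('a) \<kappa> / t) * emeasure lborel U"
    unfolding eU using chart_const_pos[OF \<kappa>(1), where 'a='a] t \<kappa> by (intro ennreal_mult) auto
  finally have "hausdorff_pre ?s (2 * t) A \<le> ennreal (chart_const TYPE('a) \<kappa> / t) * emeasure lborel U" .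
  moreover have "U \<in> sets borel" unfolding U_def B_def using X(1) by (intro sets.finite_UN) auto
  ultimately show ?thesis
  proof (intro that[of U])
    show "U \<subseteq> Om" unfolding U_def using BOm by (rule UN_least)
    show "y - t *\<^sub>R e \<notin> Om" if "y \<in> U" for y using that out unfolding U_def by (elim UN_E)
    show "\<exists>p\<in>A. dist p y \<le> t" if "y \<in> U" for y
      using that unfolding U_def by (rule UN_E) (use X(2) near in blast)
  qed
qed


text \<open>
  A converse of the divergence inequality: the layers around the superlevel sets of \<open>\<psi>\<close> all lie in the part
  of \<open>Om\<close> vacated by the translation, where they add up to at most \<open>\<psi>\<close>.
\<close>
lemma surface_integral_le_pd:
  fixes Om :: "'a::euclidean_space set"
  assumes d: "DIM('a) \<ge> 2" and ch: "cone_chart Om x e \<kappa> r" and Om: "open Om" "bounded Om"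
    and \<psi>: "smooth \<psi>" "\<And>y. 0 \<le> \<psi> y" and supp: "\<And>y. \<psi> y \<noteq> 0 \<Longrightarrow> y \<in> ball x r"
  shows "(\<integral>\<^sup>+y. ennreal (\<psi> y) \<partial>surface_measure Om) \<le>
    ennreal (chart_const TYPE('a) \<kappa> * - (LINT y|lborel. indicator Om y * pd e \<psi> y))"
proof -
  let ?G = "frontier Om" and ?N = "surface_measure Om" and ?s = "real (DIM('a) - 1)"
  let ?C = "chart_const TYPE('a) \<kappa>" and ?I = "LINT y|lborel. indicator Om y * pd e \<psi> y"
  have e: "norm e = 1" and \<kappa>: "0 < \<kappa>" and r: "0 < r" using ch by (auto simp: cone_chart_def)
  have C: "0 < ?C" by (rule chart_const_pos[OF \<kappa>])
  have G: "compact ?G" using Om by (simp add: compact_frontier_bounded)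
  have cont: "continuous_on S \<psi>" for S by (rule smooth_continuous_on[OF \<psi>(1)])
  have [measurable]: "\<psi> \<in> borel_measurable borel" by (rule smooth_borel_measurable[OF \<psi>(1)])
  define t where "t n = 1 / real (Suc n)" for n
  have t: "0 < t n" "t n \<le> 1" for n by (auto simp: t_def)
  have t0: "t \<longlonglongrightarrow> 0" unfolding t_def by (rule LIMSEQ_Suc[OF lim_1_over_n])
  let ?q = "\<lambda>n. (LINT x|lborel. indicator Om x * (\<psi> (x + t n *\<^sub>R e) - \<psi> x)) / t n"
  have lim: "?q \<longlonglongrightarrow> ?I"
    by (rule integral_difference_quotient_tendsto[OF \<psi>(1) _ Om(2) e t t0]) (use Om in auto)
  obtain R where R: "closure Om \<subseteq> cball 0 R" using bounded_closure[OF Om(2)] by (auto simp: bounded_iff subset_iff)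
  have GR: "?G \<subseteq> cball 0 R" using R by (auto simp: frontier_def)
  obtain B where B: "\<And>y. y \<in> ?G \<Longrightarrow> \<psi> y \<le> B"
    using continuous_bounded_on_compact[OF cont G] by (metis abs_le_D1 real_norm_def)
  \<comment> \<open>One \<epsilon> keeps the level valid on the layer, whose points lie off the
    boundary; the other one pays for rounding to levels.\<close>
  have main: "(\<integral>\<^sup>+y. ennreal (\<psi> y - 2 * \<epsilon>) \<partial>?N) \<le> ennreal (?C * - ?I)" if \<epsilon>: "0 < \<epsilon>" for \<epsilon>
  proof -
    obtain M :: nat where M: "B \<le> real M * \<epsilon>"
      using reals_Archimedean2[of "B / \<epsilon>"] \<epsilon> by (auto simp: pos_divide_less_eq intro: less_imp_le)
    define A where "A k = {y \<in> ?G. real k * \<epsilon> \<le> \<psi> y - \<epsilon>}" for k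
    have cA: "compact (A k)" for k
    proof -
      have "closed {x. real k * \<epsilon> \<le> \<psi> x - \<epsilon>}" by (intro closed_Collect_le continuous_intros cont)
      with G have "compact (?G \<inter> {x. real k * \<epsilon> \<le> \<psi> x - \<epsilon>})" by (rule compact_Int_closed)
      then show ?thesis by (simp add: A_def Collect_conj_eq)
    qed
    have AG: "A k \<subseteq> ?G" for k by (auto simp: A_def)
    \<comment> \<open>The shift by \<epsilon> in \<open>A k\<close> makes \<psi> positive there, so
      these sets lie inside the chart.\<close>
    have Ab: "A k \<subseteq> ball x r" for k
    proof
      fix y assume "y \<in> A k"
      then have "real k * \<epsilon> \<le> \<psi> y - \<epsilon>" by (simp add: A_def)
      moreover have "0 \<le> real k * \<epsilon>" using \<epsilon> by simp
      ultimately have "0 < \<psi> y" using \<epsilon> by linarith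
      then show "y \<in> ball x r" using supp[of y] by simp
    qed
    have "uniformly_continuous_on (cball 0 (R + 1)) \<psi>" by (intro compact_uniformly_continuous cont) auto
    then obtain \<delta> where \<delta>: "0 < \<delta>" "\<And>x y. x \<in> cball 0 (R + 1) \<Longrightarrow> y \<in> cball 0 (R + 1) \<Longrightarrow> dist y x < \<delta> \<Longrightarrow> dist (\<psi> y) (\<psi> x) < \<epsilon>"
      using \<epsilon> unfolding uniformly_continuous_on_def by metis
    have step: "(\<Sum>k\<in>{1..M}. ennreal \<epsilon> * hausdorff_pre ?s (2 * t n) (A k)) \<le> ennreal (?C * - ?q n)" if tn: "t n < \<delta>" "t n < r" for n
    proof -
      define P where "P k U \<longleftrightarrow> U \<in> sets borel \<and> U \<subseteq> Om \<and> (\<forall>y\<in>U. y - t n *\<^sub>R e \<notin> Om) \<and> (\<forall>y\<in>U. \<exists>p\<in>A k. dist p y \<le> t n) \<and>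
         hausdorff_pre ?s (2 * t n) (A k) \<le> ennreal (?C / t n) * emeasure lborel U" for k U
      have "\<exists>U. P k U" for k
        using hausdorff_pre_le_layer[OF d ch Om(1) cA AG Ab t(1) tn(2), of k] unfolding P_def by metis
      then obtain U where "\<And>k. P k (U k)" by metis
      then have U: "\<And>k. U k \<in> sets borel" "\<And>k. U k \<subseteq> Om" "\<And>k y. y \<in> U k \<Longrightarrow> y - t n *\<^sub>R e \<notin> Om"
          "\<And>k y. y \<in> U k \<Longrightarrow> \<exists>p\<in>A k. dist p y \<le> t n"
          "\<And>k. hausdorff_pre ?s (2 * t n) (A k) \<le> ennreal (?C / t n) * emeasure lborel (U k)"
        unfolding P_def by blast+
      have Ul: "real k * \<epsilon> \<le> \<psi> y" if y: "y \<in> U k" for k y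
      proof -
        obtain p where p: "p \<in> A k" "dist p y \<le> t n" using U(4)[OF y] by blast
        have pR: "norm p \<le> R" using subsetD[OF GR subsetD[OF AG p(1)]] by simp
        then have "norm y \<le> R + 1" using p(2) t(2)[of n] norm_triangle_ineq2[of y p] by (simp add: dist_norm norm_minus_commute)
        then have "dist (\<psi> y) (\<psi> p) < \<epsilon>" using \<delta>(2)[of p y] pR p(2) tn by (simp add: dist_commute)
        then have "\<psi> p - \<psi> y < \<epsilon>" by (simp add: dist_real_def abs_less_iff)
        moreover have "real k * \<epsilon> \<le> \<psi> p - \<epsilon>" using p(1) by (simp add: A_def)
        ultimately show ?thesis by linarith
      qed
      let ?h = "\<lambda>y. - ((indicator Om (y - t n *\<^sub>R e) - indicator Om y) * \<psi> y)"
      \<comment> \<open>The sign is what gives an estimate from below: in the chart, a point outside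
        \<open>Om\<close> stays outside when moved by \<open>- t n *\<^sub>R e\<close>, so the
        translate covers no new points where \<psi> is nonzero.\<close>
      have h0: "0 \<le> ?h y" for y
      proof (cases "y \<in> Om")
        case True then show ?thesis using \<psi>(2) by (simp add: indicator_def)
      next
        case False
        show ?thesis
        proof (cases "\<psi> y = 0")
          case ne: False
          have "cball (y - t n *\<^sub>R e) (\<kappa> * t n) \<inter> Om = {}"
            by (rule cone_chart_outer[OF ch False supp[OF ne] t(1) tn(2)])
          moreover have "y - t n *\<^sub>R e \<in> cball (y - t n *\<^sub>R e) (\<kappa> * t n)" using \<kappa> t(1)[of n] by simp
          ultimately have "y - t n *\<^sub>R e \<notin> Om" by blast
          then show ?thesis using False by simp
        qed simp
      qed
      have pt: "(\<Sum>k\<in>{1..M}. ennreal \<epsilon> * indicator (U k) y) \<le> ennreal (?h y)" for y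
      proof (cases "\<exists>k\<in>{1..M}. y \<in> U k")
        case True
        then have y: "y \<in> Om" "y - t n *\<^sub>R e \<notin> Om" using U(2,3) by blast+
        have "(\<Sum>k\<in>{1..M}. ennreal \<epsilon> * indicator (U k) y) \<le> (\<Sum>k\<in>{1..M}. ennreal (if real k * \<epsilon> \<le> \<psi> y then \<epsilon> else 0))"
          using Ul by (intro sum_mono) (auto simp: indicator_def)
        also have "\<dots> = ennreal (\<Sum>k\<in>{1..M}. if real k * \<epsilon> \<le> \<psi> y then \<epsilon> else 0)"
          using \<epsilon> by (intro sum_ennreal) auto
        also have "\<dots> \<le> ennreal (\<psi> y)" by (intro ennreal_leI layer_sum_le \<psi> \<epsilon>)
        finally show ?thesis using y by simp
      next
        case False
        then have "(\<Sum>k\<in>{1..M}. ennreal \<epsilon> * indicator (U k) y) = 0" by (intro sum.neutral) (auto simp: indicator_def)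
        then show ?thesis by (simp only: zero_le)
      qed
      have Omb: "Om \<in> sets borel" using Om by simp
      note sh = integral_difference_indicator[OF cont Omb Om(2), of "t n *\<^sub>R e"]
      have hq: "(LINT y|lborel. ?h y) = - ?q n * t n"
        unfolding Bochner_Integration.integral_minus sh(2)[symmetric] using t(1)[of n] by simp
      have "(\<Sum>k\<in>{1..M}. ennreal \<epsilon> * hausdorff_pre ?s (2 * t n) (A k)) \<le> (\<Sum>k\<in>{1..M}. ennreal \<epsilon> * (ennreal (?C / t n) * emeasure lborel (U k)))"
        by (intro sum_mono mult_left_mono U(5)) auto
      also have "\<dots> = ennreal (?C / t n) * (\<Sum>k\<in>{1..M}. ennreal \<epsilon> * emeasure lborel (U k))"
        by (simp add: sum_distrib_left mult.left_commute)
      also have "(\<Sum>k\<in>{1..M}. ennreal \<epsilon> * emeasure lborel (U k)) = (\<integral>\<^sup>+y. (\<Sum>k\<in>{1..M}. ennreal \<epsilon> * indicator (U k) y) \<partial>lborel)"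
      proof -
        have Um [measurable]: "U k \<in> sets lborel" for k using U(1) by simp
        have c: "(\<integral>\<^sup>+y. ennreal \<epsilon> * indicator (U k) y \<partial>lborel) = ennreal \<epsilon> * emeasure lborel (U k)" for k
          by (intro nn_integral_cmult_indicator Um)
        show ?thesis by (subst nn_integral_sum, measurable, simp only: c)
      qed
      also have "\<dots> \<le> (\<integral>\<^sup>+y. ennreal (?h y) \<partial>lborel)" by (intro nn_integral_mono pt)
      also have "\<dots> = ennreal (LINT y|lborel. ?h y)"
        by (rule nn_integral_eq_integral[OF integrable_minus[OF sh(1)]]) (use h0 in simp)
      also have "ennreal (?C / t n) * ennreal (LINT y|lborel. ?h y) = ennreal ((?C / t n) * (LINT y|lborel. ?h y))"
      proof (rule ennreal_mult[symmetric])
        show "0 \<le> (LINT y|lborel. ?h y)" by (rule Bochner_Integration.integral_nonneg) (rule h0)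
      qed (use C t(1)[of n] in auto)
      also have "(?C / t n) * (LINT y|lborel. ?h y) = ?C * - ?q n" unfolding hq using t(1)[of n] by simp
      finally show ?thesis by (simp add: mult_left_mono)
    qed
    have ev: "\<forall>\<^sub>F n in sequentially. t n < \<delta> \<and> t n < r \<and> t n < \<delta>' / 2" if "0 < \<delta>'" for \<delta>'
      using that \<delta> r by (intro eventually_conj order_tendstoD(2)[OF t0]) auto
    \<comment> \<open>The translation tends to zero while the scale \<delta>' of the premeasure is
      fixed; premeasures at the finer scales \<open>2 * t n\<close> are larger. The scale itself is
      sent to zero afterwards.\<close>
    have pre: "(\<Sum>k\<in>{1..M}. ennreal \<epsilon> * hausdorff_pre ?s \<delta>' (A k)) \<le> ennreal (?C * - ?I)" if \<delta>': "0 < \<delta>'" for \<delta>'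
    proof (rule tendsto_lowerbound[where f = "\<lambda>n. ennreal (?C * - ?q n)"])
      show "(\<lambda>n. ennreal (?C * - ?q n)) \<longlonglongrightarrow> ennreal (?C * - ?I)"
        by (intro tendsto_ennrealI tendsto_intros lim)
      show "\<forall>\<^sub>F n in sequentially. (\<Sum>k\<in>{1..M}. ennreal \<epsilon> * hausdorff_pre ?s \<delta>' (A k)) \<le> ennreal (?C * - ?q n)"
        using ev[OF \<delta>']
      proof eventually_elim
        case (elim n)
        have "(\<Sum>k\<in>{1..M}. ennreal \<epsilon> * hausdorff_pre ?s \<delta>' (A k)) \<le> (\<Sum>k\<in>{1..M}. ennreal \<epsilon> * hausdorff_pre ?s (2 * t n) (A k))"
          using elim by (intro sum_mono mult_left_mono hausdorff_pre_antimono) auto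
        also have "\<dots> \<le> ennreal (?C * - ?q n)" by (rule step) (use elim in auto)
        finally show ?case .
      qed
    qed simp
    have Hlim: "(\<lambda>j. hausdorff_pre ?s (t j) (A k)) \<longlonglongrightarrow> hausdorff_outer ?s (A k)" for k
    proof -
      have "incseq (\<lambda>j. hausdorff_pre ?s (t j) (A k))"
        by (intro incseq_SucI hausdorff_pre_antimono) (simp add: t_def frac_le)
      then have "(\<lambda>j. hausdorff_pre ?s (t j) (A k)) \<longlonglongrightarrow> (SUP j. hausdorff_pre ?s (t j) (A k))"
        by (rule LIMSEQ_SUP)
      also have "(SUP j. hausdorff_pre ?s (t j) (A k)) = hausdorff_outer ?s (A k)"
      proof (rule antisym)
        show "(SUP j. hausdorff_pre ?s (t j) (A k)) \<le> hausdorff_outer ?s (A k)"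
          by (intro SUP_least hausdorff_pre_le_outer t)
        show "hausdorff_outer ?s (A k) \<le> (SUP j. hausdorff_pre ?s (t j) (A k))"
          unfolding hausdorff_outer_def
        proof (rule SUP_least)
          fix \<delta>' :: real assume "\<delta>' \<in> {0<..}"
          then obtain j where "t j < \<delta>'" using order_tendstoD(2)[OF t0, of \<delta>'] by (auto simp: eventually_sequentially)
          then have "hausdorff_pre ?s \<delta>' (A k) \<le> hausdorff_pre ?s (t j) (A k)" by (intro hausdorff_pre_antimono) simp
          also have "\<dots> \<le> (SUP j. hausdorff_pre ?s (t j) (A k))" by (rule SUP_upper) simp
          finally show "hausdorff_pre ?s \<delta>' (A k) \<le> (SUP j. hausdorff_pre ?s (t j) (A k))" .
        qed
      qed
      finally show ?thesis .
    qed
    have "(\<lambda>j. \<Sum>k\<in>{1..M}. ennreal \<epsilon> * hausdorff_pre ?s (t j) (A k)) \<longlonglongrightarrow> (\<Sum>k\<in>{1..M}. ennreal \<epsilon> * hausdorff_outer ?s (A k))"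
      by (intro tendsto_sum ennreal_tendsto_cmult Hlim) simp
    then have H: "(\<Sum>k\<in>{1..M}. ennreal \<epsilon> * hausdorff_outer ?s (A k)) \<le> ennreal (?C * - ?I)"
      by (rule tendsto_upperbound) (use pre t in auto)
    have sA: "A k \<in> sets ?N" for k
      by (rule closed_in_sets_surface_measure) (use cA AG in \<open>auto simp: compact_imp_closed\<close>)
    have NA: "emeasure ?N (A k) = hausdorff_outer ?s (A k)" for k
      by (rule emeasure_surface_measure) (use cA AG in \<open>auto simp: compact_imp_closed\<close>)
    have "(\<integral>\<^sup>+y. ennreal (\<psi> y - 2 * \<epsilon>) \<partial>?N) \<le> (\<integral>\<^sup>+y. (\<Sum>k\<in>{1..M}. ennreal \<epsilon> * indicator (A k) y) \<partial>?N)"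
    proof (rule nn_integral_mono)
      fix y assume "y \<in> space ?N"
      then have y: "y \<in> ?G" by (simp add: space_surface_measure)
      show "ennreal (\<psi> y - 2 * \<epsilon>) \<le> (\<Sum>k\<in>{1..M}. ennreal \<epsilon> * indicator (A k) y)"
      proof (cases "\<psi> y - \<epsilon> \<ge> 0")
        case True
        have "\<psi> y - \<epsilon> \<le> (\<Sum>k\<in>{1..M}. if real k * \<epsilon> \<le> \<psi> y - \<epsilon> then \<epsilon> else 0) + \<epsilon>"
          by (rule layer_sum_ge[OF True \<epsilon>]) (use B[OF y] M \<epsilon> in linarith)
        then have "ennreal (\<psi> y - 2 * \<epsilon>) \<le> ennreal (\<Sum>k\<in>{1..M}. if real k * \<epsilon> \<le> \<psi> y - \<epsilon> then \<epsilon> else 0)"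
          by (intro ennreal_leI) simp
        also have "\<dots> = (\<Sum>k\<in>{1..M}. ennreal (if real k * \<epsilon> \<le> \<psi> y - \<epsilon> then \<epsilon> else 0))"
          using \<epsilon> by (intro sum_ennreal[symmetric]) auto
        also have "\<dots> = (\<Sum>k\<in>{1..M}. ennreal \<epsilon> * indicator (A k) y)"
          using y by (intro sum.cong refl) (simp add: A_def indicator_def)
        finally show ?thesis .
      next
        case False
        then have "\<psi> y - 2 * \<epsilon> \<le> 0" using \<epsilon> by simp
        then show ?thesis by (simp add: ennreal_neg)
      qed
    qed
    also have "\<dots> = (\<Sum>k\<in>{1..M}. ennreal \<epsilon> * emeasure ?N (A k))"
    proof -
      note sA [measurable]
      have c: "(\<integral>\<^sup>+x. ennreal \<epsilon> * indicator (A k) x \<partial>?N) = ennreal \<epsilon> * emeasure ?N (A k)" for k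
        by (intro nn_integral_cmult_indicator sA)
      show ?thesis by (subst nn_integral_sum, measurable, simp only: c)
    qed
    also have "\<dots> \<le> ennreal (?C * - ?I)" using H by (simp only: NA)
    finally show ?thesis .
  qed
  \<comment> \<open>Monotone convergence removes the shift, so finiteness of the boundary measure is
    not presupposed.\<close>
  have "(\<lambda>n. \<integral>\<^sup>+y. ennreal (\<psi> y - 2 * t n) \<partial>?N) \<longlonglongrightarrow> (\<integral>\<^sup>+y. ennreal (\<psi> y) \<partial>?N)"
  proof (rule nn_integral_LIMSEQ)
    show "incseq (\<lambda>n y. ennreal (\<psi> y - 2 * t n))"
      by (intro incseq_SucI le_funI ennreal_leI) (simp add: t_def frac_le)
    show "(\<lambda>y. ennreal (\<psi> y - 2 * t n)) \<in> borel_measurable ?N" for n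
      by (intro measurable_compose[OF _ measurable_ennreal] continuous_measurable_surface_measure continuous_intros cont)
    show "(\<lambda>n. ennreal (\<psi> y - 2 * t n)) \<longlonglongrightarrow> ennreal (\<psi> y)" for y
    proof -
      have "(\<lambda>n. \<psi> y - 2 * t n) \<longlonglongrightarrow> \<psi> y - 2 * 0" by (intro tendsto_intros t0)
      then show ?thesis by (intro tendsto_ennrealI) simp
    qed
  qed
  then show ?thesis by (rule tendsto_upperbound) (use main t in auto)
qed

text \<open>The estimate above is applied to the nonnegative function
  \<open>\<theta> y * (\<Phi> y)\<^sup>2\<close>; the product rule leaves a term with the gradient
  of \<theta>, bounded by \<open>M\<close>, and one of the form
  \<open>2 * \<Phi> y * pd e \<Phi> y\<close>, split by the arithmetic-geometric mean
  inequality.\<close>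

lemma trace_inequality_chart:
  fixes Om :: "'a::euclidean_space set"
  assumes d: "DIM('a) \<ge> 2" and ch: "cone_chart Om x e \<kappa> r" and Om: "open Om" "bounded Om"
    and \<theta>: "smooth \<theta>" "\<And>y. 0 \<le> \<theta> y" "\<And>y. \<theta> y \<le> 1" "\<And>y. \<theta> y \<noteq> 0 \<Longrightarrow> y \<in> ball x r"
  shows "\<exists>C\<ge>0. \<forall>\<Phi>. smooth \<Phi> \<longrightarrow> (\<integral>\<^sup>+y. ennreal (\<theta> y * (\<Phi> y)\<^sup>2) \<partial>surface_measure Om) \<le>
      ennreal (C * (LINT y|lborel. indicator Om y * ((\<Phi> y)\<^sup>2 + (norm (grad \<Phi> y))\<^sup>2)))"
proof -
  let ?K = "chart_const TYPE('a) \<kappa>"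
  have e: "norm e = 1" and \<kappa>: "0 < \<kappa>" using ch by (auto simp: cone_chart_def)
  have K: "0 < ?K" by (rule chart_const_pos[OF \<kappa>])
  note gc = continuous_on_grad
  have pdg: "pd e f y = grad f y \<bullet> e" if "smooth f" for f y
    by (rule pd_eq_grad_inner[OF smooth_differentiable[OF that]])
  have pdle: "\<bar>pd e f y\<bar> \<le> norm (grad f y)" if "smooth f" for f y
    unfolding pdg[OF that] using Cauchy_Schwarz_ineq2[of "grad f y" e] e by simp
  have "vanishes_outside (norm x + r) \<theta>"
    unfolding vanishes_outside_def
  proof (intro allI impI, rule ccontr)
    fix y assume y: "norm y > norm x + r" "\<theta> y \<noteq> 0"
    then have "dist x y < r" using \<theta>(4) by simp
    then show False using y norm_triangle_ineq2[of y x] by (simp add: dist_norm norm_minus_commute)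
  qed
  then have "vanishes_outside (norm x + r) (pd b \<theta>)" for b by (rule pd_support)
  then have "vanishes_outside (norm x + r) (\<lambda>y. norm (grad \<theta> y))"
    by (auto simp: vanishes_outside_def grad_eq_pd)
  then obtain M where M: "0 \<le> M" "\<And>y. norm (grad \<theta> y) \<le> M"
    using bounded_compact_support[of "\<lambda>y. norm (grad \<theta> y)"] continuous_on_norm[OF gc[OF \<theta>(1)], of UNIV] by auto
  show ?thesis
  proof (intro exI[of _ "?K * (M + 1)"] conjI allI impI)
    show "0 \<le> ?K * (M + 1)" using K M by simp
    fix \<Phi> :: "'a \<Rightarrow> real" assume \<Phi>: "smooth \<Phi>"
    let ?\<psi> = "\<lambda>y. \<theta> y * (\<Phi> y * \<Phi> y)"
    have s: "smooth ?\<psi>" by (intro smooth_mult \<theta> \<Phi>)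
    have pds: "pd e ?\<psi> y = \<theta> y * (2 * \<Phi> y * pd e \<Phi> y) + pd e \<theta> y * (\<Phi> y)\<^sup>2" for y
      using pd_mult[OF smooth_differentiable[OF \<theta>(1)] smooth_differentiable[OF smooth_mult[OF \<Phi> \<Phi>]], of e y]
        pd_mult[OF smooth_differentiable[OF \<Phi>] smooth_differentiable[OF \<Phi>], of e y]
      by (simp add: power2_eq_square algebra_simps)
    have le: "- pd e ?\<psi> y \<le> (M + 1) * ((\<Phi> y)\<^sup>2 + (norm (grad \<Phi> y))\<^sup>2)" for y
    proof -
      have a: "\<bar>2 * \<Phi> y * pd e \<Phi> y\<bar> \<le> (\<Phi> y)\<^sup>2 + (norm (grad \<Phi> y))\<^sup>2"
      proof -
        have "\<bar>2 * \<Phi> y * pd e \<Phi> y\<bar> \<le> 2 * \<bar>\<Phi> y\<bar> * norm (grad \<Phi> y)"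
          using pdle[OF \<Phi>, of y] by (simp add: abs_mult mult_left_mono)
        also have "\<dots> \<le> (\<Phi> y)\<^sup>2 + (norm (grad \<Phi> y))\<^sup>2" using sum_squares_bound[of "\<bar>\<Phi> y\<bar>" "norm (grad \<Phi> y)"] by simp
        finally show ?thesis .
      qed
      have b: "\<bar>\<theta> y * (2 * \<Phi> y * pd e \<Phi> y)\<bar> \<le> 1 * ((\<Phi> y)\<^sup>2 + (norm (grad \<Phi> y))\<^sup>2)"
        unfolding abs_mult[of "\<theta> y"] using \<theta>(2,3)[of y] a by (intro mult_mono) auto
      have "\<bar>pd e \<theta> y * (\<Phi> y)\<^sup>2\<bar> \<le> M * (\<Phi> y)\<^sup>2"
        unfolding abs_mult using pdle[OF \<theta>(1), of y] M(2)[of y] by (simp add: mult_right_mono)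
      moreover have "M * (\<Phi> y)\<^sup>2 \<le> M * ((\<Phi> y)\<^sup>2 + (norm (grad \<Phi> y))\<^sup>2)" using M(1) by (intro mult_left_mono) auto
      ultimately show ?thesis unfolding pds using b by (simp add: distrib_right abs_le_iff)
    qed
    have Omb: "Om \<in> sets borel" using Om by simp
    have cpd: "continuous_on UNIV (pd e ?\<psi>)"
      using pdg[OF s] gc[OF s] by (simp add: continuous_intros)
    have i1: "integrable lborel (\<lambda>y. indicator Om y * pd e ?\<psi> y)"
      by (rule integrable_indicator_continuous[OF cpd Omb Om(2)])
    have i2: "integrable lborel (\<lambda>y. indicator Om y * ((\<Phi> y)\<^sup>2 + (norm (grad \<Phi> y))\<^sup>2))"
      by (rule integrable_indicator_continuous[OF _ Omb Om(2)])
        (intro continuous_intros gc[OF \<Phi>] smooth_continuous_on[OF \<Phi>])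
    have "(\<integral>\<^sup>+y. ennreal (\<theta> y * (\<Phi> y)\<^sup>2) \<partial>surface_measure Om) = (\<integral>\<^sup>+y. ennreal (?\<psi> y) \<partial>surface_measure Om)"
      by (simp add: power2_eq_square)
    also have "\<dots> \<le> ennreal (?K * - (LINT y|lborel. indicator Om y * pd e ?\<psi> y))"
      by (rule surface_integral_le_pd[OF d ch Om s]) (use \<theta> in auto)
    also have "\<dots> \<le> ennreal (?K * (M + 1) * (LINT y|lborel. indicator Om y * ((\<Phi> y)\<^sup>2 + (norm (grad \<Phi> y))\<^sup>2)))"
    proof (rule ennreal_leI)
      have "- (LINT y|lborel. indicator Om y * pd e ?\<psi> y) = (LINT y|lborel. - (indicator Om y * pd e ?\<psi> y))" by simp
      also have "\<dots> \<le> (LINT y|lborel. (M + 1) * (indicator Om y * ((\<Phi> y)\<^sup>2 + (norm (grad \<Phi> y))\<^sup>2)))"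
      proof (rule integral_mono)
        show "- (indicator Om y * pd e ?\<psi> y) \<le> (M + 1) * (indicator Om y * ((\<Phi> y)\<^sup>2 + (norm (grad \<Phi> y))\<^sup>2))" for y
          using le[of y] by (simp add: indicator_def)
      qed (use i1 i2 in auto)
      also have "\<dots> = (M + 1) * (LINT y|lborel. indicator Om y * ((\<Phi> y)\<^sup>2 + (norm (grad \<Phi> y))\<^sup>2))" by simp
      finally show "?K * - (LINT y|lborel. indicator Om y * pd e ?\<psi> y) \<le>
          ?K * (M + 1) * (LINT y|lborel. indicator Om y * ((\<Phi> y)\<^sup>2 + (norm (grad \<Phi> y))\<^sup>2))"
        using K by (simp only: mult.assoc) (intro mult_left_mono, auto)
    qed
    finally show "(\<integral>\<^sup>+y. ennreal (\<theta> y * (\<Phi> y)\<^sup>2) \<partial>surface_measure Om) \<le>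
      ennreal (?K * (M + 1) * (LINT y|lborel. indicator Om y * ((\<Phi> y)\<^sup>2 + (norm (grad \<Phi> y))\<^sup>2)))" .
  qed
qed

text \<open>Supports within two thirds of the chart radius leave a margin for the width of the
  mollifiers. All of the closure is covered, since the atlas serves both boundary integrals and a
  partition of unity on the domain.\<close>

definition finite_atlas :: "'a::euclidean_space set \<Rightarrow> 'a set \<Rightarrow> ('a \<Rightarrow> 'a) \<Rightarrow> ('a \<Rightarrow> real) \<Rightarrow> ('a \<Rightarrow> real) \<Rightarrow> ('a \<Rightarrow> 'a \<Rightarrow> real) \<Rightarrow> bool" where
  "finite_atlas Om X e \<kappa> r \<theta> \<longleftrightarrow> finite X \<and> X \<subseteq> closure Om \<and> (\<forall>x\<in>X. cone_chart Om x (e x) (\<kappa> x) (r x) \<and>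
     smooth (\<theta> x) \<and> (\<forall>y. 0 \<le> \<theta> x y \<and> \<theta> x y \<le> 1) \<and> (\<forall>y. \<theta> x y \<noteq> 0 \<longrightarrow> dist x y \<le> 2 / 3 * r x)) \<and>
     (\<forall>y\<in>closure Om. \<exists>x\<in>X. \<theta> x y = 1)"

lemma lipschitz_domain_finite_atlas:
  fixes Om :: "'a::euclidean_space set"
  assumes Om: "lipschitz_domain Om"
  shows "\<exists>X e \<kappa> r \<theta>. finite_atlas Om X e \<kappa> r \<theta>"
proof -
  have "\<exists>e \<kappa> r. cone_chart Om x e \<kappa> r" if "x \<in> closure Om" for x
    using lipschitz_domain_cone_chart[OF Om that] by metis
  then obtain e \<kappa> r where ch: "\<And>x. x \<in> closure Om \<Longrightarrow> cone_chart Om x (e x) (\<kappa> x) (r x)" by metis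
  define Q where "Q x \<theta> \<longleftrightarrow> smooth \<theta> \<and> (\<forall>y. 0 \<le> \<theta> y \<and> \<theta> y \<le> 1) \<and> (\<forall>y. dist x y \<le> r x / 3 \<longrightarrow> \<theta> y = 1) \<and> (\<forall>y. \<theta> y \<noteq> 0 \<longrightarrow> dist x y \<le> 2 / 3 * r x)" for x and \<theta> :: "'a \<Rightarrow> real"
  have "\<exists>\<theta>. Q x \<theta>" if "x \<in> closure Om" for x
  proof -
    have "0 < r x / 3" using ch[OF that] by (simp add: cone_chart_def)
    then obtain \<theta> :: "'a \<Rightarrow> real" where "smooth \<theta>" "\<And>y. 0 \<le> \<theta> y" "\<And>y. \<theta> y \<le> 1"
      "\<And>y. dist x y \<le> r x / 3 \<Longrightarrow> \<theta> y = 1" "\<And>y. \<theta> y \<noteq> 0 \<Longrightarrow> dist x y \<le> 2 * (r x / 3)"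
      by (rule smooth_cutoff[of "r x / 3" x]) blast
    then have "Q x \<theta>" by (simp add: Q_def)
    then show ?thesis by (rule exI[of _ \<theta>])
  qed
  then obtain \<theta> where \<theta>: "\<And>x. x \<in> closure Om \<Longrightarrow> Q x (\<theta> x)" by metis
  have "compact (closure Om)" using Om by (simp add: lipschitz_domain_def compact_closure)
  then obtain X where X: "finite X" "X \<subseteq> closure Om" "closure Om \<subseteq> (\<Union>x\<in>X. ball x (r x / 3))"
  proof (rule compactE_image[where C = "closure Om" and f = "\<lambda>x. ball x (r x / 3)"])
    show "closure Om \<subseteq> (\<Union>x\<in>closure Om. ball x (r x / 3))"
      using ch by (force simp: cone_chart_def)
  qed auto
  have cov: "\<exists>x\<in>X. \<theta> x y = 1" if y: "y \<in> closure Om" for y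
  proof -
    have "y \<in> (\<Union>x\<in>X. ball x (r x / 3))" using X(3) y by (rule subsetD)
    then obtain x where x: "x \<in> X" "y \<in> ball x (r x / 3)" by (rule UN_E)
    then have "\<theta> x y = 1" using \<theta>[of x] X(2) by (auto simp: Q_def)
    then show ?thesis using x(1) by blast
  qed
  have "finite_atlas Om X e \<kappa> r \<theta>"
    unfolding finite_atlas_def
  proof (intro conjI ballI)
    fix x assume "x \<in> X"
    then have x: "x \<in> closure Om" using X(2) by blast
    show "cone_chart Om x (e x) (\<kappa> x) (r x)" by (rule ch[OF x])
    show "smooth (\<theta> x)" "\<forall>y. 0 \<le> \<theta> x y \<and> \<theta> x y \<le> 1" "\<forall>y. \<theta> x y \<noteq> 0 \<longrightarrow> dist x y \<le> 2 / 3 * r x"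
      using \<theta>[OF x] by (auto simp: Q_def)
  qed (use X cov in auto)
  then show ?thesis by blast
qed

text \<open>At each boundary point some cutoff equals 1, so the square of \<Phi> is at most the sum
  of its localised versions.\<close>

lemma trace_inequality:
  fixes Om :: "'a::euclidean_space set"
  assumes d: "DIM('a) \<ge> 2" and Om: "lipschitz_domain Om"
  shows "\<exists>C\<ge>0. \<forall>\<Phi>. smooth \<Phi> \<longrightarrow> (\<integral>\<^sup>+y. ennreal ((\<Phi> y)\<^sup>2) \<partial>surface_measure Om) \<le>
      ennreal (C * (LINT y|lborel. indicator Om y * ((\<Phi> y)\<^sup>2 + (norm (grad \<Phi> y))\<^sup>2)))"
proof -
  let ?N = "surface_measure Om"
  have o: "open Om" "bounded Om" using Om by (auto simp: lipschitz_domain_def)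
  obtain X e \<kappa> r \<theta> where "finite_atlas Om X e \<kappa> r \<theta>"
    using lipschitz_domain_finite_atlas[OF Om] by blast
  then have X: "finite X" "X \<subseteq> closure Om" "\<And>x. x \<in> X \<Longrightarrow> cone_chart Om x (e x) (\<kappa> x) (r x)"
    "\<And>x. x \<in> X \<Longrightarrow> smooth (\<theta> x)" "\<And>x y. x \<in> X \<Longrightarrow> 0 \<le> \<theta> x y" "\<And>x y. x \<in> X \<Longrightarrow> \<theta> x y \<le> 1"
    "\<And>x y. x \<in> X \<Longrightarrow> \<theta> x y \<noteq> 0 \<Longrightarrow> dist x y \<le> 2 / 3 * r x" "\<And>y. y \<in> closure Om \<Longrightarrow> \<exists>x\<in>X. \<theta> x y = 1"
    by (simp_all add: finite_atlas_def)
  define E where "E \<Phi> = (LINT y|lborel. indicator Om y * ((\<Phi> y)\<^sup>2 + (norm (grad \<Phi> y))\<^sup>2))" for \<Phi>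
  have E0: "0 \<le> E \<Phi>" for \<Phi> unfolding E_def by (rule Bochner_Integration.integral_nonneg) simp
  have "\<exists>C\<ge>0. \<forall>\<Phi>. smooth \<Phi> \<longrightarrow> (\<integral>\<^sup>+y. ennreal (\<theta> x y * (\<Phi> y)\<^sup>2) \<partial>?N) \<le> ennreal (C * E \<Phi>)" if x: "x \<in> X" for x
  proof -
    have r: "0 < r x" using X(3)[OF x] by (simp add: cone_chart_def)
    have "y \<in> ball x (r x)" if "\<theta> x y \<noteq> 0" for y using X(7)[OF x that] r by simp
    then show ?thesis
      unfolding E_def by (rule trace_inequality_chart[OF d X(3)[OF x] o X(4)[OF x] X(5)[OF x] X(6)[OF x]])
  qed
  then obtain C where C: "\<And>x. x \<in> X \<Longrightarrow> 0 \<le> C x"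
     "\<And>x \<Phi>. x \<in> X \<Longrightarrow> smooth \<Phi> \<Longrightarrow> (\<integral>\<^sup>+y. ennreal (\<theta> x y * (\<Phi> y)\<^sup>2) \<partial>?N) \<le> ennreal (C x * E \<Phi>)" by metis
  show ?thesis
  proof (intro exI[of _ "\<Sum>x\<in>X. C x"] conjI allI impI)
    show "0 \<le> (\<Sum>x\<in>X. C x)" by (intro sum_nonneg C)
    fix \<Phi> :: "'a \<Rightarrow> real" assume \<Phi>: "smooth \<Phi>"
    have "(\<integral>\<^sup>+y. ennreal ((\<Phi> y)\<^sup>2) \<partial>?N) \<le> (\<integral>\<^sup>+y. (\<Sum>x\<in>X. ennreal (\<theta> x y * (\<Phi> y)\<^sup>2)) \<partial>?N)"
    proof (rule nn_integral_mono)
      fix y assume "y \<in> space ?N"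
      then have "y \<in> closure Om" by (auto simp: space_surface_measure frontier_def)
      then obtain x where x: "x \<in> X" "\<theta> x y = 1" using X(8) by blast
      have "ennreal ((\<Phi> y)\<^sup>2) = ennreal (\<theta> x y * (\<Phi> y)\<^sup>2)" using x by simp
      also have "\<dots> \<le> (\<Sum>x\<in>X. ennreal (\<theta> x y * (\<Phi> y)\<^sup>2))" by (rule member_le_sum) (use x X in auto)
      finally show "ennreal ((\<Phi> y)\<^sup>2) \<le> (\<Sum>x\<in>X. ennreal (\<theta> x y * (\<Phi> y)\<^sup>2))" .
    qed
    also have "\<dots> = (\<Sum>x\<in>X. \<integral>\<^sup>+y. ennreal (\<theta> x y * (\<Phi> y)\<^sup>2) \<partial>?N)"
      by (rule nn_integral_sum)
        (intro measurable_compose[OF _ measurable_ennreal] continuous_measurable_surface_measure continuous_intros smooth_continuous_on X \<Phi>)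
    also have "\<dots> \<le> (\<Sum>x\<in>X. ennreal (C x * E \<Phi>))" by (intro sum_mono C \<Phi>)
    also have "\<dots> = ennreal ((\<Sum>x\<in>X. C x) * E \<Phi>)"
      unfolding sum_distrib_right by (intro sum_ennreal mult_nonneg_nonneg C E0)
    finally show "(\<integral>\<^sup>+y. ennreal ((\<Phi> y)\<^sup>2) \<partial>?N) \<le> ennreal ((\<Sum>x\<in>X. C x) * (LINT y|lborel. indicator Om y * ((\<Phi> y)\<^sup>2 + (norm (grad \<Phi> y))\<^sup>2)))"
      unfolding E_def .
  qed
qed

text \<open>The trace inequality for the constant function 1, whose right-hand side is a real
  number.\<close>

lemma surface_measure_finite:
  fixes Om :: "'a::euclidean_space set"
  assumes d: "DIM('a) \<ge> 2" and Om: "lipschitz_domain Om"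
  shows "emeasure (surface_measure Om) (frontier Om) < \<infinity>"
proof -
  obtain C where C: "\<forall>\<Phi>. smooth \<Phi> \<longrightarrow> (\<integral>\<^sup>+y. ennreal ((\<Phi> y)\<^sup>2) \<partial>surface_measure Om) \<le>
      ennreal (C * (LINT y|lborel. indicator Om y * ((\<Phi> y)\<^sup>2 + (norm (grad \<Phi> y))\<^sup>2)))"
    using trace_inequality[OF d Om] by blast
  have "emeasure (surface_measure Om) (frontier Om) = (\<integral>\<^sup>+y. ennreal (1\<^sup>2) \<partial>surface_measure Om)"
    by (simp add: space_surface_measure)
  also have "\<dots> < \<infinity>"
    using C[rule_format, OF smooth_const[of 1]] by (rule order.strict_trans1) simp
  finally show ?thesis .
qed

section \<open>Approximation up to the boundary\<close>

lemma null_sequence_squeeze: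
  fixes a b :: "nat \<Rightarrow> real"
  assumes "\<And>n. 0 \<le> a n" "\<And>n. a n \<le> b n" "b \<longlonglongrightarrow> 0"
  shows "a \<longlonglongrightarrow> 0"
  by (rule tendsto_sandwich[OF always_eventually always_eventually tendsto_const assms(3)]) (use assms in auto)

text \<open>A partition of unity without division: each new function is its cutoff times the product
  of \<open>1 - \<theta>\<close> over the functions already treated, and the sum telescopes. It
  equals 1 wherever some cutoff does.\<close>

lemma smooth_partition:
  assumes "finite X" "\<And>x. x \<in> X \<Longrightarrow> smooth (\<theta> x)"
  shows "\<exists>\<zeta>. (\<forall>x\<in>X. smooth (\<zeta> x) \<and> (\<forall>y. \<zeta> x y \<noteq> 0 \<longrightarrow> \<theta> x y \<noteq> 0)) \<and>
    (\<forall>y. (\<Sum>x\<in>X. \<zeta> x y) = 1 - (\<Prod>x\<in>X. 1 - \<theta> x y))"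
  using assms
proof (induction X rule: finite_induct)
  case (insert x X)
  then obtain \<zeta> where \<zeta>: "\<And>z. z \<in> X \<Longrightarrow> smooth (\<zeta> z)" "\<And>z y. z \<in> X \<Longrightarrow> \<zeta> z y \<noteq> 0 \<Longrightarrow> \<theta> z y \<noteq> 0"
    "\<And>y. (\<Sum>x\<in>X. \<zeta> x y) = 1 - (\<Prod>x\<in>X. 1 - \<theta> x y)" by (metis insertI2)
  define c where "c y = \<theta> x y * (\<Prod>z\<in>X. 1 - \<theta> z y)" for y
  have "smooth c" unfolding c_def[abs_def] by (intro smooth_mult smooth_prod smooth_diff smooth_const insert.prems) auto
  moreover have "(\<Sum>z\<in>insert x X. (\<zeta>(x := c)) z y) = 1 - (\<Prod>z\<in>insert x X. 1 - \<theta> z y)" for y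
  proof -
    have "(\<Sum>z\<in>X. (\<zeta>(x := c)) z y) = (\<Sum>z\<in>X. \<zeta> z y)" using insert.hyps by (intro sum.cong) auto
    then show ?thesis using insert.hyps \<zeta>(3)[of y] by (simp add: c_def algebra_simps)
  qed
  ultimately show ?case using \<zeta>(1,2)
    by (intro exI[of _ "\<zeta>(x := c)"]) (auto simp: c_def)
qed simp

text \<open>Borel representatives extended by zero, so that convolutions over \<^const>\<open>lborel\<close> make sense.\<close>
definition L2_on :: "'a::euclidean_space set \<Rightarrow> ('a \<Rightarrow> real) \<Rightarrow> bool" where
  "L2_on Om f \<longleftrightarrow> square_integrable lborel f \<and> (\<forall>x. x \<notin> Om \<longrightarrow> f x = 0)"

lemma L2_on_zero: "L2_on Om (\<lambda>x. 0)"
  by (simp add: L2_on_def)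

lemma L2_on_add: "L2_on Om f \<Longrightarrow> L2_on Om g \<Longrightarrow> L2_on Om (\<lambda>x. f x + g x)"
  by (simp add: L2_on_def square_integrable_add)

lemma L2_on_sum: "(\<And>i. i \<in> I \<Longrightarrow> L2_on Om (f i)) \<Longrightarrow> L2_on Om (\<lambda>x. \<Sum>i\<in>I. f i x)"
  by (induction I rule: infinite_finite_induct) (auto intro: L2_on_add L2_on_zero)

lemma L2_on_measurable: "L2_on Om f \<Longrightarrow> f \<in> borel_measurable borel"
  by (simp add: L2_on_def square_integrable_def)

lemma L2_on_mult:
  assumes f: "L2_on Om f" and g: "continuous_on UNIV g" and Om: "bounded Om"
  shows "L2_on Om (\<lambda>x. g x * f x)"
proof -
  obtain R where R: "\<And>x. x \<in> Om \<Longrightarrow> norm x \<le> R" using Om by (auto simp: bounded_iff)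
  obtain B where B: "\<forall>y\<in>cball 0 R. norm (g y) \<le> B"
    using continuous_bounded_on_compact[OF g compact_cball] by blast
  have "square_integrable lborel (\<lambda>x. g x * f x)"
  proof (rule square_integrable_dominated[where B = "\<bar>B\<bar>"])
    show "square_integrable lborel f" using f by (simp add: L2_on_def)
    have [measurable]: "f \<in> borel_measurable borel" "g \<in> borel_measurable borel"
      using f g by (auto intro: borel_measurable_continuous_onI L2_on_measurable)
    show "(\<lambda>x. g x * f x) \<in> borel_measurable lborel" by measurable
    have "norm (g x * f x) \<le> \<bar>B\<bar> * norm (f x)" for x
    proof (cases "x \<in> Om")
      case True
      then have "norm (g x) \<le> B" using R B by simp
      then show ?thesis unfolding norm_mult by (intro mult_right_mono) auto
    qed (use f in \<open>auto simp: L2_on_def\<close>)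
    then show "AE x in lborel. norm (g x * f x) \<le> \<bar>B\<bar> * norm (f x)" by simp
  qed
  then show ?thesis using f by (simp add: L2_on_def)
qed

lemma L2_on_integrable:
  assumes "L2_on Om f" "bounded Om"
  shows "integrable lborel f"
proof -
  obtain R where R: "\<And>x. x \<in> Om \<Longrightarrow> norm x \<le> R" using assms(2) by (auto simp: bounded_iff)
  then have "vanishes_outside R f" using assms(1) by (force simp: L2_on_def vanishes_outside_def)
  then show ?thesis using assms(1) by (intro integrable_of_bounded_support[of f R]) (auto simp: L2_on_def)
qed

lemma kernel_mono: "kernel \<rho> K \<Longrightarrow> \<rho> \<le> \<rho>' \<Longrightarrow> kernel \<rho>' K"
  by (auto simp: kernel_def vanishes_outside_def)

lemma conv_tendsto:
  fixes Om :: "'a::euclidean_space set"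
  assumes f: "L2_on Om f" and Om: "Om \<in> sets borel" "bounded Om"
    and K: "\<And>n. kernel (\<rho> n) (K n)" and \<rho>: "\<rho> \<longlonglongrightarrow> 0"
  shows "(\<lambda>n. l2_norm (lebesgue_on Om) (\<lambda>x. conv (K n) f x - f x)) \<longlonglongrightarrow> 0"
proof (rule LIMSEQ_I)
  fix \<epsilon> :: real assume \<epsilon>: "0 < \<epsilon>"
  obtain R where R: "\<And>x. x \<in> Om \<Longrightarrow> norm x \<le> R" using Om(2) by (auto simp: bounded_iff)
  then have v: "vanishes_outside R f" using f by (force simp: L2_on_def vanishes_outside_def)
  have "Om \<subseteq> cball 0 R" using R by auto
  then obtain d where d: "0 < d" "\<And>K. kernel d K \<Longrightarrow> l2_norm (lebesgue_on Om) (\<lambda>x. conv K f x - f x) \<le> \<epsilon> / 2"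
    using conv_approximate_identity[of f R Om "\<epsilon> / 2"] f v Om \<epsilon> by (auto simp: L2_on_def)
  obtain N where N: "\<And>n. n \<ge> N \<Longrightarrow> \<rho> n < d"
    using order_tendstoD(2)[OF \<rho> d(1)] by (auto simp: eventually_sequentially)
  have "norm (l2_norm (lebesgue_on Om) (\<lambda>x. conv (K n) f x - f x) - 0) < \<epsilon>" if "n \<ge> N" for n
    using d(2)[OF kernel_mono[OF K less_imp_le[OF N[OF that]]]] \<epsilon> by simp
  then show "\<exists>N. \<forall>n\<ge>N. norm (l2_norm (lebesgue_on Om) (\<lambda>x. conv (K n) f x - f x) - 0) < \<epsilon>" by blast
qed

lemma pd_eq_0_of_const_on_open:
  assumes "open S" "x \<in> S" "\<And>y. y \<in> S \<Longrightarrow> f y = c"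
  shows "pd b f x = 0"
proof -
  have "((\<lambda>y. c) has_derivative (\<lambda>v. 0)) (at x)" by simp
  then have "(f has_derivative (\<lambda>v. 0)) (at x)"
    by (rule has_derivative_transform_within_open[OF _ assms(1,2)]) (simp add: assms(3))
  then show ?thesis by (simp add: pd_eqI)
qed

lemma conv_sum_right:
  assumes "\<And>i. i \<in> I \<Longrightarrow> integrable lborel (\<lambda>z. K (y - z) * f i z)"
  shows "conv K (\<lambda>z. \<Sum>i\<in>I. f i z) y = (\<Sum>i\<in>I. conv K (f i) y)"
  unfolding conv_def sum_distrib_left using assms by (subst Bochner_Integration.integral_sum) auto

text \<open>The weak derivative passes to the mollification because the kernel, cut off by \<open>\<zeta>\<close>, is a test function.\<close>
lemma conv_weak_div:
  fixes Om :: "'a::euclidean_space set" and F :: "'a \<Rightarrow> 'a \<Rightarrow> real"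
  assumes Om: "bounded Om" and K: "smooth K" "vanishes_outside \<rho> K" and \<zeta>: "smooth \<zeta>"
    and F: "\<And>b. b \<in> Basis \<Longrightarrow> L2_on Om (F b)" and h: "L2_on Om h"
    and W: "\<And>\<psi>. test_function Om \<psi> \<Longrightarrow> (\<Sum>b\<in>Basis. LINT z|lborel. F b z * pd b \<psi> z) = - (LINT z|lborel. h z * \<psi> z)"
    and supp: "\<exists>C. compact C \<and> C \<subseteq> Om \<and> (\<forall>z. K (y - z) * \<zeta> z \<noteq> 0 \<longrightarrow> z \<in> C)"
  shows "(\<Sum>b\<in>Basis. conv (pd b K) (\<lambda>z. \<zeta> z * F b z) y) =
    conv K (\<lambda>z. \<zeta> z * h z + (\<Sum>b\<in>Basis. pd b \<zeta> z * F b z)) y"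
proof -
  \<comment> \<open>The point \<open>y\<close> is fixed and \<open>z\<close> is the variable. The
    derivative of the first factor carries the sign -1, that of \<zeta> produces the terms
    \<open>pd b \<zeta> z * F b z\<close> on the right-hand side.\<close>
  define \<psi> where "\<psi> z = K ((-1) *\<^sub>R z + y) * \<zeta> z" for z
  have \<psi>eq: "\<psi> z = K (y - z) * \<zeta> z" for z by (simp add: \<psi>_def)
  have sK: "smooth (\<lambda>z. K ((-1) *\<^sub>R z + y))" by (rule smooth_translate_reflect[OF K(1)])
  have s\<psi>: "smooth \<psi>" unfolding \<psi>_def[abs_def] by (intro smooth_mult sK \<zeta>)
  have pd\<psi>: "pd b \<psi> z = K (y - z) * pd b \<zeta> z - pd b K (y - z) * \<zeta> z" for b z
    using pd_mult[OF smooth_differentiable[OF sK] smooth_differentiable[OF \<zeta>], of b z] pd_translate_reflect[OF K(1), of b "-1" y z]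
    by (simp add: \<psi>_def[abs_def])
  obtain C where C: "compact C" "C \<subseteq> Om" "\<And>z. \<psi> z \<noteq> 0 \<Longrightarrow> z \<in> C" using supp by (auto simp: \<psi>eq)
  have clC: "closure {z. \<psi> z \<noteq> 0} \<subseteq> C" using C by (intro closure_minimal) (auto simp: compact_imp_closed)
  then have "compact (closure {z. \<psi> z \<noteq> 0})"
    using bounded_subset[OF compact_imp_bounded[OF C(1)]] by (simp add: compact_eq_bounded_closed)
  then have t: "test_function Om \<psi>" using s\<psi> clC C(2) by (auto simp: test_function_def)
  note Fi = L2_on_integrable[OF L2_on_mult[OF F _ Om] Om] and hi = L2_on_integrable[OF L2_on_mult[OF h _ Om] Om]
  have c\<zeta>: "continuous_on UNIV \<zeta>" "\<And>b. b \<in> Basis \<Longrightarrow> continuous_on UNIV (pd b \<zeta>)"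
    using \<zeta> by (auto intro: smooth_continuous_on smooth_pd)
  note cK = smooth_continuous_on[OF K(1)]
  have i1: "integrable lborel (\<lambda>z. pd b K (y - z) * (\<zeta> z * F b z))" if "b \<in> Basis" for b
    by (rule conv_integrable[OF smooth_continuous_on[OF smooth_pd[OF K(1) that]] pd_support[OF K(2)] Fi[OF that c\<zeta>(1)]])
  have i2: "integrable lborel (\<lambda>z. K (y - z) * (pd b \<zeta> z * F b z))" if "b \<in> Basis" for b
    by (rule conv_integrable[OF cK K(2) Fi[OF that c\<zeta>(2)[OF that]]])
  have i3: "integrable lborel (\<lambda>z. K (y - z) * (\<zeta> z * h z))"
    by (rule conv_integrable[OF cK K(2) hi[OF c\<zeta>(1)]])
  have i4: "integrable lborel (\<lambda>z. K (y - z) * (\<Sum>b\<in>Basis. pd b \<zeta> z * F b z))"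
    unfolding sum_distrib_left by (intro Bochner_Integration.integrable_sum i2)
  have e1: "(LINT z|lborel. F b z * pd b \<psi> z) = conv K (\<lambda>z. pd b \<zeta> z * F b z) y - conv (pd b K) (\<lambda>z. \<zeta> z * F b z) y" if "b \<in> Basis" for b
  proof -
    have "(LINT z|lborel. F b z * pd b \<psi> z) = (LINT z|lborel. K (y - z) * (pd b \<zeta> z * F b z) - pd b K (y - z) * (\<zeta> z * F b z))"
      by (intro Bochner_Integration.integral_cong) (auto simp: pd\<psi> algebra_simps)
    also have "\<dots> = conv K (\<lambda>z. pd b \<zeta> z * F b z) y - conv (pd b K) (\<lambda>z. \<zeta> z * F b z) y"
      unfolding conv_def by (rule Bochner_Integration.integral_diff[OF i2[OF that] i1[OF that]])
    finally show ?thesis .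
  qed
  have "(\<Sum>b\<in>Basis. conv K (\<lambda>z. pd b \<zeta> z * F b z) y - conv (pd b K) (\<lambda>z. \<zeta> z * F b z) y) = - (LINT z|lborel. h z * \<psi> z)"
    using W[OF t] e1 by simp
  also have "(LINT z|lborel. h z * \<psi> z) = conv K (\<lambda>z. \<zeta> z * h z) y"
    unfolding conv_def by (intro Bochner_Integration.integral_cong) (auto simp: \<psi>eq)
  finally have "(\<Sum>b\<in>Basis. conv (pd b K) (\<lambda>z. \<zeta> z * F b z) y) = conv K (\<lambda>z. \<zeta> z * h z) y + (\<Sum>b\<in>Basis. conv K (\<lambda>z. pd b \<zeta> z * F b z) y)"
    by (simp add: sum_subtractf)
  also have "(\<Sum>b\<in>Basis. conv K (\<lambda>z. pd b \<zeta> z * F b z) y) = conv K (\<lambda>z. \<Sum>b\<in>Basis. pd b \<zeta> z * F b z) y"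
    using conv_sum_right[of Basis K y "\<lambda>b z. pd b \<zeta> z * F b z"] i2 by simp
  also have "conv K (\<lambda>z. \<zeta> z * h z) y + \<dots> = conv K (\<lambda>z. \<zeta> z * h z + (\<Sum>b\<in>Basis. pd b \<zeta> z * F b z)) y"
    unfolding conv_def distrib_left by (rule Bochner_Integration.integral_add[OF i3 i4, symmetric])
  finally show ?thesis .
qed

text \<open>
  In each chart the mollifier is centred at \<open>- t *\<^sub>R e\<close> with radius \<open>\<kappa> * t\<close>: by the cone property, the value at
  a point of \<open>Om\<close> then only depends on values inside \<open>Om\<close>, up to the boundary.
\<close>
lemma smoothing_operator:
  fixes Om :: "'a::euclidean_space set"
  assumes Om: "lipschitz_domain Om"
  shows "\<exists>R :: nat \<Rightarrow> ('a \<Rightarrow> real) \<Rightarrow> 'a \<Rightarrow> real.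
    (\<forall>n f. L2_on Om f \<longrightarrow> smooth (R n f)) \<and> (\<forall>n. R n (\<lambda>_. 0) = (\<lambda>_. 0)) \<and>
    (\<forall>f. L2_on Om f \<longrightarrow> (\<lambda>n. l2_norm (lebesgue_on Om) (\<lambda>x. R n f x - f x)) \<longlonglongrightarrow> 0) \<and>
    (\<forall>F h. (\<forall>b\<in>Basis. L2_on Om (F b)) \<longrightarrow> L2_on Om h \<longrightarrow>
       (\<forall>\<psi>. test_function Om \<psi> \<longrightarrow> (\<Sum>b\<in>Basis. LINT z|lborel. F b z * pd b \<psi> z) = - (LINT z|lborel. h z * \<psi> z)) \<longrightarrow>
       (\<lambda>n. l2_norm (lebesgue_on Om) (\<lambda>x. (\<Sum>b\<in>Basis. pd b (R n (F b)) x) - h x)) \<longlonglongrightarrow> 0)"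
proof -
  have o: "open Om" "bounded Om" and ob: "Om \<in> sets borel" using Om by (auto simp: lipschitz_domain_def)
  obtain X e \<kappa> r \<theta> where "finite_atlas Om X e \<kappa> r \<theta>"
    using lipschitz_domain_finite_atlas[OF Om] by blast
  then have X: "finite X" "X \<subseteq> closure Om" "\<And>x. x \<in> X \<Longrightarrow> cone_chart Om x (e x) (\<kappa> x) (r x)"
    "\<And>x. x \<in> X \<Longrightarrow> smooth (\<theta> x)" "\<And>x y. x \<in> X \<Longrightarrow> \<theta> x y \<noteq> 0 \<Longrightarrow> dist x y \<le> 2 / 3 * r x"
    "\<And>y. y \<in> closure Om \<Longrightarrow> \<exists>x\<in>X. \<theta> x y = 1"
    by (simp_all add: finite_atlas_def)
  have "\<exists>\<zeta>. (\<forall>x\<in>X. smooth (\<zeta> x) \<and> (\<forall>y. \<zeta> x y \<noteq> 0 \<longrightarrow> \<theta> x y \<noteq> 0)) \<and>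
      (\<forall>y. (\<Sum>x\<in>X. \<zeta> x y) = 1 - (\<Prod>x\<in>X. 1 - \<theta> x y))"
    by (rule smooth_partition[OF X(1)]) (rule X(4))
  then obtain \<zeta> where \<zeta>0: "(\<forall>x\<in>X. smooth (\<zeta> x) \<and> (\<forall>y. \<zeta> x y \<noteq> 0 \<longrightarrow> \<theta> x y \<noteq> 0)) \<and>
      (\<forall>y. (\<Sum>x\<in>X. \<zeta> x y) = 1 - (\<Prod>x\<in>X. 1 - \<theta> x y))" by (rule exE)
  then have \<zeta>: "smooth (\<zeta> x)" "\<zeta> x y \<noteq> 0 \<Longrightarrow> dist x y \<le> 2 / 3 * r x" if "x \<in> X" for x y
    using bspec[OF conjunct1[OF \<zeta>0] that] X(5)[OF that, of y] by simp_all
  have \<zeta>sum: "(\<Sum>x\<in>X. \<zeta> x y) = 1 - (\<Prod>x\<in>X. 1 - \<theta> x y)" for y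
    using conjunct2[OF \<zeta>0] by (rule spec)
  have \<zeta>1: "(\<Sum>x\<in>X. \<zeta> x y) = 1" if "y \<in> Om" for y
  proof -
    have "y \<in> closure Om" using that by (rule subsetD[OF closure_subset])
    then obtain x where "x \<in> X" "\<theta> x y = 1" by (rule bexE[OF X(6)])
    then have "(\<Prod>x\<in>X. 1 - \<theta> x y) = 0" using X(1) by (intro prod_zero) auto
    then show ?thesis using \<zeta>sum by simp
  qed
  have \<zeta>c: "continuous_on UNIV (\<zeta> x)" if "x \<in> X" for x using \<zeta>(1)[OF that] by (rule smooth_continuous_on)
  have \<zeta>pc: "continuous_on UNIV (pd b (\<zeta> x))" if "x \<in> X" "b \<in> Basis" for x b
    using smooth_pd[OF \<zeta>(1)[OF that(1)] that(2)] by (rule smooth_continuous_on)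
  have ch: "norm (e x) = 1" "0 < \<kappa> x" "\<kappa> x \<le> 1/2" "0 < r x" if "x \<in> X" for x
    using X(3)[OF that] by (auto simp: cone_chart_def)
  define t where "t n = 1 / real (Suc n)" for n
  have t: "0 < t n" for n by (auto simp: t_def)
  have t0: "t \<longlonglongrightarrow> 0" unfolding t_def by (rule LIMSEQ_Suc[OF lim_1_over_n])
  have t20: "(\<lambda>n. 2 * t n) \<longlonglongrightarrow> 0" using tendsto_mult[OF tendsto_const t0, of 2] by simp
  define K where "K x n = mollifier (- (t n *\<^sub>R e x)) (\<kappa> x * t n)" for x n
  have K: "kernel (2 * t n) (K x n)" if "x \<in> X" for x n
  proof -
    have "\<kappa> x * t n \<le> 1 * t n" using ch[OF that] t[of n] by (intro mult_right_mono) auto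
    then show ?thesis unfolding K_def by (intro kernel_mollifier) (use ch[OF that] t[of n] in auto)
  qed
  have Ks: "smooth (K x n)" "vanishes_outside (2 * t n) (K x n)" if "x \<in> X" for x n
    using K[OF that, of n] by (auto simp: kernel_def)
  \<comment> \<open>The function is localised before it is convolved, so that each piece meets only
    the kernel of its own chart.\<close>
  define R where "R n f y = (\<Sum>x\<in>X. conv (K x n) (\<lambda>z. \<zeta> x z * f z) y)" for n f y
  have li: "integrable lborel (\<lambda>z. \<zeta> x z * f z)" if "L2_on Om f" "x \<in> X" for f x
    by (rule L2_on_integrable[OF L2_on_mult[OF that(1) \<zeta>c[OF that(2)] o(2)] o(2)])
  have sc: "smooth (conv (K x n) (\<lambda>z. \<zeta> x z * f z))" if "L2_on Om f" "x \<in> X" for f x n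
    by (rule smooth_conv[OF Ks[OF that(2)] li[OF that]])
  have sR: "smooth (R n f)" if "L2_on Om f" for n f
    unfolding R_def[abs_def] by (intro smooth_sum sc that)
  \<comment> \<open>This allows the divergence statement to be used for fields with a single nonzero
    component, which turns it into a statement on partial derivatives.\<close>
  have R0: "R n (\<lambda>_. 0) = (\<lambda>_. 0)" for n by (auto simp: R_def conv_def)
  have lim_sum: "(\<lambda>n. l2_norm (lebesgue_on Om) (\<lambda>y. \<Sum>x\<in>X. conv (K x n) (g x) y - g x y)) \<longlonglongrightarrow> 0"
    if g: "\<And>x. x \<in> X \<Longrightarrow> L2_on Om (g x)" for g
  proof -
    have sq: "square_integrable (lebesgue_on Om) (\<lambda>y. conv (K x n) (g x) y - g x y)" if "x \<in> X" for x n
      by (intro square_integrable_diff square_integrable_lebesgue_on ob)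
        (use g[OF that] square_integrable_conv(1)[OF K[OF that] L2_on_integrable[OF g[OF that] o(2)]] in \<open>auto simp: L2_on_def\<close>)
    have "(\<lambda>n. \<Sum>x\<in>X. l2_norm (lebesgue_on Om) (\<lambda>y. conv (K x n) (g x) y - g x y)) \<longlonglongrightarrow> (\<Sum>x\<in>X. 0)"
      by (intro tendsto_sum conv_tendsto[OF g ob o(2) K t20])
    then have "(\<lambda>n. \<Sum>x\<in>X. l2_norm (lebesgue_on Om) (\<lambda>y. conv (K x n) (g x) y - g x y)) \<longlonglongrightarrow> 0"
      by (simp only: sum.neutral_const)
    from null_sequence_squeeze[OF l2_norm_nonneg l2_norm_sum[OF sq] this] show ?thesis .
  qed
  have dens: "(\<lambda>n. l2_norm (lebesgue_on Om) (\<lambda>x. R n f x - f x)) \<longlonglongrightarrow> 0" if f: "L2_on Om f" for f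
  proof -
    have "l2_norm (lebesgue_on Om) (\<lambda>x. R n f x - f x) =
        l2_norm (lebesgue_on Om) (\<lambda>y. \<Sum>x\<in>X. conv (K x n) (\<lambda>z. \<zeta> x z * f z) y - \<zeta> x y * f y)" for n
    proof (rule l2_norm_cong)
      fix y assume "y \<in> space (lebesgue_on Om)"
      then have "y \<in> Om" by (simp add: space_restrict_space)
      then show "norm (R n f y - f y) = norm (\<Sum>x\<in>X. conv (K x n) (\<lambda>z. \<zeta> x z * f z) y - \<zeta> x y * f y)"
        by (simp add: R_def sum_subtractf sum_distrib_right[symmetric] \<zeta>1)
    qed
    then show ?thesis using lim_sum[of "\<lambda>x z. \<zeta> x z * f z"] L2_on_mult[OF f \<zeta>c o(2)] by simp
  qed
  have div: "(\<lambda>n. l2_norm (lebesgue_on Om) (\<lambda>x. (\<Sum>b\<in>Basis. pd b (R n (F b)) x) - h x)) \<longlonglongrightarrow> 0"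
    if F: "\<forall>b\<in>Basis. L2_on Om (F b)" and h: "L2_on Om h"
      and W: "\<forall>\<psi>. test_function Om \<psi> \<longrightarrow> (\<Sum>b\<in>Basis. LINT z|lborel. F b z * pd b \<psi> z) = - (LINT z|lborel. h z * \<psi> z)" for F h
  proof -
    \<comment> \<open>The divergence of the localised field. The terms with derivatives of the
      cutoffs cancel in the sum over the charts, because the \<open>\<zeta> x\<close> add up to 1 on
      \<open>Om\<close>.\<close>
    define g where "g x z = \<zeta> x z * h z + (\<Sum>b\<in>Basis. pd b (\<zeta> x) z * F b z)" for x z
    have g: "L2_on Om (g x)" if "x \<in> X" for x
      unfolding g_def[abs_def] using that F h o(2) by (intro L2_on_add L2_on_sum L2_on_mult \<zeta>c \<zeta>pc) auto
    have gsum: "(\<Sum>x\<in>X. g x y) = h y" if y: "y \<in> Om" for y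
    proof -
      have "(\<Sum>x\<in>X. pd b (\<zeta> x) y) = 0" for b
      proof -
        have "(\<Sum>x\<in>X. pd b (\<zeta> x) y) = pd b (\<lambda>y. \<Sum>x\<in>X. \<zeta> x y) y"
          by (rule pd_sum[symmetric]) (use \<zeta>(1) smooth_differentiable in auto)
        also have "\<dots> = 0" by (rule pd_eq_0_of_const_on_open[OF o(1) y, where c = 1]) (rule \<zeta>1)
        finally show ?thesis .
      qed
      then have "(\<Sum>x\<in>X. \<Sum>b\<in>Basis. pd b (\<zeta> x) y * F b y) = 0"
        by (subst sum.swap) (simp add: sum_distrib_right[symmetric])
      then show ?thesis by (simp add: g_def sum.distrib sum_distrib_right[symmetric] \<zeta>1[OF y])
    qed
    \<comment> \<open>The kernels then have radius \<open>2 * t n\<close> below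
      \<open>r x / 3\<close>, the margin left by the cutoffs: a point whose average meets the
      support of \<open>\<zeta> x\<close> lies in the chart.\<close>
    have "\<forall>x\<in>X. \<forall>\<^sub>F n in sequentially. t n < r x / 6"
      using ch by (intro ballI order_tendstoD(2)[OF t0]) auto
    then have ev: "\<forall>\<^sub>F n in sequentially. \<forall>x\<in>X. t n < r x / 6" by (rule eventually_ball_finite[OF X(1)])
    have eq: "l2_norm (lebesgue_on Om) (\<lambda>y. \<Sum>x\<in>X. conv (K x n) (g x) y - g x y) =
        l2_norm (lebesgue_on Om) (\<lambda>x. (\<Sum>b\<in>Basis. pd b (R n (F b)) x) - h x)" if tn: "\<forall>x\<in>X. t n < r x / 6" for n
    proof (rule l2_norm_cong)
      fix y assume "y \<in> space (lebesgue_on Om)"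
      then have y: "y \<in> Om" by (simp add: space_restrict_space)
      have "(\<Sum>b\<in>Basis. pd b (R n (F b)) y) = (\<Sum>b\<in>Basis. \<Sum>x\<in>X. conv (pd b (K x n)) (\<lambda>z. \<zeta> x z * F b z) y)"
      proof (rule sum.cong[OF refl])
        fix b :: 'a assume b: "b \<in> Basis"
        have "pd b (R n (F b)) y = (\<Sum>x\<in>X. pd b (conv (K x n) (\<lambda>z. \<zeta> x z * F b z)) y)"
          unfolding R_def[abs_def] using sc F b by (intro pd_sum smooth_differentiable) auto
        also have "\<dots> = (\<Sum>x\<in>X. conv (pd b (K x n)) (\<lambda>z. \<zeta> x z * F b z) y)"
          using F b by (intro sum.cong refl) (simp add: pd_conv[OF Ks li])
        finally show "pd b (R n (F b)) y = (\<Sum>x\<in>X. conv (pd b (K x n)) (\<lambda>z. \<zeta> x z * F b z) y)" .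
      qed
      also have "\<dots> = (\<Sum>x\<in>X. \<Sum>b\<in>Basis. conv (pd b (K x n)) (\<lambda>z. \<zeta> x z * F b z) y)" by (rule sum.swap)
      also have "\<dots> = (\<Sum>x\<in>X. conv (K x n) (g x) y)"
      proof (rule sum.cong[OF refl])
        fix x assume x: "x \<in> X"
        show "(\<Sum>b\<in>Basis. conv (pd b (K x n)) (\<lambda>z. \<zeta> x z * F b z) y) = conv (K x n) (g x) y"
          unfolding g_def[abs_def]
        proof (rule conv_weak_div[OF o(2) Ks[OF x] \<zeta>(1)[OF x]])
          \<comment> \<open>The set over which the off-centre kernel averages at \<open>y\<close>;
            the cone condition puts it inside \<open>Om\<close>.\<close>
          let ?C = "cball (y + t n *\<^sub>R e x) (\<kappa> x * t n)"
          have inC: "z \<in> ?C" if "K x n (y - z) \<noteq> 0" for z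
          proof (rule ccontr)
            assume "z \<notin> ?C"
            then have "\<kappa> x * t n \<le> norm (y - z - - (t n *\<^sub>R e x))" by (simp add: dist_norm algebra_simps)
            moreover have "0 < \<kappa> x * t n" using ch[OF x] t[of n] by simp
            ultimately have "K x n (y - z) = 0" unfolding K_def by (intro mollifier_support) auto
            then show False using that by simp
          qed
          show "\<exists>C. compact C \<and> C \<subseteq> Om \<and> (\<forall>z. K x n (y - z) * \<zeta> x z \<noteq> 0 \<longrightarrow> z \<in> C)"
          proof (cases "\<exists>z. K x n (y - z) * \<zeta> x z \<noteq> 0")
            case True
            then obtain z where z: "K x n (y - z) \<noteq> 0" "\<zeta> x z \<noteq> 0" by auto
            have "dist x z \<le> 2 / 3 * r x" using \<zeta>(2)[OF x z(2)] .
            moreover have "norm (y - z) \<le> 2 * t n"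
              using z(1) vanishes_outsideD[OF Ks(2)[OF x, of n], of "y - z"] by (auto simp: not_less[symmetric])
            moreover have "dist x y \<le> dist x z + norm (y - z)" using dist_triangle2[of x y z] by (simp add: dist_norm)
            ultimately have "y \<in> ball x (r x)" using tn x ch(4)[OF x] by (simp add: field_simps) (smt (verit))
            then have "?C \<subseteq> Om"
              using y closure_subset tn x ch(4)[OF x] t[of n] by (intro cone_chart_inner[OF X(3)[OF x]]) force+
            then show ?thesis using inC by (intro exI[of _ ?C]) auto
          qed (intro exI[of _ "{}"], auto)
        qed (use F h W in auto)
      qed
      finally show "norm (\<Sum>x\<in>X. conv (K x n) (g x) y - g x y) = norm ((\<Sum>b\<in>Basis. pd b (R n (F b)) y) - h y)"
        by (simp add: sum_subtractf gsum[OF y])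
    qed
    show ?thesis
      by (rule Lim_transform_eventually[OF lim_sum[OF g]]) (use ev eq in \<open>auto elim: eventually_mono\<close>)
  qed
  show ?thesis
  proof (intro exI[of _ R] conjI)
    show "\<forall>n f. L2_on Om f \<longrightarrow> smooth (R n f)" using sR by simp
    show "\<forall>n. R n (\<lambda>_. 0) = (\<lambda>_. 0)" using R0 by simp
    show "\<forall>f. L2_on Om f \<longrightarrow> (\<lambda>n. l2_norm (lebesgue_on Om) (\<lambda>x. R n f x - f x)) \<longlonglongrightarrow> 0" using dens by simp
    show "\<forall>F h. (\<forall>b\<in>Basis. L2_on Om (F b)) \<longrightarrow> L2_on Om h \<longrightarrow>
       (\<forall>\<psi>. test_function Om \<psi> \<longrightarrow> (\<Sum>b\<in>Basis. LINT z|lborel. F b z * pd b \<psi> z) = - (LINT z|lborel. h z * \<psi> z)) \<longrightarrow>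
       (\<lambda>n. l2_norm (lebesgue_on Om) (\<lambda>x. (\<Sum>b\<in>Basis. pd b (R n (F b)) x) - h x)) \<longlonglongrightarrow> 0"
      using div by simp
  qed
qed

text \<open>A Lebesgue-measurable function agrees almost everywhere with a Borel one; cutting the
  latter off outside \<open>Om\<close> does not affect integrals over \<open>Om\<close>.\<close>

lemma L2_on_representative:
  fixes \<phi> :: "'a::euclidean_space \<Rightarrow> real"
  assumes \<phi>: "square_integrable (lebesgue_on Om) \<phi>" and Om: "Om \<in> sets borel"
  shows "\<exists>f. L2_on Om f \<and> (AE x in lebesgue_on Om. \<phi> x = f x)"
proof -
  have OmL: "Om \<in> sets lebesgue" using Om by simp
  have "(\<lambda>x. if x \<in> Om then \<phi> x else 0) \<in> borel_measurable lebesgue"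
    using \<phi> OmL by (simp add: borel_measurable_if square_integrable_def)
  then obtain g where g: "g \<in> borel_measurable lborel" "AE x in lborel. (if x \<in> Om then \<phi> x else 0) = g x"
    using completion_ex_borel_measurable_real by blast
  define f where "f x = indicator Om x * g x" for x
  have fm: "f \<in> borel_measurable borel" unfolding f_def[abs_def] using g(1) Om by measurable
  have "AE x in lebesgue. (if x \<in> Om then \<phi> x else 0) = g x" using g(2) by (rule AE_completion)
  then have ae: "AE x in lebesgue_on Om. \<phi> x = f x"
    using OmL by (subst AE_restrict_space_iff) (auto simp: f_def elim: eventually_mono)
  then have "square_integrable (lebesgue_on Om) f"
    by (rule square_integrable_cong_AE[OF \<phi> borel_measurable_lebesgue_on[OF fm]])
  then have "integrable (lebesgue_on Om) (\<lambda>x. (norm (f x))\<^sup>2)" by (simp add: square_integrable_def)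
  then have "integrable lebesgue (\<lambda>x. indicator Om x *\<^sub>R (norm (f x))\<^sup>2)"
    using OmL by (subst (asm) integrable_restrict_space) auto
  also have "(\<lambda>x. indicator Om x *\<^sub>R (norm (f x))\<^sup>2) = (\<lambda>x. (norm (f x))\<^sup>2)"
    by (auto simp: f_def indicator_def)
  finally have "integrable lborel (\<lambda>x. (norm (f x))\<^sup>2)"
    using fm by (subst (asm) integrable_completion) auto
  then have "L2_on Om f" using fm by (simp add: L2_on_def square_integrable_def f_def)
  then show ?thesis using ae by blast
qed

section \<open>Weak derivatives\<close>

lemma square_integrable_lebesgue_on_continuous:
  fixes g :: "'a::euclidean_space \<Rightarrow> real"
  assumes g: "continuous_on UNIV g" and Om: "Om \<in> sets borel" "bounded Om"
  shows "square_integrable (lebesgue_on Om) g"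
proof -
  have L: "L2_on Om (\<lambda>x. g x * (indicator Om x * 1))"
    by (rule L2_on_mult[OF _ g Om(2)]) (simp only: L2_on_def square_integrable_indicator[OF Om], simp)
  then have "square_integrable (lebesgue_on Om) (\<lambda>x. g x * (indicator Om x * 1))"
    by (intro square_integrable_lebesgue_on(1) Om) (simp only: L2_on_def)
  then show ?thesis
  proof (rule square_integrable_cong_AE)
    show "g \<in> borel_measurable (lebesgue_on Om)"
      by (intro borel_measurable_lebesgue_on borel_measurable_continuous_onI g)
    show "AE x in lebesgue_on Om. g x * (indicator Om x * 1) = g x"
      by (intro AE_I2) (simp add: space_restrict_space)
  qed
qed

lemma square_integrable_mult_continuous:
  fixes g f :: "'a::euclidean_space \<Rightarrow> real"
  assumes f: "square_integrable (lebesgue_on Om) f" and g: "continuous_on UNIV g" and Om: "bounded Om"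
  shows "square_integrable (lebesgue_on Om) (\<lambda>x. g x * f x)"
proof -
  obtain R where R: "\<And>x. x \<in> Om \<Longrightarrow> norm x \<le> R" using Om by (auto simp: bounded_iff)
  obtain B where B: "\<forall>y\<in>cball 0 R. norm (g y) \<le> B"
    using continuous_bounded_on_compact[OF g compact_cball] by blast
  have [measurable]: "f \<in> borel_measurable (lebesgue_on Om)" "g \<in> borel_measurable (lebesgue_on Om)"
    using f g by (auto simp: square_integrable_def intro: borel_measurable_lebesgue_on borel_measurable_continuous_onI)
  show ?thesis
  proof (rule square_integrable_dominated[OF f])
    show "(\<lambda>x. g x * f x) \<in> borel_measurable (lebesgue_on Om)" by measurable
    show "AE x in lebesgue_on Om. norm (g x * f x) \<le> B * norm (f x)"
    proof (intro AE_I2)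
      fix x assume "x \<in> space (lebesgue_on Om)"
      then have "norm (g x) \<le> B" using B R by (simp add: space_restrict_space)
      then show "norm (g x * f x) \<le> B * norm (f x)" by (simp add: abs_mult mult_right_mono)
    qed
  qed
qed

lemma integral_representative:
  assumes ae: "AE x in lebesgue_on Om. \<phi> x = f x" and \<phi>: "square_integrable (lebesgue_on Om) \<phi>"
    and f: "L2_on Om f" and g: "continuous_on UNIV g" and Om: "Om \<in> sets borel"
  shows "(LINT x|lebesgue_on Om. \<phi> x * g x) = (LINT x|lborel. f x * g x)"
proof -
  have [measurable]: "f \<in> borel_measurable borel" "g \<in> borel_measurable borel"
    using f g by (auto intro: L2_on_measurable borel_measurable_continuous_onI)
  have m: "f \<in> borel_measurable (lebesgue_on Om)" "g \<in> borel_measurable (lebesgue_on Om)"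
    by (auto intro!: borel_measurable_lebesgue_on)
  have "(LINT x|lebesgue_on Om. \<phi> x * g x) = (LINT x|lebesgue_on Om. f x * g x)"
    by (rule integral_cong_AE) (use \<phi> m ae in \<open>auto simp: square_integrable_def intro!: borel_measurable_times elim: eventually_mono\<close>)
  also have "\<dots> = (LINT x|lborel. indicator Om x *\<^sub>R (f x * g x))"
    by (rule integral_lebesgue_on_borel[OF _ Om]) measurable
  also have "\<dots> = (LINT x|lborel. f x * g x)"
    using f by (intro Bochner_Integration.integral_cong) (auto simp: L2_on_def indicator_def)
  finally show ?thesis .
qed

text \<open>The squared increments weighted by \<open>2 ^ k\<close> have a finite total integral, so
  the weighted series converges almost everywhere. There the increments decay like powers of
  \<open>sqrt (1/2)\<close> and are summable.\<close>

lemma l2_Cauchy_subsequence_limit: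
  fixes F :: "nat \<Rightarrow> 'a \<Rightarrow> real"
  assumes F: "\<And>n. square_integrable M (F n)"
    and step: "\<And>k. l2_norm M (\<lambda>x. F (Suc k) x - F k x) \<le> (1/2) ^ k"
  obtains f where "f \<in> borel_measurable M" "AE x in M. (\<lambda>k. F k x) \<longlonglongrightarrow> f x"
proof -
  have [measurable]: "F n \<in> borel_measurable M" for n using F by (simp add: square_integrable_def)
  define d where "d k x = F (Suc k) x - F k x" for k x
  have ds: "square_integrable M (d k)" for k unfolding d_def[abs_def] by (intro square_integrable_diff F)
  have [measurable]: "d k \<in> borel_measurable M" for k unfolding d_def[abs_def] by measurable
  have "(\<integral>\<^sup>+x. (\<Sum>k. ennreal (2 ^ k * (d k x)\<^sup>2)) \<partial>M) = (\<Sum>k. \<integral>\<^sup>+x. ennreal (2 ^ k * (d k x)\<^sup>2) \<partial>M)"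
    by (rule nn_integral_suminf) measurable
  also have "\<dots> \<le> (\<Sum>k. ennreal ((1/2) ^ k))"
  proof (rule suminf_le)
    fix k
    have "(\<integral>\<^sup>+x. ennreal (2 ^ k * (d k x)\<^sup>2) \<partial>M) = ennreal (2 ^ k) * (\<integral>\<^sup>+x. ennreal ((norm (d k x))\<^sup>2) \<partial>M)"
      by (simp add: ennreal_mult nn_integral_cmult)
    also have "\<dots> = ennreal (2 ^ k * (l2_norm M (d k))\<^sup>2)"
      unfolding nn_integral_power2_l2[OF ds] by (rule ennreal_mult[symmetric]) auto
    also have "\<dots> \<le> ennreal ((1/2) ^ k)"
    proof (rule ennreal_leI)
      have "(l2_norm M (d k))\<^sup>2 \<le> ((1/2) ^ k)\<^sup>2"
        unfolding d_def[abs_def] by (intro power_mono step) simp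
      then have "2 ^ k * (l2_norm M (d k))\<^sup>2 \<le> 2 ^ k * ((1/2) ^ k)\<^sup>2" by (intro mult_left_mono) auto
      also have "\<dots> = (1/2) ^ k" by (simp add: power2_eq_square power_divide)
      finally show "2 ^ k * (l2_norm M (d k))\<^sup>2 \<le> (1/2) ^ k" .
    qed
    finally show "(\<integral>\<^sup>+x. ennreal (2 ^ k * (d k x)\<^sup>2) \<partial>M) \<le> ennreal ((1/2) ^ k)" .
  qed auto
  also have "(\<Sum>k. ennreal ((1/2) ^ k)) = ennreal (\<Sum>k. (1/2) ^ k)"
    by (rule suminf_ennreal2) (auto intro: summable_geometric)
  finally have fin: "(\<integral>\<^sup>+x. (\<Sum>k. ennreal (2 ^ k * (d k x)\<^sup>2)) \<partial>M) \<noteq> \<infinity>"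
    by (auto simp: top_unique)
  have "AE x in M. (\<Sum>k. ennreal (2 ^ k * (d k x)\<^sup>2)) \<noteq> \<infinity>"
    by (rule nn_integral_PInf_AE[OF _ fin]) measurable
  then have conv: "AE x in M. convergent (\<lambda>k. F k x)"
  proof eventually_elim
    case (elim x)
    define S where "S = enn2real (\<Sum>k. ennreal (2 ^ k * (d k x)\<^sup>2))"
    have S: "(\<Sum>k. ennreal (2 ^ k * (d k x)\<^sup>2)) = ennreal S" "0 \<le> S"
      using elim by (auto simp: S_def less_top)
    have bd: "\<bar>d k x\<bar> \<le> sqrt S * (sqrt (1/2)) ^ k" for k
    proof -
      have "ennreal (2 ^ k * (d k x)\<^sup>2) \<le> ennreal S"
        using sum_le_suminf[of "\<lambda>k. ennreal (2 ^ k * (d k x)\<^sup>2)" "{k}"] S(1) by simp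
      then have "2 ^ k * (d k x)\<^sup>2 \<le> S" using S(2) by simp
      then have "(d k x)\<^sup>2 \<le> S * (1/2) ^ k" by (simp add: power_divide pos_le_divide_eq mult.commute)
      then have "sqrt ((d k x)\<^sup>2) \<le> sqrt (S * (1/2) ^ k)" by (rule real_sqrt_le_mono)
      then have "\<bar>d k x\<bar> \<le> sqrt (S * (1/2) ^ k)" by (simp only: real_sqrt_abs)
      then show ?thesis by (simp only: real_sqrt_mult real_sqrt_power)
    qed
    have "summable (\<lambda>k. sqrt S * (sqrt (1/2)) ^ k)"
      by (intro summable_mult summable_geometric) (simp add: real_sqrt_divide)
    then have "summable (\<lambda>k. d k x)" by (rule summable_comparison_test'[where N = 0]) (use bd in simp)
    then have "convergent (\<lambda>n. \<Sum>k<n. d k x)" by (simp add: summable_iff_convergent)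
    moreover have "(\<Sum>k<n. d k x) = F n x - F 0 x" for n
      unfolding d_def by (rule sum_lessThan_telescope)
    ultimately have "convergent (\<lambda>n. F n x - F 0 x)" by simp
    then have "convergent (\<lambda>n. (F n x - F 0 x) + F 0 x)" by (intro convergent_add convergent_const)
    then show ?case by simp
  qed
  show ?thesis
  proof (rule that[of "\<lambda>x. lim (\<lambda>k. F k x)"])
    show "(\<lambda>x. lim (\<lambda>k. F k x)) \<in> borel_measurable M" by measurable
    show "AE x in M. (\<lambda>k. F k x) \<longlonglongrightarrow> lim (\<lambda>k. F k x)"
      using conv by eventually_elim (simp add: convergent_LIMSEQ_iff)
  qed
qed

text \<open>The Riesz-Fischer theorem: a fast subsequence converges almost everywhere, and Fatou's
  lemma upgrades this to convergence in norm of the whole sequence.\<close>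

lemma l2_complete:
  fixes F :: "nat \<Rightarrow> 'a \<Rightarrow> real"
  assumes F: "\<And>n. square_integrable M (F n)"
    and cauchy: "\<And>\<epsilon>. 0 < \<epsilon> \<Longrightarrow> \<exists>N. \<forall>m\<ge>N. \<forall>n\<ge>N. l2_norm M (\<lambda>x. F m x - F n x) \<le> \<epsilon>"
  shows "\<exists>f. square_integrable M f \<and> (\<lambda>n. l2_norm M (\<lambda>x. F n x - f x)) \<longlonglongrightarrow> 0"
proof -
  have "\<forall>k. \<exists>N. \<forall>m\<ge>N. \<forall>n\<ge>N. l2_norm M (\<lambda>x. F m x - F n x) \<le> (1/2) ^ k"
    using cauchy by simp
  then obtain N where N: "\<And>k m n. m \<ge> N k \<Longrightarrow> n \<ge> N k \<Longrightarrow> l2_norm M (\<lambda>x. F m x - F n x) \<le> (1/2) ^ k" by metis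
  \<comment> \<open>Summing makes the indices monotone and at least \<open>N k\<close>; the extra
    \<open>k\<close> makes them unbounded.\<close>
  define s where "s k = (\<Sum>j\<le>k. N j) + k" for k
  have s: "N k \<le> s k" "s k \<le> s (Suc k)" "k \<le> s k" for k
    by (auto simp: s_def intro: trans_le_add1 member_le_sum)
  have st: "l2_norm M (\<lambda>x. F (s (Suc k)) x - F (s k) x) \<le> (1/2) ^ k" for k
    using s[of k] by (intro N) auto
  obtain f where f: "f \<in> borel_measurable M" "AE x in M. (\<lambda>k. F (s k) x) \<longlonglongrightarrow> f x"
    by (rule l2_Cauchy_subsequence_limit[of M "\<lambda>k. F (s k)", OF F st])
  have [measurable]: "F n \<in> borel_measurable M" for n using F by (simp add: square_integrable_def)
  note f(1) [measurable]
  have bound: "square_integrable M (\<lambda>x. F n x - f x) \<and> l2_norm M (\<lambda>x. F n x - f x) \<le> \<epsilon>"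
    if "0 < \<epsilon>" and NN: "\<And>m. m \<ge> K \<Longrightarrow> l2_norm M (\<lambda>x. F n x - F m x) \<le> \<epsilon>" for n K \<epsilon>
  proof -
    have "(\<integral>\<^sup>+x. ennreal ((norm (F n x - f x))\<^sup>2) \<partial>M) = (\<integral>\<^sup>+x. liminf (\<lambda>k. ennreal ((norm (F n x - F (s k) x))\<^sup>2)) \<partial>M)"
    proof (rule nn_integral_cong_AE)
      show "AE x in M. ennreal ((norm (F n x - f x))\<^sup>2) = liminf (\<lambda>k. ennreal ((norm (F n x - F (s k) x))\<^sup>2))"
        using f(2)
      proof eventually_elim
        case (elim x)
        have "(\<lambda>k. ennreal ((norm (F n x - F (s k) x))\<^sup>2)) \<longlonglongrightarrow> ennreal ((norm (F n x - f x))\<^sup>2)"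
          by (intro tendsto_ennrealI tendsto_intros elim)
        then have "liminf (\<lambda>k. ennreal ((norm (F n x - F (s k) x))\<^sup>2)) = ennreal ((norm (F n x - f x))\<^sup>2)"
          by (intro lim_imp_Liminf sequentially_bot)
        then show ?case by (rule sym)
      qed
    qed
    also have "\<dots> \<le> liminf (\<lambda>k. \<integral>\<^sup>+x. ennreal ((norm (F n x - F (s k) x))\<^sup>2) \<partial>M)"
      by (rule nn_integral_liminf) measurable
    also have "\<dots> \<le> ennreal (\<epsilon>\<^sup>2)"
    proof (rule Liminf_le)
      show "\<forall>\<^sub>F k in sequentially. (\<integral>\<^sup>+x. ennreal ((norm (F n x - F (s k) x))\<^sup>2) \<partial>M) \<le> ennreal (\<epsilon>\<^sup>2)"
        unfolding eventually_sequentially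
      proof (intro exI[of _ K] allI impI)
        fix k assume "K \<le> k"
        then have "l2_norm M (\<lambda>x. F n x - F (s k) x) \<le> \<epsilon>" using s(3)[of k] by (intro NN) simp
        then show "(\<integral>\<^sup>+x. ennreal ((norm (F n x - F (s k) x))\<^sup>2) \<partial>M) \<le> ennreal (\<epsilon>\<^sup>2)"
          by (subst nn_integral_power2_l2[OF square_integrable_diff[OF F F]]) (intro ennreal_leI power_mono, auto)
      qed
    qed simp
    finally have le: "(\<integral>\<^sup>+x. ennreal ((norm (F n x - f x))\<^sup>2) \<partial>M) \<le> ennreal (\<epsilon>\<^sup>2)" .
    have m: "(\<lambda>x. F n x - f x) \<in> borel_measurable M" by measurable
    show ?thesis using square_integrable_l2_norm_leI[OF m le] that(1) by simp
  qed
  obtain N1 where N1: "\<And>m n. m \<ge> N1 \<Longrightarrow> n \<ge> N1 \<Longrightarrow> l2_norm M (\<lambda>x. F m x - F n x) \<le> 1"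
    using cauchy[of 1] by auto
  have "square_integrable M (\<lambda>x. F N1 x - f x)" using bound[of 1 N1 N1] N1 by simp
  from square_integrable_diff[OF F[of N1] this] have fs: "square_integrable M f" by simp
  have "(\<lambda>n. l2_norm M (\<lambda>x. F n x - f x)) \<longlonglongrightarrow> 0"
  proof (rule LIMSEQ_I)
    fix \<epsilon> :: real assume \<epsilon>: "0 < \<epsilon>"
    then obtain K where K: "\<And>m n. m \<ge> K \<Longrightarrow> n \<ge> K \<Longrightarrow> l2_norm M (\<lambda>x. F m x - F n x) \<le> \<epsilon> / 2"
      using cauchy[of "\<epsilon> / 2"] by auto
    have "norm (l2_norm M (\<lambda>x. F n x - f x) - 0) < \<epsilon>" if "n \<ge> K" for n
      using bound[of "\<epsilon> / 2" K n] K that \<epsilon> by simp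
    then show "\<exists>no. \<forall>n\<ge>no. norm (l2_norm M (\<lambda>x. F n x - f x) - 0) < \<epsilon>" by blast
  qed
  then show ?thesis using fs by blast
qed

section \<open>Uniqueness and smooth approximation of weak derivatives\<close>

lemma test_function_smooth: "test_function Om \<psi> \<Longrightarrow> smooth \<psi>"
  by (simp add: test_function_def)

lemma test_function_mult:
  assumes g: "smooth g" and \<psi>: "test_function Om \<psi>"
  shows "test_function Om (\<lambda>x. g x * \<psi> x)"
proof -
  have sub: "closure {x. g x * \<psi> x \<noteq> 0} \<subseteq> closure {x. \<psi> x \<noteq> 0}" by (intro closure_mono) auto
  have "bounded (closure {x. \<psi> x \<noteq> 0})" using \<psi> by (simp add: test_function_def compact_imp_bounded)
  then have "bounded (closure {x. g x * \<psi> x \<noteq> 0})" using sub by (rule bounded_subset)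
  then have "compact (closure {x. g x * \<psi> x \<noteq> 0})" by (simp add: compact_eq_bounded_closed)
  then show ?thesis using sub \<psi> g by (auto simp: test_function_def intro: smooth_mult)
qed

lemma inner_grad_sum: "(v::'a::euclidean_space) \<bullet> grad \<psi> x = (\<Sum>b\<in>Basis. (v \<bullet> b) * pd b \<psi> x)"
  by (subst euclidean_inner) (simp add: grad_inner_Basis)

lemma square_integrable_smooth:
  assumes "smooth (g :: 'a::euclidean_space \<Rightarrow> real)" "Om \<in> sets borel" "bounded Om"
  shows "square_integrable (lebesgue_on Om) g"
  by (intro square_integrable_lebesgue_on_continuous smooth_continuous_on assms)

lemma square_integrable_grad:
  assumes "smooth (g :: 'a::euclidean_space \<Rightarrow> real)" "Om \<in> sets borel" "bounded Om"
  shows "square_integrable (lebesgue_on Om) (grad g)"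
  unfolding grad_eq_pd[abs_def]
  by (intro square_integrable_from_components square_integrable_smooth smooth_pd assms)

lemma weak_grad_component:
  fixes Om :: "'a::euclidean_space set"
  assumes Om: "Om \<in> sets borel" "bounded Om" and \<phi>: "square_integrable (lebesgue_on Om) \<phi>"
    and G: "square_integrable (lebesgue_on Om) G" and w: "has_weak_grad Om \<phi> G"
    and \<psi>: "test_function Om \<psi>" and b: "b \<in> Basis"
  shows "(LINT x|lebesgue_on Om. \<phi> x * pd b \<psi> x) = - (LINT x|lebesgue_on Om. (G x \<bullet> b) * \<psi> x)"
proof -
  note s = test_function_smooth[OF \<psi>]
  note i1 = integrable_scaleR_l2[OF \<phi> square_integrable_grad[OF s Om]]
    and i2 = integrable_scaleR_l2[OF square_integrable_smooth[OF s Om] G]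
  have "(LINT x|lebesgue_on Om. \<phi> x * pd b \<psi> x) = (LINT x|lebesgue_on Om. (\<phi> x *\<^sub>R grad \<psi> x) \<bullet> b)"
    by (simp add: grad_inner_Basis[OF b])
  also have "\<dots> = (LINT x|lebesgue_on Om. \<phi> x *\<^sub>R grad \<psi> x) \<bullet> b" by (rule integral_inner_left) (use i1 in simp)
  also have "\<dots> = - ((LINT x|lebesgue_on Om. \<psi> x *\<^sub>R G x) \<bullet> b)" using w \<psi> by (simp add: has_weak_grad_def)
  also have "(LINT x|lebesgue_on Om. \<psi> x *\<^sub>R G x) \<bullet> b = (LINT x|lebesgue_on Om. (\<psi> x *\<^sub>R G x) \<bullet> b)"
    by (rule integral_inner_left[symmetric]) (use i2 in simp)
  finally show ?thesis by (simp add: mult.commute)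
qed

context
  fixes Om :: "'a::euclidean_space set"
  assumes lip: "lipschitz_domain Om"
begin

lemma Om_facts: "open Om" "bounded Om" "Om \<in> sets borel" "Om \<noteq> {}"
  using lip by (auto simp: lipschitz_domain_def)

text \<open>The approximating fields are chosen before the weak divergence \<open>h\<close>: the
  same sequence works for every \<open>h\<close>, and this yields uniqueness.\<close>

lemma weak_div_smooth_approx:
  assumes \<sigma>: "square_integrable (lebesgue_on Om) \<sigma>"
  shows "\<exists>S :: nat \<Rightarrow> 'a \<Rightarrow> 'a \<Rightarrow> real. (\<forall>n. \<forall>b\<in>Basis. smooth (S n b)) \<and>
    (\<forall>b\<in>Basis. (\<lambda>n. l2_norm (lebesgue_on Om) (\<lambda>x. S n b x - \<sigma> x \<bullet> b)) \<longlonglongrightarrow> 0) \<and>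
    (\<forall>h. square_integrable (lebesgue_on Om) h \<longrightarrow> has_weak_div Om \<sigma> h \<longrightarrow>
       (\<lambda>n. l2_norm (lebesgue_on Om) (\<lambda>x. (\<Sum>b\<in>Basis. pd b (S n b) x) - h x)) \<longlonglongrightarrow> 0)"
proof -
  let ?M = "lebesgue_on Om"
  obtain R :: "nat \<Rightarrow> ('a \<Rightarrow> real) \<Rightarrow> 'a \<Rightarrow> real" where
    R: "\<forall>n f. L2_on Om f \<longrightarrow> smooth (R n f)"
      "\<forall>f. L2_on Om f \<longrightarrow> (\<lambda>n. l2_norm ?M (\<lambda>x. R n f x - f x)) \<longlonglongrightarrow> 0"
      "\<forall>F h. (\<forall>b\<in>Basis. L2_on Om (F b)) \<longrightarrow> L2_on Om h \<longrightarrow>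
       (\<forall>\<psi>. test_function Om \<psi> \<longrightarrow> (\<Sum>b\<in>Basis. LINT z|lborel. F b z * pd b \<psi> z) = - (LINT z|lborel. h z * \<psi> z)) \<longrightarrow>
       (\<lambda>n. l2_norm ?M (\<lambda>x. (\<Sum>b\<in>Basis. pd b (R n (F b)) x) - h x)) \<longlonglongrightarrow> 0"
    using smoothing_operator[OF lip] by (elim exE conjE) simp
  have "\<exists>f. L2_on Om f \<and> (AE x in ?M. \<sigma> x \<bullet> b = f x)" for b
    by (rule L2_on_representative[OF square_integrable_component[OF \<sigma>] Om_facts(3)])
  then obtain F where F: "\<And>b. L2_on Om (F b)" "\<And>b. AE x in ?M. \<sigma> x \<bullet> b = F b x" by metis
  have Fm: "F b \<in> borel_measurable ?M" for b by (rule borel_measurable_lebesgue_on[OF L2_on_measurable[OF F(1)]])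
  have sm: "R n f \<in> borel_measurable ?M" if "L2_on Om f" for n f
    using R(1) that by (intro borel_measurable_lebesgue_on smooth_borel_measurable) auto
  show ?thesis
  proof (intro exI[of _ "\<lambda>n b. R n (F b)"] conjI allI ballI impI)
    show "smooth (R n (F b))" for n b using R(1) F(1) by blast
    fix b :: 'a
    have "l2_norm ?M (\<lambda>x. R n (F b) x - \<sigma> x \<bullet> b) = l2_norm ?M (\<lambda>x. R n (F b) x - F b x)" for n
      by (rule l2_norm_cong_AE)
        (use F(2)[of b] Fm sm[OF F(1)] square_integrable_measurable[OF square_integrable_component[OF \<sigma>]] in
          \<open>auto intro!: borel_measurable_diff elim: eventually_mono\<close>)
    then show "(\<lambda>n. l2_norm ?M (\<lambda>x. R n (F b) x - \<sigma> x \<bullet> b)) \<longlonglongrightarrow> 0"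
      using R(2) F(1)[of b] by simp
  next
    fix h assume h: "square_integrable ?M h" and w: "has_weak_div Om \<sigma> h"
    obtain h' where h': "L2_on Om h'" "AE x in ?M. h x = h' x"
      using L2_on_representative[OF h Om_facts(3)] by blast
    have W: "(\<Sum>b\<in>Basis. LINT z|lborel. F b z * pd b \<psi> z) = - (LINT z|lborel. h' z * \<psi> z)" if \<psi>: "test_function Om \<psi>" for \<psi>
    proof -
      note s = test_function_smooth[OF \<psi>]
      have "(\<Sum>b\<in>Basis. LINT z|lborel. F b z * pd b \<psi> z) = (\<Sum>b\<in>Basis. LINT x|?M. (\<sigma> x \<bullet> b) * pd b \<psi> x)"
        by (intro sum.cong refl integral_representative[symmetric] F square_integrable_component \<sigma> smooth_continuous_on smooth_pd s Om_facts)
      also have "\<dots> = (LINT x|?M. (\<Sum>b\<in>Basis. (\<sigma> x \<bullet> b) * pd b \<psi> x))"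
        by (rule Bochner_Integration.integral_sum[symmetric])
          (intro square_integrable_times square_integrable_component \<sigma> square_integrable_smooth smooth_pd s Om_facts)
      also have "\<dots> = (LINT x|?M. \<sigma> x \<bullet> grad \<psi> x)" by (simp add: inner_grad_sum)
      also have "\<dots> = - (LINT x|?M. h x * \<psi> x)" using w \<psi> by (simp add: has_weak_div_def)
      also have "(LINT x|?M. h x * \<psi> x) = (LINT z|lborel. h' z * \<psi> z)"
        by (rule integral_representative[OF h'(2) h h'(1) smooth_continuous_on[OF s] Om_facts(3)])
      finally show ?thesis .
    qed
    have "(\<lambda>n. l2_norm ?M (\<lambda>x. (\<Sum>b\<in>Basis. pd b (R n (F b)) x) - h' x)) \<longlonglongrightarrow> 0"
      using R(3) F(1) h'(1) W by blast
    moreover have "l2_norm ?M (\<lambda>x. (\<Sum>b\<in>Basis. pd b (R n (F b)) x) - h' x) = l2_norm ?M (\<lambda>x. (\<Sum>b\<in>Basis. pd b (R n (F b)) x) - h x)" for n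
    proof (rule l2_norm_cong_AE)
      have "(\<lambda>x. \<Sum>b\<in>Basis. pd b (R n (F b)) x) \<in> borel_measurable ?M"
        using R(1) F(1) by (intro borel_measurable_sum borel_measurable_lebesgue_on smooth_borel_measurable smooth_pd) auto
      then show "(\<lambda>x. (\<Sum>b\<in>Basis. pd b (R n (F b)) x) - h' x) \<in> borel_measurable ?M"
        "(\<lambda>x. (\<Sum>b\<in>Basis. pd b (R n (F b)) x) - h x) \<in> borel_measurable ?M"
        using square_integrable_measurable[OF h] borel_measurable_lebesgue_on[OF L2_on_measurable[OF h'(1)]]
        by (auto intro!: borel_measurable_diff)
    qed (use h'(2) in \<open>auto elim: eventually_mono\<close>)
    ultimately show "(\<lambda>n. l2_norm ?M (\<lambda>x. (\<Sum>b\<in>Basis. pd b (R n (F b)) x) - h x)) \<longlonglongrightarrow> 0" by simp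
  qed
qed

text \<open>Both functions are the limit of the same sequence of smooth divergences, which avoids a
  separate density result for test functions.\<close>

lemma weak_div_unique:
  assumes \<sigma>: "square_integrable (lebesgue_on Om) \<sigma>"
    and h: "square_integrable (lebesgue_on Om) h" "has_weak_div Om \<sigma> h"
    and h': "square_integrable (lebesgue_on Om) h'" "has_weak_div Om \<sigma> h'"
  shows "AE x in lebesgue_on Om. h x = h' x"
proof -
  let ?M = "lebesgue_on Om"
  obtain S :: "nat \<Rightarrow> 'a \<Rightarrow> 'a \<Rightarrow> real" where S: "\<forall>n. \<forall>b\<in>Basis. smooth (S n b)"
    "\<forall>h. square_integrable ?M h \<longrightarrow> has_weak_div Om \<sigma> h \<longrightarrow>
       (\<lambda>n. l2_norm ?M (\<lambda>x. (\<Sum>b\<in>Basis. pd b (S n b) x) - h x)) \<longlonglongrightarrow> 0"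
    using weak_div_smooth_approx[OF \<sigma>] by (elim exE conjE) simp
  have "square_integrable ?M (\<lambda>x. \<Sum>b\<in>Basis. pd b (S n b) x)" for n
    using S(1) by (intro square_integrable_sum square_integrable_smooth smooth_pd Om_facts) auto
  then show ?thesis
    by (rule l2_norm_limit_unique[OF _ h(1) h'(1)]) (use S(2) h h' in auto)
qed

text \<open>A partial derivative is the divergence of a field pointing in one direction, so facts on
  weak divergences pass to weak gradients.\<close>

lemma weak_grad_imp_weak_div:
  assumes \<phi>: "square_integrable (lebesgue_on Om) \<phi>" and G: "square_integrable (lebesgue_on Om) G"
    and w: "has_weak_grad Om \<phi> G" and b: "b \<in> Basis"
  shows "has_weak_div Om (\<lambda>x. \<phi> x *\<^sub>R b) (\<lambda>x. G x \<bullet> b)"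
  unfolding has_weak_div_def
proof (intro allI impI)
  fix \<psi> assume "test_function Om \<psi>"
  then show "(LINT x|lebesgue_on Om. (\<phi> x *\<^sub>R b) \<bullet> grad \<psi> x) = - (LINT x|lebesgue_on Om. G x \<bullet> b * \<psi> x)"
    using weak_grad_component[OF Om_facts(3,2) \<phi> G w _ b, of \<psi>] grad_inner_Basis[OF b, of \<psi>]
    by (simp add: inner_commute[of b])
qed

lemma weak_grad_unique:
  assumes \<phi>: "square_integrable (lebesgue_on Om) \<phi>"
    and G: "square_integrable (lebesgue_on Om) G" "has_weak_grad Om \<phi> G"
    and G': "square_integrable (lebesgue_on Om) G'" "has_weak_grad Om \<phi> G'"
  shows "AE x in lebesgue_on Om. G x = G' x"
proof -
  have "AE x in lebesgue_on Om. G x \<bullet> b = G' x \<bullet> b" if b: "b \<in> Basis" for b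
    by (rule weak_div_unique[OF square_integrable_scaleR_vector[OF \<phi>, of b]])
      (intro square_integrable_component G G' weak_grad_imp_weak_div \<phi> b)+
  then have "AE x in lebesgue_on Om. \<forall>b\<in>Basis. G x \<bullet> b = G' x \<bullet> b" by (intro AE_finite_allI) auto
  then show ?thesis by (auto simp: euclidean_eq_iff[where 'a='a] elim: eventually_mono)
qed

text \<open>The smoothing operator acts on a field whose only nonzero component is the function
  itself. The smoothed function does not depend on which component that is, so one sequence serves
  all partial derivatives.\<close>

lemma weak_grad_smooth_approx:
  assumes \<phi>: "square_integrable (lebesgue_on Om) \<phi>" and G: "square_integrable (lebesgue_on Om) G"
    and w: "has_weak_grad Om \<phi> G"
  shows "\<exists>\<Phi> :: nat \<Rightarrow> 'a \<Rightarrow> real. (\<forall>n. smooth (\<Phi> n)) \<and>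
    (\<lambda>n. l2_norm (lebesgue_on Om) (\<lambda>x. \<Phi> n x - \<phi> x)) \<longlonglongrightarrow> 0 \<and>
    (\<lambda>n. l2_norm (lebesgue_on Om) (\<lambda>x. grad (\<Phi> n) x - G x)) \<longlonglongrightarrow> 0"
proof -
  let ?M = "lebesgue_on Om"
  obtain R :: "nat \<Rightarrow> ('a \<Rightarrow> real) \<Rightarrow> 'a \<Rightarrow> real" where
    R: "\<forall>n f. L2_on Om f \<longrightarrow> smooth (R n f)" "\<forall>n. R n (\<lambda>_. 0) = (\<lambda>_. 0)"
      "\<forall>f. L2_on Om f \<longrightarrow> (\<lambda>n. l2_norm ?M (\<lambda>x. R n f x - f x)) \<longlonglongrightarrow> 0"
      "\<forall>F h. (\<forall>b\<in>Basis. L2_on Om (F b)) \<longrightarrow> L2_on Om h \<longrightarrow>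
       (\<forall>\<psi>. test_function Om \<psi> \<longrightarrow> (\<Sum>b\<in>Basis. LINT z|lborel. F b z * pd b \<psi> z) = - (LINT z|lborel. h z * \<psi> z)) \<longrightarrow>
       (\<lambda>n. l2_norm ?M (\<lambda>x. (\<Sum>b\<in>Basis. pd b (R n (F b)) x) - h x)) \<longlonglongrightarrow> 0"
    using smoothing_operator[OF lip] by (elim exE conjE) simp
  obtain f where f: "L2_on Om f" "AE x in ?M. \<phi> x = f x"
    using L2_on_representative[OF \<phi> Om_facts(3)] by blast
  have s: "smooth (R n f)" for n using R(1) f(1) by blast
  have fm: "f \<in> borel_measurable ?M" by (rule borel_measurable_lebesgue_on[OF L2_on_measurable[OF f(1)]])
  have Rm: "R n f \<in> borel_measurable ?M" for n by (intro borel_measurable_lebesgue_on smooth_borel_measurable s)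
  have "l2_norm ?M (\<lambda>x. R n f x - \<phi> x) = l2_norm ?M (\<lambda>x. R n f x - f x)" for n
    by (rule l2_norm_cong_AE)
      (use f(2) fm Rm square_integrable_measurable[OF \<phi>] in \<open>auto intro!: borel_measurable_diff elim: eventually_mono\<close>)
  then have lim1: "(\<lambda>n. l2_norm ?M (\<lambda>x. R n f x - \<phi> x)) \<longlonglongrightarrow> 0" using R(3) f(1) by simp
  have lim2: "(\<lambda>n. l2_norm ?M (\<lambda>x. pd b (R n f) x - G x \<bullet> b)) \<longlonglongrightarrow> 0" if b: "b \<in> Basis" for b
  proof -
    define F where "F b' = (if b' = b then f else (\<lambda>_. 0))" for b'
    have gs: "square_integrable ?M (\<lambda>x. G x \<bullet> b)" by (rule square_integrable_component[OF G])
    obtain h where h: "L2_on Om h" "AE x in ?M. G x \<bullet> b = h x"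
      using L2_on_representative[OF gs Om_facts(3)] by blast
    have pd0: "pd b' (\<lambda>_. 0) x = 0" for b' x :: 'a using pd_const[of b' 0] by (rule fun_cong)
    have W: "(\<Sum>b'\<in>Basis. LINT z|lborel. F b' z * pd b' \<psi> z) = - (LINT z|lborel. h z * \<psi> z)" if \<psi>: "test_function Om \<psi>" for \<psi>
    proof -
      note s\<psi> = test_function_smooth[OF \<psi>]
      have "(\<Sum>b'\<in>Basis. LINT z|lborel. F b' z * pd b' \<psi> z) = (\<Sum>b'\<in>Basis. if b' = b then (LINT z|lborel. f z * pd b \<psi> z) else 0)"
        by (intro sum.cong refl) (auto simp: F_def)
      also have "\<dots> = (LINT z|lborel. f z * pd b \<psi> z)" using b by simp
      also have "\<dots> = (LINT x|?M. \<phi> x * pd b \<psi> x)"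
        by (rule integral_representative[symmetric, OF f(2) \<phi> f(1) smooth_continuous_on[OF smooth_pd[OF s\<psi> b]] Om_facts(3)])
      also have "\<dots> = - (LINT x|?M. (G x \<bullet> b) * \<psi> x)" by (rule weak_grad_component[OF Om_facts(3,2) \<phi> G w \<psi> b])
      also have "(LINT x|?M. (G x \<bullet> b) * \<psi> x) = (LINT z|lborel. h z * \<psi> z)"
        by (rule integral_representative[OF h(2) gs h(1) smooth_continuous_on[OF s\<psi>] Om_facts(3)])
      finally show ?thesis .
    qed
    have "(\<lambda>n. l2_norm ?M (\<lambda>x. (\<Sum>b'\<in>Basis. pd b' (R n (F b')) x) - h x)) \<longlonglongrightarrow> 0"
    proof (rule R(4)[rule_format])
      show "L2_on Om (F b')" for b' using f(1) by (simp add: F_def L2_on_zero)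
    qed (use h W in auto)
    moreover have "(\<Sum>b'\<in>Basis. pd b' (R n (F b')) x) = pd b (R n f) x" for n x
    proof -
      have "(\<Sum>b'\<in>Basis. pd b' (R n (F b')) x) = (\<Sum>b'\<in>Basis. if b' = b then pd b (R n f) x else 0)"
        by (intro sum.cong refl) (auto simp: F_def R(2) pd0)
      then show ?thesis using b by simp
    qed
    ultimately have "(\<lambda>n. l2_norm ?M (\<lambda>x. pd b (R n f) x - h x)) \<longlonglongrightarrow> 0" by simp
    moreover have "l2_norm ?M (\<lambda>x. pd b (R n f) x - h x) = l2_norm ?M (\<lambda>x. pd b (R n f) x - G x \<bullet> b)" for n
      by (rule l2_norm_cong_AE)
        (use h(2) square_integrable_measurable[OF gs] borel_measurable_lebesgue_on[OF L2_on_measurable[OF h(1)]]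
          borel_measurable_lebesgue_on[OF smooth_borel_measurable[OF smooth_pd[OF s b]]] in
          \<open>auto intro!: borel_measurable_diff elim: eventually_mono\<close>)
    ultimately show ?thesis by simp
  qed
  have "(\<lambda>n. l2_norm ?M (\<lambda>x. grad (R n f) x - G x)) \<longlonglongrightarrow> 0"
  proof (rule null_sequence_squeeze[OF l2_norm_nonneg])
    show "l2_norm ?M (\<lambda>x. grad (R n f) x - G x) \<le> (\<Sum>b\<in>Basis. l2_norm ?M (\<lambda>x. pd b (R n f) x - G x \<bullet> b))" for n
      using l2_norm_components_le[OF square_integrable_diff[OF square_integrable_grad[OF s Om_facts(3,2)] G], of n]
      by (simp add: inner_diff_left grad_inner_Basis)
    have "(\<lambda>n. \<Sum>b\<in>Basis. l2_norm ?M (\<lambda>x. pd b (R n f) x - G x \<bullet> b)) \<longlonglongrightarrow> (\<Sum>b\<in>(Basis::'a set). 0)"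
      by (intro tendsto_sum lim2)
    then show "(\<lambda>n. \<Sum>b\<in>Basis. l2_norm ?M (\<lambda>x. pd b (R n f) x - G x \<bullet> b)) \<longlonglongrightarrow> 0" by (simp only: sum.neutral_const)
  qed
  then show ?thesis using s lim1 by (intro exI[of _ "\<lambda>n. R n f"] conjI allI)
qed

end

section \<open>Traces and extremal principles\<close>

lemma H1_norm_bounds:
  "l2_norm (lebesgue_on Om) \<phi> \<le> H1_norm Om \<phi>"
  "l2_norm (lebesgue_on Om) (weak_grad Om \<phi>) \<le> H1_norm Om \<phi>"
  "H1_norm Om \<phi> \<le> l2_norm (lebesgue_on Om) \<phi> + l2_norm (lebesgue_on Om) (weak_grad Om \<phi>)"
  "0 \<le> H1_norm Om \<phi>"
  unfolding H1_norm_def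
  by (rule real_sqrt_sum_squares_ge1 real_sqrt_sum_squares_ge2 sqrt_sum_squares_le_sum real_sqrt_ge_zero; simp)+

lemma H1_square_integrable: "\<phi> \<in> H1 Om \<Longrightarrow> square_integrable (lebesgue_on Om) \<phi>"
  by (simp add: H1_def)

lemma weak_grad_spec:
  assumes "\<phi> \<in> H1 Om"
  shows "square_integrable (lebesgue_on Om) (weak_grad Om \<phi>)" "has_weak_grad Om \<phi> (weak_grad Om \<phi>)"
proof -
  have "\<exists>G. square_integrable (lebesgue_on Om) G \<and> has_weak_grad Om \<phi> G" using assms by (simp add: H1_def)
  then have "square_integrable (lebesgue_on Om) (weak_grad Om \<phi>) \<and> has_weak_grad Om \<phi> (weak_grad Om \<phi>)"
    unfolding weak_grad_def by (rule someI_ex)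
  then show "square_integrable (lebesgue_on Om) (weak_grad Om \<phi>)" "has_weak_grad Om \<phi> (weak_grad Om \<phi>)" by auto
qed

lemma grad_mult:
  assumes "smooth f" "smooth g"
  shows "grad (\<lambda>x. f x * g x) x = f x *\<^sub>R grad g x + g x *\<^sub>R grad f x"
  unfolding grad_eq_pd scaleR_sum_right sum.distrib[symmetric]
  by (intro sum.cong refl)
    (simp add: pd_mult smooth_differentiable assms scaleR_add_left[symmetric] mult.commute del: scaleR_add_left)

context
  fixes Om :: "'a::euclidean_space set"
  assumes lip: "lipschitz_domain Om" and dim: "DIM('a) \<ge> 2"
begin

lemmas Om = Om_facts[OF lip]

lemma weak_grad_AE:
  assumes "square_integrable (lebesgue_on Om) \<phi>" "square_integrable (lebesgue_on Om) G" "has_weak_grad Om \<phi> G"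
  shows "\<phi> \<in> H1 Om" "AE x in lebesgue_on Om. weak_grad Om \<phi> x = G x"
proof -
  show "\<phi> \<in> H1 Om" using assms by (auto simp: H1_def)
  from weak_grad_unique[OF lip assms(1) weak_grad_spec[OF this] assms(2,3)]
  show "AE x in lebesgue_on Om. weak_grad Om \<phi> x = G x" .
qed

lemma H1_lincomb:
  assumes \<phi>: "\<phi> \<in> H1 Om" and \<eta>: "\<eta> \<in> H1 Om"
  shows "(\<lambda>x. a * \<phi> x + c * \<eta> x) \<in> H1 Om"
    and "AE x in lebesgue_on Om. weak_grad Om (\<lambda>x. a * \<phi> x + c * \<eta> x) x = a *\<^sub>R weak_grad Om \<phi> x + c *\<^sub>R weak_grad Om \<eta> x"
proof -
  let ?M = "lebesgue_on Om"
  note g = weak_grad_spec[OF \<phi>] weak_grad_spec[OF \<eta>] and s = H1_square_integrable[OF \<phi>] H1_square_integrable[OF \<eta>]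
  have w: "has_weak_grad Om (\<lambda>x. a * \<phi> x + c * \<eta> x) (\<lambda>x. a *\<^sub>R weak_grad Om \<phi> x + c *\<^sub>R weak_grad Om \<eta> x)"
    unfolding has_weak_grad_def
  proof (intro allI impI)
    fix \<psi> assume \<psi>: "test_function Om \<psi>"
    note sm = test_function_smooth[OF \<psi>]
    note gs = square_integrable_grad[OF sm Om(3,2)] and ps = square_integrable_smooth[OF sm Om(3,2)]
    have "(LINT x|?M. (a * \<phi> x + c * \<eta> x) *\<^sub>R grad \<psi> x) = (LINT x|?M. a *\<^sub>R (\<phi> x *\<^sub>R grad \<psi> x) + c *\<^sub>R (\<eta> x *\<^sub>R grad \<psi> x))"
      by (simp add: scaleR_add_left)
    also have "\<dots> = a *\<^sub>R (LINT x|?M. \<phi> x *\<^sub>R grad \<psi> x) + c *\<^sub>R (LINT x|?M. \<eta> x *\<^sub>R grad \<psi> x)"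
      using integrable_scaleR_l2[OF s(1) gs] integrable_scaleR_l2[OF s(2) gs] by (simp del: scaleR_scaleR)
    also have "\<dots> = - (a *\<^sub>R (LINT x|?M. \<psi> x *\<^sub>R weak_grad Om \<phi> x) + c *\<^sub>R (LINT x|?M. \<psi> x *\<^sub>R weak_grad Om \<eta> x))"
      using g(2,4) \<psi> by (simp add: has_weak_grad_def)
    also have "a *\<^sub>R (LINT x|?M. \<psi> x *\<^sub>R weak_grad Om \<phi> x) + c *\<^sub>R (LINT x|?M. \<psi> x *\<^sub>R weak_grad Om \<eta> x)
        = (LINT x|?M. a *\<^sub>R (\<psi> x *\<^sub>R weak_grad Om \<phi> x) + c *\<^sub>R (\<psi> x *\<^sub>R weak_grad Om \<eta> x))"
      using integrable_scaleR_l2[OF ps g(1)] integrable_scaleR_l2[OF ps g(3)] by (simp del: scaleR_scaleR)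
    also have "\<dots> = (LINT x|?M. \<psi> x *\<^sub>R (a *\<^sub>R weak_grad Om \<phi> x + c *\<^sub>R weak_grad Om \<eta> x))"
      by (simp add: scaleR_add_right mult.commute)
    finally show "(LINT x|?M. (a * \<phi> x + c * \<eta> x) *\<^sub>R grad \<psi> x) = - (LINT x|?M. \<psi> x *\<^sub>R (a *\<^sub>R weak_grad Om \<phi> x + c *\<^sub>R weak_grad Om \<eta> x))" .
  qed
  have s1: "square_integrable ?M (\<lambda>x. a * \<phi> x + c * \<eta> x)"
    by (intro square_integrable_add square_integrable_cmult s)
  have s2: "square_integrable ?M (\<lambda>x. a *\<^sub>R weak_grad Om \<phi> x + c *\<^sub>R weak_grad Om \<eta> x)"
    by (intro square_integrable_add square_integrable_scaleR g)
  show "(\<lambda>x. a * \<phi> x + c * \<eta> x) \<in> H1 Om"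
    and "AE x in lebesgue_on Om. weak_grad Om (\<lambda>x. a * \<phi> x + c * \<eta> x) x = a *\<^sub>R weak_grad Om \<phi> x + c *\<^sub>R weak_grad Om \<eta> x"
    using weak_grad_AE[OF s1 s2 w] .
qed

text \<open>The factor 2 comes from passing through the sum of the two seminorms; it is harmless
  since only convergence to zero and boundedness matter.\<close>

lemma H1_norm_lincomb:
  assumes \<phi>: "\<phi> \<in> H1 Om" and \<eta>: "\<eta> \<in> H1 Om"
  shows "H1_norm Om (\<lambda>x. a * \<phi> x + c * \<eta> x) \<le> 2 * \<bar>a\<bar> * H1_norm Om \<phi> + 2 * \<bar>c\<bar> * H1_norm Om \<eta>"
proof -
  let ?M = "lebesgue_on Om"
  note g = weak_grad_spec[OF \<phi>] weak_grad_spec[OF \<eta>] and s = H1_square_integrable[OF \<phi>] H1_square_integrable[OF \<eta>]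
  have 1: "l2_norm ?M (\<lambda>x. a * \<phi> x + c * \<eta> x) \<le> \<bar>a\<bar> * l2_norm ?M \<phi> + \<bar>c\<bar> * l2_norm ?M \<eta>"
    using l2_norm_triangle[OF square_integrable_scaleR[OF s(1), of a] square_integrable_scaleR[OF s(2), of c]]
    by (simp add: l2_norm_scaleR[of ?M a \<phi>, simplified] l2_norm_scaleR[of ?M c \<eta>, simplified])
  have "l2_norm ?M (weak_grad Om (\<lambda>x. a * \<phi> x + c * \<eta> x)) = l2_norm ?M (\<lambda>x. a *\<^sub>R weak_grad Om \<phi> x + c *\<^sub>R weak_grad Om \<eta> x)"
    by (rule l2_norm_cong_AE[OF _ _ H1_lincomb(2)[OF \<phi> \<eta>]])
      (intro square_integrable_measurable weak_grad_spec H1_lincomb \<phi> \<eta> square_integrable_add square_integrable_scaleR)+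
  also have "\<dots> \<le> \<bar>a\<bar> * l2_norm ?M (weak_grad Om \<phi>) + \<bar>c\<bar> * l2_norm ?M (weak_grad Om \<eta>)"
    using l2_norm_triangle[OF square_integrable_scaleR[OF g(1), of a] square_integrable_scaleR[OF g(3), of c]]
    by (simp add: l2_norm_scaleR)
  finally have 2: "l2_norm ?M (weak_grad Om (\<lambda>x. a * \<phi> x + c * \<eta> x)) \<le> \<bar>a\<bar> * l2_norm ?M (weak_grad Om \<phi>) + \<bar>c\<bar> * l2_norm ?M (weak_grad Om \<eta>)" .
  have 3: "\<bar>d\<bar> * l2_norm ?M \<xi> \<le> \<bar>d\<bar> * H1_norm Om \<xi>" "\<bar>d\<bar> * l2_norm ?M (weak_grad Om \<xi>) \<le> \<bar>d\<bar> * H1_norm Om \<xi>" for d \<xi>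
    by (intro mult_left_mono H1_norm_bounds; simp)+
  show ?thesis
    using H1_norm_bounds(3)[of Om "\<lambda>x. a * \<phi> x + c * \<eta> x"] 1 2 3[of a \<phi>] 3[of c \<eta>] by linarith
qed

section \<open>The trace operator on H1\<close>

lemma integral_pd_le:
  assumes P: "smooth P" and b: "b \<in> Basis"
  shows "\<bar>LINT x|lebesgue_on Om. pd b P x\<bar> \<le> sweep_const TYPE('a) * (LINT x|surface_measure Om. \<bar>P x\<bar>)"
proof -
  have "(LINT x|lebesgue_on Om. pd b P x) = (LINT x|lborel. indicator Om x *\<^sub>R pd b P x)"
    by (rule integral_lebesgue_on_borel[OF smooth_borel_measurable[OF smooth_pd[OF P b]] Om(3)])
  then show ?thesis
    using integral_pd_le_surface_integral[OF dim _ Om(1,2) surface_measure_finite[OF dim lip] P, of b] b by simp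
qed

text \<open>The product of \<Phi> and a test function vanishes on the boundary, so the divergence
  inequality forces the integrals of its derivatives to be zero: integration by parts without a
  boundary term.\<close>

lemma smooth_weak_grad:
  assumes \<Phi>: "smooth \<Phi>"
  shows "\<Phi> \<in> H1 Om" "AE x in lebesgue_on Om. weak_grad Om \<Phi> x = grad \<Phi> x"
proof -
  let ?M = "lebesgue_on Om"
  have w: "has_weak_grad Om \<Phi> (grad \<Phi>)"
    unfolding has_weak_grad_def
  proof (intro allI impI)
    fix \<psi> assume \<psi>: "test_function Om \<psi>"
    note sm = test_function_smooth[OF \<psi>]
    let ?P = "\<lambda>x. \<Phi> x * \<psi> x"
    have P: "smooth ?P" by (intro smooth_mult \<Phi> sm)
    have fr: "?P x = 0" if "x \<in> frontier Om" for x
    proof -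
      have "x \<notin> Om" using that Om(1) by (simp add: frontier_def interior_open)
      then have "x \<notin> closure {x. \<psi> x \<noteq> 0}" using \<psi> by (auto simp: test_function_def)
      then have "x \<notin> {x. \<psi> x \<noteq> 0}" by (rule contra_subsetD[OF closure_subset])
      then have "\<psi> x = 0" by simp
      then show ?thesis by simp
    qed
    have z: "(LINT x|?M. pd b ?P x) = 0" if b: "b \<in> Basis" for b
    proof -
      have "(LINT x|surface_measure Om. \<bar>?P x\<bar>) = (LINT x|surface_measure Om. 0)"
        by (intro Bochner_Integration.integral_cong refl) (simp add: space_surface_measure fr del: mult_eq_0_iff)
      then show ?thesis using integral_pd_le[OF P b] by simp
    qed
    have int: "integrable ?M (pd b ?P)" if "b \<in> Basis" for b
      using square_integrable_times[OF square_integrable_smooth[OF smooth_pd[OF P that] Om(3,2)] square_integrable_smooth[OF smooth_const[of 1] Om(3,2)]]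
      by simp
    have "(LINT x|?M. grad ?P x) = (\<Sum>b\<in>Basis. LINT x|?M. pd b ?P x *\<^sub>R b)"
      unfolding grad_eq_pd by (intro Bochner_Integration.integral_sum integrable_scaleR_left int)
    also have "\<dots> = (\<Sum>b\<in>Basis. (LINT x|?M. pd b ?P x) *\<^sub>R b)"
      by (intro sum.cong refl integral_scaleR_left int)
    also have "\<dots> = 0" by (simp add: z)
    finally have "(LINT x|?M. \<Phi> x *\<^sub>R grad \<psi> x + \<psi> x *\<^sub>R grad \<Phi> x) = 0" by (simp add: grad_mult[OF \<Phi> sm])
    moreover have "(LINT x|?M. \<Phi> x *\<^sub>R grad \<psi> x + \<psi> x *\<^sub>R grad \<Phi> x) = (LINT x|?M. \<Phi> x *\<^sub>R grad \<psi> x) + (LINT x|?M. \<psi> x *\<^sub>R grad \<Phi> x)"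
      by (intro Bochner_Integration.integral_add integrable_scaleR_l2 square_integrable_smooth square_integrable_grad \<Phi> sm Om)
    ultimately show "(LINT x|?M. \<Phi> x *\<^sub>R grad \<psi> x) = - (LINT x|?M. \<psi> x *\<^sub>R grad \<Phi> x)" by (simp add: eq_neg_iff_add_eq_0)
  qed
  show "\<Phi> \<in> H1 Om" "AE x in lebesgue_on Om. weak_grad Om \<Phi> x = grad \<Phi> x"
    using weak_grad_AE[OF square_integrable_smooth[OF \<Phi> Om(3,2)] square_integrable_grad[OF \<Phi> Om(3,2)] w] .
qed

lemma l2_norm_weak_grad_smooth_diff:
  assumes \<Phi>: "smooth \<Phi>" and \<phi>: "\<phi> \<in> H1 Om"
  shows "l2_norm (lebesgue_on Om) (weak_grad Om (\<lambda>x. \<Phi> x - \<phi> x)) = l2_norm (lebesgue_on Om) (\<lambda>x. grad \<Phi> x - weak_grad Om \<phi> x)"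
    "(\<lambda>x. \<Phi> x - \<phi> x) \<in> H1 Om"
proof -
  note c = H1_lincomb[OF smooth_weak_grad(1)[OF \<Phi>] \<phi>, of 1 "-1"]
  show H: "(\<lambda>x. \<Phi> x - \<phi> x) \<in> H1 Om" using c(1) by simp
  have "AE x in lebesgue_on Om. weak_grad Om (\<lambda>x. \<Phi> x - \<phi> x) x = grad \<Phi> x - weak_grad Om \<phi> x"
    using c(2) smooth_weak_grad(2)[OF \<Phi>] by eventually_elim simp
  then show "l2_norm (lebesgue_on Om) (weak_grad Om (\<lambda>x. \<Phi> x - \<phi> x)) = l2_norm (lebesgue_on Om) (\<lambda>x. grad \<Phi> x - weak_grad Om \<phi> x)"
    by (rule l2_norm_cong_AE[rotated 2])
      (intro square_integrable_measurable weak_grad_spec H \<phi> square_integrable_diff square_integrable_grad \<Phi> Om)+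
qed

lemma l2_norm_trace_le:
  "\<exists>C\<ge>0. \<forall>\<Phi>. smooth \<Phi> \<longrightarrow> square_integrable (surface_measure Om) \<Phi> \<and> l2_norm (surface_measure Om) \<Phi> \<le> C * H1_norm Om \<Phi>"
proof -
  let ?M = "lebesgue_on Om" and ?N = "surface_measure Om"
  obtain C where C: "0 \<le> C" and le: "\<forall>\<Phi>. smooth \<Phi> \<longrightarrow> (\<integral>\<^sup>+y. ennreal ((\<Phi> y)\<^sup>2) \<partial>surface_measure Om) \<le>
      ennreal (C * (LINT y|lborel. indicator Om y * ((\<Phi> y)\<^sup>2 + (norm (grad \<Phi> y))\<^sup>2)))"
    using trace_inequality[OF dim lip] by (elim exE conjE)
  show ?thesis
  proof (intro exI[of _ "sqrt C"] conjI allI impI)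
    show "0 \<le> sqrt C" using C by simp
    fix \<Phi> :: "'a \<Rightarrow> real" assume \<Phi>: "smooth \<Phi>"
    have "(\<lambda>y. (\<Phi> y)\<^sup>2 + (norm (grad \<Phi> y))\<^sup>2) \<in> borel_measurable borel"
      by (intro borel_measurable_continuous_onI continuous_intros smooth_continuous_on continuous_on_grad \<Phi>)
    from integral_lebesgue_on_borel[OF this Om(3)]
    have "(LINT y|lborel. indicator Om y * ((\<Phi> y)\<^sup>2 + (norm (grad \<Phi> y))\<^sup>2)) = (LINT y|?M. (\<Phi> y)\<^sup>2 + (norm (grad \<Phi> y))\<^sup>2)"
      by simp
    also have "\<dots> = (l2_norm ?M \<Phi>)\<^sup>2 + (l2_norm ?M (grad \<Phi>))\<^sup>2"
      using square_integrable_smooth[OF \<Phi> Om(3,2)] square_integrable_grad[OF \<Phi> Om(3,2)]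
      by (simp add: l2_norm_power2 square_integrable_def)
    also have "l2_norm ?M (grad \<Phi>) = l2_norm ?M (weak_grad Om \<Phi>)"
      by (rule l2_norm_cong_AE) (use smooth_weak_grad[OF \<Phi>] weak_grad_spec[OF smooth_weak_grad(1)[OF \<Phi>]]
          square_integrable_measurable square_integrable_grad[OF \<Phi> Om(3,2)] in \<open>auto elim: eventually_mono\<close>)
    also have "(l2_norm ?M \<Phi>)\<^sup>2 + (l2_norm ?M (weak_grad Om \<Phi>))\<^sup>2 = (H1_norm Om \<Phi>)\<^sup>2" by (simp add: H1_norm_def)
    finally have eq: "(LINT y|lborel. indicator Om y * ((\<Phi> y)\<^sup>2 + (norm (grad \<Phi> y))\<^sup>2)) = (H1_norm Om \<Phi>)\<^sup>2" .
    have "(\<integral>\<^sup>+y. ennreal ((norm (\<Phi> y))\<^sup>2) \<partial>?N) \<le> ennreal ((sqrt C * H1_norm Om \<Phi>)\<^sup>2)"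
      using le[rule_format, OF \<Phi>] C unfolding eq by (simp add: power_mult_distrib)
    then show "square_integrable ?N \<Phi>" "l2_norm ?N \<Phi> \<le> sqrt C * H1_norm Om \<Phi>"
      using square_integrable_l2_norm_leI[of \<Phi> ?N "sqrt C * H1_norm Om \<Phi>"] C H1_norm_bounds(4)[of Om \<Phi>]
        continuous_measurable_surface_measure[OF smooth_continuous_on[OF \<Phi>]] by auto
  qed
qed

lemma has_trace_lincomb:
  assumes \<phi>: "\<phi> \<in> H1 Om" "has_trace Om \<phi> f" and \<eta>: "\<eta> \<in> H1 Om" "has_trace Om \<eta> g"
  shows "has_trace Om (\<lambda>x. a * \<phi> x + c * \<eta> x) (\<lambda>x. a * f x + c * g x)"
proof -
  let ?N = "surface_measure Om"
  obtain \<Phi> where \<Phi>: "\<And>k. smooth (\<Phi> k)" "\<And>k. \<Phi> k \<in> H1 Om" "\<And>k. square_integrable ?N (\<Phi> k)"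
      "(\<lambda>k. H1_norm Om (\<lambda>x. \<Phi> k x - \<phi> x)) \<longlonglongrightarrow> 0" "(\<lambda>k. l2_norm ?N (\<lambda>x. \<Phi> k x - f x)) \<longlonglongrightarrow> 0" and f: "square_integrable ?N f"
    using \<phi>(2) unfolding has_trace_def by blast
  obtain \<Psi> where \<Psi>: "\<And>k. smooth (\<Psi> k)" "\<And>k. \<Psi> k \<in> H1 Om" "\<And>k. square_integrable ?N (\<Psi> k)"
      "(\<lambda>k. H1_norm Om (\<lambda>x. \<Psi> k x - \<eta> x)) \<longlonglongrightarrow> 0" "(\<lambda>k. l2_norm ?N (\<lambda>x. \<Psi> k x - g x)) \<longlonglongrightarrow> 0" and g: "square_integrable ?N g"
    using \<eta>(2) unfolding has_trace_def by blast
  have eq: "a * \<Phi> k x + c * \<Psi> k x - (a * p x + c * q x) = a * (\<Phi> k x - p x) + c * (\<Psi> k x - q x)" for k x and p q :: "'a \<Rightarrow> real"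
    by (simp add: algebra_simps)
  show ?thesis
    unfolding has_trace_def
  proof (intro conjI exI[of _ "\<lambda>k x. a * \<Phi> k x + c * \<Psi> k x"] allI)
    show "square_integrable ?N (\<lambda>x. a * f x + c * g x)" by (intro square_integrable_add square_integrable_cmult f g)
    show "smooth (\<lambda>x. a * \<Phi> k x + c * \<Psi> k x)" for k by (intro smooth_add smooth_mult smooth_const \<Phi> \<Psi>)
    show "(\<lambda>x. a * \<Phi> k x + c * \<Psi> k x) \<in> H1 Om" for k by (rule H1_lincomb(1)[OF \<Phi>(2) \<Psi>(2)])
    show "square_integrable ?N (\<lambda>x. a * \<Phi> k x + c * \<Psi> k x)" for k by (intro square_integrable_add square_integrable_cmult \<Phi> \<Psi>)
    show "(\<lambda>k. H1_norm Om (\<lambda>x. a * \<Phi> k x + c * \<Psi> k x - (a * \<phi> x + c * \<eta> x))) \<longlonglongrightarrow> 0"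
    proof (rule null_sequence_squeeze[OF H1_norm_bounds(4)])
      show "H1_norm Om (\<lambda>x. a * \<Phi> k x + c * \<Psi> k x - (a * \<phi> x + c * \<eta> x)) \<le>
          2 * \<bar>a\<bar> * H1_norm Om (\<lambda>x. \<Phi> k x - \<phi> x) + 2 * \<bar>c\<bar> * H1_norm Om (\<lambda>x. \<Psi> k x - \<eta> x)" for k
        unfolding eq by (intro H1_norm_lincomb l2_norm_weak_grad_smooth_diff \<Phi> \<Psi> \<phi> \<eta>)
      show "(\<lambda>k. 2 * \<bar>a\<bar> * H1_norm Om (\<lambda>x. \<Phi> k x - \<phi> x) + 2 * \<bar>c\<bar> * H1_norm Om (\<lambda>x. \<Psi> k x - \<eta> x)) \<longlonglongrightarrow> 0"
        using tendsto_add[OF tendsto_mult[OF tendsto_const \<Phi>(4)] tendsto_mult[OF tendsto_const \<Psi>(4)]] by simp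
    qed
    show "(\<lambda>k. l2_norm ?N (\<lambda>x. a * \<Phi> k x + c * \<Psi> k x - (a * f x + c * g x))) \<longlonglongrightarrow> 0"
    proof (rule null_sequence_squeeze[OF l2_norm_nonneg])
      show "l2_norm ?N (\<lambda>x. a * \<Phi> k x + c * \<Psi> k x - (a * f x + c * g x)) \<le>
          \<bar>a\<bar> * l2_norm ?N (\<lambda>x. \<Phi> k x - f x) + \<bar>c\<bar> * l2_norm ?N (\<lambda>x. \<Psi> k x - g x)" for k
      proof -
        note s = square_integrable_diff[OF \<Phi>(3) f, of k] square_integrable_diff[OF \<Psi>(3) g, of k]
        show ?thesis unfolding eq
          using l2_norm_triangle[OF square_integrable_scaleR[OF s(1), of a] square_integrable_scaleR[OF s(2), of c]]
            l2_norm_scaleR[of ?N a "\<lambda>x. \<Phi> k x - f x"] l2_norm_scaleR[of ?N c "\<lambda>x. \<Psi> k x - g x"] by simp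
      qed
      show "(\<lambda>k. \<bar>a\<bar> * l2_norm ?N (\<lambda>x. \<Phi> k x - f x) + \<bar>c\<bar> * l2_norm ?N (\<lambda>x. \<Psi> k x - g x)) \<longlonglongrightarrow> 0"
        using tendsto_add[OF tendsto_mult[OF tendsto_const \<Phi>(5)] tendsto_mult[OF tendsto_const \<Psi>(5)]] by simp
    qed
  qed
qed

text \<open>By the trace inequality, smooth approximations convergent in the H1 norm are Cauchy on
  the boundary.\<close>

lemma has_trace_exists:
  assumes \<phi>: "\<phi> \<in> H1 Om"
  shows "\<exists>f. has_trace Om \<phi> f"
proof -
  let ?M = "lebesgue_on Om" and ?N = "surface_measure Om"
  obtain \<Phi> :: "nat \<Rightarrow> 'a \<Rightarrow> real" where \<Phi>: "\<forall>n. smooth (\<Phi> n)"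
    "(\<lambda>n. l2_norm ?M (\<lambda>x. \<Phi> n x - \<phi> x)) \<longlonglongrightarrow> 0" "(\<lambda>n. l2_norm ?M (\<lambda>x. grad (\<Phi> n) x - weak_grad Om \<phi> x)) \<longlonglongrightarrow> 0"
    using weak_grad_smooth_approx[OF lip H1_square_integrable[OF \<phi>] weak_grad_spec[OF \<phi>]] by (elim exE conjE)
  have s: "smooth (\<Phi> n)" for n using \<Phi>(1) by simp
  have H: "(\<lambda>n. H1_norm Om (\<lambda>x. \<Phi> n x - \<phi> x)) \<longlonglongrightarrow> 0"
  proof (rule null_sequence_squeeze[OF H1_norm_bounds(4)])
    show "H1_norm Om (\<lambda>x. \<Phi> n x - \<phi> x) \<le> l2_norm ?M (\<lambda>x. \<Phi> n x - \<phi> x) + l2_norm ?M (\<lambda>x. grad (\<Phi> n) x - weak_grad Om \<phi> x)" for n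
      using H1_norm_bounds(3)[of Om "\<lambda>x. \<Phi> n x - \<phi> x"] by (simp only: l2_norm_weak_grad_smooth_diff(1)[OF s \<phi>])
    show "(\<lambda>n. l2_norm ?M (\<lambda>x. \<Phi> n x - \<phi> x) + l2_norm ?M (\<lambda>x. grad (\<Phi> n) x - weak_grad Om \<phi> x)) \<longlonglongrightarrow> 0"
      using tendsto_add[OF \<Phi>(2,3)] by simp
  qed
  obtain C where C: "0 \<le> C" "\<forall>\<Phi>. smooth \<Phi> \<longrightarrow> square_integrable ?N \<Phi> \<and> l2_norm ?N \<Phi> \<le> C * H1_norm Om \<Phi>"
    using l2_norm_trace_le by (elim exE conjE)
  have sN: "square_integrable ?N (\<Phi> n)" for n using C(2) s by blast
  have "\<exists>f. square_integrable ?N f \<and> (\<lambda>n. l2_norm ?N (\<lambda>x. \<Phi> n x - f x)) \<longlonglongrightarrow> 0"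
  proof (rule l2_complete[OF sN])
    fix \<epsilon> :: real assume \<epsilon>: "0 < \<epsilon>"
    \<comment> \<open>The four accounts for two terms, each doubled by
      \<open>H1_norm_lincomb\<close>; \<open>C + 1\<close> avoids a division by zero.\<close>
    have "0 < \<epsilon> / (C + 1) / 4" using C(1) \<epsilon> by simp
    then obtain N where N: "\<And>n. n \<ge> N \<Longrightarrow> H1_norm Om (\<lambda>x. \<Phi> n x - \<phi> x) < \<epsilon> / (C + 1) / 4"
      using order_tendstoD(2)[OF H] by (auto simp: eventually_sequentially)
    have "l2_norm ?N (\<lambda>x. \<Phi> m x - \<Phi> n x) \<le> \<epsilon>" if mn: "m \<ge> N" "n \<ge> N" for m n
    proof -
      have "H1_norm Om (\<lambda>x. \<Phi> m x - \<Phi> n x) = H1_norm Om (\<lambda>x. 1 * (\<Phi> m x - \<phi> x) + (-1) * (\<Phi> n x - \<phi> x))" by simp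
      also have "\<dots> \<le> 2 * \<bar>1\<bar> * H1_norm Om (\<lambda>x. \<Phi> m x - \<phi> x) + 2 * \<bar>-1\<bar> * H1_norm Om (\<lambda>x. \<Phi> n x - \<phi> x)"
        by (intro H1_norm_lincomb l2_norm_weak_grad_smooth_diff s \<phi>)
      also have "\<dots> = 2 * H1_norm Om (\<lambda>x. \<Phi> m x - \<phi> x) + 2 * H1_norm Om (\<lambda>x. \<Phi> n x - \<phi> x)" by simp
      also have "\<dots> \<le> \<epsilon> / (C + 1)" using N[OF mn(1)] N[OF mn(2)] by linarith
      finally have h: "H1_norm Om (\<lambda>x. \<Phi> m x - \<Phi> n x) \<le> \<epsilon> / (C + 1)" .
      have "l2_norm ?N (\<lambda>x. \<Phi> m x - \<Phi> n x) \<le> C * H1_norm Om (\<lambda>x. \<Phi> m x - \<Phi> n x)"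
        using C(2) smooth_diff[OF s s] by blast
      also have "\<dots> \<le> C * (\<epsilon> / (C + 1))" using h C(1) by (rule mult_left_mono)
      also have "\<dots> \<le> \<epsilon>" using C(1) \<epsilon> by (simp add: pos_divide_le_eq mult.commute)
      finally show ?thesis .
    qed
    then show "\<exists>N. \<forall>m\<ge>N. \<forall>n\<ge>N. l2_norm ?N (\<lambda>x. \<Phi> m x - \<Phi> n x) \<le> \<epsilon>" by blast
  qed
  then obtain f where f: "square_integrable ?N f" "(\<lambda>n. l2_norm ?N (\<lambda>x. \<Phi> n x - f x)) \<longlonglongrightarrow> 0" by (elim exE conjE)
  have "has_trace Om \<phi> f"
    unfolding has_trace_def
    by (intro conjI exI[of _ \<Phi>] allI f H s sN smooth_weak_grad)
  then show ?thesis by (rule exI[of _ f])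
qed

lemma has_trace_bdry_trace: "\<phi> \<in> H1 Om \<Longrightarrow> has_trace Om \<phi> (bdry_trace Om \<phi>)"
  unfolding bdry_trace_def by (rule someI_ex[OF has_trace_exists])

text \<open>By linearity, uniqueness of traces reduces to this case.\<close>

lemma has_trace_zero:
  assumes "has_trace Om (\<lambda>x. 0) h"
  shows "AE x in surface_measure Om. h x = 0"
proof -
  let ?N = "surface_measure Om"
  obtain \<Phi> where \<Phi>: "\<And>k. smooth (\<Phi> k)" "\<And>k. square_integrable ?N (\<Phi> k)"
      "(\<lambda>k. H1_norm Om (\<lambda>x. \<Phi> k x - 0)) \<longlonglongrightarrow> 0" "(\<lambda>k. l2_norm ?N (\<lambda>x. \<Phi> k x - h x)) \<longlonglongrightarrow> 0" and h: "square_integrable ?N h"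
    using assms unfolding has_trace_def by blast
  obtain C where C: "0 \<le> C" "\<forall>\<Phi>. smooth \<Phi> \<longrightarrow> square_integrable ?N \<Phi> \<and> l2_norm ?N \<Phi> \<le> C * H1_norm Om \<Phi>"
    using l2_norm_trace_le by (elim exE conjE)
  have "(\<lambda>k. l2_norm ?N (\<lambda>x. \<Phi> k x - 0)) \<longlonglongrightarrow> 0"
  proof (rule null_sequence_squeeze[OF l2_norm_nonneg])
    show "l2_norm ?N (\<lambda>x. \<Phi> k x - 0) \<le> C * H1_norm Om (\<lambda>x. \<Phi> k x - 0)" for k using C(2) \<Phi>(1)[of k] by simp
    show "(\<lambda>k. C * H1_norm Om (\<lambda>x. \<Phi> k x - 0)) \<longlonglongrightarrow> 0" using tendsto_mult[OF tendsto_const \<Phi>(3)] by simp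
  qed
  from l2_norm_limit_unique[OF \<Phi>(2) h square_integrable_zero \<Phi>(4) this] show ?thesis .
qed

lemma bdry_trace_lincomb:
  assumes \<phi>: "\<phi> \<in> H1 Om" and \<eta>: "\<eta> \<in> H1 Om"
  shows "AE x in surface_measure Om. bdry_trace Om (\<lambda>x. a * \<phi> x + c * \<eta> x) x = a * bdry_trace Om \<phi> x + c * bdry_trace Om \<eta> x"
proof -
  let ?\<xi> = "\<lambda>x. a * \<phi> x + c * \<eta> x"
  have \<xi>: "?\<xi> \<in> H1 Om" by (rule H1_lincomb[OF \<phi> \<eta>])
  have "has_trace Om ?\<xi> (\<lambda>x. a * bdry_trace Om \<phi> x + c * bdry_trace Om \<eta> x)"
    by (intro has_trace_lincomb \<phi> \<eta> has_trace_bdry_trace)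
  from has_trace_lincomb[OF \<xi> has_trace_bdry_trace[OF \<xi>] \<xi> this, of 1 "-1"]
  have "has_trace Om (\<lambda>x. 1 * ?\<xi> x + (-1) * ?\<xi> x)
      (\<lambda>x. 1 * bdry_trace Om ?\<xi> x + (-1) * (a * bdry_trace Om \<phi> x + c * bdry_trace Om \<eta> x))" .
  moreover have "(\<lambda>x. 1 * ?\<xi> x + (-1) * ?\<xi> x) = (\<lambda>x. 0)" by (intro ext) simp
  ultimately have "has_trace Om (\<lambda>x. 0) (\<lambda>x. 1 * bdry_trace Om ?\<xi> x + (-1) * (a * bdry_trace Om \<phi> x + c * bdry_trace Om \<eta> x))"
    by (simp only:)
  then show ?thesis by (rule has_trace_zero[THEN eventually_mono]) simp
qed

text \<open>For a smooth approximation \<Phi> of \<phi> the left-hand side is the integral of the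
  divergence of the product field, hence bounded by boundary norms of \<Phi> and \<open>S\<close>.
  The norms of \<Phi> tend to zero as the trace of \<phi> does vanish.\<close>

lemma green_smooth_field:
  assumes \<phi>: "\<phi> \<in> H1 Om" and t: "AE x in surface_measure Om. bdry_trace Om \<phi> x = 0"
    and S: "\<And>b. b \<in> Basis \<Longrightarrow> smooth (S b)"
  shows "(LINT x|lebesgue_on Om. weak_grad Om \<phi> x \<bullet> (\<Sum>b\<in>Basis. S b x *\<^sub>R b)) + (LINT x|lebesgue_on Om. \<phi> x * (\<Sum>b\<in>Basis. pd b (S b) x)) = 0"
proof -
  let ?M = "lebesgue_on Om" and ?N = "surface_measure Om" and ?C = "sweep_const TYPE('a)"
  let ?V = "\<lambda>x. \<Sum>b\<in>Basis. S b x *\<^sub>R b" and ?D = "\<lambda>x. \<Sum>b\<in>Basis. pd b (S b) x"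
  obtain \<Phi> where \<Phi>: "\<And>k. smooth (\<Phi> k)" "\<And>k. square_integrable ?N (\<Phi> k)"
      "(\<lambda>k. H1_norm Om (\<lambda>x. \<Phi> k x - \<phi> x)) \<longlonglongrightarrow> 0" "(\<lambda>k. l2_norm ?N (\<lambda>x. \<Phi> k x - bdry_trace Om \<phi> x)) \<longlonglongrightarrow> 0"
      and bs: "square_integrable ?N (bdry_trace Om \<phi>)"
    using has_trace_bdry_trace[OF \<phi>] unfolding has_trace_def by blast
  have "l2_norm ?N (\<lambda>x. \<Phi> k x - bdry_trace Om \<phi> x) = l2_norm ?N (\<Phi> k)" for k
    by (rule l2_norm_cong_AE) (use square_integrable_measurable[OF \<Phi>(2)] square_integrable_measurable[OF bs] t in
        \<open>auto intro!: borel_measurable_diff elim: eventually_mono\<close>)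
  then have \<Phi>N: "(\<lambda>k. l2_norm ?N (\<Phi> k)) \<longlonglongrightarrow> 0" using \<Phi>(4) by simp
  have SN: "square_integrable ?N (S b)" if "b \<in> Basis" for b
    using l2_norm_trace_le S[OF that] by (elim exE conjE) blast
  have Vs: "square_integrable ?M ?V" by (intro square_integrable_from_components square_integrable_smooth S Om)
  have Ds: "square_integrable ?M ?D" by (intro square_integrable_sum square_integrable_smooth smooth_pd S Om)
  have ps: "square_integrable ?M (\<Phi> k)" "square_integrable ?M (grad (\<Phi> k))" for k
    by (intro square_integrable_smooth square_integrable_grad \<Phi> Om)+
  have lim1: "(\<lambda>k. LINT x|?M. grad (\<Phi> k) x \<bullet> ?V x) \<longlonglongrightarrow> (LINT x|?M. weak_grad Om \<phi> x \<bullet> ?V x)"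
  proof (rule l2_inner_tendsto[OF ps(2) weak_grad_spec(1)[OF \<phi>] Vs])
    show "(\<lambda>k. l2_norm ?M (\<lambda>x. grad (\<Phi> k) x - weak_grad Om \<phi> x)) \<longlonglongrightarrow> 0"
      using null_sequence_squeeze[OF l2_norm_nonneg H1_norm_bounds(2) \<Phi>(3)]
      by (simp only: l2_norm_weak_grad_smooth_diff(1)[OF \<Phi>(1) \<phi>])
  qed
  have lim2: "(\<lambda>k. LINT x|?M. \<Phi> k x * ?D x) \<longlonglongrightarrow> (LINT x|?M. \<phi> x * ?D x)"
    using l2_inner_tendsto[OF ps(1) H1_square_integrable[OF \<phi>] Ds null_sequence_squeeze[OF l2_norm_nonneg H1_norm_bounds(1) \<Phi>(3)]]
    by simp
  let ?I = "\<lambda>k. (LINT x|?M. grad (\<Phi> k) x \<bullet> ?V x) + (LINT x|?M. \<Phi> k x * ?D x)"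
  have bound: "\<bar>?I k\<bar> \<le> (\<Sum>b\<in>Basis. ?C * (l2_norm ?N (\<Phi> k) * l2_norm ?N (S b)))" for k
  proof -
    have P: "smooth (\<lambda>x. \<Phi> k x * S b x)" if "b \<in> Basis" for b by (intro smooth_mult \<Phi> S that)
    have "?I k = (LINT x|?M. grad (\<Phi> k) x \<bullet> ?V x + \<Phi> k x * ?D x)"
      by (intro Bochner_Integration.integral_add[symmetric] square_integrable_inner square_integrable_times ps Vs Ds)
    also have "\<dots> = (LINT x|?M. (\<Sum>b\<in>Basis. pd b (\<lambda>x. \<Phi> k x * S b x) x))"
    proof (intro Bochner_Integration.integral_cong refl)
      fix x
      have "grad (\<Phi> k) x \<bullet> ?V x = (\<Sum>b\<in>Basis. pd b (\<Phi> k) x * S b x)"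
        by (simp add: inner_sum_right grad_inner_Basis mult.commute)
      then show "grad (\<Phi> k) x \<bullet> ?V x + \<Phi> k x * ?D x = (\<Sum>b\<in>Basis. pd b (\<lambda>x. \<Phi> k x * S b x) x)"
        by (simp add: pd_mult smooth_differentiable \<Phi> S sum.distrib sum_distrib_left)
    qed
    also have "\<dots> = (\<Sum>b\<in>Basis. LINT x|?M. pd b (\<lambda>x. \<Phi> k x * S b x) x)"
    proof (rule Bochner_Integration.integral_sum)
      fix b :: 'a assume "b \<in> Basis"
      from square_integrable_times[OF square_integrable_smooth[OF smooth_pd[OF P[OF this] this] Om(3,2)] square_integrable_smooth[OF smooth_const[of 1] Om(3,2)]]
      show "integrable ?M (\<lambda>x. pd b (\<lambda>x. \<Phi> k x * S b x) x)" by simp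
    qed
    finally have "\<bar>?I k\<bar> \<le> (\<Sum>b\<in>Basis. \<bar>LINT x|?M. pd b (\<lambda>x. \<Phi> k x * S b x) x\<bar>)" by (simp only: sum_abs)
    also have "\<dots> \<le> (\<Sum>b\<in>Basis. ?C * (l2_norm ?N (\<Phi> k) * l2_norm ?N (S b)))"
    proof (rule sum_mono)
      fix b :: 'a assume b: "b \<in> Basis"
      have "\<bar>LINT x|?M. pd b (\<lambda>x. \<Phi> k x * S b x) x\<bar> \<le> ?C * (LINT x|?N. \<bar>\<Phi> k x * S b x\<bar>)"
        by (rule integral_pd_le[OF P[OF b] b])
      also have "(LINT x|?N. \<bar>\<Phi> k x * S b x\<bar>) \<le> l2_norm ?N (\<Phi> k) * l2_norm ?N (S b)"
      proof -
        have abs: "square_integrable ?N (\<lambda>x. \<bar>f x\<bar>)" "l2_norm ?N (\<lambda>x. \<bar>f x\<bar>) = l2_norm ?N f" if "square_integrable ?N f" for f :: "'a \<Rightarrow> real"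
          using that by (auto simp: square_integrable_def l2_norm_def)
        show ?thesis
          using l2_Cauchy_Schwarz[OF abs(1)[OF \<Phi>(2)[of k]] abs(1)[OF SN[OF b]]]
          by (simp add: abs(2)[OF \<Phi>(2)] abs(2)[OF SN[OF b]] abs_mult)
      qed
      finally show "\<bar>LINT x|?M. pd b (\<lambda>x. \<Phi> k x * S b x) x\<bar> \<le> ?C * (l2_norm ?N (\<Phi> k) * l2_norm ?N (S b))"
        using sweep_const_pos[where 'a='a] by simp
    qed
    finally show ?thesis .
  qed
  have "(\<lambda>k. \<Sum>b\<in>Basis. ?C * (l2_norm ?N (\<Phi> k) * l2_norm ?N (S b))) \<longlonglongrightarrow> (\<Sum>b\<in>(Basis::'a set). ?C * (0 * l2_norm ?N (S b)))"
    by (intro tendsto_intros \<Phi>N)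
  then have "(\<lambda>k. \<Sum>b\<in>Basis. ?C * (l2_norm ?N (\<Phi> k) * l2_norm ?N (S b))) \<longlonglongrightarrow> 0" by simp
  then have "(\<lambda>k. \<bar>?I k\<bar>) \<longlonglongrightarrow> 0" by (rule null_sequence_squeeze[OF abs_ge_zero bound])
  then have "?I \<longlonglongrightarrow> 0" by (simp only: tendsto_rabs_zero_iff)
  from LIMSEQ_unique[OF tendsto_add[OF lim1 lim2] this] show ?thesis .
qed

text \<open>The field is approximated only after the limit in \<phi> has been taken: the boundary
  norms of the approximating fields are not controlled, so the two limits cannot be merged.\<close>

lemma green_zero_trace:
  assumes \<phi>: "\<phi> \<in> H1 Om" and t: "AE x in surface_measure Om. bdry_trace Om \<phi> x = 0"
    and \<sigma>: "square_integrable (lebesgue_on Om) \<sigma>" and h: "square_integrable (lebesgue_on Om) h" and w: "has_weak_div Om \<sigma> h"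
  shows "(LINT x|lebesgue_on Om. weak_grad Om \<phi> x \<bullet> \<sigma> x) + (LINT x|lebesgue_on Om. \<phi> x * h x) = 0"
proof -
  let ?M = "lebesgue_on Om"
  obtain S :: "nat \<Rightarrow> 'a \<Rightarrow> 'a \<Rightarrow> real" where S: "\<forall>n. \<forall>b\<in>Basis. smooth (S n b)"
    "\<forall>b\<in>Basis. (\<lambda>n. l2_norm ?M (\<lambda>x. S n b x - \<sigma> x \<bullet> b)) \<longlonglongrightarrow> 0"
    "\<forall>h. square_integrable ?M h \<longrightarrow> has_weak_div Om \<sigma> h \<longrightarrow>
       (\<lambda>n. l2_norm ?M (\<lambda>x. (\<Sum>b\<in>Basis. pd b (S n b) x) - h x)) \<longlonglongrightarrow> 0"
    using weak_div_smooth_approx[OF lip \<sigma>] by (elim exE conjE)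
  let ?V = "\<lambda>n x. \<Sum>b\<in>Basis. S n b x *\<^sub>R b" and ?D = "\<lambda>n x. \<Sum>b\<in>Basis. pd b (S n b) x"
  have s: "smooth (S n b)" if "b \<in> Basis" for n b using S(1) that by blast
  have Vs: "square_integrable ?M (?V n)" for n by (intro square_integrable_from_components square_integrable_smooth s Om)
  have Ds: "square_integrable ?M (?D n)" for n by (intro square_integrable_sum square_integrable_smooth smooth_pd s Om)
  have "(\<lambda>n. LINT x|?M. ?V n x \<bullet> weak_grad Om \<phi> x) \<longlonglongrightarrow> (LINT x|?M. \<sigma> x \<bullet> weak_grad Om \<phi> x)"
  proof (rule l2_inner_tendsto[OF Vs \<sigma> weak_grad_spec(1)[OF \<phi>]], rule null_sequence_squeeze[OF l2_norm_nonneg])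
    show "l2_norm ?M (\<lambda>x. ?V n x - \<sigma> x) \<le> (\<Sum>b\<in>Basis. l2_norm ?M (\<lambda>x. S n b x - \<sigma> x \<bullet> b))" for n
    proof -
      have "(?V n x - \<sigma> x) \<bullet> b = S n b x - \<sigma> x \<bullet> b" if "b \<in> Basis" for b x
        using that by (simp add: inner_diff_left inner_sum_left inner_Basis if_distrib[of "\<lambda>c. _ * c"] cong: if_cong)
      then show ?thesis using l2_norm_components_le[OF square_integrable_diff[OF Vs \<sigma>], of n] by simp
    qed
    have "(\<lambda>n. \<Sum>b\<in>Basis. l2_norm ?M (\<lambda>x. S n b x - \<sigma> x \<bullet> b)) \<longlonglongrightarrow> (\<Sum>b\<in>(Basis::'a set). 0)"
      using S(2) by (intro tendsto_sum) auto
    then show "(\<lambda>n. \<Sum>b\<in>Basis. l2_norm ?M (\<lambda>x. S n b x - \<sigma> x \<bullet> b)) \<longlonglongrightarrow> 0" by (simp only: sum.neutral_const)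
  qed
  moreover have "(\<lambda>n. LINT x|?M. ?D n x \<bullet> \<phi> x) \<longlonglongrightarrow> (LINT x|?M. h x \<bullet> \<phi> x)"
    by (rule l2_inner_tendsto[OF Ds h H1_square_integrable[OF \<phi>]]) (use S(3) h w in blast)
  ultimately have "(\<lambda>n. (LINT x|?M. ?V n x \<bullet> weak_grad Om \<phi> x) + (LINT x|?M. ?D n x \<bullet> \<phi> x)) \<longlonglongrightarrow>
      (LINT x|?M. \<sigma> x \<bullet> weak_grad Om \<phi> x) + (LINT x|?M. h x \<bullet> \<phi> x)" by (rule tendsto_add)
  moreover have "(LINT x|?M. ?V n x \<bullet> weak_grad Om \<phi> x) + (LINT x|?M. ?D n x \<bullet> \<phi> x) = 0" for n
  proof -
    have "(LINT x|?M. weak_grad Om \<phi> x \<bullet> ?V n x) + (LINT x|?M. \<phi> x * ?D n x) = 0"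
      by (rule green_smooth_field[OF \<phi> t]) (rule s)
    then show ?thesis by (simp only: inner_commute[of "?V n _"] inner_real_def mult.commute[of "?D n _"])
  qed
  ultimately have "(LINT x|?M. \<sigma> x \<bullet> weak_grad Om \<phi> x) + (LINT x|?M. h x \<bullet> \<phi> x) = 0"
    by (simp add: LIMSEQ_const_iff)
  then show ?thesis by (simp only: inner_commute[of "\<sigma> _"] inner_real_def mult.commute[of "h _"])
qed

text \<open>The field \<open>(x \<bullet> e) *\<^sub>R (\<phi> x *\<^sub>R e)\<close> has divergence \<open>\<phi>\<close>, so Green's formula gives that the integral of \<open>\<phi>\<^sup>2\<close> vanishes.\<close>
lemma zero_grad_zero_trace:
  assumes \<phi>: "\<phi> \<in> H1 Om" and t: "AE x in surface_measure Om. bdry_trace Om \<phi> x = 0"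
    and g: "AE x in lebesgue_on Om. weak_grad Om \<phi> x = 0"
  shows "AE x in lebesgue_on Om. \<phi> x = 0"
proof -
  let ?M = "lebesgue_on Om"
  obtain e :: 'a where e: "e \<in> Basis" using nonempty_Basis by blast
  note \<phi>s = H1_square_integrable[OF \<phi>] and gs = weak_grad_spec(1)[OF \<phi>]
  have cont: "continuous_on UNIV (\<lambda>x. x \<bullet> e)" by (intro continuous_intros)
  have xs: "square_integrable ?M (\<lambda>x. (x \<bullet> e) * \<phi> x)" by (rule square_integrable_mult_continuous[OF \<phi>s cont Om(2)])
  have \<sigma>s: "square_integrable ?M (\<lambda>x. ((x \<bullet> e) * \<phi> x) *\<^sub>R e)" by (rule square_integrable_scaleR_vector[OF xs])
  have w: "has_weak_div Om (\<lambda>x. ((x \<bullet> e) * \<phi> x) *\<^sub>R e) \<phi>"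
    unfolding has_weak_div_def
  proof (intro allI impI)
    fix \<psi> assume \<psi>: "test_function Om \<psi>"
    note s = test_function_smooth[OF \<psi>]
    \<comment> \<open>Testing the vanishing weak gradient with this function produces \<psi> itself
      as an extra term, which becomes the divergence.\<close>
    let ?\<theta> = "\<lambda>x. (x \<bullet> e) * \<psi> x"
    have \<theta>: "test_function Om ?\<theta>" by (rule test_function_mult[OF smooth_inner \<psi>])
    have pe: "pd e (\<lambda>x. x \<bullet> e) x = 1" for x
    proof -
      have "((\<lambda>x. x \<bullet> e) has_derivative (\<lambda>v. v \<bullet> e)) (at x)" by (auto intro!: derivative_eq_intros)
      from pd_eqI[OF this] show ?thesis using e by simp
    qed
    have pd\<theta>: "pd e ?\<theta> x = (x \<bullet> e) * pd e \<psi> x + \<psi> x" for x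
      by (simp add: pd_mult smooth_differentiable smooth_inner s pe)
    have "(LINT x|?M. \<phi> x * pd e ?\<theta> x) = - (LINT x|?M. (weak_grad Om \<phi> x \<bullet> e) * ?\<theta> x)"
      by (rule weak_grad_component[OF Om(3,2) \<phi>s gs weak_grad_spec(2)[OF \<phi>] \<theta> e])
    also have "(LINT x|?M. (weak_grad Om \<phi> x \<bullet> e) * ?\<theta> x) = 0"
      by (rule integral_eq_zero_AE) (use g in \<open>auto elim: eventually_mono\<close>)
    finally have "(LINT x|?M. \<phi> x * pd e ?\<theta> x) = 0" by simp
    moreover have "\<phi> x * pd e ?\<theta> x = ((x \<bullet> e) * \<phi> x) * pd e \<psi> x + \<phi> x * \<psi> x" for x
      unfolding pd\<theta> by (simp add: algebra_simps)
    ultimately have "(LINT x|?M. ((x \<bullet> e) * \<phi> x) * pd e \<psi> x + \<phi> x * \<psi> x) = 0"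
      by (simp only:)
    moreover have "(LINT x|?M. ((x \<bullet> e) * \<phi> x) * pd e \<psi> x + \<phi> x * \<psi> x) = (LINT x|?M. ((x \<bullet> e) * \<phi> x) * pd e \<psi> x) + (LINT x|?M. \<phi> x * \<psi> x)"
      by (intro Bochner_Integration.integral_add square_integrable_times xs \<phi>s square_integrable_smooth smooth_pd s e Om)
    moreover have eq: "(((x \<bullet> e) * \<phi> x) *\<^sub>R e) \<bullet> grad \<psi> x = ((x \<bullet> e) * \<phi> x) * pd e \<psi> x" for x
      using grad_inner_Basis[OF e, of \<psi> x] by (simp add: inner_commute[of e])
    ultimately show "(LINT x|?M. (((x \<bullet> e) * \<phi> x) *\<^sub>R e) \<bullet> grad \<psi> x) = - (LINT x|?M. \<phi> x * \<psi> x)"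
      unfolding eq by linarith
  qed
  have "(LINT x|?M. weak_grad Om \<phi> x \<bullet> (((x \<bullet> e) * \<phi> x) *\<^sub>R e)) = 0"
    by (rule integral_eq_zero_AE) (use g in \<open>auto elim: eventually_mono\<close>)
  then have "(LINT x|?M. \<phi> x * \<phi> x) = 0" using green_zero_trace[OF \<phi> t \<sigma>s \<phi>s w] by simp
  then have "l2_norm ?M \<phi> = 0" by (simp add: l2_norm_def power2_eq_square)
  then show ?thesis using l2_norm_eq_0_iff[OF \<phi>s] by simp
qed

text \<open>Independence of the lift, which makes the normal trace a function of boundary
  values.\<close>

lemma integral_weak_grad_cong_trace:
  assumes \<phi>: "\<phi> \<in> H1 Om" and \<eta>: "\<eta> \<in> H1 Om" and eq: "AE x in surface_measure Om. bdry_trace Om \<phi> x = bdry_trace Om \<eta> x"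
    and \<tau>: "\<tau> \<in> div_free Om"
  shows "(LINT x|lebesgue_on Om. weak_grad Om \<phi> x \<bullet> \<tau> x) = (LINT x|lebesgue_on Om. weak_grad Om \<eta> x \<bullet> \<tau> x)"
proof -
  let ?M = "lebesgue_on Om" and ?d = "\<lambda>x. 1 * \<phi> x + (-1) * \<eta> x"
  have \<tau>s: "square_integrable ?M \<tau>" and w: "has_weak_div Om \<tau> (\<lambda>_. 0)" using \<tau> by (auto simp: div_free_def)
  note d = H1_lincomb[OF \<phi> \<eta>, of 1 "-1"] and i = square_integrable_inner[OF weak_grad_spec(1) \<tau>s]
  have "AE x in surface_measure Om. bdry_trace Om ?d x = 0"
    using bdry_trace_lincomb[OF \<phi> \<eta>, of 1 "-1"] eq by eventually_elim simp
  from green_zero_trace[OF d(1) this \<tau>s square_integrable_zero w]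
  have "(LINT x|?M. weak_grad Om ?d x \<bullet> \<tau> x) = 0" by simp
  also have "(LINT x|?M. weak_grad Om ?d x \<bullet> \<tau> x) = (LINT x|?M. weak_grad Om \<phi> x \<bullet> \<tau> x - weak_grad Om \<eta> x \<bullet> \<tau> x)"
  proof (rule integral_cong_AE)
    show "AE x in ?M. weak_grad Om ?d x \<bullet> \<tau> x = weak_grad Om \<phi> x \<bullet> \<tau> x - weak_grad Om \<eta> x \<bullet> \<tau> x"
      using d(2) by eventually_elim (simp add: inner_diff_left)
  qed (use i[OF d(1)] i[OF \<phi>] i[OF \<eta>] in auto)
  also have "\<dots> = (LINT x|?M. weak_grad Om \<phi> x \<bullet> \<tau> x) - (LINT x|?M. weak_grad Om \<eta> x \<bullet> \<tau> x)"
    by (rule Bochner_Integration.integral_diff[OF i[OF \<phi>] i[OF \<eta>]])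
  finally show ?thesis by simp
qed

section \<open>The normal trace of divergence-free fields\<close>

lemma H1_zero: "(\<lambda>x. 0) \<in> H1 Om" "H1_norm Om (\<lambda>x. 0) = 0" "AE x in surface_measure Om. bdry_trace Om (\<lambda>x. 0) x = 0"
proof -
  show H: "(\<lambda>x. 0) \<in> H1 Om" by (rule smooth_weak_grad(1)[OF smooth_const])
  show "H1_norm Om (\<lambda>x. 0) = 0"
    using H1_norm_lincomb[OF H H, of 0 0] H1_norm_bounds(4)[of Om "\<lambda>x. 0"] by simp
  show "AE x in surface_measure Om. bdry_trace Om (\<lambda>x. 0) x = 0"
    by (rule has_trace_zero[OF has_trace_bdry_trace[OF H]])
qed

lemma weak_div_div_free:
  assumes "\<tau> \<in> div_free Om"
  shows "square_integrable (lebesgue_on Om) (weak_div Om \<tau>)" "AE x in lebesgue_on Om. weak_div Om \<tau> x = 0"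
proof -
  have \<tau>s: "square_integrable (lebesgue_on Om) \<tau>" and w: "has_weak_div Om \<tau> (\<lambda>_. 0)"
    using assms by (auto simp: div_free_def)
  have "\<exists>h. square_integrable (lebesgue_on Om) h \<and> has_weak_div Om \<tau> h" using w square_integrable_zero by blast
  then have wd: "square_integrable (lebesgue_on Om) (weak_div Om \<tau>) \<and> has_weak_div Om \<tau> (weak_div Om \<tau>)"
    unfolding weak_div_def by (rule someI_ex)
  then show "square_integrable (lebesgue_on Om) (weak_div Om \<tau>)" by simp
  show "AE x in lebesgue_on Om. weak_div Om \<tau> x = 0"
    using wd by (intro weak_div_unique[OF lip \<tau>s _ _ square_integrable_zero w]) auto
qed

lemma green_div_free:
  assumes \<tau>: "\<tau> \<in> div_free Om" and \<phi>: "\<phi> \<in> H1 Om"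
  shows "(LINT x|lebesgue_on Om. weak_grad Om \<phi> x \<bullet> \<tau> x + \<phi> x * weak_div Om \<tau> x) = (LINT x|lebesgue_on Om. weak_grad Om \<phi> x \<bullet> \<tau> x)"
proof (rule integral_cong_AE)
  have "square_integrable (lebesgue_on Om) \<tau>" using \<tau> by (simp add: div_free_def)
  note i = square_integrable_inner[OF weak_grad_spec(1)[OF \<phi>] this]
  show "(\<lambda>x. weak_grad Om \<phi> x \<bullet> \<tau> x) \<in> borel_measurable (lebesgue_on Om)" using i by auto
  show "(\<lambda>x. weak_grad Om \<phi> x \<bullet> \<tau> x + \<phi> x * weak_div Om \<tau> x) \<in> borel_measurable (lebesgue_on Om)"
    using i square_integrable_times[OF H1_square_integrable[OF \<phi>] weak_div_div_free(1)[OF \<tau>]] by auto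
  show "AE x in lebesgue_on Om. weak_grad Om \<phi> x \<bullet> \<tau> x + \<phi> x * weak_div Om \<tau> x = weak_grad Om \<phi> x \<bullet> \<tau> x"
    using weak_div_div_free(2)[OF \<tau>] by eventually_elim simp
qed

text \<open>The functional integrates \<tau> against the gradient of any lift. The bound by the
  Cauchy-Schwarz inequality holds for every lift, so the infimum over lifts gives continuity in the
  quotient norm.\<close>

lemma normal_trace_exists:
  assumes \<tau>: "\<tau> \<in> div_free Om"
  shows "\<exists>\<Lambda>. \<Lambda> \<in> H_minus_half Om \<and> (\<forall>\<phi>\<in>H1 Om. bdry_pairing (bdry_trace Om \<phi>) \<Lambda> =
        (LINT x|lebesgue_on Om. weak_grad Om \<phi> x \<bullet> \<tau> x + \<phi> x * weak_div Om \<tau> x))"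
proof -
  let ?M = "lebesgue_on Om"
  have \<tau>s: "square_integrable ?M \<tau>" using \<tau> by (simp add: div_free_def)
  note i = square_integrable_inner[OF weak_grad_spec(1) \<tau>s]
  define lift where "lift f = (SOME \<phi>. \<phi> \<in> H1 Om \<and> bdry_eq Om (bdry_trace Om \<phi>) f)" for f
  define \<Lambda> where "\<Lambda> f = (LINT x|?M. weak_grad Om (lift f) x \<bullet> \<tau> x)" for f
  have \<Lambda>: "\<Lambda> f = (LINT x|?M. weak_grad Om \<phi> x \<bullet> \<tau> x)" if \<phi>: "\<phi> \<in> H1 Om" "bdry_eq Om (bdry_trace Om \<phi>) f" for \<phi> f
  proof -
    have "lift f \<in> H1 Om \<and> bdry_eq Om (bdry_trace Om (lift f)) f"
      unfolding lift_def by (rule someI[of _ \<phi>]) (use \<phi> in simp)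
    then have "lift f \<in> H1 Om" "AE x in surface_measure Om. bdry_trace Om (lift f) x = bdry_trace Om \<phi> x"
      using \<phi>(2) unfolding bdry_eq_def by (auto elim: eventually_elim2)
    then show ?thesis unfolding \<Lambda>_def by (intro integral_weak_grad_cong_trace \<phi> \<tau>)
  qed
  have lin: "\<Lambda> (\<lambda>x. a * f x + c * h x) = a * \<Lambda> f + c * \<Lambda> h" if fh: "f \<in> H_half Om" "h \<in> H_half Om" for f h a c
  proof -
    obtain \<phi> where \<phi>: "\<phi> \<in> H1 Om" "bdry_eq Om (bdry_trace Om \<phi>) f"
      using fh(1) by (auto simp: H_half_def)
    obtain \<eta> where \<eta>: "\<eta> \<in> H1 Om" "bdry_eq Om (bdry_trace Om \<eta>) h"
      using fh(2) by (auto simp: H_half_def)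
    note d = H1_lincomb[OF \<phi>(1) \<eta>(1), of a c]
    have "bdry_eq Om (bdry_trace Om (\<lambda>x. a * \<phi> x + c * \<eta> x)) (\<lambda>x. a * f x + c * h x)"
      unfolding bdry_eq_def using bdry_trace_lincomb[OF \<phi>(1) \<eta>(1), of a c] \<phi>(2) \<eta>(2) unfolding bdry_eq_def
      by eventually_elim simp
    then have "\<Lambda> (\<lambda>x. a * f x + c * h x) = (LINT x|?M. weak_grad Om (\<lambda>x. a * \<phi> x + c * \<eta> x) x \<bullet> \<tau> x)"
      by (rule \<Lambda>[OF d(1)])
    also have "\<dots> = (LINT x|?M. a * (weak_grad Om \<phi> x \<bullet> \<tau> x) + c * (weak_grad Om \<eta> x \<bullet> \<tau> x))"
    proof (rule integral_cong_AE)
      show "AE x in ?M. weak_grad Om (\<lambda>x. a * \<phi> x + c * \<eta> x) x \<bullet> \<tau> x = a * (weak_grad Om \<phi> x \<bullet> \<tau> x) + c * (weak_grad Om \<eta> x \<bullet> \<tau> x)"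
        using d(2) by eventually_elim (simp add: inner_add_left)
    qed (use i[OF d(1)] i[OF \<phi>(1)] i[OF \<eta>(1)] in auto)
    also have "\<dots> = a * (LINT x|?M. weak_grad Om \<phi> x \<bullet> \<tau> x) + c * (LINT x|?M. weak_grad Om \<eta> x \<bullet> \<tau> x)"
      using i[OF \<phi>(1)] i[OF \<eta>(1)] by simp
    finally show ?thesis by (simp only: \<Lambda>[OF \<phi>] \<Lambda>[OF \<eta>])
  qed
  have "\<Lambda> \<in> H_minus_half Om"
    unfolding H_minus_half_def mem_Collect_eq
  proof (intro conjI ballI allI exI[of _ "l2_norm ?M \<tau>"])
    show "\<Lambda> (\<lambda>x. f x + h x) = \<Lambda> f + \<Lambda> h" if "f \<in> H_half Om" "h \<in> H_half Om" for f h
      using lin[OF that, of 1 1] by simp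
    show "\<Lambda> (\<lambda>x. c * f x) = c * \<Lambda> f" if "f \<in> H_half Om" for c f
      using lin[OF that that, of c 0] by simp
    show "\<bar>\<Lambda> f\<bar> \<le> l2_norm ?M \<tau> * H_half_norm Om f" if f: "f \<in> H_half Om" for f
    proof -
      let ?A = "{\<phi> \<in> H1 Om. bdry_eq Om (bdry_trace Om \<phi>) f}"
      have ne: "?A \<noteq> {}" using f by (auto simp: H_half_def)
      have le: "\<bar>\<Lambda> f\<bar> \<le> l2_norm ?M \<tau> * H1_norm Om \<phi>" if "\<phi> \<in> ?A" for \<phi>
      proof -
        have "\<bar>\<Lambda> f\<bar> \<le> l2_norm ?M (weak_grad Om \<phi>) * l2_norm ?M \<tau>"
          using that \<Lambda>[of \<phi> f] l2_Cauchy_Schwarz[OF weak_grad_spec(1) \<tau>s, of \<phi>] by simp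
        also have "\<dots> \<le> H1_norm Om \<phi> * l2_norm ?M \<tau>" by (intro mult_right_mono H1_norm_bounds) simp
        finally show ?thesis by (simp add: mult.commute)
      qed
      show ?thesis
      proof (cases "l2_norm ?M \<tau> = 0")
        case True
        obtain \<phi> where "\<phi> \<in> ?A" using ne by blast
        from le[OF this] show ?thesis by (simp add: True)
      next
        case False
        then have pos: "0 < l2_norm ?M \<tau>" using l2_norm_nonneg[of ?M \<tau>] by linarith
        have "\<bar>\<Lambda> f\<bar> / l2_norm ?M \<tau> \<le> (INF \<phi>\<in>?A. H1_norm Om \<phi>)"
          by (rule cINF_greatest[OF ne]) (use le pos in \<open>simp add: pos_divide_le_eq mult.commute\<close>)
        then show ?thesis using pos by (simp add: H_half_norm_def pos_divide_le_eq mult.commute)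
      qed
    qed
  qed
  moreover have "bdry_pairing (bdry_trace Om \<phi>) \<Lambda> = (LINT x|?M. weak_grad Om \<phi> x \<bullet> \<tau> x + \<phi> x * weak_div Om \<tau> x)" if \<phi>: "\<phi> \<in> H1 Om" for \<phi>
  proof -
    show ?thesis
      unfolding bdry_pairing_def green_div_free[OF \<tau> \<phi>] by (rule \<Lambda>[OF \<phi>]) (simp add: bdry_eq_def)
  qed
  ultimately show ?thesis by (intro exI[of _ \<Lambda>] conjI ballI)
qed

text \<open>A functional in \<open>H_minus_half\<close> acts on functions, not on classes modulo
  null sets, and \<open>f\<close> may differ from the chosen trace on a null set. The difference has
  quotient norm zero, so boundedness makes the functional vanish on it.\<close>

lemma bdry_pairing_normal_trace:
  assumes \<tau>: "\<tau> \<in> div_free Om" and \<phi>: "\<phi> \<in> H1 Om" and f: "bdry_eq Om (bdry_trace Om \<phi>) f"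
  shows "bdry_pairing f (normal_trace Om \<tau>) = (LINT x|lebesgue_on Om. weak_grad Om \<phi> x \<bullet> \<tau> x)"
proof -
  let ?M = "lebesgue_on Om" and ?\<Lambda> = "normal_trace Om \<tau>"
  have \<Lambda>: "?\<Lambda> \<in> H_minus_half Om" and gr: "\<forall>\<phi>\<in>H1 Om. bdry_pairing (bdry_trace Om \<phi>) ?\<Lambda> =
        (LINT x|?M. weak_grad Om \<phi> x \<bullet> \<tau> x + \<phi> x * weak_div Om \<tau> x)"
    using someI_ex[OF normal_trace_exists[OF \<tau>], folded normal_trace_def] by auto
  have 1: "?\<Lambda> (bdry_trace Om \<phi>) = (LINT x|?M. weak_grad Om \<phi> x \<bullet> \<tau> x)"
    using gr \<phi> green_div_free[OF \<tau> \<phi>] by (simp add: bdry_pairing_def)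
  let ?b = "bdry_trace Om \<phi>" and ?d = "\<lambda>x. f x - bdry_trace Om \<phi> x"
  have d0: "bdry_eq Om (bdry_trace Om (\<lambda>x. 0)) ?d"
    unfolding bdry_eq_def using H1_zero(3) f unfolding bdry_eq_def by eventually_elim simp
  then have dH: "?d \<in> H_half Om" using H1_zero(1) unfolding H_half_def by blast
  have bH: "?b \<in> H_half Om" using \<phi> unfolding H_half_def bdry_eq_def by auto
  have n0: "H_half_norm Om ?d = 0"
  proof (rule antisym)
    let ?A = "{\<phi> \<in> H1 Om. bdry_eq Om (bdry_trace Om \<phi>) ?d}"
    have z: "(\<lambda>x. 0) \<in> ?A" using d0 H1_zero(1) by simp
    have "bdd_below (H1_norm Om ` ?A)" by (rule bdd_belowI2[of _ 0]) (rule H1_norm_bounds(4))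
    from cINF_lower[OF this z] show "H_half_norm Om ?d \<le> 0" by (simp add: H_half_norm_def H1_zero(2))
    show "0 \<le> H_half_norm Om ?d" unfolding H_half_norm_def
      by (rule cINF_greatest) (use z H1_norm_bounds(4) in auto)
  qed
  obtain C where "\<bar>?\<Lambda> ?d\<bar> \<le> C * H_half_norm Om ?d" using \<Lambda> dH unfolding H_minus_half_def by blast
  then have "?\<Lambda> ?d = 0" by (simp add: n0)
  moreover have "?\<Lambda> (\<lambda>x. ?b x + ?d x) = ?\<Lambda> ?b + ?\<Lambda> ?d"
  proof -
    have "\<forall>f\<in>H_half Om. \<forall>h\<in>H_half Om. ?\<Lambda> (\<lambda>x. f x + h x) = ?\<Lambda> f + ?\<Lambda> h"
      using \<Lambda> by (simp add: H_minus_half_def)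
    from bspec[OF bspec[OF this bH] dH] show ?thesis .
  qed
  ultimately show ?thesis using 1 by (simp add: bdry_pairing_def)
qed

text \<open>Stated as identities with a squared remainder, so that optimality and uniqueness can
  both be read off. The last claim turns equality of gradients into equality of functions, as needed
  for minimisers.\<close>

lemma harmonic_extremal_principles:
  assumes u: "u \<in> H1 Om" "weakly_harmonic Om u" "bdry_eq Om (bdry_trace Om u) g"
    and v: "v \<in> H1 Om" "weakly_harmonic Om v"
  defines "f \<equiv> \<lambda>x. g x - bdry_trace Om v x"
    and "w\<^sub>0 \<equiv> \<lambda>x. u x - v x"
  defines "J \<equiv> \<lambda>\<tau>. 2 * bdry_pairing f (normal_trace Om \<tau>) - (l2_norm (lebesgue_on Om) \<tau>)\<^sup>2"
    and "E \<equiv> \<lambda>w. (l2_norm (lebesgue_on Om) (weak_grad Om w))\<^sup>2"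
    and "W \<equiv> {w \<in> H1 Om. bdry_eq Om (bdry_trace Om w) f}"
  shows "w\<^sub>0 \<in> W" "weak_grad Om w\<^sub>0 \<in> div_free Om"
    "\<And>\<tau>. \<tau> \<in> div_free Om \<Longrightarrow> J \<tau> = E w\<^sub>0 - (l2_norm (lebesgue_on Om) (\<lambda>x. \<tau> x - weak_grad Om w\<^sub>0 x))\<^sup>2"
    "\<And>w. w \<in> W \<Longrightarrow> E w = E w\<^sub>0 + (l2_norm (lebesgue_on Om) (weak_grad Om (\<lambda>x. w x - w\<^sub>0 x)))\<^sup>2"
    "\<And>w. w \<in> W \<Longrightarrow> AE x in lebesgue_on Om. weak_grad Om (\<lambda>x. w x - w\<^sub>0 x) x = 0 \<Longrightarrow> AE x in lebesgue_on Om. w x = w\<^sub>0 x"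
proof -
  let ?M = "lebesgue_on Om" and ?G = "weak_grad Om"
  note c = H1_lincomb[OF u(1) v(1), of 1 "-1"]
  have w0: "w\<^sub>0 \<in> H1 Om" using c(1) by (simp add: w\<^sub>0_def)
  have g0: "AE x in ?M. ?G w\<^sub>0 x = ?G u x - ?G v x" using c(2) by (simp add: w\<^sub>0_def)
  have t0: "bdry_eq Om (bdry_trace Om w\<^sub>0) f"
  proof -
    have "AE x in surface_measure Om. bdry_trace Om w\<^sub>0 x = bdry_trace Om u x - bdry_trace Om v x"
      using bdry_trace_lincomb[OF u(1) v(1), of 1 "-1"] by (simp add: w\<^sub>0_def)
    then show ?thesis using u(3) unfolding bdry_eq_def f_def by eventually_elim simp
  qed
  then show wW: "w\<^sub>0 \<in> W" using w0 by (simp add: W_def)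
  note gs = weak_grad_spec(1)[OF u(1)] weak_grad_spec(1)[OF v(1)] weak_grad_spec(1)[OF w0]
  show df: "?G w\<^sub>0 \<in> div_free Om"
    unfolding div_free_def mem_Collect_eq has_weak_div_def
  proof (intro conjI allI impI gs(3))
    fix \<psi> assume \<psi>: "test_function Om \<psi>"
    note q = square_integrable_grad[OF test_function_smooth[OF \<psi>] Om(3,2)]
    note i = square_integrable_inner[OF gs(1) q] square_integrable_inner[OF gs(2) q] square_integrable_inner[OF gs(3) q]
    have "(LINT x|?M. ?G w\<^sub>0 x \<bullet> grad \<psi> x) = (LINT x|?M. ?G u x \<bullet> grad \<psi> x - ?G v x \<bullet> grad \<psi> x)"
    proof (rule integral_cong_AE)
      show "AE x in ?M. ?G w\<^sub>0 x \<bullet> grad \<psi> x = ?G u x \<bullet> grad \<psi> x - ?G v x \<bullet> grad \<psi> x"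
        using g0 by eventually_elim (simp add: inner_diff_left)
    qed (use i in auto)
    also have "\<dots> = 0"
      using u(2) v(2) \<psi> i by (simp add: weakly_harmonic_def has_weak_div_def)
    finally show "(LINT x|?M. ?G w\<^sub>0 x \<bullet> grad \<psi> x) = - (LINT x|?M. 0 * \<psi> x)" by simp
  qed
  show "J \<tau> = E w\<^sub>0 - (l2_norm ?M (\<lambda>x. \<tau> x - ?G w\<^sub>0 x))\<^sup>2" if \<tau>: "\<tau> \<in> div_free Om" for \<tau>
  proof -
    have \<tau>s: "square_integrable ?M \<tau>" using \<tau> by (simp add: div_free_def)
    have "(l2_norm ?M (\<lambda>x. \<tau> x + (-1) *\<^sub>R ?G w\<^sub>0 x))\<^sup>2 =
        (l2_norm ?M \<tau>)\<^sup>2 + 2 * (LINT x|?M. \<tau> x \<bullet> ((-1) *\<^sub>R ?G w\<^sub>0 x)) + (l2_norm ?M (\<lambda>x. (-1) *\<^sub>R ?G w\<^sub>0 x))\<^sup>2"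
      by (rule l2_norm_add_power2[OF \<tau>s square_integrable_scaleR[OF gs(3)]])
    then have "(l2_norm ?M (\<lambda>x. \<tau> x - ?G w\<^sub>0 x))\<^sup>2 = (l2_norm ?M \<tau>)\<^sup>2 - 2 * (LINT x|?M. ?G w\<^sub>0 x \<bullet> \<tau> x) + E w\<^sub>0"
      using l2_norm_scaleR[of ?M "-1" "?G w\<^sub>0"] by (simp add: E_def inner_commute)
    then show ?thesis unfolding J_def bdry_pairing_normal_trace[OF \<tau> w0 t0] by simp
  qed
  have diff: "(\<lambda>x. w x - w\<^sub>0 x) \<in> H1 Om" "AE x in surface_measure Om. bdry_trace Om (\<lambda>x. w x - w\<^sub>0 x) x = 0"
    "AE x in ?M. ?G w x = ?G w\<^sub>0 x + ?G (\<lambda>x. w x - w\<^sub>0 x) x" if w: "w \<in> W" for w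
  proof -
    have wH: "w \<in> H1 Om" and wt: "bdry_eq Om (bdry_trace Om w) f" using w by (auto simp: W_def)
    note l = H1_lincomb[OF wH w0, of 1 "-1"]
    show "(\<lambda>x. w x - w\<^sub>0 x) \<in> H1 Om" using l(1) by simp
    have "AE x in surface_measure Om. bdry_trace Om (\<lambda>x. w x - w\<^sub>0 x) x = bdry_trace Om w x - bdry_trace Om w\<^sub>0 x"
      using bdry_trace_lincomb[OF wH w0, of 1 "-1"] by simp
    then show "AE x in surface_measure Om. bdry_trace Om (\<lambda>x. w x - w\<^sub>0 x) x = 0"
      using wt t0 unfolding bdry_eq_def by eventually_elim simp
    show "AE x in ?M. ?G w x = ?G w\<^sub>0 x + ?G (\<lambda>x. w x - w\<^sub>0 x) x" using l(2) by eventually_elim simp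
  qed
  show "E w = E w\<^sub>0 + (l2_norm ?M (?G (\<lambda>x. w x - w\<^sub>0 x)))\<^sup>2" if w: "w \<in> W" for w
  proof -
    let ?d = "\<lambda>x. w x - w\<^sub>0 x"
    have wH: "w \<in> H1 Om" using w by (simp add: W_def)
    note ds = weak_grad_spec(1)[OF diff(1)[OF w]]
    have "has_weak_div Om (?G w\<^sub>0) (\<lambda>_. 0)" using df by (simp add: div_free_def)
    from green_zero_trace[OF diff(1,2)[OF w] gs(3) square_integrable_zero this]
    \<comment> \<open>The cross term of the square: the competitor differs by a function of zero
      trace, tested against a divergence-free field.\<close>
    have orth: "(LINT x|?M. ?G w\<^sub>0 x \<bullet> ?G ?d x) = 0" by (simp add: inner_commute)
    have "l2_norm ?M (?G w) = l2_norm ?M (\<lambda>x. ?G w\<^sub>0 x + ?G ?d x)"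
      by (rule l2_norm_cong_AE[OF _ _ diff(3)[OF w]])
        (intro square_integrable_measurable weak_grad_spec(1)[OF wH] square_integrable_add gs ds)+
    then show ?thesis using l2_norm_add_power2[OF gs(3) ds] orth by (simp add: E_def)
  qed
  show "AE x in ?M. w x = w\<^sub>0 x" if w: "w \<in> W" and z: "AE x in ?M. ?G (\<lambda>x. w x - w\<^sub>0 x) x = 0" for w
    using zero_grad_zero_trace[OF diff(1,2)[OF w] z] by simp
qed

end

theorem theorem4:
  fixes Om :: "(real ^ 'd) set" and g u v :: "real ^ 'd \<Rightarrow> real"
  assumes "CARD('d) = 2 \<or> CARD('d) = 3"
    and "lipschitz_domain Om"
    and "g \<in> H_half Om"
    and "u \<in> H1 Om" and "weakly_harmonic Om u" and "bdry_eq Om (bdry_trace Om u) g"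
    and "v \<in> H1 Om" and "weakly_harmonic Om v"
  shows "let f = (\<lambda>x. g x - bdry_trace Om v x);
             J = (\<lambda>\<tau>. 2 * bdry_pairing f (normal_trace Om \<tau>) - (l2_norm (lebesgue_on Om) \<tau>)\<^sup>2);
             E = (\<lambda>w. (l2_norm (lebesgue_on Om) (weak_grad Om w))\<^sup>2);
             W = {w \<in> H1 Om. bdry_eq Om (bdry_trace Om w) f};
             w\<^sub>0 = (\<lambda>x. u x - v x);
             \<tau>\<^sub>0 = weak_grad Om w\<^sub>0
         in is_maximum (J ` div_free Om) ((l2_norm (lebesgue_on Om) (weak_grad Om w\<^sub>0))\<^sup>2) \<and>
            is_minimum (E ` W) ((l2_norm (lebesgue_on Om) (weak_grad Om w\<^sub>0))\<^sup>2) \<and>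
            is_arg_max J (\<lambda>\<tau>. \<tau> \<in> div_free Om) \<tau>\<^sub>0 \<and>
            (\<forall>\<tau>. is_arg_max J (\<lambda>\<tau>. \<tau> \<in> div_free Om) \<tau> \<longrightarrow> (AE x in lebesgue_on Om. \<tau> x = \<tau>\<^sub>0 x)) \<and>
            is_arg_min E (\<lambda>w. w \<in> W) w\<^sub>0 \<and>
            (\<forall>w. is_arg_min E (\<lambda>w. w \<in> W) w \<longrightarrow> (AE x in lebesgue_on Om. w x = w\<^sub>0 x))"
proof -
  have dim: "DIM(real ^ 'd) \<ge> 2" using assms(1) by auto
  let ?M = "lebesgue_on Om"
  define f where "f = (\<lambda>x. g x - bdry_trace Om v x)"
  define J where "J = (\<lambda>\<tau>. 2 * bdry_pairing f (normal_trace Om \<tau>) - (l2_norm ?M \<tau>)\<^sup>2)"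
  define E where "E = (\<lambda>w. (l2_norm ?M (weak_grad Om w))\<^sup>2)"
  define W where "W = {w \<in> H1 Om. bdry_eq Om (bdry_trace Om w) f}"
  define w0 where "w0 = (\<lambda>x. u x - v x)"
  note P = harmonic_extremal_principles[OF assms(2) dim assms(4-8), folded f_def w0_def,
      folded J_def E_def W_def]
  define \<tau>0 where "\<tau>0 = weak_grad Om w0"
  have w0: "w0 \<in> W" and \<tau>0: "\<tau>0 \<in> div_free Om" using P(1,2) by (auto simp: \<tau>0_def)
  have E0: "(l2_norm ?M (weak_grad Om w0))\<^sup>2 = E w0" by (simp add: E_def)
  have J: "J \<tau> = E w0 - (l2_norm ?M (\<lambda>x. \<tau> x - \<tau>0 x))\<^sup>2" if "\<tau> \<in> div_free Om" for \<tau>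
    using P(3)[OF that] by (simp add: \<tau>0_def J_def E_def)
  have J0: "J \<tau>0 = E w0" using J[OF \<tau>0] by (simp add: l2_norm_def)
  have Jle: "J \<tau> \<le> E w0" if "\<tau> \<in> div_free Om" for \<tau> using J[OF that] by simp
  have E: "E w = E w0 + (l2_norm ?M (weak_grad Om (\<lambda>x. w x - w0 x)))\<^sup>2" if "w \<in> W" for w
    using P(4)[OF that] by (simp add: E_def w0_def)
  have Ele: "E w0 \<le> E w" if "w \<in> W" for w using E[OF that] by simp
  have "is_maximum (J ` div_free Om) (E w0)"
    unfolding is_maximum_def using J0 \<tau>0 Jle by (auto intro: rev_image_eqI)
  moreover have "is_minimum (E ` W) (E w0)"
    unfolding is_minimum_def using w0 Ele by auto
  moreover have "is_arg_max J (\<lambda>\<tau>. \<tau> \<in> div_free Om) \<tau>0"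
    unfolding is_arg_max_def using \<tau>0 Jle J0 by (auto simp: not_less)
  moreover have "AE x in ?M. \<tau> x = \<tau>0 x" if "is_arg_max J (\<lambda>\<tau>. \<tau> \<in> div_free Om) \<tau>" for \<tau>
  proof -
    have \<tau>: "\<tau> \<in> div_free Om" and "J \<tau>0 \<le> J \<tau>" using that \<tau>0 by (auto simp: is_arg_max_def not_less)
    then have "l2_norm ?M (\<lambda>x. \<tau> x - \<tau>0 x) = 0" using J[OF \<tau>] J0 by simp
    moreover have "square_integrable ?M (\<lambda>x. \<tau> x - \<tau>0 x)"
      using \<tau> \<tau>0 by (intro square_integrable_diff) (auto simp: div_free_def)
    ultimately show ?thesis by (simp add: l2_norm_eq_0_iff)
  qed
  moreover have "is_arg_min E (\<lambda>w. w \<in> W) w0"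
    unfolding is_arg_min_def using w0 Ele by (auto simp: not_less)
  moreover have "AE x in ?M. w x = w0 x" if "is_arg_min E (\<lambda>w. w \<in> W) w" for w
  proof -
    have w: "w \<in> W" and "E w \<le> E w0" using that w0 by (auto simp: is_arg_min_def not_less)
    \<comment> \<open>Equal energies leave no room for the remainder; a zero gradient together with
      zero trace then identifies the functions.\<close>
    then have n: "l2_norm ?M (weak_grad Om (\<lambda>x. w x - w0 x)) = 0" using E[OF w] by simp
    have "(\<lambda>x. w x - w0 x) \<in> H1 Om"
      using H1_lincomb(1)[OF assms(2) dim, of w w0 1 "-1"] w w0 by (simp add: W_def)
    then have "AE x in ?M. weak_grad Om (\<lambda>x. w x - w0 x) x = 0"
      using n weak_grad_spec(1) l2_norm_eq_0_iff by blast
    then show ?thesis using P(5)[OF w] by (simp add: w0_def)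
  qed
  ultimately show ?thesis
    unfolding Let_def f_def[symmetric] w0_def[symmetric] J_def[symmetric] E_def[symmetric] W_def[symmetric] \<tau>0_def[symmetric]
    unfolding E0[unfolded \<tau>0_def[symmetric]] by blast
qed



end
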